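(* Let $a\ge b\ge-1/2$ be real numbers. For any pair $(z,z')\in\mathcal H$, the spectral $z$-measure $M_{z,z',a,b|\infty}$ is the unique invariant probability measure with respect to the semigroup $(P_\infty(t))_{t\ge0}$ on $\Omega_\infty$, where $(P_\infty(t))_{t\ge0}$ is the unique Feller semigroup on $\Omega_\infty$ satisfying $P_\infty(t)\Lambda^\infty_N=\Lambda^\infty_NP_N(t)$ for all $N\ge2$, $t\ge0$.
   Context: Notation. $\mathbb Z_+=\{0,1,2,\dots\}$, $\mathbb N=\{1,2,\dots\}$, $\epsilon=\frac{a+b+1}{2}\ge0$, $\widehat x=(x+\epsilon)^2$ for $x\in\mathbb Z_+$. $\mathbb{GT}^+_N$ is the set of $\lambda=(\lambda_1\ge\dots\ge\lambda_N)$ with $\lambda_i\in\mathbb Z_+$. To $\lambda$ (resp. $\nu$) in $\mathbb{GT}^+_N$ associate $l_i=\lambda_i+N-i$ (resp. $n_i=\nu_i+N-i$) and $\widehat l_i=(l_i+\epsilon)^2$ (resp. $\widehat n_i$). Parameters. $\mathcal Z_{princ}=\{(z,z')\in\mathbb C^2\setminus\mathbb R^2: z'=\overline z\}$, $\mathcal Z_{compl}=\{(z,z')\in\mathbb R^2:\exists m\in\mathbb Z,\ m<z,z'<m+1\}$. $\mathcal H$ is the set of $(z,z')\in\mathbb C^2$ such that both $(z,z')$ and $(z+2\epsilon,z'+2\epsilon)$ belong to $\mathcal Z_{princ}\sqcup\mathcal Z_{compl}$ and $z+z'+b>-1$. Semigroups $P_N$. Given $(z,z')\in\mathcal H$ and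 $N\ge1$ put $u=z+N-1$, $u'=z'+N-1$ and $$\beta(x)=\frac{(x+2\epsilon)(x+a+1)(x-u)(x-u')}{2(x+\epsilon)(2x+2\epsilon+1)}\ (x\in\mathbb Z_+),\qquad \delta(x)=\frac{x(x+b)(x+u+2\epsilon)(x+u'+2\epsilon)}{2(x+\epsilon)(2x+2\epsilon-1)}\ (x\in\mathbb N),\quad\delta(0)=0,$$ where for $x=0$ and $\epsilon=0$ the factor $\frac{x+2\epsilon}{2(x+\epsilon)}$ is read as $1$. Let $R$ be the tridiagonal $\mathbb Z_+\times\mathbb Z_+$ matrix with $R(x,x+1)=\beta(x)$, $R(x,x-1)=\delta(x)$, $R(x,x)=-\beta(x)-\delta(x)$, and for $\lambda,\nu\in\mathbb{GT}^+_N$ $$R^{(N)}(\lambda,\nu)=\frac{\prod_{i<j}(\widehat n_i-\widehat n_j)}{\prod_{i<j}(\widehat l_i-\widehat l_j)}\sum_{k=1}^N R(l_k,n_k)\mathbf 1_{\{l_i=n_i\ \forall i\ne k\}}-c_N\mathbf 1_{\{\lambda=\nu\}},\quad c_N=\frac{N(N-1)(N-2)}3-\frac{N(N-1)}2(u+u'+b).$$ $(P_N(t))_{t\ge0}$ is the unique (standard) Markov semigroup on $\mathbb{GT}^+_N$ with $q$-matrix $R^{(N)}$ (i.e. $R^{(N)}=\lim_{h\downarrow0}(P_N(h)-I)/h$ entrywise); it is a Feller semigroup. The space $\Omega_\infty$. It is the closed subspace of $\mathbb R^\infty\times\mathbb R^\infty\times\mathbb R$ (product topology) of triples $\omega=(\alpha,\beta,\delta)$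 with $\alpha_1\ge\alpha_2\ge\dots\ge0$, $1\ge\beta_1\ge\beta_2\ge\dots\ge0$, $\delta\ge\sum_{i\ge1}(\alpha_i+\beta_i)$; it is locally compact with countable base. Put $\gamma=\delta-\sum_i(\alpha_i+\beta_i)$ and $\Psi(x;\omega)=e^{\gamma(x-1)}\prod_{i=1}^\infty\frac{1+\beta_i(2-\beta_i)(x-1)/2}{1-\alpha_i(2+\alpha_i)(x-1)/2}$, $x\in[-1,1]$. Kernels. Let $\mathfrak P_k(x|a,b)$ be the Jacobi polynomials: $\deg\mathfrak P_k=k$, orthogonal on $[-1,1]$ with weight $(1-x)^a(1+x)^b$. For $\lambda\in\mathbb{GT}^+_N$ put $\mathfrak P_\lambda(x_1,\dots,x_N|a,b)=\det_{1\le i,j\le N}[\mathfrak P_{\lambda_i+N-i}(x_j|a,b)]/\prod_{i<j}(x_i-x_j)$ and $\Phi_\lambda=\mathfrak P_\lambda/\mathfrak P_\lambda(1,\dots,1|a,b)$ (denominator nonzero). The $\Phi_\lambda$ form an orthogonal basis of the Hilbert space $H_N$ of symmetric functions on $[-1,1]^N$ square integrable with respect to $\prod_{i<j}(x_i-x_j)^2\prod_i(1-x_i)^a(1+x_i)^bdx_i$. The Markov kernel $\Lambda^\infty_N$ from $\Omega_\infty$ to $\mathbb{GT}^+_N$ is defined by the expansion in $H_N$: $\prod_{i=1}^N\Psi(x_i;\omega)=\sum_{\lambda\in\mathbb{GT}^+_N}\Lambda^\infty_N(\omega,\lambda)\Phi_\lambda(x_1,\dots,x_N|a,b)$. $z$-measures.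 $M_{z,z',a,b|N}$ is the probability measure on $\mathbb{GT}^+_N$ given by $M_{z,z',a,b|N}(\lambda)=const_N\prod_{i<j}(\widehat l_i-\widehat l_j)^2\prod_{i=1}^NW_N(l_i)$, with $const_N$ the normalization constant and $$W_N(x)=\frac{(x+\epsilon)\,\Gamma(x+2\epsilon)\Gamma(x+a+1)}{\Gamma(x+b+1)\Gamma(x+1)\Gamma(z-x+N)\Gamma(z'-x+N)\Gamma(z+x+N+2\epsilon)\Gamma(z'+x+N+2\epsilon)}$$ (when $\epsilon=0$ and $x=0$, $(x+\epsilon)\Gamma(x+2\epsilon)$ is read as $\frac12$). $M_{z,z',a,b|\infty}$ is the unique probability measure on $\Omega_\infty$ with $M_{z,z',a,b|\infty}\Lambda^\infty_N=M_{z,z',a,b|N}$ for all $N\ge1$. Feller semigroups. A Markov semigroup on a locally compact second countable space $X$ is a family of Markov kernels $P(t)$ from $X$ to $X$ with $P(0)$ the identity kernel and $P(t+s)=P(t)P(s)$; it is Feller if each $P(t)$ maps $C_0(X)$ into itself and $t\mapsto P(t)f$ is continuous $[0,\infty)\to C_0(X)$ for $f\in C_0(X)$. A probability measure $\nu$ is invariant if $\nu P(t)=\nu$ for all $t\ge0$. *)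

theory Defs
  imports "HOL-Probability.Probability" "Jordan_Normal_Form.Determinant"
begin

section \<open>Markov semigroups\<close>

text \<open>
  A Markov kernel from \<open>X\<close> to \<open>Y\<close> is an element of \<open>X \<rightarrow>\<^sub>M prob_algebra Y\<close>. Composition of kernels
  (and application of a kernel to a measure) is \<open>bind\<close>, written from left to right.
\<close>

definition markov_semigroup :: "'x measure \<Rightarrow> (real \<Rightarrow> 'x \<Rightarrow> 'x measure) \<Rightarrow> bool" where
  "markov_semigroup X P \<longleftrightarrow>
     (\<forall>t\<ge>0. P t \<in> X \<rightarrow>\<^sub>M prob_algebra X) \<and>
     (\<forall>x\<in>space X. P 0 x = return X x) \<and>
     (\<forall>s\<ge>0. \<forall>t\<ge>0. \<forall>x\<in>space X. P (t + s) x = P t x \<bind> P s)"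

definition C0_on :: "'x::topological_space set \<Rightarrow> ('x \<Rightarrow> real) set" where
  "C0_on S = {f. continuous_on S f \<and>
     (\<forall>e>0. \<exists>K\<subseteq>S. compact K \<and> (\<forall>x\<in>S - K. \<bar>f x\<bar> < e))}"

definition kernel_apply :: "('x \<Rightarrow> 'x measure) \<Rightarrow> ('x \<Rightarrow> real) \<Rightarrow> 'x \<Rightarrow> real" where
  "kernel_apply K f x = (\<integral>y. f y \<partial>K x)"

definition feller_semigroup :: "'x::topological_space set \<Rightarrow> (real \<Rightarrow> 'x \<Rightarrow> 'x measure) \<Rightarrow> bool" where
  "feller_semigroup S P \<longleftrightarrow>
     markov_semigroup (restrict_space borel S) P \<and>
     (\<forall>t\<ge>0. \<forall>f\<in>C0_on S. kernel_apply (P t) f \<in> C0_on S) \<and>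
     (\<forall>f\<in>C0_on S. \<forall>t\<ge>0.
        uniform_limit S (\<lambda>s. kernel_apply (P s) f) (kernel_apply (P t) f) (at t within {0..}))"

definition invariant_prob :: "'x measure \<Rightarrow> (real \<Rightarrow> 'x \<Rightarrow> 'x measure) \<Rightarrow> 'x measure \<Rightarrow> bool" where
  "invariant_prob X P \<nu> \<longleftrightarrow> \<nu> \<in> space (prob_algebra X) \<and> (\<forall>t\<ge>0. \<nu> \<bind> P t = \<nu>)"

section \<open>Signatures and parameters\<close>

text \<open>
  All indices start at 0, so the \<open>i\<close>-th coordinate of a signature, \<open>1 \<le> i \<le> N\<close>, is \<open>lam ! (i - 1)\<close>.
\<close>

definition GT :: "nat \<Rightarrow> nat list set" where
  "GT N = {lam. length lam = N \<and> sorted_wrt (\<ge>) lam}"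

definition shifted :: "nat \<Rightarrow> nat list \<Rightarrow> nat \<Rightarrow> nat" where
  "shifted N lam i = lam ! i + (N - 1 - i)"

definition eps :: "real \<Rightarrow> real \<Rightarrow> real" where
  "eps a b = (a + b + 1) / 2"

definition hat :: "real \<Rightarrow> real \<Rightarrow> nat \<Rightarrow> real" where
  "hat a b x = (real x + eps a b)\<^sup>2"

definition vandermonde :: "nat \<Rightarrow> (nat \<Rightarrow> real) \<Rightarrow> real" where
  "vandermonde N x = (\<Prod>j<N. \<Prod>i<j. (x i - x j))"

definition Z_princ :: "(complex \<times> complex) set" where
  "Z_princ = {(z, z'). \<not> (z \<in> \<real> \<and> z' \<in> \<real>) \<and> z' = cnj z}"

definition Z_compl :: "(complex \<times> complex) set" where
  "Z_compl = {(z, z'). z \<in> \<real> \<and> z' \<in> \<real> \<and>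
     (\<exists>m::int. of_int m < Re z \<and> Re z < of_int m + 1 \<and> of_int m < Re z' \<and> Re z' < of_int m + 1)}"

text \<open>For pairs in \<open>Z_princ\<close> or \<open>Z_compl\<close> the sum \<open>z + z'\<close> is real, hence
  the real part in the inequality.\<close>

definition H_params :: "real \<Rightarrow> real \<Rightarrow> (complex \<times> complex) set" where
  "H_params a b = {(z, z').
     (z, z') \<in> Z_princ \<union> Z_compl \<and>
     (z + of_real (2 * eps a b), z' + of_real (2 * eps a b)) \<in> Z_princ \<union> Z_compl \<and>
     Re (z + z') + b > -1}"

section \<open>The semigroups at finite level\<close>

text \<open>
  Each \<open>Re\<close> in this section and in the weight \<open>W\<close> below is applied to an expression which is real
  for admissible \<open>(z, z')\<close>; it only changes the type.
\<close>

definition birth_rate :: "real \<Rightarrow> real \<Rightarrow> complex \<Rightarrow> complex \<Rightarrow> nat \<Rightarrow> nat \<Rightarrow> real" where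
  "birth_rate a b z z' N x =
     (let e = eps a b; u = z + of_nat N - 1; u' = z' + of_nat N - 1 in
      (if x = 0 \<and> e = 0 then 1 else (real x + 2 * e) / (2 * (real x + e))) *
      ((real x + a + 1) * Re ((of_nat x - u) * (of_nat x - u')) / (2 * real x + 2 * e + 1)))"

definition death_rate :: "real \<Rightarrow> real \<Rightarrow> complex \<Rightarrow> complex \<Rightarrow> nat \<Rightarrow> nat \<Rightarrow> real" where
  "death_rate a b z z' N x =
     (let e = eps a b; u = z + of_nat N - 1; u' = z' + of_nat N - 1 in
      if x = 0 then 0 else
      real x * (real x + b) *
        Re ((of_nat x + u + of_real (2 * e)) * (of_nat x + u' + of_real (2 * e))) /
      (2 * (real x + e) * (2 * real x + 2 * e - 1)))"

definition R_matrix :: "real \<Rightarrow> real \<Rightarrow> complex \<Rightarrow> complex \<Rightarrow> nat \<Rightarrow> nat \<Rightarrow> nat \<Rightarrow> real" where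
  "R_matrix a b z z' N x y =
     (if y = x + 1 then birth_rate a b z z' N x
      else if x = y + 1 then death_rate a b z z' N x
      else if x = y then - birth_rate a b z z' N x - death_rate a b z z' N x
      else 0)"

definition c_const :: "real \<Rightarrow> complex \<Rightarrow> complex \<Rightarrow> nat \<Rightarrow> real" where
  "c_const b z z' N =
     (let u = z + of_nat N - 1; u' = z' + of_nat N - 1 in
      real N * (real N - 1) * (real N - 2) / 3 - real N * (real N - 1) / 2 * (Re (u + u') + b))"

definition RN :: "real \<Rightarrow> real \<Rightarrow> complex \<Rightarrow> complex \<Rightarrow> nat \<Rightarrow> nat list \<Rightarrow> nat list \<Rightarrow> real" where
  "RN a b z z' N lam \<nu> =
     (let l = shifted N lam; n = shifted N \<nu> in
      vandermonde N (hat a b \<circ> n) / vandermonde N (hat a b \<circ> l) *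
        (\<Sum>k<N. if \<forall>i<N. i \<noteq> k \<longrightarrow> l i = n i then R_matrix a b z z' N (l k) (n k) else 0) -
      (if lam = \<nu> then c_const b z z' N else 0))"

definition has_q_matrix ::
  "'x set \<Rightarrow> (real \<Rightarrow> 'x \<Rightarrow> 'x measure) \<Rightarrow> ('x \<Rightarrow> 'x \<Rightarrow> real) \<Rightarrow> bool" where
  "has_q_matrix E P Q \<longleftrightarrow> (\<forall>x\<in>E. \<forall>y\<in>E.
     ((\<lambda>h. (measure (P h x) {y} - (if x = y then 1 else 0)) / h) \<longlongrightarrow> Q x y) (at_right 0))"

section \<open>The space \<open>\<Omega>\<^sub>\<infinity>\<close>\<close>

type_synonym omega = "(nat \<Rightarrow> real) \<times> (nat \<Rightarrow> real) \<times> real"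

definition Omega :: "omega set" where
  "Omega = {(\<alpha>, \<beta>, \<delta>).
     (\<forall>i. 0 \<le> \<alpha> i \<and> \<alpha> (Suc i) \<le> \<alpha> i) \<and>
     (\<forall>i. 0 \<le> \<beta> i \<and> \<beta> (Suc i) \<le> \<beta> i \<and> \<beta> i \<le> 1) \<and>
     summable (\<lambda>i. \<alpha> i + \<beta> i) \<and> (\<Sum>i. \<alpha> i + \<beta> i) \<le> \<delta>}"

definition Omega_borel :: "omega measure" where
  "Omega_borel = restrict_space borel Omega"

definition Psi :: "omega \<Rightarrow> real \<Rightarrow> real" where
  "Psi \<omega> x = (case \<omega> of (\<alpha>, \<beta>, \<delta>) \<Rightarrow>
     exp ((\<delta> - (\<Sum>i. \<alpha> i + \<beta> i)) * (x - 1)) *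
     (\<Prod>i. (1 + \<beta> i * (2 - \<beta> i) * (x - 1) / 2) / (1 - \<alpha> i * (2 + \<alpha> i) * (x - 1) / 2)))"

section \<open>Multivariate Jacobi polynomials and the kernels \<open>\<Lambda>\<^sup>\<infinity>\<^sub>N\<close>\<close>

definition jacobi_weight :: "real \<Rightarrow> real \<Rightarrow> real \<Rightarrow> real" where
  "jacobi_weight a b x = (1 - x) powr a * (1 + x) powr b"

text \<open>
  The normalization of the Jacobi polynomials is left free: it cancels in \<open>Phi\<close>.
\<close>

definition jacobi_polys :: "real \<Rightarrow> real \<Rightarrow> (nat \<Rightarrow> real poly) \<Rightarrow> bool" where
  "jacobi_polys a b p \<longleftrightarrow>
     (\<forall>k. p k \<noteq> 0 \<and> degree (p k) = k) \<and>
     (\<forall>j k. j \<noteq> k \<longrightarrow>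
        (LBINT x:{-1..1}. poly (p j) x * poly (p k) x * jacobi_weight a b x) = 0)"

text \<open>
  The quotient of the alternant by the Vandermonde determinant is a polynomial. Its value at an
  arbitrary point \<open>x\<close> (in particular at \<open>(1,\<dots>,1)\<close>, where the quotient reads \<open>0/0\<close>) is the limit of
  the quotient at \<open>x\<close> through points with pairwise distinct coordinates. Points are functions
  on \<open>nat\<close> of which only the values below \<open>N\<close> matter.
\<close>

definition jacobi_quot :: "(nat \<Rightarrow> real poly) \<Rightarrow> nat \<Rightarrow> nat list \<Rightarrow> (nat \<Rightarrow> real) \<Rightarrow> real" where
  "jacobi_quot p N lam x =
     Determinant.det (Matrix.mat N N (\<lambda>(i, j). poly (p (shifted N lam i)) (x j))) / vandermonde N x"

definition jacobi_multi :: "(nat \<Rightarrow> real poly) \<Rightarrow> nat \<Rightarrow> nat list \<Rightarrow> (nat \<Rightarrow> real) \<Rightarrow> real" where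
  "jacobi_multi p N lam x = Lim (at x within {y. inj_on y {..<N}}) (jacobi_quot p N lam)"

definition Phi :: "(nat \<Rightarrow> real poly) \<Rightarrow> nat \<Rightarrow> nat list \<Rightarrow> (nat \<Rightarrow> real) \<Rightarrow> real" where
  "Phi p N lam x = jacobi_multi p N lam x / jacobi_multi p N lam (\<lambda>_. 1)"

definition H_norm2 :: "real \<Rightarrow> real \<Rightarrow> nat \<Rightarrow> ((nat \<Rightarrow> real) \<Rightarrow> real) \<Rightarrow> ennreal" where
  "H_norm2 a b N f =
     (\<integral>\<^sup>+ x. ennreal ((f x)\<^sup>2 * (vandermonde N x)\<^sup>2 * (\<Prod>i<N. jacobi_weight a b (x i)))
        \<partial>(\<Pi>\<^sub>M i\<in>{..<N}. restrict_space lborel {-1..1}))"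

text \<open>
  The series is required to converge in the Hilbert space with squared norm \<open>H_norm2\<close>, along finite
  subsets of the index set (for orthogonal series the order of summation does not matter).
\<close>

definition is_Lambda ::
  "real \<Rightarrow> real \<Rightarrow> (nat \<Rightarrow> real poly) \<Rightarrow> nat \<Rightarrow> (omega \<Rightarrow> nat list measure) \<Rightarrow> bool" where
  "is_Lambda a b p N K \<longleftrightarrow>
     K \<in> Omega_borel \<rightarrow>\<^sub>M prob_algebra (count_space (GT N)) \<and>
     (\<forall>\<omega>\<in>Omega.
        ((\<lambda>F. H_norm2 a b N (\<lambda>x. (\<Prod>i<N. Psi \<omega> (x i)) - (\<Sum>lam\<in>F. measure (K \<omega>) {lam} * Phi p N lam x)))
          \<longlongrightarrow> 0) (finite_subsets_at_top (GT N)))"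

section \<open>The z-measures\<close>

definition W_weight :: "real \<Rightarrow> real \<Rightarrow> complex \<Rightarrow> complex \<Rightarrow> nat \<Rightarrow> nat \<Rightarrow> real" where
  "W_weight a b z z' N x =
     (let e = eps a b; e2 = complex_of_real (2 * e) in
      (if x = 0 \<and> e = 0 then 1 / 2 else (real x + e) * Gamma (real x + 2 * e)) *
        Gamma (real x + a + 1) / (Gamma (real x + b + 1) * Gamma (real x + 1) *
      Re (Gamma (z - of_nat x + of_nat N) * Gamma (z' - of_nat x + of_nat N) *
          Gamma (z + of_nat x + of_nat N + e2) * Gamma (z' + of_nat x + of_nat N + e2))))"

definition z_weight :: "real \<Rightarrow> real \<Rightarrow> complex \<Rightarrow> complex \<Rightarrow> nat \<Rightarrow> nat list \<Rightarrow> real" where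
  "z_weight a b z z' N lam =
     (vandermonde N (hat a b \<circ> shifted N lam))\<^sup>2 * (\<Prod>i<N. W_weight a b z z' N (shifted N lam i))"

definition z_measure :: "real \<Rightarrow> real \<Rightarrow> complex \<Rightarrow> complex \<Rightarrow> nat \<Rightarrow> nat list measure" where
  "z_measure a b z z' N = point_measure (GT N)
     (\<lambda>lam. ennreal (z_weight a b z z' N lam / (\<Sum>\<^sub>\<infinity>\<mu>\<in>GT N. z_weight a b z z' N \<mu>)))"

text \<open>The measure \<open>M\<^bsub>z,z',a,b|\<infinity>\<^esub>\<close>, for given kernels \<open>\<Lambda> N\<close>, is characterized by its projections.\<close>

definition is_spectral_z_measure ::
  "real \<Rightarrow> real \<Rightarrow> complex \<Rightarrow> complex \<Rightarrow> (nat \<Rightarrow> omega \<Rightarrow> nat list measure) \<Rightarrow> omega measure \<Rightarrow> bool"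
  where
  "is_spectral_z_measure a b z z' \<Lambda> M \<longleftrightarrow>
     M \<in> space (prob_algebra Omega_borel) \<and> (\<forall>N\<ge>1. M \<bind> \<Lambda> N = z_measure a b z z' N)"

end

theory Submission
  imports Defs "HOL-Complex_Analysis.Cauchy_Integral_Formula"
begin

text \<open>
  At level \<open>N\<close>, the generator \<open>RN\<close> is a Doob transform of \<open>N\<close> independent birth and death processes, in
  detailed balance with the \<open>z\<close>-measure, and a Lyapunov function built from the eigenfunctions of the
  one-dimensional generator excludes bounded solutions of \<open>R f = l f\<close> for some \<open>l > 0\<close>. Hence the resolvent is
  the minimal one, which inherits reversibility, and the \<open>z\<close>-measure is the only invariant probability
  measure of the irreducible chain.

  The kernels \<open>\<Lambda> N\<close>, \<open>N \<ge> 2\<close>, jointly separate probability measures \<open>\<nu>\<close> on \<open>Omega\<close>: the coefficients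
  \<open>(\<nu> \<bind> \<Lambda> N) {\<mu>}\<close> determine the integral of \<open>Psi \<omega> (x 1) \<dots> Psi \<omega> (x N)\<close> over \<open>\<nu>\<close> by completeness of the
  Jacobi polynomials; setting coordinates to \<open>1\<close>, where \<open>Psi\<close> is \<open>1\<close>, one obtains all mixed moments
  of the bounded functions \<open>Psi \<omega> (pt j)\<close>, and these functions separate the points of \<open>Omega\<close>.

  By intertwining, \<open>M\<close> and \<open>M \<bind> P t\<close> have the same images under all \<open>\<Lambda> N\<close>, and every invariant \<open>\<nu>\<close> has
  invariant images, which are the \<open>z\<close>-measures.
\<close>

section \<open>Invariant measures of Markov kernels on countable sets\<close>

text \<open>Detailed balance for an unbounded q-matrix does not by itself make the z-measure
  invariant: the semigroup is known only through its derivatives at time 0, and an exploding chain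
  could be continued in several ways. The resolvent turns the question into algebra. It solves the
  backward equation, whose minimal solution is a limit of explicit iterates; balance bounds every
  iterate by the z-measure, and total mass 1 turns the bound into an equality. One parameter l is
  enough, so no Laplace transform is inverted. The Lyapunov function is forced by the algebra. In
  the Newton basis with nodes (r + e)^2 the generator is triangular; the alternant of the first N
  basis functions is the Vandermonde product V up to sign, and raising its top index by one
  multiplies it by the sum of the (n_i + e)^2 minus a constant. The sum of the first N eigenvalues
  is c_N. On Omega the difficulty is topological: \<gamma> is not continuous. The compact sets on
  which \<delta> is bounded repair this, since there the values of Psi are continuous and compact
  sets have compact, hence Borel, images.\<close>

lemma integral_bind_prob_algebra:
  fixes f :: "'b \<Rightarrow> real"
  assumes M: "M \<in> space (prob_algebra X)" and N: "N \<in> X \<rightarrow>\<^sub>M prob_algebra Y"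
    and f: "f \<in> borel_measurable Y" "\<And>y. y \<in> space Y \<Longrightarrow> \<bar>f y\<bar> \<le> B"
  shows "(\<integral>y. f y \<partial>(M \<bind> N)) = (\<integral>x. (\<integral>y. f y \<partial>N x) \<partial>M)"
proof -
  have M': "prob_space M" "sets M = sets X" using M by (auto simp: space_prob_algebra)
  then have N': "N \<in> M \<rightarrow>\<^sub>M subprob_algebra Y"
    using measurable_prob_algebraD[OF N] measurable_cong_sets by blast
  show ?thesis
    using f N' M' subprob_space.emeasure_space_le_1[OF subprob_space_kernel[OF N']]
    by (intro integral_bind[where K = Y and B = B and B' = 1] prob_space.finite_measure AE_I2) auto
qed

lemma measure_bind_prob_algebra:
  assumes M: "M \<in> space (prob_algebra X)" and N: "N \<in> X \<rightarrow>\<^sub>M prob_algebra Y" and A: "A \<in> sets Y"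
  shows "measure (M \<bind> N) A = (\<integral>x. measure (N x) A \<partial>M)"
proof -
  have M': "prob_space M" "sets M = sets X" using M by (auto simp: space_prob_algebra)
  then have N': "N \<in> M \<rightarrow>\<^sub>M subprob_algebra Y"
    using measurable_prob_algebraD[OF N] measurable_cong_sets by blast
  show ?thesis
    using M'(1) prob_space_imp_subprob_space subprob_space.measure_bind[OF _ N' A] by blast
qed

lemma bind_in_prob_algebra:
  assumes M: "M \<in> space (prob_algebra X)" and N: "N \<in> X \<rightarrow>\<^sub>M prob_algebra Y"
  shows "M \<bind> N \<in> space (prob_algebra Y)"
  using measurable_space[OF measurable_bind_prob_space[OF _ N, of "\<lambda>_. M" "count_space {()}"], of "()"] M
  by simp

lemma bind_assoc_prob_algebra:
  assumes M: "M \<in> space (prob_algebra X)" and N: "N \<in> X \<rightarrow>\<^sub>M prob_algebra Y"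
    and K: "K \<in> Y \<rightarrow>\<^sub>M prob_algebra Z"
  shows "(M \<bind> N) \<bind> K = M \<bind> (\<lambda>x. N x \<bind> K)"
proof -
  have "sets M = sets X" using M by (auto simp: space_prob_algebra)
  then have "N \<in> M \<rightarrow>\<^sub>M subprob_algebra Y"
    using measurable_prob_algebraD[OF N] measurable_cong_sets by blast
  then show ?thesis using bind_assoc measurable_prob_algebraD[OF K] by blast
qed

lemma prob_count_space_eq_density:
  assumes E: "countable E" and M: "M \<in> space (prob_algebra (count_space E))"
  shows "M = density (count_space E) (\<lambda>x. ennreal (measure M {x}))"
proof (rule measure_eqI_countable[OF _ _ E])
  have sets: "sets M = Pow E" and M': "prob_space M"
    using M by (auto simp: space_prob_algebra)
  then interpret prob_space M by simp
  show "sets M = Pow E" by fact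
  show "sets (density (count_space E) (\<lambda>x. ennreal (measure M {x}))) = Pow E" by simp
  fix a assume "a \<in> E"
  then show "emeasure M {a} = emeasure (density (count_space E) (\<lambda>x. ennreal (measure M {x}))) {a}"
    by (simp add: emeasure_density emeasure_eq_measure nn_integral_cmult_indicator)
qed

lemma prob_count_space_integral:
  fixes f :: "'x \<Rightarrow> real"
  assumes E: "countable E" and M: "M \<in> space (prob_algebra (count_space E))"
    and f: "\<And>x. x \<in> E \<Longrightarrow> \<bar>f x\<bar> \<le> B"
  shows "integrable M f" "integrable (count_space E) (\<lambda>x. measure M {x} * f x)"
    "(\<integral>x. f x \<partial>M) = (\<integral>x. measure M {x} * f x \<partial>count_space E)"
proof -
  have sets: "sets M = sets (count_space E)" and M': "prob_space M"
    using M by (auto simp: space_prob_algebra)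
  then interpret prob_space M by simp
  have sp: "space M = E" using sets_eq_imp_space_eq[OF sets] by simp
  have meas: "f \<in> borel_measurable M" using sets by (simp add: measurable_cong_sets[OF sets refl])
  show int: "integrable M f"
    using f sp meas by (intro integrable_const_bound[where B = B]) auto
  note d = prob_count_space_eq_density[OF E M]
  show "integrable (count_space E) (\<lambda>x. measure M {x} * f x)"
    using int by (subst (asm) d) (simp add: integrable_density)
  show "(\<integral>x. f x \<partial>M) = (\<integral>x. measure M {x} * f x \<partial>count_space E)"
    by (subst d) (simp add: integral_density)
qed

lemma invariant_unique_of_positive:
  assumes E: "countable E" and K: "K \<in> count_space E \<rightarrow>\<^sub>M prob_algebra (count_space E)"
    and pos: "\<And>x y. x \<in> E \<Longrightarrow> y \<in> E \<Longrightarrow> measure (K x) {y} > 0"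
    and \<mu>: "\<mu> \<in> space (prob_algebra (count_space E))" "\<mu> \<bind> K = \<mu>"
    and \<nu>: "\<nu> \<in> space (prob_algebra (count_space E))" "\<nu> \<bind> K = \<nu>"
  shows "\<mu> = \<nu>"
proof -
  \<comment> \<open>\<open>A\<close> is the positive set of \<open>\<mu> - \<nu>\<close>; applying \<open>K\<close> strictly decreases the mass of \<open>A\<close> unless \<open>A\<close>
    is empty or everything.\<close>
  define d where "d x = measure \<mu> {x} - measure \<nu> {x}" for x
  define A where "A = {x\<in>E. d x > 0}"
  interpret \<mu>: prob_space \<mu> using \<mu> by (auto simp: space_prob_algebra)
  interpret \<nu>: prob_space \<nu> using \<nu> by (auto simp: space_prob_algebra)
  have sets: "sets \<mu> = Pow E" "sets \<nu> = Pow E" using \<mu> \<nu> by (auto simp: space_prob_algebra)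
  have Kx: "prob_space (K x)" "sets (K x) = Pow E" "space (K x) = E" if "x \<in> E" for x
    using measurable_space[OF K, of x] that sets_eq_imp_space_eq[of "K x" "count_space E"]
    by (auto simp: space_prob_algebra)
  have Kle: "measure (K x) B \<le> 1" if "x \<in> E" for x B
    using prob_space.prob_le_1[OF Kx(1)[OF that]] .
  have diff: "(\<integral>x. f x \<partial>\<mu>) - (\<integral>x. f x \<partial>\<nu>) = (\<integral>x. d x * f x \<partial>count_space E)"
    and int: "integrable (count_space E) (\<lambda>x. d x * f x)"
    if f: "\<And>x. x \<in> E \<Longrightarrow> \<bar>f x\<bar> \<le> 1" for f
    using prob_count_space_integral[OF E \<mu>(1) f] prob_count_space_integral[OF E \<nu>(1) f]
    by (simp_all add: d_def left_diff_distrib)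
  have A: "A \<in> sets (count_space E)" by (auto simp: A_def)
  have m: "measure \<mu> A = (\<integral>x. measure (K x) A \<partial>\<mu>)" "measure \<nu> A = (\<integral>x. measure (K x) A \<partial>\<nu>)"
    using measure_bind_prob_algebra[OF \<mu>(1) K A] measure_bind_prob_algebra[OF \<nu>(1) K A] \<mu>(2) \<nu>(2) by auto
  have m': "measure \<mu> A = (\<integral>x. indicator A x \<partial>\<mu>)" "measure \<nu> A = (\<integral>x. indicator A x \<partial>\<nu>)"
    using sets A by (simp_all add: Int_absorb2)
  have bd: "\<bar>indicator A x - measure (K x) A\<bar> \<le> 1" if "x \<in> E" for x
    using Kle[OF that, of A] by (auto simp: indicator_def)
  have "(\<integral>x. d x * (indicator A x - measure (K x) A) \<partial>count_space E) = 0"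
    using diff[of "\<lambda>x. indicator A x - measure (K x) A", OF bd] diff[of "indicator A"] 
      diff[of "\<lambda>x. measure (K x) A"] int[of "indicator A"] int[of "\<lambda>x. measure (K x) A"] Kle m m'
    by (simp add: right_diff_distrib indicator_def)
  \<comment> \<open>On \<open>A\<close> both factors are nonnegative, off \<open>A\<close> both are
    nonpositive.\<close>
  moreover have nn: "0 \<le> d x * (indicator A x - measure (K x) A)" if "x \<in> E" for x
    using that Kle[OF that, of A]
    by (cases "x \<in> A") (auto simp: A_def not_less mult_nonpos_nonneg indicator_def intro!: mult_nonneg_nonneg mult_nonpos_nonpos)
  ultimately have "AE x in count_space E. d x * (indicator A x - measure (K x) A) = 0"
    using integral_nonneg_eq_0_iff_AE[OF int[OF bd]] by (auto simp: AE_count_space)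
  then have zero: "d x * (indicator A x - measure (K x) A) = 0" if "x \<in> E" for x
    using that by (auto simp: AE_count_space)
  have dsum: "(\<integral>x. d x \<partial>count_space E) = 0" and dint: "integrable (count_space E) d"
    using diff[of "\<lambda>_. 1"] int[of "\<lambda>_. 1"] \<mu>.prob_space \<nu>.prob_space by auto
  have d0: "d x = 0" if "x \<in> E" for x
  proof (cases "A = {}")
    case True
    then have "\<forall>x\<in>E. 0 \<le> - d x" by (auto simp: A_def)
    then have "AE x in count_space E. - d x = 0"
      using integral_nonneg_eq_0_iff_AE[of "count_space E" "\<lambda>x. - d x"] dsum dint by (auto simp: AE_count_space)
    then show ?thesis using that by (auto simp: AE_count_space)
  next
    case False
    then obtain x where x: "x \<in> A" by blast
    then have xE: "x \<in> E" and dx: "d x > 0" by (auto simp: A_def)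
    interpret Kx: prob_space "K x" using Kx xE by auto
    from zero[OF xE] x dx have one: "measure (K x) A = 1" by auto
    have "E \<subseteq> A"
    proof
      fix y assume y: "y \<in> E"
      show "y \<in> A"
      proof (rule ccontr)
        assume "y \<notin> A"
        then have "measure (K x) A + measure (K x) {y} = measure (K x) (A \<union> {y})"
          using y A Kx[OF xE] by (intro Kx.finite_measure_Union[symmetric]) auto
        also have "\<dots> \<le> 1" by simp
        finally show False using one pos[OF xE y] by simp
      qed
    qed
    then have "\<forall>x\<in>E. 0 \<le> d x" by (auto simp: A_def dest: order.strict_implies_order)
    then have "AE x in count_space E. d x = 0"
      using integral_nonneg_eq_0_iff_AE[of "count_space E" "\<lambda>x. d x"] dsum dint by (auto simp: AE_count_space)
    then show ?thesis using that by (auto simp: AE_count_space)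
  qed
  show ?thesis
    using d0 by (intro measure_eqI_countable[OF sets E]) (simp add: d_def \<mu>.emeasure_eq_measure \<nu>.emeasure_eq_measure)
qed

section \<open>Markov chains with a given q-matrix\<close>

locale q_chain =
  fixes E :: "'x set" and P :: "real \<Rightarrow> 'x \<Rightarrow> 'x measure" and Q :: "'x \<Rightarrow> 'x \<Rightarrow> real"
  assumes countable_E: "countable E"
    and semigroup: "markov_semigroup (count_space E) P"
    and q_matrix: "has_q_matrix E P Q"
    and finite_rows: "\<And>x. x \<in> E \<Longrightarrow> finite {y\<in>E. Q x y \<noteq> 0}"
    and conservative: "\<And>x. x \<in> E \<Longrightarrow> (\<Sum>y\<in>{y\<in>E. Q x y \<noteq> 0}. Q x y) = 0"
begin

abbreviation "X \<equiv> count_space E"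

definition gen :: "('x \<Rightarrow> real) \<Rightarrow> 'x \<Rightarrow> real" where
  "gen f x = (\<Sum>y\<in>{y\<in>E. Q x y \<noteq> 0}. Q x y * f y)"

lemma P_kernel: "t \<ge> 0 \<Longrightarrow> P t \<in> X \<rightarrow>\<^sub>M prob_algebra X"
  and P_0: "x \<in> E \<Longrightarrow> P 0 x = return X x"
  and P_add: "s \<ge> 0 \<Longrightarrow> t \<ge> 0 \<Longrightarrow> x \<in> E \<Longrightarrow> P (t + s) x = P t x \<bind> P s"
  using semigroup unfolding markov_semigroup_def by auto

lemma P_prob: "t \<ge> 0 \<Longrightarrow> x \<in> E \<Longrightarrow> P t x \<in> space (prob_algebra X)"
  using measurable_space[OF P_kernel] by simp

lemma prob_space_E:
  assumes "M \<in> space (prob_algebra X)"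
  shows "prob_space M" "sets M = Pow E" "space M = E"
  using assms sets_eq_imp_space_eq[of M X] by (auto simp: space_prob_algebra)

lemma P_le_1: "t \<ge> 0 \<Longrightarrow> x \<in> E \<Longrightarrow> measure (P t x) A \<le> 1"
  using prob_space.prob_le_1[OF prob_space_E(1)[OF P_prob]] by auto

lemma abs_integral_le:
  fixes f :: "'x \<Rightarrow> real"
  assumes M: "M \<in> space (prob_algebra X)" and f: "\<And>y. y \<in> E \<Longrightarrow> \<bar>f y\<bar> \<le> B"
  shows "\<bar>\<integral>y. f y \<partial>M\<bar> \<le> B"
proof -
  interpret prob_space M using prob_space_E M by auto
  have "\<bar>\<integral>y. f y \<partial>M\<bar> \<le> (\<integral>y. \<bar>f y\<bar> \<partial>M)" by (rule integral_abs_bound)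
  also have "\<dots> \<le> (\<integral>y. B \<partial>M)"
    using prob_count_space_integral(1)[OF countable_E M, of "\<lambda>y. \<bar>f y\<bar>" B] f prob_space_E(3)[OF M]
    by (intro integral_mono) auto
  also have "\<dots> = B" using prob_space by simp
  finally show ?thesis .
qed

text \<open>Only a finite part of the space is kept, at the cost of \<open>B\<close> times the mass
  outside \<open>S\<close>. For \<open>S\<close> containing a row of \<open>Q\<close> that mass is
  o(h) at time h, which is what \<open>generator_limit\<close> needs.\<close>

lemma integral_split:
  fixes f :: "'x \<Rightarrow> real"
  assumes M: "M \<in> space (prob_algebra X)" and f: "\<And>y. y \<in> E \<Longrightarrow> \<bar>f y\<bar> \<le> B"
    and S: "finite S" "S \<subseteq> E"
  shows "\<bar>(\<integral>y. f y \<partial>M) - (\<Sum>y\<in>S. measure M {y} * f y)\<bar> \<le> B * (1 - (\<Sum>y\<in>S. measure M {y}))"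
proof -
  interpret prob_space M using prob_space_E M by auto
  note sM = prob_space_E(2,3)[OF M]
  have int: "integrable M g" if "\<And>y. y \<in> E \<Longrightarrow> \<bar>g y\<bar> \<le> C" for g :: "'x \<Rightarrow> real" and C
    using prob_count_space_integral(1)[OF countable_E M that] .
  have sub: "(\<integral>y. indicator S y * g y \<partial>M) = (\<Sum>y\<in>S. measure M {y} * g y)" for g :: "'x \<Rightarrow> real"
  proof -
    have "(\<integral>y. indicator S y * g y \<partial>M) = (\<integral>y. (\<Sum>s\<in>S. indicator {s} y * g s) \<partial>M)"
      using S by (intro Bochner_Integration.integral_cong refl) (auto simp: indicator_def)
    also have "\<dots> = (\<Sum>s\<in>S. (\<integral>y. indicator {s} y * g s \<partial>M))"
      using sM S by (intro Bochner_Integration.integral_sum integrable_mult_left integrable_real_indicator) (auto simp: less_top[symmetric])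
    also have "\<dots> = (\<Sum>y\<in>S. measure M {y} * g y)"
      using S sM by (intro sum.cong refl) (auto simp: Int_absorb2)
    finally show ?thesis .
  qed
  have iS: "integrable M (\<lambda>y. indicator S y * f y)"
    using f by (intro int[of _ "B"]) (force simp: indicator_def)
  have "(\<integral>y. f y \<partial>M) - (\<Sum>y\<in>S. measure M {y} * f y) = (\<integral>y. f y - indicator S y * f y \<partial>M)"
    using sub[of f] int[OF f] iS by simp
  also have "\<bar>\<dots>\<bar> \<le> (\<integral>y. \<bar>f y - indicator S y * f y\<bar> \<partial>M)" by (rule integral_abs_bound)
  also have "\<dots> \<le> (\<integral>y. B - indicator S y * B \<partial>M)"
    using f sM int[OF f] iS S
    by (intro integral_mono Bochner_Integration.integrable_diff integrable_abs integrable_mult_left integrable_real_indicator)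
       (auto simp: indicator_def less_top[symmetric])
  also have "\<dots> = B - (\<Sum>y\<in>S. measure M {y} * B)"
    using sub[of "\<lambda>_. B"] prob_space sM S
    by (subst Bochner_Integration.integral_diff)
       (auto intro!: integrable_mult_left integrable_real_indicator simp: less_top[symmetric])
  finally show ?thesis by (simp add: sum_distrib_right[symmetric] sum_distrib_left algebra_simps)
qed

section \<open>Short-time behaviour of the transition probabilities\<close>

lemma transition_ge_0_limit:
  assumes "x \<in> E" "y \<in> E"
  shows "((\<lambda>h. (measure (P h x) {y} - (if x = y then 1 else 0)) / h) \<longlongrightarrow> Q x y) (at_right 0)"
  using q_matrix assms unfolding has_q_matrix_def by blast

lemma Q_nonneg:
  assumes "x \<in> E" "y \<in> E" "x \<noteq> y"
  shows "0 \<le> Q x y"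
  using assms transition_ge_0_limit[of x y]
  by (intro tendsto_lowerbound[of _ "Q x y" "at_right 0"])
     (auto simp: eventually_at_filter intro!: always_eventually)

lemma transition_tendsto:
  assumes "x \<in> E" "y \<in> E"
  shows "((\<lambda>h. measure (P h x) {y}) \<longlongrightarrow> (if x = y then 1 else 0)) (at_right 0)"
proof -
  define c :: real where "c = (if x = y then 1 else 0)"
  have "((\<lambda>h. (measure (P h x) {y} - c) / h * h + c) \<longlongrightarrow> Q x y * 0 + c) (at_right 0)"
    unfolding c_def by (intro tendsto_add tendsto_mult tendsto_ident_at tendsto_const transition_ge_0_limit assms)
  then have "((\<lambda>h. (measure (P h x) {y} - c) / h * h + c) \<longlongrightarrow> c) (at_right 0)" by simp
  moreover have "eventually (\<lambda>h. (measure (P h x) {y} - c) / h * h + c = measure (P h x) {y}) (at_right 0)"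
    by (auto simp: eventually_at_filter)
  ultimately show ?thesis unfolding c_def[symmetric] by (rule Lim_transform_eventually)
qed

text \<open>Entrywise derivatives control only finitely many states at once. The row of
  \<open>x\<close> is finite and sums to 0, so the difference quotients of the kept probabilities
  sum to something tending to 0, and the escaping mass is negligible against h.\<close>

lemma generator_limit:
  assumes x: "x \<in> E" and f: "\<And>y. y \<in> E \<Longrightarrow> \<bar>f y\<bar> \<le> B"
  shows "((\<lambda>h. (kernel_apply (P h) f x - f x) / h) \<longlongrightarrow> gen f x) (at_right 0)"
proof -
  define S where "S = insert x {y\<in>E. Q x y \<noteq> 0}"
  have S: "finite S" "S \<subseteq> E" using x finite_rows by (auto simp: S_def)
  define D where "D h y = (measure (P h x) {y} - (if x = y then 1 else 0)) / h" for h y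
  have D: "((\<lambda>h. D h y) \<longlongrightarrow> Q x y) (at_right 0)" if "y \<in> S" for y
    unfolding D_def using that S by (intro transition_ge_0_limit x) auto
  have gen_S: "(\<Sum>y\<in>S. Q x y * g y) = (\<Sum>y\<in>{y\<in>E. Q x y \<noteq> 0}. Q x y * g y)" for g
    using S finite_rows[OF x] by (intro sum.mono_neutral_right) (auto simp: S_def)
  have main: "((\<lambda>h. \<Sum>y\<in>S. D h y * f y) \<longlongrightarrow> gen f x) (at_right 0)"
    unfolding gen_def gen_S[symmetric] by (intro tendsto_intros D)
  have "((\<lambda>h. \<Sum>y\<in>S. D h y) \<longlongrightarrow> 0) (at_right 0)"
    using tendsto_sum[of S "\<lambda>y h. D h y" "Q x" "at_right 0"] D gen_S[of "\<lambda>_. 1"] conservative[OF x] by simp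
  then have err: "((\<lambda>h. - B * (\<Sum>y\<in>S. D h y)) \<longlongrightarrow> 0) (at_right 0)"
    by (rule tendsto_mult_right_zero)
  have id: "(\<Sum>y\<in>S. D h y * g y) = ((\<Sum>y\<in>S. measure (P h x) {y} * g y) - g x) / h" for g h
  proof -
    have "(\<Sum>y\<in>S. D h y * g y) = (\<Sum>y\<in>S. (measure (P h x) {y} * g y - (if x = y then g y else 0)) / h)"
      by (intro sum.cong refl) (auto simp: D_def field_simps)
    also have "\<dots> = ((\<Sum>y\<in>S. measure (P h x) {y} * g y) - g x) / h"
      using S by (simp add: sum_divide_distrib[symmetric] sum_subtractf S_def)
    finally show ?thesis .
  qed
  have bound: "\<bar>(kernel_apply (P h) f x - f x) / h - (\<Sum>y\<in>S. D h y * f y)\<bar> \<le> - B * (\<Sum>y\<in>S. D h y)"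
    if "h > 0" for h
  proof -
    have "\<bar>kernel_apply (P h) f x - (\<Sum>y\<in>S. measure (P h x) {y} * f y)\<bar>
        \<le> B * (1 - (\<Sum>y\<in>S. measure (P h x) {y}))"
      unfolding kernel_apply_def using that by (intro integral_split P_prob x f S) auto
    then have "\<bar>kernel_apply (P h) f x - (\<Sum>y\<in>S. measure (P h x) {y} * f y)\<bar> / h
        \<le> B * (1 - (\<Sum>y\<in>S. measure (P h x) {y})) / h"
      using that by (intro divide_right_mono) auto
    also have "B * (1 - (\<Sum>y\<in>S. measure (P h x) {y})) / h = - B * (\<Sum>y\<in>S. D h y)"
    proof -
      have "(\<Sum>y\<in>S. D h y) = ((\<Sum>y\<in>S. measure (P h x) {y}) - 1) / h" using id[of h "\<lambda>_. 1"] by simp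
      then show ?thesis by (simp add: field_simps)
    qed
    also have "\<bar>kernel_apply (P h) f x - (\<Sum>y\<in>S. measure (P h x) {y} * f y)\<bar> / h
       = \<bar>(kernel_apply (P h) f x - f x) / h - (\<Sum>y\<in>S. D h y * f y)\<bar>"
    proof -
      have "(kernel_apply (P h) f x - f x) / h - (\<Sum>y\<in>S. D h y * f y)
          = (kernel_apply (P h) f x - (\<Sum>y\<in>S. measure (P h x) {y} * f y)) / h"
        unfolding id[of h f] by (simp add: diff_divide_distrib)
      then show ?thesis using that by (simp only: abs_divide abs_of_pos)
    qed
    finally show ?thesis .
  qed
  have "((\<lambda>h. (kernel_apply (P h) f x - f x) / h - (\<Sum>y\<in>S. D h y * f y)) \<longlongrightarrow> 0) (at_right 0)"
    using bound by (intro Lim_null_comparison[OF _ err]) (auto simp: eventually_at_filter)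
  from tendsto_add[OF this main] show ?thesis by simp
qed

lemma kernel_apply_add:
  assumes "s \<ge> 0" "t \<ge> 0" "x \<in> E" and f: "\<And>y. y \<in> E \<Longrightarrow> \<bar>f y\<bar> \<le> B"
  shows "kernel_apply (P (t + s)) f x = kernel_apply (P t) (kernel_apply (P s) f) x"
  unfolding kernel_apply_def P_add[OF assms(1-3)]
  using assms by (intro integral_bind_prob_algebra[OF P_prob P_kernel]) auto

lemma kernel_apply_bound:
  assumes "t \<ge> 0" "x \<in> E" and f: "\<And>y. y \<in> E \<Longrightarrow> \<bar>f y\<bar> \<le> B"
  shows "\<bar>kernel_apply (P t) f x\<bar> \<le> B"
  unfolding kernel_apply_def using assms by (intro abs_integral_le P_prob) auto

text \<open>The extra time \<open>h\<close> is spent first: with probability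
  \<open>measure (P h x) {x}\<close> the chain is then at \<open>x\<close>, and otherwise the two
  values differ by at most \<open>2 * B\<close>. The bound does not involve
  \<open>t\<close>.\<close>

lemma kernel_apply_time_diff:
  assumes "h \<ge> 0" "t \<ge> 0" "x \<in> E" and f: "\<And>y. y \<in> E \<Longrightarrow> \<bar>f y\<bar> \<le> B"
  shows "\<bar>kernel_apply (P (h + t)) f x - kernel_apply (P t) f x\<bar> \<le> 2 * B * (1 - measure (P h x) {x})"
proof -
  let ?g = "kernel_apply (P t) f"
  have g: "\<bar>?g y\<bar> \<le> B" if "y \<in> E" for y using kernel_apply_bound[OF assms(2) that f] .
  have "\<bar>kernel_apply (P (h + t)) f x - measure (P h x) {x} * ?g x\<bar> \<le> B * (1 - measure (P h x) {x})"
  proof -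
    have "kernel_apply (P (h + t)) f x = (\<integral>y. ?g y \<partial>P h x)"
      using kernel_apply_add[of t h x f B] assms by (simp add: kernel_apply_def[of "P h"])
    then show ?thesis
      using integral_split[OF P_prob[OF assms(1,3)], of ?g B "{x}"] g assms by simp
  qed
  moreover have "\<bar>(1 - measure (P h x) {x}) * ?g x\<bar> \<le> (1 - measure (P h x) {x}) * B"
    using g[OF assms(3)] P_le_1[OF assms(1,3), of "{x}"] by (subst abs_mult) (intro mult_mono, auto)
  moreover have "kernel_apply (P (h + t)) f x - ?g x
      = (kernel_apply (P (h + t)) f x - measure (P h x) {x} * ?g x) - (1 - measure (P h x) {x}) * ?g x"
    "2 * B * (1 - measure (P h x) {x}) = B * (1 - measure (P h x) {x}) + (1 - measure (P h x) {x}) * B"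
    by (simp_all add: algebra_simps)
  ultimately show ?thesis by linarith
qed

lemma kernel_apply_continuous:
  assumes x: "x \<in> E" and f: "\<And>y. y \<in> E \<Longrightarrow> \<bar>f y\<bar> \<le> B"
  shows "continuous_on {0..} (\<lambda>t. kernel_apply (P t) f x)"
  unfolding continuous_on_def
proof
  fix t :: real assume "t \<in> {0..}"
  then have t: "t \<ge> 0" by simp
  \<comment> \<open>One modulus of continuity serves both sides of \<open>t\<close>, because the
    bound on time differences is uniform in the base time.\<close>
  define w where "w h = 2 * B * (1 - measure (P h x) {x})" for h
  have w0: "w 0 = 0" using x by (simp add: w_def P_0 measure_return)
  have "(w \<longlongrightarrow> 2 * B * (1 - 1)) (at_right 0)"
    unfolding w_def using transition_tendsto[OF x x] by (intro tendsto_intros) simp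
  then have "(w \<longlongrightarrow> w 0) (at_right 0)" using w0 by simp
  moreover have "filterlim (\<lambda>s. \<bar>s - t\<bar>) (at_right 0) (at t within {0..})"
    by (auto simp: filterlim_at eventually_at_filter intro!: tendsto_eq_intros)
  ultimately have lim: "((\<lambda>s. w \<bar>s - t\<bar>) \<longlongrightarrow> w 0) (at t within {0..})"
    by (rule filterlim_compose)
  have "\<bar>kernel_apply (P s) f x - kernel_apply (P t) f x\<bar> \<le> w \<bar>s - t\<bar>" if "s \<ge> 0" for s
  proof (cases "s \<ge> t")
    case True
    then show ?thesis using kernel_apply_time_diff[of "s - t" t x f B] t x f by (simp add: w_def)
  next
    case False
    then have st: "\<bar>s - t\<bar> = t - s" "t - s + s = t" "0 \<le> t - s" by auto
    have "\<bar>kernel_apply (P (t - s + s)) f x - kernel_apply (P s) f x\<bar> \<le> w (t - s)"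
      unfolding w_def by (rule kernel_apply_time_diff[OF st(3) that x f])
    then show ?thesis unfolding st by (simp only: abs_minus_commute)
  qed
  then have "eventually (\<lambda>s. norm (kernel_apply (P s) f x - kernel_apply (P t) f x) \<le> w \<bar>s - t\<bar>) (at t within {0..})"
    by (simp add: eventually_at_filter)
  then have "((\<lambda>s. kernel_apply (P s) f x - kernel_apply (P t) f x) \<longlongrightarrow> 0) (at t within {0..})"
    by (rule Lim_null_comparison) (rule lim[unfolded w0])
  then show "((\<lambda>s. kernel_apply (P s) f x) \<longlongrightarrow> kernel_apply (P t) f x) (at t within {0..})"
    using LIM_zero_iff by blast
qed

section \<open>Positivity of transition probabilities\<close>

lemma measure_P_add:
  assumes "s \<ge> 0" "t \<ge> 0" "x \<in> E"
  shows "measure (P (s + t) x) {y} = (\<integral>z. measure (P t z) {y} \<partial>P s x)"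
proof (cases "y \<in> E")
  case True
  then show ?thesis unfolding P_add[OF assms(2,1,3)]
    using assms by (intro measure_bind_prob_algebra[OF P_prob P_kernel]) auto
next
  case False
  have "measure (P r z) {y} = 0" if "r \<ge> 0" "z \<in> E" for r z
    using False prob_space_E(2)[OF P_prob[OF that]] by (simp add: measure_notin_sets)
  then show ?thesis using assms prob_space_E(3)[OF P_prob[OF assms(1,3)]]
    by (subst Bochner_Integration.integral_cong[where g = "\<lambda>_. 0"]) auto
qed

lemma transition_mult_le:
  assumes "s \<ge> 0" "t \<ge> 0" "x \<in> E" "z \<in> E"
  shows "measure (P s x) {z} * measure (P t z) {y} \<le> measure (P (s + t) x) {y}"
proof -
  interpret prob_space "P s x" using prob_space_E P_prob assms by auto
  note sM = prob_space_E(2,3)[OF P_prob[OF assms(1,3)]]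
  have "measure (P s x) {z} * measure (P t z) {y} = (\<integral>w. indicator {z} w * measure (P t z) {y} \<partial>P s x)"
    using assms sM by (simp add: Int_absorb2)
  also have "\<dots> \<le> (\<integral>w. measure (P t w) {y} \<partial>P s x)"
    using assms sM P_le_1
    by (intro integral_mono integrable_mult_left integrable_real_indicator
          prob_count_space_integral(1)[OF countable_E P_prob, where B = 1]) (auto simp: indicator_def less_top[symmetric])
  also have "\<dots> = measure (P (s + t) x) {y}" using measure_P_add assms by simp
  finally show ?thesis .
qed

text \<open>Near time 0 the diagonal entry is close to 1; a long time is cut into finitely many
  short ones, at the end of each of which the chain is required to be at \<open>x\<close>.\<close>

lemma transition_diag_pos:
  assumes x: "x \<in> E" and t: "t \<ge> 0"
  shows "measure (P t x) {x} > 0"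
proof -
  have "eventually (\<lambda>h. measure (P h x) {x} > 0) (at_right 0)"
    using transition_tendsto[OF x x] by (rule order_tendstoD) simp
  then obtain d where d: "d > 0" "\<And>h. 0 < h \<Longrightarrow> h < d \<Longrightarrow> measure (P h x) {x} > 0"
    by (auto simp: eventually_at_right_field)
  obtain n :: nat where n: "t / d < real n" using reals_Archimedean2 by blast
  define h where "h = t / Suc n"
  have h: "h \<ge> 0" "h < d" using n d(1) t by (auto simp: h_def field_simps)
  have ph: "measure (P h x) {x} > 0"
  proof (cases "h = 0")
    case True then show ?thesis using x by (simp add: P_0 measure_return)
  qed (use h d in auto)
  have "measure (P (real k * h) x) {x} > 0" for k
  proof (induction k)
    case 0 then show ?case using x by (simp add: P_0 measure_return)
  next
    case (Suc k)
    have "0 < measure (P h x) {x} * measure (P (real k * h) x) {x}" using ph Suc by simp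
    also have "\<dots> \<le> measure (P (h + real k * h) x) {x}" using h x by (intro transition_mult_le) auto
    finally show ?case by (simp add: algebra_simps)
  qed
  from this[of "Suc n"] show ?thesis by (simp add: h_def)
qed

lemma transition_pos:
  assumes x: "(x, y) \<in> {(x, y). x \<in> E \<and> y \<in> E \<and> Q x y > 0}\<^sup>*" and "x \<in> E" and t: "t > 0"
  shows "measure (P t x) {y} > 0"
  using x t
proof (induction arbitrary: t rule: rtrancl_induct)
  case base
  then show ?case using transition_diag_pos assms(2) by simp
next
  case (step y z)
  then have yz: "y \<in> E" "z \<in> E" "Q y z > 0" by auto
  have t: "t > 0" using step by simp
  show ?case
  proof (cases "y = z")
    case True then show ?thesis using step by auto
  next
    case False
    have "eventually (\<lambda>h. (measure (P h y) {z} - (if y = z then 1 else 0)) / h > 0) (at_right 0)"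
      using transition_ge_0_limit[OF yz(1,2)] yz(3) by (rule order_tendstoD)
    then obtain d where d: "d > 0" "\<And>h. 0 < h \<Longrightarrow> h < d \<Longrightarrow> measure (P h y) {z} / h > 0"
      using False by (auto simp: eventually_at_right_field)
    \<comment> \<open>\<open>h\<close> has to be below \<open>d\<close>, so that the derivative at 0
      makes the last jump possible, and below \<open>t\<close>, so that time remains for the earlier
      ones.\<close>
    define h where "h = min d t / 2"
    have h: "0 < h" "h < d" "h < t" using d(1) t by (auto simp: h_def)
    have "0 < measure (P (t - h) x) {y} * measure (P h y) {z}"
      using step.IH[of "t - h"] h d(2)[of h] by (simp add: zero_less_divide_iff)
    also have "\<dots> \<le> measure (P (t - h + h) x) {z}"
      using h yz assms(2) by (intro transition_mult_le) auto
    finally show ?thesis by simp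
  qed
qed

section \<open>The resolvent\<close>

definition expo :: "real \<Rightarrow> real measure" where
  "expo l = density lborel (exponential_density l)"

text \<open>This is \<open>l\<close> times the Laplace transform of the semigroup: the law of the
  chain at an independent exponential time. In this normalization it is a Markov kernel.
  \<open>max 0 t\<close> keeps the time in the range where \<open>P\<close> is constrained.\<close>

definition res :: "real \<Rightarrow> 'x \<Rightarrow> 'x measure" where
  "res l x = expo l \<bind> (\<lambda>t. P (max 0 t) x)"

lemma expo_prob: "l > 0 \<Longrightarrow> expo l \<in> space (prob_algebra borel)"
  using prob_space_exponential_density by (simp add: expo_def space_prob_algebra)

lemma P_measurable_time:
  assumes x: "x \<in> E" shows "(\<lambda>t. P (max 0 t) x) \<in> borel \<rightarrow>\<^sub>M prob_algebra X"
proof (intro measurable_prob_algebraI measurable_subprob_algebra)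
  fix t :: real
  have t: "max 0 t \<ge> 0" by simp
  show "prob_space (P (max 0 t) x)" "sets (P (max 0 t) x) = sets X"
    using prob_space_E[OF P_prob[OF t x]] by auto
  then show "subprob_space (P (max 0 t) x)" by (simp add: prob_space_imp_subprob_space)
next
  fix A assume "A \<in> sets X"
  then have A: "A \<subseteq> E" by simp
  have ka: "measure (P s x) A = kernel_apply (P s) (indicator A) x" if "s \<ge> 0" for s
    using prob_space_E(2,3)[OF P_prob[OF that x]] A by (simp add: kernel_apply_def Int_absorb2)
  have "continuous_on {0..} (\<lambda>t. kernel_apply (P t) (indicator A) x)"
    by (intro kernel_apply_continuous[where B = 1] x) (auto simp: indicator_def)
  then have "continuous_on UNIV (\<lambda>t. kernel_apply (P (max 0 t)) (indicator A) x)"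
    by (rule continuous_on_compose2) (auto intro!: continuous_intros)
  then have "(\<lambda>t. measure (P (max 0 t) x) A) \<in> borel_measurable borel"
    using ka by (simp add: borel_measurable_continuous_onI)
  moreover have "emeasure (P (max 0 t) x) A = ennreal (measure (P (max 0 t) x) A)" for t
    using prob_space.finite_measure[OF prob_space_E(1)[OF P_prob[of "max 0 t" x]]] x
    by (simp add: finite_measure.emeasure_eq_measure)
  ultimately show "(\<lambda>t. emeasure (P (max 0 t) x) A) \<in> borel_measurable borel" by simp
qed

lemma res_prob: "l > 0 \<Longrightarrow> x \<in> E \<Longrightarrow> res l x \<in> space (prob_algebra X)"
  unfolding res_def by (intro bind_in_prob_algebra[OF expo_prob P_measurable_time])

lemma res_kernel: "l > 0 \<Longrightarrow> res l \<in> X \<rightarrow>\<^sub>M prob_algebra X"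
  using res_prob by (auto simp: measurable_count_space_eq1)

lemma kernel_apply_res:
  assumes "l > 0" "x \<in> E" and f: "\<And>y. y \<in> E \<Longrightarrow> \<bar>f y\<bar> \<le> B"
  shows "kernel_apply (res l) f x = (\<integral>t. kernel_apply (P (max 0 t)) f x \<partial>expo l)"
  unfolding kernel_apply_def res_def using assms
  by (intro integral_bind_prob_algebra[OF expo_prob P_measurable_time]) auto

lemma kernel_apply_res_bound:
  assumes "l > 0" "x \<in> E" and f: "\<And>y. y \<in> E \<Longrightarrow> \<bar>f y\<bar> \<le> B"
  shows "\<bar>kernel_apply (res l) f x\<bar> \<le> B"
  unfolding kernel_apply_def using assms by (intro abs_integral_le res_prob) auto

text \<open>An exchange of two integrations. Joint measurability in state and time follows from
  measurability in time alone, since there are countably many states.\<close>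

lemma bind_res_eq_shift:
  assumes l: "l > 0" and s: "s \<ge> 0" and x: "x \<in> E"
  shows "P s x \<bind> res l = expo l \<bind> (\<lambda>t. P (s + max 0 t) x)"
proof -
  interpret A: prob_space "P s x" using prob_space_E P_prob s x by auto
  interpret B: prob_space "expo l" using expo_prob[OF l] by (auto simp: space_prob_algebra)
  interpret pair_prob_space "P s x" "expo l" ..
  have sB: "sets (expo l) = sets borel" by (simp add: expo_def)
  note sA = prob_space_E(2,3)[OF P_prob[OF s x]]
  have "(\<lambda>(y, t). P (max 0 t) y) \<in> count_space E \<Otimes>\<^sub>M borel \<rightarrow>\<^sub>M subprob_algebra X"
    using P_measurable_time countable_E
    by (intro measurable_pair_measure_countable1) (auto intro: measurable_prob_algebraD)
  then have m: "(\<lambda>(y, t). P (max 0 t) y) \<in> P s x \<Otimes>\<^sub>M expo l \<rightarrow>\<^sub>M subprob_algebra X"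
    using sA sB by (subst measurable_cong_sets[OF sets_pair_measure_cong refl]) auto
  have "P s x \<bind> res l = expo l \<bind> (\<lambda>t. P s x \<bind> (\<lambda>y. P (max 0 t) y))"
    unfolding res_def by (rule bind_rotate[OF m])
  also have "\<dots> = expo l \<bind> (\<lambda>t. P (s + max 0 t) x)"
    by (intro bind_cong refl) (simp add: P_add[OF _ s x])
  finally show ?thesis .
qed

lemma res_commute:
  assumes l: "l > 0" and s: "s \<ge> 0" and x: "x \<in> E"
  shows "P s x \<bind> res l = res l x \<bind> P s"
proof -
  have "res l x \<bind> P s = expo l \<bind> (\<lambda>t. P (max 0 t) x \<bind> P s)"
    unfolding res_def using bind_assoc_prob_algebra[OF expo_prob[OF l] P_measurable_time[OF x] P_kernel[OF s]] .
  also have "\<dots> = expo l \<bind> (\<lambda>t. P (s + max 0 t) x)"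
    by (intro bind_cong refl) (simp add: P_add[OF s _ x, symmetric] add.commute)
  finally show ?thesis using bind_res_eq_shift[OF l s x] by simp
qed

lemma expo_integral:
  fixes l :: real and g :: "real \<Rightarrow> real"
  assumes "l > 0" and "g \<in> borel_measurable borel"
  shows "(\<integral>t. g (max 0 t) \<partial>expo l) = (\<integral>t. indicator {0..} t * (l * exp (- l * t) * g t) \<partial>lborel)"
proof -
  have "(\<integral>t. g (max 0 t) \<partial>expo l) = (\<integral>t. exponential_density l t * g (max 0 t) \<partial>lborel)"
    unfolding expo_def using assms by (subst integral_real_density) (auto simp: exponential_density_nonneg)
  also have "\<dots> = (\<integral>t. indicator {0..} t * (l * exp (- l * t) * g t) \<partial>lborel)"
    by (intro Bochner_Integration.integral_cong refl) (auto simp: exponential_density_def indicator_def mult.commute)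
  finally show ?thesis .
qed

lemma expo_integrable:
  fixes l :: real and g :: "real \<Rightarrow> real"
  assumes "l > 0" and "g \<in> borel_measurable borel" and "\<And>t. t \<ge> 0 \<Longrightarrow> \<bar>g t\<bar> \<le> B"
  shows "integrable lborel (\<lambda>t. indicator {0..} t * (l * exp (- l * t) * g t))"
proof -
  interpret prob_space "expo l" using expo_prob[OF assms(1)] by (auto simp: space_prob_algebra)
  have "integrable (expo l) (\<lambda>t. g (max 0 t))"
    using assms by (intro integrable_const_bound[where B = B] AE_I2) (auto simp: expo_def)
  then have "integrable lborel (\<lambda>t. exponential_density l t * g (max 0 t))"
    unfolding expo_def using assms by (subst (asm) integrable_real_density) (auto simp: exponential_density_nonneg)
  also have "(\<lambda>t. exponential_density l t * g (max 0 t)) = (\<lambda>t. indicator {0..} t * (l * exp (- l * t) * g t))"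
    by (auto simp: exponential_density_def indicator_def mult.commute)
  finally show ?thesis .
qed

text \<open>Running the chain for a time \<open>h\<close> before the exponential clock starts cuts
  the piece over \<open>{0..h}\<close> out of the Laplace integral and multiplies the rest by
  \<open>exp (l * h)\<close>. Differentiating at \<open>h = 0\<close> through
  \<open>generator_limit\<close> gives the resolvent equation; the factor \<open>l\<close> before
  \<open>f x\<close> comes from the normalization of \<open>res\<close>.\<close>

lemma gen_res:
  assumes l: "l > 0" and x: "x \<in> E" and f: "\<And>y. y \<in> E \<Longrightarrow> \<bar>f y\<bar> \<le> B"
  shows "gen (kernel_apply (res l) f) x = l * (kernel_apply (res l) f x - f x)"
proof -
  define u where "u = kernel_apply (res l) f"
  define \<phi> where "\<phi> t = kernel_apply (P (max 0 t)) f x" for t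
  have u_bound: "\<bar>u y\<bar> \<le> B" if "y \<in> E" for y
    unfolding u_def by (rule kernel_apply_res_bound[OF l that]) (rule f)
  have cont: "continuous_on UNIV \<phi>"
    unfolding \<phi>_def using kernel_apply_continuous[of x f B] x f
    by (intro continuous_on_compose2[where f = "max 0" and g = "\<lambda>t. kernel_apply (P t) f x" and t = "{0..}"])
       (auto intro!: continuous_intros)
  then have meas [measurable]: "\<phi> \<in> borel_measurable borel" by (rule borel_measurable_continuous_onI)
  have \<phi>_bound: "\<bar>\<phi> t\<bar> \<le> B" for t unfolding \<phi>_def using kernel_apply_bound[of "max 0 t" x f B] x f by simp
  have \<phi>0: "\<phi> 0 = f x"
    unfolding \<phi>_def kernel_apply_def using x by (simp add: P_0 integral_return)
  define \<psi> where "\<psi> t = l * exp (- l * t) * \<phi> t" for t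
  have cont_\<psi>: "continuous_on S \<psi>" for S
    unfolding \<psi>_def using continuous_on_subset[OF cont, of S] by (intro continuous_intros) auto
  have "u x = (\<integral>t. \<phi> (max 0 t) \<partial>expo l)"
    using kernel_apply_res[of l x f B] l x f by (simp add: u_def \<phi>_def)
  then have u_x: "u x = (\<integral>t. indicator {0..} t * \<psi> t \<partial>lborel)"
    unfolding \<psi>_def using expo_integral[OF l meas] by simp
  have int_\<psi>: "integrable lborel (\<lambda>t. indicator {0..} t * \<psi> t)"
    unfolding \<psi>_def using expo_integrable[OF l meas] \<phi>_bound by blast
  have shift: "kernel_apply (P h) u x = exp (l * h) * (u x - integral {0..h} \<psi>)" if h: "h > 0" for h
  proof -
    have "kernel_apply (P h) u x = (\<integral>y. f y \<partial>(P h x \<bind> res l))"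
      unfolding u_def kernel_apply_def using f h l x
      by (intro integral_bind_prob_algebra[OF P_prob res_kernel, symmetric]) auto
    also have "\<dots> = (\<integral>y. f y \<partial>(expo l \<bind> (\<lambda>t. P (max 0 (h + max 0 t)) x)))"
      using h by (subst bind_res_eq_shift[OF l _ x]) (auto simp: max_def)
    also have "\<dots> = (\<integral>t. \<phi> (h + max 0 t) \<partial>expo l)"
      unfolding \<phi>_def kernel_apply_def using l x f
      by (intro integral_bind_prob_algebra[OF expo_prob measurable_compose[OF _ P_measurable_time[of x]]]) auto
    also have "\<dots> = (\<integral>t. indicator {0..} t * (l * exp (- l * t) * \<phi> (h + t)) \<partial>lborel)"
      by (rule expo_integral[OF l, of "\<lambda>t. \<phi> (h + t)"]) measurable
    also have "\<dots> = (\<integral>t. exp (l * h) * (indicator {h..} (h + t) * \<psi> (h + t)) \<partial>lborel)"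
      by (intro Bochner_Integration.integral_cong refl)
         (auto simp: indicator_def \<psi>_def algebra_simps exp_add[symmetric] mult_exp_exp)
    also have "\<dots> = (\<integral>t. exp (l * h) * (indicator {h..} t * \<psi> t) \<partial>lborel)"
      using lborel_integral_real_affine[of 1 "\<lambda>t. exp (l * h) * (indicator {h..} t * \<psi> t)" h] by simp
    also have "\<dots> = exp (l * h) * (\<integral>t. indicator {h..} t * \<psi> t \<partial>lborel)" by simp
    \<comment> \<open>The two integrands differ only at the point \<open>h\<close>.\<close>
    also have "(\<integral>t. indicator {h..} t * \<psi> t \<partial>lborel)
        = (\<integral>t. indicator {0..} t * \<psi> t - indicator {0..h} t * \<psi> t \<partial>lborel)"
      using h by (intro integral_cong_AE AE_I[of _ _ "{h}"])
        (auto simp: indicator_def \<psi>_def split: if_splits)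
    also have "\<dots> = u x - (\<integral>t. indicator {0..h} t * \<psi> t \<partial>lborel)"
      unfolding u_x using borel_integrable_compact[OF _ cont_\<psi>, of "{0..h}"]
      by (intro Bochner_Integration.integral_diff int_\<psi>) (simp add: indicator_scaleR_eq_if mult.commute[of "indicator _ _"] if_distrib cong: if_cong)
    also have "(\<integral>t. indicator {0..h} t * \<psi> t \<partial>lborel) = integral {0..h} \<psi>"
      using set_borel_integral_eq_integral(2)[of "{0..h}" \<psi>] borel_integrable_compact[OF _ cont_\<psi>, of "{0..h}"]
      by (simp add: set_lebesgue_integral_def set_integrable_def)
    finally show ?thesis .
  qed
  have "((\<lambda>h. integral {0..h} \<psi>) has_real_derivative \<psi> 0) (at 0 within {0..1})"
    by (rule integral_has_real_derivative[OF cont_\<psi>]) auto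
  then have "((\<lambda>h. integral {0..h} \<psi> / h) \<longlongrightarrow> l * f x) (at 0 within {0..1})"
    by (simp add: has_field_derivative_iff \<psi>_def \<phi>0)
  then have L1: "((\<lambda>h. integral {0..h} \<psi> / h) \<longlongrightarrow> l * f x) (at_right 0)"
    by (simp add: at_within_Icc_at_right)
  have "((\<lambda>h. exp (l * h)) has_real_derivative l) (at 0)"
    by (auto intro!: derivative_eq_intros)
  then have "((\<lambda>h. (exp (l * h) - 1) / h) \<longlongrightarrow> l) (at 0)"
    by (simp add: has_field_derivative_iff)
  then have L2: "((\<lambda>h. (exp (l * h) - 1) / h) \<longlongrightarrow> l) (at_right 0)"
    by (rule filterlim_mono) (auto simp: at_le)
  have L3: "((\<lambda>h. exp (l * h)) \<longlongrightarrow> exp (l * 0)) (at_right 0)"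
    by (intro tendsto_intros)
  have "((\<lambda>h. (exp (l * h) - 1) / h * u x - exp (l * h) * (integral {0..h} \<psi> / h)) \<longlongrightarrow> l * u x - exp (l * 0) * (l * f x)) (at_right 0)"
    by (intro tendsto_diff tendsto_mult L1 L2 L3 tendsto_const)
  moreover have "eventually (\<lambda>h. (exp (l * h) - 1) / h * u x - exp (l * h) * (integral {0..h} \<psi> / h)
      = (kernel_apply (P h) u x - u x) / h) (at_right 0)"
    unfolding eventually_at_filter by (intro always_eventually) (auto simp: shift field_simps)
  ultimately have "((\<lambda>h. (kernel_apply (P h) u x - u x) / h) \<longlongrightarrow> l * u x - exp (l * 0) * (l * f x)) (at_right 0)"
    by (rule Lim_transform_eventually)
  then have "gen u x = l * u x - exp (l * 0) * (l * f x)"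
    using generator_limit[of x u B, OF x u_bound] by (intro tendsto_unique[of "at_right 0"]) auto
  then show ?thesis by (simp add: u_def algebra_simps)
qed

end

section \<open>Uniqueness of the invariant measure of a reversible chain\<close>

text \<open>\<open>F_gen\<close> together with finite sublevel sets is the classical criterion
  against explosion. The growth rate of \<open>F\<close> is also the resolvent parameter, so that a
  single \<open>l\<close> occurs.\<close>

locale reversible_q_chain = q_chain E P Q
  for E :: "'x set" and P :: "real \<Rightarrow> 'x \<Rightarrow> 'x measure" and Q :: "'x \<Rightarrow> 'x \<Rightarrow> real" +
  fixes \<pi> :: "'x measure" and F :: "'x \<Rightarrow> real" and l :: real
  assumes \<pi>_prob: "\<pi> \<in> space (prob_algebra (count_space E))"
    and balance: "\<And>x y. x \<in> E \<Longrightarrow> y \<in> E \<Longrightarrow> measure \<pi> {x} * Q x y = measure \<pi> {y} * Q y x"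
    and \<pi>_pos: "\<And>x. x \<in> E \<Longrightarrow> measure \<pi> {x} > 0"
    and irreducible: "\<And>x y. x \<in> E \<Longrightarrow> y \<in> E \<Longrightarrow> (x, y) \<in> {(x, y). x \<in> E \<and> y \<in> E \<and> Q x y > 0}\<^sup>*"
    and l_pos: "l > 0"
    and F_ge_1: "\<And>x. x \<in> E \<Longrightarrow> F x \<ge> 1"
    and F_gen: "\<And>x. x \<in> E \<Longrightarrow> (\<Sum>y\<in>{y\<in>E. Q x y \<noteq> 0}. Q x y * F y) \<le> l * F x"
    and F_finite: "\<And>c. finite {x\<in>E. F x \<le> c}"
begin

text \<open>Maximum principle: since \<open>F\<close> has finite sublevel sets, \<open>d - e F\<close> attains its supremum, for every
  \<open>e > 0\<close>.\<close>

lemma eigenfunction_nonpos: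
  assumes bound: "\<And>x. x \<in> E \<Longrightarrow> d x \<le> B" and gen: "\<And>x. x \<in> E \<Longrightarrow> gen d x = l * d x" and x: "x \<in> E"
  shows "d x \<le> 0"
proof (rule ccontr)
  assume "\<not> d x \<le> 0"
  then have dx: "d x > 0" by simp
  \<comment> \<open>With this \<open>e\<close> the value of \<open>g\<close> at \<open>x\<close> is
    \<open>d x / 2\<close>, still positive.\<close>
  define e where "e = d x / (2 * F x)"
  have Fx: "F x \<ge> 1" using F_ge_1 x .
  have e: "e > 0" using dx Fx by (simp add: e_def)
  define g where "g y = d y - e * F y" for y
  define S where "S = {y\<in>E. g y > 0}"
  have "g x > 0" using dx Fx by (simp add: g_def e_def)
  then have S_ne: "S \<noteq> {}" using x by (auto simp: S_def)
  have "S \<subseteq> {y\<in>E. F y \<le> B / e}"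
  proof
    fix y assume y: "y \<in> S"
    then have "e * F y \<le> B" using bound[of y] by (auto simp: S_def g_def)
    then show "y \<in> {y\<in>E. F y \<le> B / e}" using e y by (auto simp: S_def field_simps)
  qed
  then have fin: "finite S" using F_finite finite_subset by blast
  obtain m where m: "m \<in> S" "\<And>y. y \<in> S \<Longrightarrow> g y \<le> g m"
    using Max_in[of "g ` S"] Max_ge[of "g ` S"] fin S_ne by fastforce
  then have mE: "m \<in> E" and gm: "g m > 0" by (auto simp: S_def)
  have max: "g y \<le> g m" if "y \<in> E" for y
    using m(2)[of y] that gm by (cases "y \<in> S") (auto simp: S_def)
  \<comment> \<open>At a maximum no jump leads to a larger value, and the row sums to 0, so the
    generator is nonpositive there.\<close>
  have "gen g m \<le> (\<Sum>y\<in>{y\<in>E. Q m y \<noteq> 0}. Q m y * g m)"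
    unfolding gen_def
  proof (rule sum_mono)
    fix y assume "y \<in> {y\<in>E. Q m y \<noteq> 0}"
    then show "Q m y * g y \<le> Q m y * g m"
      using max[of y] Q_nonneg[OF mE, of y] by (cases "m = y") (auto intro: mult_left_mono)
  qed
  also have "\<dots> = 0" using conservative[OF mE] by (simp add: sum_distrib_right[symmetric])
  finally have "gen g m \<le> 0" .
  moreover have "gen g m = gen d m - e * gen F m"
    by (simp add: gen_def g_def right_diff_distrib sum_subtractf sum_distrib_left mult.left_commute)
  moreover have "e * gen F m \<le> e * (l * F m)"
    using F_gen[OF mE] e by (intro mult_left_mono) (auto simp: gen_def)
  ultimately have "l * g m \<le> 0" using gen[OF mE] by (simp add: g_def algebra_simps)
  then show False using l_pos gm by (simp add: mult_le_0_iff)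
qed

section \<open>The minimal resolvent, by number of jumps\<close>

definition nb :: "'x \<Rightarrow> 'x set" where
  "nb x = {y\<in>E. y \<noteq> x \<and> Q x y \<noteq> 0}"

lemma finite_nb: "x \<in> E \<Longrightarrow> finite (nb x)"
  using finite_rows[of x] unfolding nb_def by (rule finite_subset[rotated]) auto

lemma nb_sym: "x \<in> E \<Longrightarrow> y \<in> E \<Longrightarrow> y \<in> nb x \<longleftrightarrow> x \<in> nb y"
  using balance[of x y] \<pi>_pos[of x] \<pi>_pos[of y] by (auto simp: nb_def)

lemma gen_eq_nb:
  assumes x: "x \<in> E" shows "gen f x = (\<Sum>y\<in>nb x. Q x y * f y) + Q x x * f x"
proof -
  have "gen f x = (\<Sum>y\<in>insert x (nb x). Q x y * f y)"
    unfolding gen_def using finite_nb[OF x] x by (intro sum.mono_neutral_left) (auto simp: nb_def)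
  then show ?thesis using finite_nb[OF x] by (simp add: nb_def)
qed

lemma sum_nb: "x \<in> E \<Longrightarrow> (\<Sum>y\<in>nb x. Q x y) = - Q x x"
  using gen_eq_nb[of x "\<lambda>_. 1"] conservative[of x] by (simp add: gen_def)

lemma nb_nonneg: "x \<in> E \<Longrightarrow> y \<in> nb x \<Longrightarrow> Q x y \<ge> 0"
  by (rule Q_nonneg) (auto simp: nb_def)

lemma denom_pos: "x \<in> E \<Longrightarrow> l - Q x x > 0"
  using sum_nonneg[of "nb x" "Q x"] nb_nonneg sum_nb[of x] l_pos by force

text \<open>For the minimal chain started at \<open>x\<close>, \<open>iter k x y\<close> is the
  probability that a clock of rate \<open>l\<close> rings at \<open>y\<close> after fewer than
  \<open>k\<close> jumps; \<open>l - Q x x\<close> is the total rate of clock and jumps.\<close>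

fun iter :: "nat \<Rightarrow> 'x \<Rightarrow> 'x \<Rightarrow> real" where
  "iter 0 x y = 0"
| "iter (Suc k) x y = (l * of_bool (x = y) + (\<Sum>z\<in>nb x. Q x z * iter k z y)) / (l - Q x x)"

text \<open>The defining recursion splits off the first jump; here the last one is split off, the
  form against which a measure on the starting point can be integrated. In the induction step a
  first and a last jump are removed in either order, and the same double sum \<open>T\<close>
  remains.\<close>

lemma iter_forward:
  assumes "x \<in> E" "y \<in> E"
  shows "iter (Suc k) x y = (l * of_bool (x = y) + (\<Sum>z\<in>nb y. iter k x z * Q z y)) / (l - Q y y)"
  using assms
proof (induction k arbitrary: x y)
  case 0
  then show ?case by simp
next
  case (Suc k)
  note xy = \<open>x \<in> E\<close> \<open>y \<in> E\<close>
  let ?dx = "l - Q x x" and ?dy = "l - Q y y"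
  define T where "T = (\<Sum>z\<in>nb x. \<Sum>w\<in>nb y. Q x z * iter k z w * Q w y)"
  have one: "(\<Sum>z\<in>nb x. Q x z * of_bool (z = y)) = of_bool (y \<in> nb x) * Q x y"
    using finite_nb[OF xy(1)] by (simp add: of_bool_def if_distrib sum.delta cong: if_cong)
  have two: "(\<Sum>w\<in>nb y. of_bool (x = w) * Q w y) = of_bool (y \<in> nb x) * Q x y"
    using finite_nb[OF xy(2)] nb_sym[OF xy]
    by (simp add: of_bool_def if_distrib[of "\<lambda>c. c * _"] sum.delta cong: if_cong)
  have "(\<Sum>z\<in>nb x. Q x z * iter (Suc k) z y)
      = (\<Sum>z\<in>nb x. (l * (Q x z * of_bool (z = y)) + (\<Sum>w\<in>nb y. Q x z * iter k z w * Q w y)) / ?dy)"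
  proof (intro sum.cong refl)
    fix z assume "z \<in> nb x"
    then have z: "z \<in> E" by (simp add: nb_def)
    show "Q x z * iter (Suc k) z y = (l * (Q x z * of_bool (z = y)) + (\<Sum>w\<in>nb y. Q x z * iter k z w * Q w y)) / ?dy"
      unfolding Suc.IH[OF z xy(2)]
      by (simp only: times_divide_eq_right distrib_left sum_distrib_left mult.left_commute[of "Q x z" l] mult.assoc)
  qed
  also have "\<dots> = (l * (\<Sum>z\<in>nb x. Q x z * of_bool (z = y)) + T) / ?dy"
    by (simp add: sum_divide_distrib[symmetric] sum.distrib sum_distrib_left[symmetric] T_def)
  finally have A: "iter (Suc (Suc k)) x y = (l * of_bool (x = y) + (l * (of_bool (y \<in> nb x) * Q x y) + T) / ?dy) / ?dx"
    unfolding iter.simps(2)[of "Suc k"] one by simp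
  have "(\<Sum>w\<in>nb y. iter (Suc k) x w * Q w y)
      = (\<Sum>w\<in>nb y. (l * (of_bool (x = w) * Q w y) + (\<Sum>z\<in>nb x. Q x z * iter k z w * Q w y)) / ?dx)"
    by (intro sum.cong refl) (simp only: iter.simps(2) times_divide_eq_left distrib_right sum_distrib_right mult.assoc)
  also have "\<dots> = (l * (\<Sum>w\<in>nb y. of_bool (x = w) * Q w y) + T) / ?dx"
    unfolding T_def by (subst sum.swap[of _ "nb y"])
      (simp add: sum_divide_distrib[symmetric] sum.distrib sum_distrib_left[symmetric])
  finally have B: "(\<Sum>w\<in>nb y. iter (Suc k) x w * Q w y) = (l * (of_bool (y \<in> nb x) * Q x y) + T) / ?dx"
    unfolding two .
  show ?case unfolding A B using denom_pos[OF xy(1)] denom_pos[OF xy(2)]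
    by (cases "x = y") (auto simp: field_simps)
qed

lemma iter_nonneg: "x \<in> E \<Longrightarrow> 0 \<le> iter k x y"
proof (induction k arbitrary: x)
  case (Suc k)
  then show ?case using denom_pos[of x] l_pos nb_nonneg[of x]
    by (auto intro!: divide_nonneg_pos add_nonneg_nonneg sum_nonneg mult_nonneg_nonneg simp: nb_def)
qed simp

lemma iter_mono:
  assumes "x \<in> E" shows "iter k x y \<le> iter (Suc k) x y"
  using assms
proof (induction k arbitrary: x)
  case 0 then show ?case using iter_nonneg[of x 1 y] by simp
next
  case (Suc k)
  show ?case unfolding iter.simps(2)[of "Suc k" x y] iter.simps(2)[of k x y]
    using denom_pos[OF Suc.prems] nb_nonneg[OF Suc.prems] Suc.IH
    by (intro divide_right_mono add_left_mono sum_mono mult_left_mono) (auto simp: nb_def simp del: iter.simps)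
qed

definition K :: "'x \<Rightarrow> 'x \<Rightarrow> real" where "K x y = measure (res l x) {y}"

text \<open>The resolvent equation for the indicator of \<open>y\<close>, solved for the diagonal
  term: \<open>K\<close> is a fixed point of the recursion that \<open>iter\<close> runs from
  0.\<close>

lemma K_eq:
  assumes "x \<in> E" "y \<in> E"
  shows "gen (\<lambda>x. K x y) x = l * (K x y - of_bool (x = y))"
    and "K x y = (l * of_bool (x = y) + (\<Sum>z\<in>nb x. Q x z * K z y)) / (l - Q x x)"
proof -
  have k: "K z y = kernel_apply (res l) (indicator {y}) z" if "z \<in> E" for z
    using prob_space_E(2,3)[OF res_prob[OF l_pos that]] assms by (simp add: K_def kernel_apply_def Int_absorb2)
  have "gen (kernel_apply (res l) (indicator {y})) x = l * (kernel_apply (res l) (indicator {y}) x - indicator {y} x)"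
    by (rule gen_res[OF l_pos assms(1), where B = 1]) (auto simp: indicator_def)
  moreover have "gen (kernel_apply (res l) (indicator {y})) x = gen (\<lambda>x. K x y) x"
    unfolding gen_def using k by (intro sum.cong) auto
  ultimately show *: "gen (\<lambda>x. K x y) x = l * (K x y - of_bool (x = y))"
    using k[OF assms(1)] by (simp add: indicator_def of_bool_def)
  show "K x y = (l * of_bool (x = y) + (\<Sum>z\<in>nb x. Q x z * K z y)) / (l - Q x x)"
    using * denom_pos[OF assms(1)] unfolding gen_eq_nb[OF assms(1)] by (simp add: field_simps)
qed

lemma K_bounds: "x \<in> E \<Longrightarrow> 0 \<le> K x y" "x \<in> E \<Longrightarrow> K x y \<le> 1"
  using prob_space.prob_le_1[OF prob_space_E(1)[OF res_prob[OF l_pos]]] by (auto simp: K_def)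

lemma iter_le_K: "x \<in> E \<Longrightarrow> y \<in> E \<Longrightarrow> iter k x y \<le> K x y"
proof (induction k arbitrary: x)
  case 0 then show ?case by (simp add: K_bounds)
next
  case (Suc k)
  show ?case unfolding iter.simps(2) K_eq(2)[OF Suc.prems]
    using denom_pos[OF Suc.prems(1)] nb_nonneg[OF Suc.prems(1)] Suc.IH Suc.prems(2)
    by (intro divide_right_mono add_left_mono sum_mono mult_left_mono) (auto simp: nb_def)
qed

text \<open>The increasing iterates stay below \<open>K\<close> and their limit solves the same
  backward equation. The difference is bounded and satisfies \<open>gen d x = l * d x\<close>, so
  the maximum principle removes it: this is where non-explosion enters.\<close>

lemma iter_tendsto_K:
  assumes "x \<in> E" "y \<in> E" shows "(\<lambda>k. iter k x y) \<longlonglongrightarrow> K x y"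
proof -
  have conv: "convergent (\<lambda>k. iter k x y)" if "x \<in> E" for x
  proof (rule Bseq_monoseq_convergent)
    show "Bseq (\<lambda>k. iter k x y)"
      using iter_le_K[OF that assms(2)] iter_nonneg[OF that] by (intro BseqI'[of _ "K x y"]) auto
    show "monoseq (\<lambda>k. iter k x y)" using iter_mono[OF that] by (auto simp: monoseq_Suc)
  qed
  define n where "n x = lim (\<lambda>k. iter k x y)" for x
  have lim: "(\<lambda>k. iter k x y) \<longlonglongrightarrow> n x" if "x \<in> E" for x
    unfolding n_def using conv[OF that] convergent_LIMSEQ_iff by blast
  have n_eq: "n x = (l * of_bool (x = y) + (\<Sum>z\<in>nb x. Q x z * n z)) / (l - Q x x)" if x: "x \<in> E" for x
  proof -
    have "(\<lambda>k. iter (Suc k) x y) \<longlonglongrightarrow> (l * of_bool (x = y) + (\<Sum>z\<in>nb x. Q x z * n z)) / (l - Q x x)"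
      unfolding iter.simps using denom_pos[OF x]
      by (intro tendsto_intros lim) (auto simp: nb_def)
    then show ?thesis using LIMSEQ_unique[OF LIMSEQ_Suc[OF lim[OF x]]] by blast
  qed
  have n_le: "n x \<le> K x y" "0 \<le> n x" if "x \<in> E" for x
    using lim[OF that] iter_le_K[OF that assms(2)] iter_nonneg[OF that]
    by (auto intro: LIMSEQ_le_const2 LIMSEQ_le_const)
  define d where "d x = K x y - n x" for x
  have "gen d x = l * d x" if x: "x \<in> E" for x
  proof -
    have "gen n x = l * (n x - of_bool (x = y))"
      using n_eq[OF x] denom_pos[OF x] unfolding gen_eq_nb[OF x] by (simp add: field_simps)
    moreover have "gen d x = gen (\<lambda>x. K x y) x - gen n x"
      by (simp add: gen_def d_def right_diff_distrib sum_subtractf)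
    ultimately show ?thesis using K_eq(1)[OF x assms(2)] by (simp add: d_def algebra_simps)
  qed
  moreover have "d x \<le> 1" if "x \<in> E" for x
    using K_bounds(2)[OF that, of y] n_le(2)[OF that] by (simp add: d_def)
  ultimately have "d x \<le> 0"
    using eigenfunction_nonpos assms(1) by blast
  then show ?thesis using lim[OF assms(1)] n_le(1)[OF assms(1)] by (simp add: d_def)
qed

text \<open>By the last-jump recursion and balance, the bound reproduces itself: the incoming flow
  into \<open>y\<close> equals \<open>measure \<pi> {y} * (- Q y y)\<close>, and together with
  \<open>l * measure \<pi> {y}\<close> it cancels the denominator. Only an inequality can hold,
  since an iterate omits long paths.\<close>

lemma \<pi>_iter_le:
  assumes "y \<in> E" shows "(\<integral>x. iter k x y \<partial>\<pi>) \<le> measure \<pi> {y}"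
  using assms
proof (induction k arbitrary: y)
  case 0 then show ?case by simp
next
  case (Suc k)
  note y = \<open>y \<in> E\<close>
  interpret prob_space \<pi> using prob_space_E \<pi>_prob by auto
  note s\<pi> = prob_space_E(2,3)[OF \<pi>_prob]
  have int: "integrable \<pi> (\<lambda>x. iter k x z)" if "z \<in> E" for z k
    using iter_nonneg iter_le_K[OF _ that] K_bounds(2)
    by (intro prob_count_space_integral(1)[OF countable_E \<pi>_prob, of _ 1]) (force intro: order_trans)
  have "(\<integral>x. iter (Suc k) x y \<partial>\<pi>)
     = (\<integral>x. (l * indicator {y} x + (\<Sum>z\<in>nb y. iter k x z * Q z y)) / (l - Q y y) \<partial>\<pi>)"
    using s\<pi> iter_forward[OF _ y] by (intro Bochner_Integration.integral_cong) (auto simp: indicator_def of_bool_def simp del: iter.simps)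
  also have "\<dots> = (l * measure \<pi> {y} + (\<Sum>z\<in>nb y. (\<integral>x. iter k x z \<partial>\<pi>) * Q z y)) / (l - Q y y)"
    using int s\<pi> y by (subst integral_divide_zero, subst Bochner_Integration.integral_add)
      (auto simp: nb_def less_top[symmetric] Int_absorb2)
  also have "\<dots> \<le> (l * measure \<pi> {y} + (\<Sum>z\<in>nb y. measure \<pi> {z} * Q z y)) / (l - Q y y)"
  proof (intro divide_right_mono add_left_mono sum_mono mult_right_mono)
    fix z assume "z \<in> nb y"
    then have "z \<in> E" "y \<in> nb z" using nb_sym[OF _ y] by (auto simp: nb_def)
    then show "(\<integral>x. iter k x z \<partial>\<pi>) \<le> measure \<pi> {z}" "0 \<le> Q z y" using Suc.IH nb_nonneg by auto
  qed (use denom_pos[OF y] in auto)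
  also have "(\<Sum>z\<in>nb y. measure \<pi> {z} * Q z y) = measure \<pi> {y} * (\<Sum>z\<in>nb y. Q y z)"
    unfolding sum_distrib_left using balance y by (intro sum.cong) (auto simp: nb_def)
  also have "\<dots> = measure \<pi> {y} * (- Q y y)" using sum_nb[OF y] by simp
  also have "(l * measure \<pi> {y} + measure \<pi> {y} * (- Q y y)) / (l - Q y y) = measure \<pi> {y}"
    using denom_pos[OF y] by (simp add: field_simps)
  finally show ?case .
qed

text \<open>The iterates give an inequality on every singleton; both sides have total mass 1, hence
  it is an equality.\<close>

lemma \<pi>_res: "\<pi> \<bind> res l = \<pi>"
proof -
  note s\<pi> = prob_space_E[OF \<pi>_prob]
  note r = bind_in_prob_algebra[OF \<pi>_prob res_kernel[OF l_pos]]
  note sr = prob_space_E[OF r]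
  interpret \<pi>: prob_space \<pi> by (rule s\<pi>)
  interpret R: prob_space "\<pi> \<bind> res l" by (rule sr)
  have le: "measure (\<pi> \<bind> res l) {y} \<le> measure \<pi> {y}" if y: "y \<in> E" for y
  proof -
    have "(\<lambda>k. \<integral>x. iter k x y \<partial>\<pi>) \<longlonglongrightarrow> (\<integral>x. K x y \<partial>\<pi>)"
    proof (rule integral_dominated_convergence[where w = "\<lambda>_. 1"])
      show "AE x in \<pi>. (\<lambda>k. iter k x y) \<longlonglongrightarrow> K x y"
        using iter_tendsto_K[OF _ y] s\<pi> by (intro AE_I2) simp
      show "AE x in \<pi>. norm (iter k x y) \<le> 1" for k
        using iter_nonneg iter_le_K[OF _ y] K_bounds(2) s\<pi> by (intro AE_I2) (force intro: order_trans)
    qed (use s\<pi> in \<open>auto simp: measurable_cong_sets[of \<pi> "count_space E"]\<close>)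
    then have "(\<integral>x. K x y \<partial>\<pi>) \<le> measure \<pi> {y}"
      using \<pi>_iter_le[OF y] by (blast intro: LIMSEQ_le_const2)
    moreover have "measure (\<pi> \<bind> res l) {y} = (\<integral>x. K x y \<partial>\<pi>)"
      unfolding K_def using y by (intro measure_bind_prob_algebra[OF \<pi>_prob res_kernel[OF l_pos]]) auto
    ultimately show ?thesis by simp
  qed
  define d where "d x = measure \<pi> {x} - measure (\<pi> \<bind> res l) {x}" for x
  note i = prob_count_space_integral(2,3)[OF countable_E \<pi>_prob, of "\<lambda>_. 1" 1]
    prob_count_space_integral(2,3)[OF countable_E r, of "\<lambda>_. 1" 1]
  have int: "integrable (count_space E) d"
    using i(1,3) unfolding d_def by (intro Bochner_Integration.integrable_diff) auto
  have "(\<integral>x. d x \<partial>count_space E) = 0"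
    using i \<pi>.prob_space R.prob_space by (simp add: d_def)
  moreover have "AE x in count_space E. 0 \<le> d x" using le by (auto simp: AE_count_space d_def)
  ultimately have "AE x in count_space E. d x = 0"
    using integral_nonneg_eq_0_iff_AE[OF int] by blast
  then show ?thesis
    using sr s\<pi> by (intro measure_eqI_countable[OF _ _ countable_E])
      (auto simp: d_def AE_count_space \<pi>.emeasure_eq_measure R.emeasure_eq_measure)
qed

text \<open>Irreducibility makes the transition probability positive at every positive time, and the
  exponential law is carried by positive times.\<close>

lemma res_pos:
  assumes "x \<in> E" "y \<in> E" shows "measure (res l x) {y} > 0"
proof -
  interpret prob_space "expo l" using expo_prob[OF l_pos] by (auto simp: space_prob_algebra)
  have bind: "measure (res l x) {y} = (\<integral>t. measure (P (max 0 t) x) {y} \<partial>expo l)"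
    unfolding res_def using assms
    by (intro measure_bind_prob_algebra[OF expo_prob P_measurable_time]) (auto simp: l_pos)
  have meas: "(\<lambda>t. measure (P (max 0 t) x) {y}) \<in> borel_measurable (expo l)"
    using measurable_compose[OF P_measurable_time[OF assms(1)] measurable_measure_prob_algebra[of "{y}" X]] assms(2)
    by (simp add: expo_def)
  have int: "integrable (expo l) (\<lambda>t. measure (P (max 0 t) x) {y})"
    using meas P_le_1[of _ x "{y}"] assms by (intro integrable_const_bound[where B = 1]) auto
  have "measure (res l x) {y} \<noteq> 0"
  proof
    assume "measure (res l x) {y} = 0"
    then have "AE t in expo l. measure (P (max 0 t) x) {y} = 0"
      using bind int by (simp add: integral_nonneg_eq_0_iff_AE)
    moreover have "AE t in expo l. t > 0"
      unfolding expo_def using AE_lborel_singleton[of "0::real"]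
      by (subst AE_density) (auto simp: exponential_density_def)
    ultimately have "AE t in expo l. False"
    proof eventually_elim
      case (elim t)
      then show ?case using transition_pos[OF irreducible assms(1), of y t] assms by simp
    qed
    then show False by simp
  qed
  then show ?thesis using measure_nonneg[of "res l x" "{y}"] by linarith
qed

text \<open>\<open>P t\<close> commutes with \<open>res l\<close>, so the image of
  \<open>\<pi>\<close> under \<open>P t\<close> is again invariant for \<open>res l\<close>. This
  kernel is strictly positive and therefore has only one invariant probability measure.\<close>

theorem \<pi>_invariant:
  assumes t: "t \<ge> 0" shows "\<pi> \<bind> P t = \<pi>"
proof (rule invariant_unique_of_positive[OF countable_E res_kernel[OF l_pos] res_pos])
  show P\<pi>: "\<pi> \<bind> P t \<in> space (prob_algebra X)" by (rule bind_in_prob_algebra[OF \<pi>_prob P_kernel[OF t]])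
  have "(\<pi> \<bind> P t) \<bind> res l = \<pi> \<bind> (\<lambda>x. P t x \<bind> res l)"
    by (rule bind_assoc_prob_algebra[OF \<pi>_prob P_kernel[OF t] res_kernel[OF l_pos]])
  also have "\<dots> = \<pi> \<bind> (\<lambda>x. res l x \<bind> P t)"
    using res_commute[OF l_pos t] prob_space_E(3)[OF \<pi>_prob] by (intro bind_cong[OF refl]) simp
  also have "\<dots> = (\<pi> \<bind> res l) \<bind> P t"
    by (rule bind_assoc_prob_algebra[OF \<pi>_prob res_kernel[OF l_pos] P_kernel[OF t], symmetric])
  finally show "(\<pi> \<bind> P t) \<bind> res l = \<pi> \<bind> P t" unfolding \<pi>_res .
qed (use \<pi>_prob \<pi>_res in auto)

theorem invariant_eq_\<pi>:
  assumes \<nu>: "\<nu> \<in> space (prob_algebra X)" "\<And>t. t \<ge> 0 \<Longrightarrow> \<nu> \<bind> P t = \<nu>"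
  shows "\<nu> = \<pi>"
proof (rule invariant_unique_of_positive[OF countable_E P_kernel[of 1]])
  show "measure (P 1 x) {y} > 0" if "x \<in> E" "y \<in> E" for x y
    using transition_pos[OF irreducible[OF that] that(1)] by simp
qed (use \<nu> \<pi>_prob \<pi>_invariant[of 1] in simp_all)

end

section \<open>Alternants\<close>

text \<open>Monic of degree \<open>k\<close> for all nodes, so alternants of these functions are
  Vandermonde products whatever \<open>h\<close> is; the nodes remain free to suit the
  generator.\<close>

definition newton :: "(nat \<Rightarrow> real) \<Rightarrow> nat \<Rightarrow> real \<Rightarrow> real" where
  "newton h k t = (\<Prod>r<k. t - h r)"

lemma newton_simps [simp]: "newton h 0 t = 1" "newton h (Suc k) t = newton h k t * (t - h k)"
  by (simp_all add: newton_def)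

text \<open>A sum over permutations, so that an operator in one variable can be applied term by
  term; \<open>alternant_det\<close> gives the determinant when row or column arguments are
  wanted.\<close>

definition alternant :: "nat \<Rightarrow> (nat \<Rightarrow> 'a \<Rightarrow> real) \<Rightarrow> (nat \<Rightarrow> 'a) \<Rightarrow> real" where
  "alternant N f x = (\<Sum>p | p permutes {..<N}. of_int (sign p) * (\<Prod>i<N. f (p i) (x i)))"

lemma alternant_det: "alternant N f x = Determinant.det (Matrix.mat N N (\<lambda>(i, j). f j (x i)))"
proof -
  have *: "Determinant.det (Matrix.mat N N (\<lambda>(i, j). f j (x i))) =
    (\<Sum>p | p permutes {0..<N}. signof p * (\<Prod>i = 0..<N. Matrix.mat N N (\<lambda>(i, j). f j (x i)) $$ (i, p i)))"
    by (rule Determinant.det_def') simp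
  show ?thesis
    unfolding * alternant_def lessThan_atLeast0
    by (intro sum.cong refl arg_cong2[where f = "(*)"] prod.cong)
       (auto simp: permutes_in_image[where S = "{0..<N}"])
qed

lemma alternant_cong:
  assumes "\<And>i j. i < N \<Longrightarrow> j < N \<Longrightarrow> f j (x i) = g j (y i)"
  shows "alternant N f x = alternant N g y"
  unfolding alternant_det using assms by (intro arg_cong[where f = Determinant.det] Matrix.eq_matI) auto

lemma alternant_equal_args:
  assumes "i < N" "j < N" "i \<noteq> j" "x i = x j"
  shows "alternant N f x = 0"
  unfolding alternant_det using assms
  by (intro Determinant.det_identical_rows[of _ N i j]) (auto intro!: Matrix.eq_vecI)

lemma alternant_equal_funs:
  assumes "i < N" "j < N" "i \<noteq> j" "f i = f j"
  shows "alternant N f x = 0"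
  unfolding alternant_det using assms
  by (intro Determinant.det_identical_columns[of _ N i j]) (auto intro!: Matrix.eq_vecI)

lemma alternant_linear:
  assumes "j < N"
  shows "alternant N (f(j := \<lambda>t. c * g t + d * h t)) x
       = c * alternant N (f(j := g)) x + d * alternant N (f(j := h)) x"
proof -
  have "(\<Prod>i<N. (f(j := \<lambda>t. c * g t + d * h t)) (p i) (x i))
      = c * (\<Prod>i<N. (f(j := g)) (p i) (x i)) + d * (\<Prod>i<N. (f(j := h)) (p i) (x i))"
    if p: "p permutes {..<N}" for p
  proof -
    obtain k where k: "k < N" "p k = j" using p assms
      by (metis permutes_surj surjD permutes_in_image lessThan_iff)
    have ne: "p i \<noteq> j" if "i \<noteq> k" for i using k that permutes_inj[OF p] by (auto dest: injD)
    have split: "(\<Prod>i<N. (f(j := q)) (p i) (x i)) = q (x k) * (\<Prod>i\<in>{..<N} - {k}. f (p i) (x i))" for q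
      using k ne by (subst prod.remove[of _ k]) (auto intro!: prod.cong)
    show ?thesis unfolding split by (simp add: algebra_simps)
  qed
  then show ?thesis
    unfolding alternant_def by (simp add: sum_distrib_left sum.distrib[symmetric] algebra_simps)
qed

text \<open>The Leibniz rule: an operator acting on one variable at a time may equally act on one
  function at a time.\<close>

lemma alternant_leibniz:
  "(\<Sum>i<N. \<Sum>p | p permutes {..<N}. of_int (sign p) * (D (f (p i)) (x i) * (\<Prod>k\<in>{..<N} - {i}. f (p k) (x k))))
     = (\<Sum>j<N. alternant N (f(j := D (f j))) x)"
proof -
  have "(\<Sum>j<N. alternant N (f(j := D (f j))) x)
     = (\<Sum>p | p permutes {..<N}. \<Sum>j<N. of_int (sign p) * (\<Prod>i<N. (f(j := D (f j))) (p i) (x i)))"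
    unfolding alternant_def by (rule sum.swap)
  also have "\<dots> = (\<Sum>p | p permutes {..<N}. \<Sum>i<N. of_int (sign p) * (D (f (p i)) (x i) * (\<Prod>k\<in>{..<N} - {i}. f (p k) (x k))))"
  proof (rule sum.cong[OF refl])
    fix p assume "p \<in> {p. p permutes {..<N}}"
    then have p: "p permutes {..<N}" by simp
    have "(\<Sum>j<N. of_int (sign p) * (\<Prod>i<N. (f(j := D (f j))) (p i) (x i)))
       = (\<Sum>i<N. of_int (sign p) * (\<Prod>k<N. (f(p i := D (f (p i)))) (p k) (x k)))"
      using sum.permute[OF p, of "\<lambda>j. of_int (sign p) * (\<Prod>i<N. (f(j := D (f j))) (p i) (x i))"]
      by (simp add: o_def)
    also have "\<dots> = (\<Sum>i<N. of_int (sign p) * (D (f (p i)) (x i) * (\<Prod>k\<in>{..<N} - {i}. f (p k) (x k))))"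
    proof (intro sum.cong refl arg_cong2[where f = "(*)"])
      fix i assume i: "i \<in> {..<N}"
      have ne: "p k \<noteq> p i" if "k \<noteq> i" for k using that permutes_inj[OF p] by (auto dest: injD)
      show "(\<Prod>k<N. (f(p i := D (f (p i)))) (p k) (x k)) = D (f (p i)) (x i) * (\<Prod>k\<in>{..<N} - {i}. f (p k) (x k))"
        using i ne by (subst prod.remove[of _ i]) (auto intro!: prod.cong)
    qed
    finally show "(\<Sum>j<N. of_int (sign p) * (\<Prod>i<N. (f(j := D (f j))) (p i) (x i)))
       = (\<Sum>i<N. of_int (sign p) * (D (f (p i)) (x i) * (\<Prod>k\<in>{..<N} - {i}. f (p k) (x k))))" .
  qed
  also have "\<dots> = (\<Sum>i<N. \<Sum>p | p permutes {..<N}. of_int (sign p) * (D (f (p i)) (x i) * (\<Prod>k\<in>{..<N} - {i}. f (p k) (x k))))"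
    by (rule sum.swap)
  finally show ?thesis by simp
qed

lemma alternant_update:
  assumes "i < N"
  shows "alternant N f (x(i := y))
    = (\<Sum>p | p permutes {..<N}. of_int (sign p) * (f (p i) y * (\<Prod>k\<in>{..<N} - {i}. f (p k) (x k))))"
  unfolding alternant_def
proof (intro sum.cong refl arg_cong2[where f = "(*)"])
  fix p
  show "(\<Prod>k<N. f (p k) ((x(i := y)) k)) = f (p i) y * (\<Prod>k\<in>{..<N} - {i}. f (p k) (x k))"
    using assms by (subst prod.remove[of _ i]) (auto intro!: prod.cong)
qed

text \<open>The Leibniz rule for a difference operator. At 0 truncated subtraction makes the
  downward difference vanish, so no boundary condition on \<open>\<delta>\<close> is needed
  here.\<close>

lemma alternant_generator:
  fixes \<beta> \<delta> :: "nat \<Rightarrow> real" and x :: "nat \<Rightarrow> nat" and f :: "nat \<Rightarrow> nat \<Rightarrow> real"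
  defines "D \<equiv> \<lambda>g t. \<beta> t * (g (t + 1) - g t) + \<delta> t * (g (t - 1) - g t)"
  shows "(\<Sum>i<N. \<beta> (x i) * (alternant N f (x(i := x i + 1)) - alternant N f x)
              + \<delta> (x i) * (alternant N f (x(i := x i - 1)) - alternant N f x))
     = (\<Sum>j<N. alternant N (f(j := D (f j))) x)"
  unfolding alternant_leibniz[symmetric]
proof (rule sum.cong[OF refl])
  fix i assume "i \<in> {..<N}"
  then have i: "i < N" by simp
  have x: "alternant N f x = alternant N f (x(i := x i))" by simp
  show "\<beta> (x i) * (alternant N f (x(i := x i + 1)) - alternant N f x)
              + \<delta> (x i) * (alternant N f (x(i := x i - 1)) - alternant N f x)
     = (\<Sum>p | p permutes {..<N}. of_int (sign p) * (D (f (p i)) (x i) * (\<Prod>k\<in>{..<N} - {i}. f (p k) (x k))))"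
    unfolding x alternant_update[OF i] sum_subtractf[symmetric] sum_distrib_left sum.distrib[symmetric]
    by (intro sum.cong refl) (simp add: D_def algebra_simps)
qed

text \<open>Both evaluations of Newton alternants come from one expansion: with an additional argument \<open>w\<close>, the
  alternant is a polynomial of degree \<open>N\<close> in \<open>w\<close> vanishing at the other arguments.\<close>

lemma coeff_prod_linear:
  fixes t :: "nat \<Rightarrow> real"
  shows "degree (\<Prod>r<k. [:- t r, 1:]) = k" "Polynomial.coeff (\<Prod>r<k. [:- t r, 1:]) k = 1"
    "k > 0 \<Longrightarrow> Polynomial.coeff (\<Prod>r<k. [:- t r, 1:]) (k - 1) = - (\<Sum>r<k. t r)"
proof -
  have mon: "degree (\<Prod>r<k. [:- t r, 1:]) = k" for k
    by (simp add: degree_prod_eq_sum_degree)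
  show "degree (\<Prod>r<k. [:- t r, 1:]) = k" using mon .
  have one: "Polynomial.coeff (\<Prod>r<k. [:- t r, 1:]) k = 1" for k
    using lead_coeff_prod[of "\<lambda>r. [:- t r, 1:]" "{..<k}"] unfolding mon by simp
  then show "Polynomial.coeff (\<Prod>r<k. [:- t r, 1:]) k = 1" .
  show "k > 0 \<Longrightarrow> Polynomial.coeff (\<Prod>r<k. [:- t r, 1:]) (k - 1) = - (\<Sum>r<k. t r)"
  proof (induction k)
    case (Suc k)
    show ?case
    proof (cases k)
      case 0 then show ?thesis by simp
    next
      case (Suc m)
      have "Polynomial.coeff (q * [:- t k, 1:]) k = - t k * Polynomial.coeff q k + Polynomial.coeff q (k - 1)" for q
        using Suc by (simp add: coeff_pCons)
      from this[of "\<Prod>r<k. [:- t r, 1:]"] have "Polynomial.coeff (\<Prod>r<Suc k. [:- t r, 1:]) k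
          = - t k * Polynomial.coeff (\<Prod>r<k. [:- t r, 1:]) k + Polynomial.coeff (\<Prod>r<k. [:- t r, 1:]) (k - 1)"
        by (simp only: prod.lessThan_Suc)
      then show ?thesis using one[of k] Suc.IH Suc by simp
    qed
  qed simp
qed

lemma newton_eq_poly: "newton h k t = poly (\<Prod>r<k. [:- h r, 1:]) t"
  by (simp add: newton_def poly_prod)

lemma alternant_newton_expand:
  fixes h t :: "nat \<Rightarrow> real"
  assumes inj: "inj_on t {..<N}"
  defines "C \<equiv> alternant N (newton h) t"
  shows "alternant (Suc N) (newton h) (t(N := w)) = C * (\<Prod>i<N. w - t i)" (is ?A)
    and "N > 0 \<Longrightarrow> alternant N (\<lambda>j. newton h (if j < N - 1 then j else Suc j)) t
        = C * ((\<Sum>i<N. t i) - (\<Sum>r<N. h r))" (is "_ \<Longrightarrow> ?B")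
proof -
  define M where "M w = Matrix.mat (Suc N) (Suc N) (\<lambda>(i, j). newton h j ((t(N := w)) i))" for w
  define c where "c j = cofactor (M 0) N j" for j
  have M: "M w \<in> carrier_mat (Suc N) (Suc N)" for w by (simp add: M_def)
  \<comment> \<open>\<open>w\<close> occurs only in the last row, which these cofactors
    delete.\<close>
  have c: "cofactor (M w) N j = c j" if "j \<le> N" for w j
    unfolding c_def cofactor_def using that
    by (intro arg_cong2[where f = "(*)"] refl arg_cong[where f = Determinant.det] Matrix.eq_matI)
       (auto simp: mat_delete_def M_def)
  have expand: "alternant (Suc N) (newton h) (t(N := w)) = (\<Sum>j\<le>N. newton h j w * c j)" for w
    unfolding alternant_det M_def[symmetric] laplace_expansion_row[OF M[of w], of N, simplified]
    using c by (simp add: M_def lessThan_Suc_atMost[symmetric])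
  have cN: "c N = C"
    unfolding C_def alternant_det c_def cofactor_def
    by (simp, intro arg_cong[where f = Determinant.det] Matrix.eq_matI) (auto simp: mat_delete_def M_def)
  define P where "P = (\<Sum>j\<le>N. Polynomial.smult (c j) (\<Prod>r<j. [:- h r, 1:]))"
  have P_eval: "poly P w = alternant (Suc N) (newton h) (t(N := w))" for w
    unfolding expand P_def by (simp add: poly_sum newton_eq_poly mult.commute)
  \<comment> \<open>The coefficients at \<open>N\<close> cancel, so \<open>R\<close> would have
    degree below \<open>N\<close> while vanishing at the \<open>N\<close> distinct numbers
    \<open>t i\<close>.\<close>
  define R where "R = P - Polynomial.smult C (\<Prod>i<N. [:- t i, 1:])"
  have coeffP: "Polynomial.coeff P N = C"
  proof -
    have "Polynomial.coeff P N = (\<Sum>j\<le>N. c j * Polynomial.coeff (\<Prod>r<j. [:- h r, 1:]) N)"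
      by (simp add: P_def coeff_sum)
    also have "\<dots> = (\<Sum>j\<in>{N}. c j * Polynomial.coeff (\<Prod>r<j. [:- h r, 1:]) N)"
      by (intro sum.mono_neutral_right) (auto intro!: coeff_eq_0 simp: coeff_prod_linear(1))
    finally show ?thesis by (simp add: coeff_prod_linear(2) cN)
  qed
  have degP: "degree P \<le> N"
    unfolding P_def by (intro degree_sum_le) (auto intro!: order_trans[OF degree_smult_le] simp: coeff_prod_linear(1))
  have "R = 0"
  proof (rule ccontr)
    assume R: "R \<noteq> 0"
    have degR: "degree R \<le> N" unfolding R_def using degP
      by (intro degree_diff_le) (auto intro!: order_trans[OF degree_smult_le] simp: coeff_prod_linear(1))
    have "Polynomial.coeff R N = 0" unfolding R_def by (simp add: coeffP coeff_prod_linear(2))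
    then have "degree R < N \<or> N = 0" using R degR by (metis le_neq_implies_less leading_coeff_0_iff)
    moreover have "N \<noteq> 0" using R \<open>Polynomial.coeff R N = 0\<close> degR by (metis le_zero_eq leading_coeff_0_iff)
    moreover have "t ` {..<N} \<subseteq> {x. poly R x = 0}"
    proof
      fix y assume "y \<in> t ` {..<N}"
      then obtain i where i: "i < N" "y = t i" by auto
      have "poly P y = 0" unfolding P_eval using i by (intro alternant_equal_args[of i _ N]) auto
      then show "y \<in> {x. poly R x = 0}" using i by (auto simp: R_def poly_prod)
    qed
    then have "card (t ` {..<N}) \<le> degree R"
      using card_poly_roots_bound[OF R] card_mono[OF poly_roots_finite[OF R]] order_trans by blast
    ultimately show False using card_image[OF inj] by simp
  qed
  then have PC: "P = Polynomial.smult C (\<Prod>i<N. [:- t i, 1:])" by (simp add: R_def)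
  show ?A unfolding P_eval[symmetric] PC by (simp add: poly_prod)
  assume N: "N > 0"
  \<comment> \<open>Deleting column \<open>N - 1\<close> leaves the indices 0, ..., N - 2 and N,
    that is the alternant with raised top index; the sign is negative because N + (N - 1) is
    odd.\<close>
  have c1: "c (N - 1) = - alternant N (\<lambda>j. newton h (if j < N - 1 then j else Suc j)) t"
  proof -
    have "odd (N + (N - 1))" using N by (cases N) auto
    then have "c (N - 1) = - Determinant.det (mat_delete (M 0) N (N - 1))" by (simp add: c_def cofactor_def)
    also have "mat_delete (M 0) N (N - 1) = Matrix.mat N N (\<lambda>(i, j). newton h (if j < N - 1 then j else Suc j) (t i))"
      by (intro Matrix.eq_matI) (auto simp: mat_delete_def M_def)
    finally show ?thesis by (simp add: alternant_det)
  qed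
  have "Polynomial.coeff P (N - 1) = (\<Sum>j\<le>N. c j * Polynomial.coeff (\<Prod>r<j. [:- h r, 1:]) (N - 1))"
    by (simp add: P_def coeff_sum)
  also have "\<dots> = (\<Sum>j\<in>{N - 1, N}. c j * Polynomial.coeff (\<Prod>r<j. [:- h r, 1:]) (N - 1))"
    using N by (intro sum.mono_neutral_right) (auto intro!: coeff_eq_0 simp: coeff_prod_linear(1))
  also have "\<dots> = c (N - 1) - C * (\<Sum>r<N. h r)"
    using N by (simp add: coeff_prod_linear(2) coeff_prod_linear(3)[unfolded One_nat_def] cN right_diff_distrib)
  \<comment> \<open>The coefficients at \<open>N - 1\<close> in the two forms of \<open>P\<close>
    are compared.\<close>
  finally have "c (N - 1) - C * (\<Sum>r<N. h r) = - C * (\<Sum>i<N. t i)"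
    using N unfolding PC by (simp add: coeff_prod_linear(3)[unfolded One_nat_def])
  then show ?B unfolding c1 by (simp add: algebra_simps)
qed

lemma alternant_newton:
  "alternant N (newton h) t = (\<Prod>j<N. \<Prod>i<j. t j - t i)"
proof (induction N)
  case 0 then show ?case by (simp add: alternant_def)
next
  case (Suc N)
  show ?case
  proof (cases "inj_on t {..<N}")
    case True
    then show ?thesis using alternant_newton_expand(1)[OF True, of h "t N"] Suc by (simp add: mult.commute)
  next
    case False
    then obtain i j where ij: "i < j" "j < N" "t i = t j"
      by (auto simp: inj_on_def) (metis linorder_neqE_nat)
    then have "alternant (Suc N) (newton h) t = 0" by (intro alternant_equal_args[of i _ j]) auto
    moreover have "(\<Prod>j<Suc N. \<Prod>i<j. t j - t i) = 0"
      using ij by (intro prod_zero bexI[of _ j] bexI[of _ i]) auto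
    ultimately show ?thesis by simp
  qed
qed

lemma alternant_newton_vandermonde:
  "alternant N (newton h) t = (-1) ^ (N * (N - 1) div 2) * vandermonde N t"
proof -
  have "(\<Prod>j<N. \<Prod>i<j. t j - t i) = (\<Prod>j<N. (-1) ^ j * (\<Prod>i<j. t i - t j))"
  proof (intro prod.cong refl)
    fix j show "(\<Prod>i<j. t j - t i) = (-1) ^ j * (\<Prod>i<j. t i - t j)"
      using prod.distrib[of "\<lambda>_. -1::real" "\<lambda>i. t i - t j" "{..<j}"] by simp
  qed
  also have "\<dots> = (-1) ^ (\<Sum>j<N. j) * vandermonde N t"
    by (simp add: prod.distrib vandermonde_def power_sum)
  also have "(\<Sum>j<N. j) = N * (N - 1) div 2"
    using gauss_sum_nat[of "N - 1"] by (cases N) (auto simp: lessThan_Suc_atMost atMost_atLeast0 mult.commute)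
  finally show ?thesis by (simp add: alternant_newton)
qed

text \<open>The second factor is the factorial Schur function of a single box. With a repeated
  argument both sides are 0.\<close>

lemma alternant_newton_top:
  assumes "N > 0"
  shows "alternant N (\<lambda>j. newton h (if j < N - 1 then j else Suc j)) t
      = alternant N (newton h) t * ((\<Sum>i<N. t i) - (\<Sum>r<N. h r))"
proof (cases "inj_on t {..<N}")
  case True
  then show ?thesis using alternant_newton_expand(2) assms by blast
next
  case False
  then obtain i j where ij: "i < N" "j < N" "i \<noteq> j" "t i = t j" by (auto simp: inj_on_def)
  then show ?thesis by (simp add: alternant_equal_args[OF ij])
qed

section \<open>Signatures as strictly decreasing sequences\<close>

definition strict_on :: "nat \<Rightarrow> (nat \<Rightarrow> nat) \<Rightarrow> bool" where
  "strict_on N n \<longleftrightarrow> (\<forall>i j. i < j \<longrightarrow> j < N \<longrightarrow> n j < n i)"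

text \<open>The inverse of \<open>shifted N\<close> on strictly decreasing sequences. The
  subtraction never truncates there, by \<open>strict_on_ge\<close>.\<close>

definition unshift :: "nat \<Rightarrow> (nat \<Rightarrow> nat) \<Rightarrow> nat list" where
  "unshift N n = map (\<lambda>i. n i - (N - 1 - i)) [0..<N]"

lemma strict_on_shifted:
  assumes "lam \<in> GT N" shows "strict_on N (shifted N lam)"
proof -
  have "shifted N lam j < shifted N lam i" if "i < j" "j < N" for i j
  proof -
    have "lam ! i \<ge> lam ! j" using assms that by (auto simp: GT_def sorted_wrt_iff_nth_less)
    then show ?thesis using that by (simp add: shifted_def)
  qed
  then show ?thesis by (simp add: strict_on_def)
qed

lemma strict_on_ge:
  assumes "strict_on N n" "i < N" shows "N - 1 - i \<le> n i"
  using assms(2)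
proof (induction "N - 1 - i" arbitrary: i)
  case (Suc k)
  have "N - 1 - Suc i \<le> n (Suc i)" using Suc by (intro Suc.hyps(1)) auto
  moreover have "n (Suc i) < n i" using assms(1) Suc by (auto simp: strict_on_def)
  ultimately show ?case using Suc.hyps(2) by linarith
qed simp

lemma shifted_unshift: "strict_on N n \<Longrightarrow> i < N \<Longrightarrow> shifted N (unshift N n) i = n i"
  using strict_on_ge[of N n i] by (simp add: shifted_def unshift_def)

lemma unshift_GT:
  assumes "strict_on N n" shows "unshift N n \<in> GT N"
proof -
  have "n j - (N - 1 - j) \<le> n i - (N - 1 - i)" if "i < j" "j < N" for i j
    using that
  proof (induction j)
    case (Suc j)
    have step: "n (Suc j) - (N - 1 - Suc j) \<le> n j - (N - 1 - j)"
    proof -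
      have "n (Suc j) < n j" using assms Suc.prems by (auto simp: strict_on_def)
      then show ?thesis using Suc.prems by linarith
    qed
    show ?case
    proof (cases "i = j")
      case False
      then show ?thesis using Suc step by (intro order_trans[OF step]) auto
    qed (use step in simp)
  qed simp
  then show ?thesis by (auto simp: GT_def unshift_def sorted_wrt_iff_nth_less)
qed

lemma GT_eqI:
  assumes "lam \<in> GT N" "\<nu> \<in> GT N" "\<And>i. i < N \<Longrightarrow> shifted N lam i = shifted N \<nu> i"
  shows "lam = \<nu>"
proof (rule nth_equalityI)
  show "length lam = length \<nu>" using assms(1,2) by (simp add: GT_def)
  fix i assume "i < length lam"
  then have "i < N" using assms(1) by (simp add: GT_def)
  from assms(3)[OF this] show "lam ! i = \<nu> ! i" by (simp only: shifted_def add_right_cancel)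
qed

lemma countable_GT: "countable (GT N)" by simp

lemma vandermonde_cong: "(\<And>i. i < N \<Longrightarrow> x i = y i) \<Longrightarrow> vandermonde N x = vandermonde N y"
  unfolding vandermonde_def by (intro prod.cong refl) auto

lemma vandermonde_eq_0: "\<not> inj_on x {..<N} \<Longrightarrow> vandermonde N x = 0"
proof -
  assume "\<not> inj_on x {..<N}"
  then obtain i j where ij: "i < j" "j < N" "x i = x j"
    by (auto simp: inj_on_def) (metis linorder_neqE_nat)
  show ?thesis unfolding vandermonde_def
    using ij by (intro prod_zero bexI[of _ j] bexI[of _ i]) auto
qed

section \<open>The generators at finite level\<close>

text \<open>In the variable y = x + e the two products are f(y) and f(-y) for one quartic f, because
  the hypothesis says b - e = -(a + 1 - e). Their difference is therefore 2 y times an even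
  quadratic.\<close>

lemma odd_part_identity:
  fixes x e k a b s t :: real
  assumes "b = 2 * e - a - 1"
  shows "(x + 2 * e + k) * (x + a + 1) * (x\<^sup>2 - x * s + t) - (x - k) * (x + b) * ((x + 2 * e)\<^sup>2 + (x + 2 * e) * s + t)
     = ((k - b - s) * (x + e)\<^sup>2
      + ((a + k + 1) * (e\<^sup>2 + s * e + t) - (a + 1 - e) * (e + k) * (2 * e + s))) * (2 * (x + e))"
  unfolding assms by (simp add: algebra_simps power2_eq_square power3_eq_cube)

text \<open>Reality and positivity are carried together through products and quotients of complex
  numbers, so the \<open>Re\<close> in the rates and weights discards nothing.\<close>

definition pos_real :: "complex \<Rightarrow> bool" where "pos_real c \<longleftrightarrow> (\<exists>r>0. c = complex_of_real r)"

lemma pos_real_mult: "pos_real c \<Longrightarrow> pos_real d \<Longrightarrow> pos_real (c * d)"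
  unfolding pos_real_def by (metis mult_pos_pos of_real_mult)

lemma pos_real_divide: "pos_real c \<Longrightarrow> pos_real d \<Longrightarrow> pos_real (c / d)"
  unfolding pos_real_def by (metis divide_pos_pos of_real_divide)

lemma pos_real_Re: "pos_real c \<Longrightarrow> Re c > 0" "pos_real c \<Longrightarrow> complex_of_real (Re c) = c"
  by (auto simp: pos_real_def)

lemma pos_real_norm: "w \<noteq> 0 \<Longrightarrow> pos_real (w * cnj w)"
  unfolding pos_real_def using complex_norm_square[of w] by (intro exI[of _ "(cmod w)\<^sup>2"]) auto

text \<open>In the principal case the product is a squared modulus. In the complementary case both
  parameters lie strictly between the same two consecutive integers, so an integer shift gives both
  the same sign.\<close>

lemma Z_shift_pos_real:
  assumes "(w, w') \<in> Z_princ \<union> Z_compl"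
  shows "pos_real ((of_int n + w) * (of_int n + w'))"
  using assms
proof
  assume "(w, w') \<in> Z_princ"
  then have w: "w' = cnj w" "w \<notin> \<real>" by (auto simp: Z_princ_def Reals_cnj_iff)
  have "of_int n + w \<noteq> 0"
  proof
    assume "of_int n + w = 0"
    then have "w = of_int (- n)" by (simp add: add_eq_0_iff)
    then show False using w(2) by (metis Reals_of_int)
  qed
  then show ?thesis using pos_real_norm[of "of_int n + w"] w(1) by simp
next
  assume "(w, w') \<in> Z_compl"
  then obtain m :: int where m: "w \<in> \<real>" "w' \<in> \<real>" "of_int m < Re w" "Re w < of_int m + 1"
    "of_int m < Re w'" "Re w' < of_int m + 1" by (auto simp: Z_compl_def)
  have "n + m \<ge> 0 \<or> n + m + 1 \<le> 0" by linarith
  then have "real_of_int n + real_of_int m \<ge> 0 \<or> real_of_int n + real_of_int m + 1 \<le> 0" by linarith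
  then have "(of_int n + Re w) * (of_int n + Re w') > 0"
  proof
    assume "real_of_int n + real_of_int m \<ge> 0"
    then show ?thesis using m(3,5) by (intro mult_pos_pos) linarith+
  next
    assume "real_of_int n + real_of_int m + 1 \<le> 0"
    then show ?thesis using m(4,6) by (intro mult_neg_neg) linarith+
  qed
  moreover have "(of_int n + w) * (of_int n + w') = of_real ((of_int n + Re w) * (of_int n + Re w'))"
    using m(1,2) by (simp add: of_real_Re)
  ultimately show ?thesis unfolding pos_real_def by blast
qed

section \<open>The one-dimensional generator in the Newton basis\<close>

locale z_params =
  fixes a b :: real and z z' :: complex
  assumes ab: "a \<ge> b" "b \<ge> -1/2" and zz': "(z, z') \<in> H_params a b"
begin

abbreviation "e \<equiv> eps a b"

lemma e_nonneg: "e \<ge> 0" and e_eq: "a + b + 1 = 2 * e" using ab by (auto simp: eps_def)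

text \<open>\<open>s1\<close> and \<open>s2\<close> are the symmetric functions of u = z + N - 1 and
  u' = z' + N - 1. Through them (x - u)(x - u') and (x + u + 2e)(x + u' + 2e) become real quadratics
  in a real variable, open to polynomial identities.\<close>

definition s1 :: "nat \<Rightarrow> real" where "s1 N = Re ((z + of_nat N - 1) + (z' + of_nat N - 1))"
definition s2 :: "nat \<Rightarrow> real" where "s2 N = Re ((z + of_nat N - 1) * (z' + of_nat N - 1))"

definition birth_factor :: "nat \<Rightarrow> real \<Rightarrow> real" where "birth_factor N x = x\<^sup>2 - x * s1 N + s2 N"
definition death_factor :: "nat \<Rightarrow> real \<Rightarrow> real" where
  "death_factor N x = (x + 2 * e)\<^sup>2 + (x + 2 * e) * s1 N + s2 N"

lemma birth_factor_eq:
  "birth_factor N (real x) = Re ((of_nat x - (z + of_nat N - 1)) * (of_nat x - (z' + of_nat N - 1)))"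
  by (simp add: birth_factor_def s1_def s2_def algebra_simps power2_eq_square)

lemma death_factor_eq:
  "death_factor N (real x) = Re ((of_nat x + (z + of_nat N - 1) + of_real (2 * e)) * (of_nat x + (z' + of_nat N - 1) + of_real (2 * e)))"
  by (simp add: death_factor_def s1_def s2_def algebra_simps power2_eq_square)

lemma birth_rate_eq:
  "birth_rate a b z z' N x = (if x = 0 \<and> e = 0 then 1 else (real x + 2 * e) / (2 * (real x + e))) *
      ((real x + a + 1) * birth_factor N x / (2 * real x + 2 * e + 1))"
  unfolding birth_rate_def Let_def birth_factor_eq ..

lemma death_rate_eq:
  "death_rate a b z z' N x = (if x = 0 then 0 else
      real x * (real x + b) * death_factor N x / (2 * (real x + e) * (2 * real x + 2 * e - 1)))"
  unfolding death_rate_def Let_def death_factor_eq ..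

text \<open>In Pochhammer symbols this is (-1)^k (-x)_k (x + 2e)_k, the basis in which polynomials
  of Wilson and Racah type are expanded.\<close>

definition phi :: "nat \<Rightarrow> real \<Rightarrow> real" where
  "phi k x = (\<Prod>r<k. (x + e)\<^sup>2 - (real r + e)\<^sup>2)"

lemma phi_Suc: "phi (Suc k) x = phi k x * ((x - real k) * (x + real k + 2 * e))"
  by (simp add: phi_def power2_eq_square algebra_simps)

lemma phi_0 [simp]: "phi 0 x = 1" by (simp add: phi_def)

lemma phi_newton: "phi k (real x) = newton (hat a b) k (hat a b x)"
  by (simp add: phi_def newton_def hat_def)

text \<open>A step up shifts both Pochhammer factors by one. The factor \<open>x + 2 * e\<close>,
  which the birth rate contains, completes the result to a multiple of \<open>phi k x\<close>; in
  \<open>phi_down\<close> the factor \<open>x\<close> of the death rate does the same.\<close>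

lemma phi_up: "(x + 2 * e) * phi (Suc k) (x + 1) = phi k x * ((x + 1) * (x + 2 * e + real k) * (x + 1 + real k + 2 * e))"
proof (induction k)
  case 0 then show ?case by (simp add: phi_Suc algebra_simps)
next
  case (Suc k)
  have "(x + 2 * e) * phi (Suc (Suc k)) (x + 1) = ((x + 2 * e) * phi (Suc k) (x + 1)) * ((x - real k) * (x + real k + 2 + 2 * e))"
    unfolding phi_Suc[of "Suc k"] by (simp add: algebra_simps)
  then show ?case unfolding Suc.IH phi_Suc[of k x] by (simp add: algebra_simps)
qed

lemma phi_up_diff:
  "(x + 2 * e) * (phi (Suc k) (x + 1) - phi (Suc k) x) = real (Suc k) * (2 * x + 2 * e + 1) * (x + 2 * e + real k) * phi k x"
  unfolding right_diff_distrib phi_up unfolding phi_Suc by (simp add: algebra_simps)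

lemma phi_down: "x * phi (Suc k) (x - 1) = phi k x * ((x - real k) * (x - 1 - real k) * (x + 2 * e - 1))"
proof (induction k)
  case 0 then show ?case by (simp add: phi_Suc algebra_simps)
next
  case (Suc k)
  have "x * phi (Suc (Suc k)) (x - 1) = (x * phi (Suc k) (x - 1)) * ((x - real k - 2) * (x + real k + 2 * e))"
    unfolding phi_Suc[of "Suc k"] by (simp add: algebra_simps)
  then show ?case unfolding Suc.IH phi_Suc[of k x] by (simp add: algebra_simps)
qed

lemma phi_down_diff:
  "x * (phi (Suc k) (x - 1) - phi (Suc k) x) = - real (Suc k) * (2 * x + 2 * e - 1) * (x - real k) * phi k x"
  unfolding right_diff_distrib phi_down unfolding phi_Suc by (simp add: algebra_simps)

definition eigen :: "nat \<Rightarrow> nat \<Rightarrow> real" where "eigen N k = real k * (real k - 1 - b - s1 N)"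

text \<open>\<open>real k\<close> times the value at x = k - 1 of the even quadratic found in
  \<open>odd_part\<close> for index k - 1. The factor \<open>real k\<close> makes it 0 for
  \<open>k = 0\<close>, where \<open>k - 1\<close> is truncated.\<close>

definition sub_eigen :: "nat \<Rightarrow> nat \<Rightarrow> real" where
  "sub_eigen N k = real k * ((real k - 1 - b - s1 N) * (real (k - 1) + e)\<^sup>2
     + ((a + real k) * (e\<^sup>2 + s1 N * e + s2 N) - (a + 1 - e) * (e + real k - 1) * (2 * e + s1 N)))"

text \<open>The quotient below is the odd part of a quartic polynomial in \<open>x + e\<close>, divided by \<open>x + e\<close>.\<close>

lemma odd_part:
  assumes "x + e \<noteq> 0"
  shows "((x + 2 * e + real k) * (x + a + 1) * birth_factor N x - (x - real k) * (x + b) * death_factor N x) / (2 * (x + e))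
    = (real k - b - s1 N) * (x + e)\<^sup>2
      + ((a + real k + 1) * (e\<^sup>2 + s1 N * e + s2 N) - (a + 1 - e) * (e + real k) * (2 * e + s1 N))"
proof -
  have b: "b = 2 * e - a - 1" using e_eq by simp
  note odd_part_identity[OF b, of x "real k" "s1 N" "s2 N"]
  then show ?thesis using assms unfolding birth_factor_def death_factor_def by simp
qed

text \<open>Both differences of \<open>phi k\<close> are multiples of \<open>phi (k - 1)\<close>,
  and the rates cancel the denominators up to \<open>2 * (x + e)\<close>. By \<open>odd_part\<close>
  the sum of the two terms is \<open>phi (k - 1)\<close> times a quadratic in x + e, and (x + e)^2
  times \<open>phi (k - 1)\<close> equals \<open>phi k\<close> plus (k - 1 + e)^2 times
  \<open>phi (k - 1)\<close>.\<close>

lemma generator_phi: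
  "birth_rate a b z z' N x * (phi k (real (x + 1)) - phi k (real x))
     + death_rate a b z z' N x * (phi k (real (x - 1)) - phi k (real x))
   = eigen N k * phi k (real x) + sub_eigen N k * phi (k - 1) (real x)"
proof (cases k)
  case 0
  then show ?thesis by (simp add: eigen_def sub_eigen_def)
next
  case (Suc k')
  let ?x = "real x"
  have rhs: "eigen N k * phi k ?x + sub_eigen N k * phi (k - 1) ?x
     = real k * phi k' ?x * ((real k' - b - s1 N) * (?x + e)\<^sup>2
      + ((a + real k' + 1) * (e\<^sup>2 + s1 N * e + s2 N) - (a + 1 - e) * (e + real k') * (2 * e + s1 N)))"
    unfolding Suc eigen_def sub_eigen_def phi_Suc by (simp add: algebra_simps power2_eq_square)
  \<comment> \<open>For x = e = 0 the birth rate is given by the convention for 0/0, and the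
    identity is checked from the values of \<open>phi\<close> at 0 and 1.\<close>
  show ?thesis
  proof (cases "x = 0 \<and> e = 0")
    case True
    have "phi k 1 - phi k 0 = of_bool (k' = 0)"
    proof -
      have "phi k 0 = 0" using True unfolding Suc phi_def by (intro prod_zero) auto
      moreover have "phi k 1 = of_bool (k' = 0)"
      proof (cases k')
        case 0 then show ?thesis using Suc True by (simp add: phi_Suc)
      next
        case (Suc k'')
        then have "phi k 1 = 0" using True unfolding \<open>k = Suc k'\<close> phi_def by (intro prod_zero bexI[of _ 1]) auto
        then show ?thesis using Suc by simp
      qed
      ultimately show ?thesis by simp
    qed
    moreover have "phi k' 0 = of_bool (k' = 0)"
    proof (cases k')
      case (Suc k'')
      then have "phi k' 0 = 0" using True unfolding phi_def by (intro prod_zero) auto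
      then show ?thesis using Suc by simp
    qed simp
    moreover have "birth_rate a b z z' N x = (a + 1) * s2 N" "death_rate a b z z' N x = 0"
      using True by (simp_all add: birth_rate_eq death_rate_eq birth_factor_def)
    ultimately show ?thesis
      unfolding rhs using True Suc by (cases "k' = 0") simp_all
  next
    case False
    then have xe: "?x + e > 0" using e_nonneg by (cases "x = 0") auto
    have up: "birth_rate a b z z' N x * (phi k (real (x + 1)) - phi k ?x)
        = real k * phi k' ?x * ((?x + 2 * e + real k') * (?x + a + 1) * birth_factor N ?x) / (2 * (?x + e))"
    proof -
      have d: "2 * ?x + 2 * e + 1 \<noteq> 0" using e_nonneg by (smt (verit) of_nat_0_le_iff)
      have "birth_rate a b z z' N x * (phi k (real (x + 1)) - phi k ?x)
         = ((?x + 2 * e) * (phi (Suc k') (?x + 1) - phi (Suc k') ?x)) * (?x + a + 1) * birth_factor N ?x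
             / (2 * (?x + e) * (2 * ?x + 2 * e + 1))"
        using False by (auto simp: birth_rate_eq Suc add.commute)
      also have "\<dots> = real k * phi k' ?x * ((?x + 2 * e + real k') * (?x + a + 1) * birth_factor N ?x) / (2 * (?x + e))"
        unfolding phi_up_diff using d xe by (simp add: Suc divide_simps)
      finally show ?thesis .
    qed
    have down: "death_rate a b z z' N x * (phi k (real (x - 1)) - phi k ?x)
        = - real k * phi k' ?x * ((?x - real k') * (?x + b) * death_factor N ?x) / (2 * (?x + e))"
    proof (cases "x = 0")
      case True
      \<comment> \<open>The right side has to vanish at 0 as well: there \<open>phi k'\<close> is
        nonzero only for \<open>k' = 0\<close>, and then the factor \<open>x - k'\<close> is
        0.\<close>
      have "phi k' 0 = 0" if "k' > 0" unfolding phi_def using that by (intro prod_zero bexI[of _ 0]) auto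
      then have "phi k' 0 * real k' = 0" by (cases "k' = 0") auto
      then show ?thesis using True by (simp add: death_rate_eq) (auto simp: mult.assoc)
    next
      case x: False
      then have d: "2 * ?x + 2 * e - 1 \<noteq> 0" "real (x - 1) = ?x - 1" using e_nonneg by (auto simp: of_nat_diff)
      have "death_rate a b z z' N x * (phi k (real (x - 1)) - phi k ?x)
         = (?x * (phi (Suc k') (?x - 1) - phi (Suc k') ?x)) * (?x + b) * death_factor N ?x
             / (2 * (?x + e) * (2 * ?x + 2 * e - 1))"
        using x by (simp add: death_rate_eq Suc d(2))
      also have "\<dots> = - real k * phi k' ?x * ((?x - real k') * (?x + b) * death_factor N ?x) / (2 * (?x + e))"
        unfolding phi_down_diff using d(1) xe by (simp add: Suc divide_simps)
      finally show ?thesis .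
    qed
    have "birth_rate a b z z' N x * (phi k (real (x + 1)) - phi k ?x)
       + death_rate a b z z' N x * (phi k (real (x - 1)) - phi k ?x)
      = real k * phi k' ?x * (((?x + 2 * e + real k') * (?x + a + 1) * birth_factor N ?x - (?x - real k') * (?x + b) * death_factor N ?x) / (2 * (?x + e)))"
      unfolding up down by (simp add: diff_divide_distrib right_diff_distrib)
    also have "\<dots> = eigen N k * phi k ?x + sub_eigen N k * phi (k - 1) ?x"
      unfolding rhs using odd_part[of ?x k' N] xe by simp
    finally show ?thesis .
  qed
qed

lemma z_params: "(z, z') \<in> Z_princ \<union> Z_compl" "(z + of_real (2 * e), z' + of_real (2 * e)) \<in> Z_princ \<union> Z_compl"
  using zz' by (auto simp: H_params_def)

lemma factor_pos: "birth_factor N (real x) > 0" "death_factor N (real x) > 0"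
proof -
  have "birth_factor N (real x) = Re ((of_int (int N - 1 - int x) + z) * (of_int (int N - 1 - int x) + z'))"
    unfolding birth_factor_eq by (simp add: algebra_simps)
  then show "birth_factor N (real x) > 0" using pos_real_Re(1)[OF Z_shift_pos_real[OF z_params(1)]] by metis
  have "death_factor N (real x) = Re ((of_int (int N - 1 + int x) + (z + of_real (2 * e))) * (of_int (int N - 1 + int x) + (z' + of_real (2 * e))))"
    unfolding death_factor_eq by (simp add: algebra_simps)
  then show "death_factor N (real x) > 0" using pos_real_Re(1)[OF Z_shift_pos_real[OF z_params(2)]] by metis
qed

lemma birth_rate_pos: "birth_rate a b z z' N x > 0"
proof -
  have "(if x = 0 \<and> e = 0 then 1 else (real x + 2 * e) / (2 * (real x + e))) > 0"
    using e_nonneg by (cases "x = 0") (auto intro!: divide_pos_pos add_pos_nonneg)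
  moreover have "real x \<ge> 0" by simp
  then have "real x + a + 1 > 0" "2 * real x + 2 * e + 1 > 0"
    using ab e_nonneg by linarith+
  ultimately show ?thesis unfolding birth_rate_eq using factor_pos(1)[of N x] by simp
qed

lemma death_rate_pos:
  assumes "x > 0" shows "death_rate a b z z' N x > 0"
proof -
  have "real x \<ge> 1" using assms by simp
  then show ?thesis unfolding death_rate_eq using factor_pos(2)[of N x] assms ab(2) e_nonneg by simp
qed

lemma hat_less_iff: "hat a b x < hat a b y \<longleftrightarrow> x < y"
proof -
  have "strict_mono (hat a b)"
    unfolding hat_def using e_nonneg by (intro strict_monoI power_strict_mono) auto
  then show ?thesis by (rule strict_mono_less)
qed

lemma hat_eq_iff: "hat a b x = hat a b y \<longleftrightarrow> x = y"
  using hat_less_iff[of x y] hat_less_iff[of y x] by (metis linorder_neqE_nat order_less_irrefl)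

section \<open>The jump operator on Vandermonde alternants\<close>

definition V :: "nat \<Rightarrow> (nat \<Rightarrow> nat) \<Rightarrow> real" where "V N n = vandermonde N (hat a b \<circ> n)"

lemma V_cong: "(\<And>i. i < N \<Longrightarrow> n i = m i) \<Longrightarrow> V N n = V N m"
  unfolding V_def by (intro vandermonde_cong) simp

lemma V_pos: "strict_on N n \<Longrightarrow> V N n > 0"
  unfolding V_def vandermonde_def by (intro prod_pos ballI) (auto simp: hat_less_iff strict_on_def)

lemma V_eq_0: "\<not> inj_on n {..<N} \<Longrightarrow> V N n = 0"
  unfolding V_def by (rule vandermonde_eq_0) (simp add: inj_on_def hat_eq_iff)

lemma V_alternant:
  "alternant N (\<lambda>j t. phi j (real t)) n = (-1) ^ (N * (N - 1) div 2) * V N n"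
proof -
  have "alternant N (\<lambda>j t. phi j (real t)) n = alternant N (newton (hat a b)) (hat a b \<circ> n)"
    by (rule alternant_cong) (simp add: phi_newton)
  then show ?thesis by (simp add: alternant_newton_vandermonde V_def)
qed

text \<open>The factor gained by the alternant \<open>V\<close> when its top index is raised. It is
  0 at the sequence N - 1, ..., 0, that is at the zero signature, and nonnegative elsewhere on
  strictly decreasing sequences.\<close>

definition H :: "nat \<Rightarrow> (nat \<Rightarrow> nat) \<Rightarrow> real" where
  "H N n = (\<Sum>i<N. hat a b (n i)) - (\<Sum>r<N. hat a b r)"

lemma V_alternant_top:
  assumes "N > 0"
  shows "alternant N (\<lambda>j t. phi (if j < N - 1 then j else Suc j) (real t)) n
     = (-1) ^ (N * (N - 1) div 2) * (V N n * H N n)"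
proof -
  have "alternant N (\<lambda>j t. phi (if j < N - 1 then j else Suc j) (real t)) n
      = alternant N (\<lambda>j. newton (hat a b) (if j < N - 1 then j else Suc j)) (hat a b \<circ> n)"
    by (rule alternant_cong) (simp add: phi_newton)
  then show ?thesis
    using alternant_newton_top[OF assms, of "hat a b" "hat a b \<circ> n"]
    by (simp add: alternant_newton_vandermonde V_def H_def)
qed

abbreviation "br \<equiv> birth_rate a b z z'"
abbreviation "dr \<equiv> death_rate a b z z'"

text \<open>The generator of \<open>N\<close> independent birth and death processes on all of the
  lattice, with no exclusion between coordinates.\<close>

definition jumps :: "nat \<Rightarrow> ((nat \<Rightarrow> nat) \<Rightarrow> real) \<Rightarrow> (nat \<Rightarrow> nat) \<Rightarrow> real" where
  "jumps N h n = (\<Sum>i<N. br N (n i) * (h (n(i := n i + 1)) - h n) + dr N (n i) * (h (n(i := n i - 1)) - h n))"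

lemma jumps_alternant:
  "jumps N (alternant N (\<lambda>j t. phi (s j) (real t))) n
    = (\<Sum>j<N. eigen N (s j)) * alternant N (\<lambda>j t. phi (s j) (real t)) n
      + (\<Sum>j<N. sub_eigen N (s j) * alternant N (\<lambda>i t. phi ((s(j := s j - 1)) i) (real t)) n)"
proof -
  let ?f = "\<lambda>j t. phi (s j) (real t)"
  have "jumps N (alternant N ?f) n
      = (\<Sum>j<N. alternant N (?f(j := (\<lambda>t. br N t * (?f j (t + 1) - ?f j t) + dr N t * (?f j (t - 1) - ?f j t)))) n)"
    unfolding jumps_def by (rule alternant_generator)
  also have "\<dots> = (\<Sum>j<N. alternant N (?f(j := (\<lambda>t. eigen N (s j) * phi (s j) (real t) + sub_eigen N (s j) * phi (s j - 1) (real t)))) n)"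
    unfolding generator_phi ..
  also have "\<dots> = (\<Sum>j<N. eigen N (s j) * alternant N ?f n + sub_eigen N (s j) * alternant N (\<lambda>i t. phi ((s(j := s j - 1)) i) (real t)) n)"
  proof (intro sum.cong refl)
    fix j assume "j \<in> {..<N}"
    then have j: "j < N" by simp
    have "?f(j := \<lambda>t. phi (s j - 1) (real t)) = (\<lambda>i t. phi ((s(j := s j - 1)) i) (real t))"
      "?f(j := \<lambda>t. phi (s j) (real t)) = ?f" by auto
    then show "alternant N (?f(j := (\<lambda>t. eigen N (s j) * phi (s j) (real t) + sub_eigen N (s j) * phi (s j - 1) (real t)))) n
       = eigen N (s j) * alternant N ?f n + sub_eigen N (s j) * alternant N (\<lambda>i t. phi ((s(j := s j - 1)) i) (real t)) n"
      unfolding alternant_linear[OF j] by simp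
  qed
  finally show ?thesis by (simp add: sum.distrib sum_distrib_right)
qed

text \<open>The origin of c_N: it is the sum of the first \<open>N\<close> eigenvalues, hence the
  eigenvalue of \<open>V\<close>, and subtracting it makes the transformed generator
  conservative.\<close>

lemma sum_eigen: "(\<Sum>j<N. eigen N j) = c_const b z z' N"
proof -
  have "(\<Sum>j<M. real j * (real j - 1 - b - s)) = real M * (real M - 1) * (real M - 2) / 3 - real M * (real M - 1) / 2 * (s + b)" for M s
    by (induction M) (simp_all add: field_simps)
  from this[where M = N and s = "s1 N"] show ?thesis by (simp only: eigen_def c_const_def s1_def Let_def)
qed

lemma jumps_scale: "jumps N (\<lambda>n. c * h n) n = c * jumps N h n"
  unfolding jumps_def sum_distrib_left by (intro sum.cong refl) (simp add: algebra_simps)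

text \<open>Lowering one index in the list 0, ..., N - 1 repeats the preceding index, so every
  subdiagonal term is an alternant with two equal functions; index 0 has coefficient 0.\<close>

lemma jumps_V: "jumps N (V N) n = c_const b z z' N * V N n"
proof -
  let ?\<sigma> = "(-1) ^ (N * (N - 1) div 2) :: real"
  have "sub_eigen N j * alternant N (\<lambda>i t. phi ((id(j := j - 1)) i) (real t)) n = 0" if "j < N" for j
  proof (cases j)
    case (Suc i)
    have "alternant N (\<lambda>k t. phi ((id(j := j - 1)) k) (real t)) n = 0"
      using that Suc by (intro alternant_equal_funs[of i N j]) auto
    then show ?thesis by simp
  qed (simp add: sub_eigen_def)
  then have "jumps N (alternant N (\<lambda>j t. phi j (real t))) n = c_const b z z' N * alternant N (\<lambda>j t. phi j (real t)) n"
    using jumps_alternant[of N id n] sum.neutral[of "{..<N}" "\<lambda>j. sub_eigen N j * alternant N (\<lambda>i t. phi ((id(j := j - 1)) i) (real t)) n"]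
    by (simp add: sum_eigen)
  then show ?thesis unfolding V_alternant jumps_scale by simp
qed

text \<open>The indices are 0, ..., N - 2 and N. Lowering any of the first ones gives 0 as for
  \<open>V\<close>; lowering N fills the gap and returns \<open>V\<close> itself.\<close>

lemma jumps_V_H:
  assumes N: "N > 0"
  shows "jumps N (\<lambda>n. V N n * H N n) n
    = c_const b z z' N * (V N n * H N n) + ((eigen N N - eigen N (N - 1)) * H N n + sub_eigen N N) * V N n"
proof -
  define s where "s j = (if j < N - 1 then j else Suc j)" for j
  let ?\<sigma> = "(-1) ^ (N * (N - 1) div 2) :: real"
  obtain M where M: "N = Suc M" using N by (cases N) auto
  have low: "sub_eigen N (s j) * alternant N (\<lambda>i t. phi ((s(j := s j - 1)) i) (real t)) n = 0" if "j < M" for j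
  proof (cases j)
    case (Suc i)
    have "alternant N (\<lambda>k t. phi ((s(j := s j - 1)) k) (real t)) n = 0"
      using that Suc M by (intro alternant_equal_funs[of i N j]) (auto simp: s_def)
    then show ?thesis by simp
  qed (use that M in \<open>simp add: sub_eigen_def s_def\<close>)
  have top: "alternant N (\<lambda>i t. phi ((s(M := s M - 1)) i) (real t)) n = ?\<sigma> * V N n"
    unfolding V_alternant[symmetric] by (rule alternant_cong) (auto simp: s_def M)
  have eig: "(\<Sum>j<N. eigen N (s j)) = c_const b z z' N + eigen N N - eigen N (N - 1)"
    unfolding sum_eigen[symmetric] by (simp add: M s_def)
  have alt: "alternant N (\<lambda>j t. phi (s j) (real t)) = (\<lambda>n. ?\<sigma> * (V N n * H N n))"
    unfolding s_def V_alternant_top[OF N] ..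
  have "?\<sigma> * jumps N (\<lambda>n. V N n * H N n) n
      = (c_const b z z' N + eigen N N - eigen N (N - 1)) * (?\<sigma> * (V N n * H N n)) + sub_eigen N (s M) * (?\<sigma> * V N n)"
    using jumps_alternant[of N s n] sum.neutral[of "{..<M}" "\<lambda>j. sub_eigen N (s j) * alternant N (\<lambda>i t. phi ((s(j := s j - 1)) i) (real t)) n"] low
    unfolding alt eig jumps_scale top[symmetric] by (simp add: M)
  moreover have "s M = N" by (simp add: s_def M)
  ultimately have "?\<sigma> * jumps N (\<lambda>n. V N n * H N n) n = ?\<sigma> * (c_const b z z' N * (V N n * H N n) + ((eigen N N - eigen N (N - 1)) * H N n + sub_eigen N N) * V N n)"
    by (simp add: algebra_simps)
  then show ?thesis by simp
qed

lemma H_nonneg: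
  assumes "strict_on N n" shows "H N n \<ge> 0"
proof -
  have "(\<Sum>r<N. hat a b r) = (\<Sum>i<N. hat a b (N - 1 - i))"
    using sum.nat_diff_reindex[of "hat a b" N] by simp
  also have "\<dots> \<le> (\<Sum>i<N. hat a b (n i))"
    using strict_on_ge[OF assms] hat_less_iff by (intro sum_mono) (metis lessThan_iff not_less)
  finally show ?thesis by (simp add: H_def)
qed

text \<open>A signature belongs to its own \<open>nbr\<close> for every \<open>k\<close>. Hence a
  diagonal entry of \<open>RN\<close> collects the diagonal rates of all \<open>N\<close>
  coordinates, as the indicator in its definition requires.\<close>

definition nbr :: "nat \<Rightarrow> nat list \<Rightarrow> nat \<Rightarrow> nat list set" where
  "nbr N lam k = {\<nu>\<in>GT N. \<forall>i<N. i \<noteq> k \<longrightarrow> shifted N lam i = shifted N \<nu> i}"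

abbreviation "Rm \<equiv> R_matrix a b z z'"

lemma RN_eq:
  assumes "\<nu> \<in> GT N"
  shows "RN a b z z' N lam \<nu> = (\<Sum>k<N. if \<nu> \<in> nbr N lam k
      then V N (shifted N \<nu>) / V N (shifted N lam) * Rm N (shifted N lam k) (shifted N \<nu> k) else 0)
    - (if lam = \<nu> then c_const b z z' N else 0)"
  unfolding RN_def Let_def V_def nbr_def sum_distrib_left using assms
  by (intro arg_cong2[where f = "(-)"] sum.cong refl) auto

lemma nbr_inj: "inj_on (\<lambda>\<nu>. shifted N \<nu> k) (nbr N lam k)"
proof (rule inj_onI)
  fix \<mu> \<nu> assume *: "\<mu> \<in> nbr N lam k" "\<nu> \<in> nbr N lam k" "shifted N \<mu> k = shifted N \<nu> k"
  show "\<mu> = \<nu>"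
  proof (rule GT_eqI)
    fix i assume "i < N"
    then show "shifted N \<mu> i = shifted N \<nu> i" using * by (cases "i = k") (auto simp: nbr_def)
  qed (use * in \<open>auto simp: nbr_def\<close>)
qed

lemma Rm_nonzero: "Rm N x y \<noteq> 0 \<Longrightarrow> y \<in> {x - 1, x, x + 1}"
  by (auto simp: R_matrix_def split: if_splits)

lemma sum_Rm:
  "(\<Sum>m\<in>{x - 1, x, x + 1}. Rm N x m * h m) = br N x * (h (x + 1) - h x) + dr N x * (h (x - 1) - h x)"
proof (cases x)
  case 0
  \<comment> \<open>Truncation merges two of the three points, and the term that disappears has the
    death rate at 0 as its coefficient, which is 0.\<close>
  then have "{x - 1, x, x + 1} = {0, 1}" by auto
  then show ?thesis using 0 by (simp add: R_matrix_def death_rate_def Let_def algebra_simps)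
next
  case (Suc y)
  then show ?thesis by (simp add: R_matrix_def algebra_simps)
qed

definition moves :: "nat \<Rightarrow> nat list \<Rightarrow> nat \<Rightarrow> nat list set" where
  "moves N lam k = {\<nu>\<in>nbr N lam k. Rm N (shifted N lam k) (shifted N \<nu> k) \<noteq> 0}"

lemma finite_moves: "finite (moves N lam k)"
proof (rule finite_imageD)
  show "finite ((\<lambda>\<nu>. shifted N \<nu> k) ` moves N lam k)"
    by (rule finite_subset[of _ "{shifted N lam k - 1, shifted N lam k, shifted N lam k + 1}"])
       (use Rm_nonzero in \<open>force simp: moves_def\<close>, simp)
  show "inj_on (\<lambda>\<nu>. shifted N \<nu> k) (moves N lam k)"
    using nbr_inj by (rule inj_on_subset) (auto simp: moves_def)
qed

text \<open>A unit step cannot overtake a neighbouring coordinate without first meeting it, so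
  injectivity is the only condition.\<close>

lemma strict_on_update:
  assumes "strict_on N n" "k < N" "m \<in> {n k - 1, n k, n k + 1}" "inj_on (n(k := m)) {..<N}"
  shows "strict_on N (n(k := m))"
  unfolding strict_on_def
proof (intro allI impI)
  fix i j assume ij: "i < j" "j < N"
  have "n j < n i" using assms(1) ij by (auto simp: strict_on_def)
  moreover have "(n(k := m)) i \<noteq> (n(k := m)) j" using inj_onD[OF assms(4), of i j] ij by auto
  moreover have "n k - 1 \<le> m" "m \<le> n k + 1" using assms(3) by auto
  ultimately show "(n(k := m)) j < (n(k := m)) i" using ij by (cases "i = k"; cases "j = k") simp_all
qed

text \<open>The sum over signatures is completed to all three values of coordinate \<open>k\<close>.
  A value that no move attains either produces a collision, where \<open>h\<close> vanishes, or has
  rate 0.\<close>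

lemma sum_moves:
  assumes lam: "lam \<in> GT N" and k: "k < N"
    and h_cong: "\<And>n n'. (\<And>i. i < N \<Longrightarrow> n i = n' i) \<Longrightarrow> h n = h n'"
    and h_0: "\<And>n. \<not> inj_on n {..<N} \<Longrightarrow> h n = 0"
  defines "n \<equiv> shifted N lam"
  shows "(\<Sum>\<nu>\<in>moves N lam k. Rm N (n k) (shifted N \<nu> k) * h (shifted N \<nu>))
    = br N (n k) * (h (n(k := n k + 1)) - h n) + dr N (n k) * (h (n(k := n k - 1)) - h n)"
proof -
  let ?s = "\<lambda>\<nu>. shifted N \<nu> k"
  have "(\<Sum>\<nu>\<in>moves N lam k. Rm N (n k) (?s \<nu>) * h (shifted N \<nu>))
     = (\<Sum>\<nu>\<in>moves N lam k. Rm N (n k) (?s \<nu>) * h (n(k := ?s \<nu>)))"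
    by (intro sum.cong refl arg_cong2[where f = "(*)"] h_cong) (auto simp: moves_def nbr_def n_def)
  also have "\<dots> = (\<Sum>m\<in>?s ` moves N lam k. Rm N (n k) m * h (n(k := m)))"
    using inj_on_subset[OF nbr_inj, of "moves N lam k" N lam k]
    by (subst sum.reindex) (auto simp: moves_def)
  also have "\<dots> = (\<Sum>m\<in>{n k - 1, n k, n k + 1}. Rm N (n k) m * h (n(k := m)))"
  proof (rule sum.mono_neutral_left)
    show "?s ` moves N lam k \<subseteq> {n k - 1, n k, n k + 1}"
      using Rm_nonzero by (force simp: moves_def n_def)
    show "\<forall>m\<in>{n k - 1, n k, n k + 1} - ?s ` moves N lam k. Rm N (n k) m * h (n(k := m)) = 0"
    proof
      fix m assume m: "m \<in> {n k - 1, n k, n k + 1} - ?s ` moves N lam k"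
      show "Rm N (n k) m * h (n(k := m)) = 0"
      proof (cases "inj_on (n(k := m)) {..<N}")
        case True
        have st: "strict_on N (n(k := m))"
          using strict_on_update[OF _ k _ True] strict_on_shifted[OF lam] m by (auto simp: n_def)
        define \<nu> where "\<nu> = unshift N (n(k := m))"
        have "\<nu> \<in> nbr N lam k" using unshift_GT[OF st] shifted_unshift[OF st]
          by (auto simp: nbr_def \<nu>_def n_def)
        moreover have "?s \<nu> = m" using shifted_unshift[OF st k] by (simp add: \<nu>_def)
        ultimately have "Rm N (n k) m = 0" using m by (force simp: moves_def n_def)
        then show ?thesis by simp
      qed (simp add: h_0)
    qed
  qed simp
  also have "\<dots> = br N (n k) * (h (n(k := n k + 1)) - h n) + dr N (n k) * (h (n(k := n k - 1)) - h n)"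
    using sum_Rm[of N "n k" "\<lambda>m. h (n(k := m))"] by simp
  finally show ?thesis .
qed

lemma RN_support: "{\<nu>\<in>GT N. RN a b z z' N lam \<nu> \<noteq> 0} \<subseteq> insert lam (\<Union>k<N. moves N lam k)"
proof (rule ccontr)
  assume "\<not> ?thesis"
  then obtain \<nu> where *: "\<nu> \<in> GT N" "RN a b z z' N lam \<nu> \<noteq> 0" "\<nu> \<notin> insert lam (\<Union>k<N. moves N lam k)"
    by blast
  have "RN a b z z' N lam \<nu> = 0"
    unfolding RN_eq[OF *(1)] using *(3) by (auto intro!: sum.neutral simp: moves_def)
  then show False using * by simp
qed

lemma finite_RN: "finite {\<nu>\<in>GT N. RN a b z z' N lam \<nu> \<noteq> 0}"
  by (rule finite_subset[OF RN_support]) (simp add: finite_moves)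

text \<open>Doob transform: up to the constant, the generator is a conjugate by \<open>V\<close> of \<open>N\<close> independent
  birth and death processes. Updates leaving the strictly decreasing sequences do not contribute, as
  \<open>V\<close> vanishes there.\<close>

lemma RN_sum:
  assumes lam: "lam \<in> GT N"
    and g_cong: "\<And>n n'. (\<And>i. i < N \<Longrightarrow> n i = n' i) \<Longrightarrow> g n = g n'"
  shows "(\<Sum>\<nu>\<in>{\<nu>\<in>GT N. RN a b z z' N lam \<nu> \<noteq> 0}. RN a b z z' N lam \<nu> * g (shifted N \<nu>))
    = jumps N (\<lambda>n. V N n * g n) (shifted N lam) / V N (shifted N lam) - c_const b z z' N * g (shifted N lam)"
proof -
  define n where "n = shifted N lam"
  define T where "T = insert lam (\<Union>k<N. moves N lam k)"
  have T: "finite T" "T \<subseteq> GT N" "lam \<in> T" using lam finite_moves by (auto simp: T_def moves_def nbr_def)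
  let ?h = "\<lambda>n. V N n * g n"
  have h_cong: "?h n = ?h n'" if "\<And>i. i < N \<Longrightarrow> n i = n' i" for n n'
    using V_cong[of N n n'] g_cong[of n n'] that by simp
  have h_0: "?h n = 0" if "\<not> inj_on n {..<N}" for n using V_eq_0[OF that] by simp
  have "(\<Sum>\<nu>\<in>{\<nu>\<in>GT N. RN a b z z' N lam \<nu> \<noteq> 0}. RN a b z z' N lam \<nu> * g (shifted N \<nu>))
      = (\<Sum>\<nu>\<in>T. RN a b z z' N lam \<nu> * g (shifted N \<nu>))"
    using T RN_support[of N lam, folded T_def] by (intro sum.mono_neutral_left) auto
  also have "\<dots> = (\<Sum>\<nu>\<in>T. (\<Sum>k<N. if \<nu> \<in> nbr N lam k then Rm N (n k) (shifted N \<nu> k) * ?h (shifted N \<nu>) / V N n else 0)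
      - (if lam = \<nu> then c_const b z z' N * g n else 0))"
  proof (intro sum.cong refl)
    fix \<nu> assume "\<nu> \<in> T"
    then have "\<nu> \<in> GT N" using T by auto
    then show "RN a b z z' N lam \<nu> * g (shifted N \<nu>) = (\<Sum>k<N. if \<nu> \<in> nbr N lam k then Rm N (n k) (shifted N \<nu> k) * ?h (shifted N \<nu>) / V N n else 0)
      - (if lam = \<nu> then c_const b z z' N * g n else 0)"
      unfolding RN_eq[OF \<open>\<nu> \<in> GT N\<close>] left_diff_distrib sum_distrib_right
      by (intro arg_cong2[where f = "(-)"] sum.cong) (auto simp: n_def)
  qed
  also have "\<dots> = (\<Sum>k<N. \<Sum>\<nu>\<in>T. if \<nu> \<in> nbr N lam k then Rm N (n k) (shifted N \<nu> k) * ?h (shifted N \<nu>) / V N n else 0)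
      - c_const b z z' N * g n"
    using T by (simp add: sum_subtractf sum.swap[of _ T])
  also have "(\<Sum>k<N. \<Sum>\<nu>\<in>T. if \<nu> \<in> nbr N lam k then Rm N (n k) (shifted N \<nu> k) * ?h (shifted N \<nu>) / V N n else 0)
      = (\<Sum>k<N. (br N (n k) * (?h (n(k := n k + 1)) - ?h n) + dr N (n k) * (?h (n(k := n k - 1)) - ?h n)) / V N n)"
  proof (intro sum.cong refl)
    fix k assume "k \<in> {..<N}"
    then have k: "k < N" by simp
    have "(\<Sum>\<nu>\<in>T. if \<nu> \<in> nbr N lam k then Rm N (n k) (shifted N \<nu> k) * ?h (shifted N \<nu>) / V N n else 0)
        = (\<Sum>\<nu>\<in>moves N lam k. Rm N (n k) (shifted N \<nu> k) * ?h (shifted N \<nu>) / V N n)"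
      using T k by (intro sum.mono_neutral_cong_right) (auto simp: T_def moves_def n_def)
    also have "\<dots> = (br N (n k) * (?h (n(k := n k + 1)) - ?h n) + dr N (n k) * (?h (n(k := n k - 1)) - ?h n)) / V N n"
    proof -
      have "(\<Sum>\<nu>\<in>moves N lam k. Rm N (n k) (shifted N \<nu> k) * ?h (shifted N \<nu>))
         = br N (n k) * (?h (n(k := n k + 1)) - ?h n) + dr N (n k) * (?h (n(k := n k - 1)) - ?h n)"
        unfolding n_def by (rule sum_moves[OF lam k, where h = ?h]) (use h_cong h_0 in blast)+
      then show ?thesis by (simp only: sum_divide_distrib[symmetric])
    qed
    finally show "(\<Sum>\<nu>\<in>T. if \<nu> \<in> nbr N lam k then Rm N (n k) (shifted N \<nu> k) * ?h (shifted N \<nu>) / V N n else 0)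
        = (br N (n k) * (?h (n(k := n k + 1)) - ?h n) + dr N (n k) * (?h (n(k := n k - 1)) - ?h n)) / V N n" .
  qed
  also have "\<dots> = jumps N ?h n / V N n" unfolding jumps_def sum_divide_distrib[symmetric] ..
  finally show ?thesis by (simp add: n_def)
qed

lemma RN_conservative:
  assumes lam: "lam \<in> GT N"
  shows "(\<Sum>\<nu>\<in>{\<nu>\<in>GT N. RN a b z z' N lam \<nu> \<noteq> 0}. RN a b z z' N lam \<nu>) = 0"
  using RN_sum[OF lam, of "\<lambda>_. 1"] V_pos[OF strict_on_shifted[OF lam]] by (simp add: jumps_V)

section \<open>The Lyapunov function\<close>

definition lyapunov :: "nat \<Rightarrow> nat list \<Rightarrow> real" where
  "lyapunov N lam = 1 + H N (shifted N lam)"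

text \<open>The generator sends \<open>H\<close> to A H + B with A the difference of the two top
  eigenvalues and B the top subdiagonal entry; the absolute values cover every sign, and the summand
  1 keeps the rate positive.\<close>

definition lyapunov_rate :: "nat \<Rightarrow> real" where
  "lyapunov_rate N = 1 + \<bar>eigen N N - eigen N (N - 1)\<bar> + \<bar>sub_eigen N N\<bar>"

lemma lyapunov_ge_1: "lam \<in> GT N \<Longrightarrow> lyapunov N lam \<ge> 1"
  using H_nonneg[OF strict_on_shifted] by (simp add: lyapunov_def)

lemma H_cong: "(\<And>i. i < N \<Longrightarrow> n i = n' i) \<Longrightarrow> H N n = H N n'"
  by (simp add: H_def)

lemma lyapunov_generator:
  assumes lam: "lam \<in> GT N" and N: "N > 0"
  shows "(\<Sum>\<nu>\<in>{\<nu>\<in>GT N. RN a b z z' N lam \<nu> \<noteq> 0}. RN a b z z' N lam \<nu> * lyapunov N \<nu>) \<le> lyapunov_rate N * lyapunov N lam"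
proof -
  let ?h = "H N (shifted N lam)" and ?A = "eigen N N - eigen N (N - 1)" and ?B = "sub_eigen N N"
  have h: "?h \<ge> 0" by (rule H_nonneg[OF strict_on_shifted[OF lam]])
  have V: "V N (shifted N lam) > 0" by (rule V_pos[OF strict_on_shifted[OF lam]])
  have "(\<Sum>\<nu>\<in>{\<nu>\<in>GT N. RN a b z z' N lam \<nu> \<noteq> 0}. RN a b z z' N lam \<nu> * lyapunov N \<nu>) = ?A * ?h + ?B"
    unfolding lyapunov_def distrib_left sum.distrib mult_1_right RN_conservative[OF lam]
    using RN_sum[OF lam, of "H N", OF H_cong] V
    by (simp add: jumps_V_H[OF N] add_divide_distrib)
  also have "\<dots> \<le> \<bar>?A\<bar> * ?h + \<bar>?B\<bar>" using h by (intro add_mono mult_right_mono) auto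
  also have "\<dots> \<le> lyapunov_rate N * lyapunov N lam"
    using h mult_nonneg_nonneg[of "\<bar>?B\<bar>" ?h] unfolding lyapunov_rate_def lyapunov_def by (simp add: algebra_simps)
  finally show ?thesis .
qed

lemma finite_lyapunov_sublevel: "finite {lam\<in>GT N. lyapunov N lam \<le> c}"
proof (rule finite_subset)
  define m where "m = nat \<lceil>c + (\<Sum>r<N. hat a b r)\<rceil>"
  show "finite {xs. set xs \<subseteq> {..m} \<and> length xs = N}" by (rule finite_lists_length_eq) simp
  show "{lam\<in>GT N. lyapunov N lam \<le> c} \<subseteq> {xs. set xs \<subseteq> {..m} \<and> length xs = N}"
  proof
    fix lam assume "lam \<in> {lam\<in>GT N. lyapunov N lam \<le> c}"
    then have lam: "length lam = N" "lyapunov N lam \<le> c" by (auto simp: GT_def)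
    have "lam ! i \<le> m" if i: "i < N" for i
    proof -
      have "real (lam ! i) \<le> (real (shifted N lam i))\<^sup>2"
      proof -
        have "lam ! i \<le> shifted N lam i" by (simp add: shifted_def)
        also have "\<dots> \<le> (shifted N lam i)\<^sup>2" by (simp add: power2_eq_square)
        finally show ?thesis unfolding of_nat_power[symmetric] of_nat_le_iff .
      qed
      also have "\<dots> \<le> hat a b (shifted N lam i)"
        unfolding hat_def using e_nonneg by (intro power_mono) auto
      also have "\<dots> \<le> (\<Sum>i<N. hat a b (shifted N lam i))"
        using i by (intro member_le_sum) (auto simp: hat_def)
      also have "\<dots> \<le> c + (\<Sum>r<N. hat a b r)" using lam(2) by (simp add: lyapunov_def H_def)
      finally show ?thesis unfolding m_def by linarith
    qed
    then show "lam \<in> {xs. set xs \<subseteq> {..m} \<and> length xs = N}" using lam(1) by (auto simp: in_set_conv_nth)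
  qed
qed

end

section \<open>Detailed balance for the z-measures\<close>

lemma Z_shift_nonzero:
  assumes "(w, w') \<in> Z_princ \<union> Z_compl"
  shows "of_int n + w \<noteq> 0" "of_int n + w' \<noteq> 0"
proof -
  have "(of_int n + w) * (of_int n + w') \<noteq> 0"
    using pos_real_Re(1)[OF Z_shift_pos_real[OF assms, of n]] by (metis less_irrefl zero_complex.sel(1))
  then show "of_int n + w \<noteq> 0" "of_int n + w' \<noteq> 0" by auto
qed

lemma Z_Gamma_step:
  assumes "(w, w') \<in> Z_princ \<union> Z_compl"
  shows "Gamma (of_int (n + 1) + w) * Gamma (of_int (n + 1) + w')
    = ((of_int n + w) * (of_int n + w')) * (Gamma (of_int n + w) * Gamma (of_int n + w'))"
proof -
  have ni: "of_int n + v \<notin> \<int>\<^sub>\<le>\<^sub>0" if "\<And>m. of_int m + v \<noteq> 0" for v :: complex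
  proof
    assume "of_int n + v \<in> \<int>\<^sub>\<le>\<^sub>0"
    then obtain k where "of_int n + v = of_int k" by (auto elim!: nonpos_Ints_cases)
    then have "of_int (n - k) + v = 0" by (simp add: algebra_simps)
    then show False using that by blast
  qed
  have "Gamma (of_int (n + 1) + v) = (of_int n + v) * Gamma (of_int n + v)" if "\<And>m. of_int m + v \<noteq> 0" for v :: complex
    using Gamma_plus1[OF ni[OF that]] by (simp add: add_ac)
  from this[OF Z_shift_nonzero(1)[OF assms]] this[OF Z_shift_nonzero(2)[OF assms]] show ?thesis by simp
qed

text \<open>In the principal case the product is a squared modulus. In the complementary case both
  arguments are positive for large \<open>n\<close>, and the functional equation descends to smaller
  \<open>n\<close>, dividing each time by a product that \<open>Z_shift_pos_real\<close> shows
  positive.\<close>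

lemma Z_Gamma_pos:
  assumes Z: "(w, w') \<in> Z_princ \<union> Z_compl"
  shows "pos_real (Gamma (of_int n + w) * Gamma (of_int n + w'))"
proof (cases "(w, w') \<in> Z_princ")
  case True
  then have "w' = cnj w" by (auto simp: Z_princ_def)
  then have eq: "Gamma (of_int n + w') = cnj (Gamma (of_int n + w))"
    using cnj_Gamma[of "of_int n + w"] by simp
  have "Gamma (of_int n + w) \<noteq> 0"
  proof
    assume "Gamma (of_int n + w) = 0"
    then obtain k where "of_int n + w = of_int k" by (auto simp: Gamma_eq_zero_iff elim!: nonpos_Ints_cases)
    then have "of_int (n - k) + w = 0" by (simp add: algebra_simps)
    then show False using Z_shift_nonzero(1)[OF Z] by blast
  qed
  then show ?thesis unfolding eq by (rule pos_real_norm)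
next
  case False
  then obtain m :: int where m: "w \<in> \<real>" "w' \<in> \<real>" "of_int m < Re w" "of_int m < Re w'"
    using Z by (auto simp: Z_compl_def)
  have base: "pos_real (Gamma (of_int n + w) * Gamma (of_int n + w'))" if n: "n + m \<ge> 0" for n
  proof -
    have "real_of_int n + real_of_int m \<ge> 0" using n by linarith
    then have pos: "of_int n + Re w > 0" "of_int n + Re w' > 0" using m by linarith+
    have "of_int n + w = of_real (of_int n + Re w)" "of_int n + w' = of_real (of_int n + Re w')"
      using m(1,2) by (simp_all add: of_real_Re)
    then have "Gamma (of_int n + w) * Gamma (of_int n + w') = of_real (Gamma (of_int n + Re w) * Gamma (of_int n + Re w'))"
      by (simp only: Gamma_complex_of_real of_real_mult)
    then show ?thesis using Gamma_real_pos[OF pos(1)] Gamma_real_pos[OF pos(2)] unfolding pos_real_def by (metis mult_pos_pos)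
  qed
  have "pos_real (Gamma (of_int (- m - int k) + w) * Gamma (of_int (- m - int k) + w'))" for k
  proof (induction k)
    case 0 show ?case by (rule base) simp
  next
    case (Suc k)
    let ?n = "- m - int (Suc k)"
    have n: "?n + 1 = - m - int k" by simp
    have "((of_int ?n + w) * (of_int ?n + w')) \<noteq> 0" using Z_shift_nonzero[OF Z, of ?n] by (intro no_zero_divisors)
    then have "Gamma (of_int ?n + w) * Gamma (of_int ?n + w')
       = (Gamma (of_int (?n + 1) + w) * Gamma (of_int (?n + 1) + w')) / ((of_int ?n + w) * (of_int ?n + w'))"
      unfolding Z_Gamma_step[OF Z] by simp
    then show ?case using pos_real_divide[OF Suc.IH Z_shift_pos_real[OF Z, of ?n]] unfolding n by simp
  qed
  from this[of "nat (- m - n)"] show ?thesis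
    by (cases "n + m \<ge> 0") (use base in auto)
qed

section \<open>Balance of the one-dimensional weight\<close>

context z_params begin

definition G :: "nat \<Rightarrow> nat \<Rightarrow> complex" where
  "G N x = Gamma (z - of_nat x + of_nat N) * Gamma (z' - of_nat x + of_nat N) *
      Gamma (z + of_nat x + of_nat N + of_real (2 * e)) * Gamma (z' + of_nat x + of_nat N + of_real (2 * e))"

lemma G_eq:
  "G N x = (Gamma (of_int (int N - int x) + z) * Gamma (of_int (int N - int x) + z'))
    * (Gamma (of_int (int N + int x) + (z + of_real (2 * e))) * Gamma (of_int (int N + int x) + (z' + of_real (2 * e))))"
  by (simp add: G_def algebra_simps)

lemma G_pos: "pos_real (G N x)"
  unfolding G_eq by (intro pos_real_mult Z_Gamma_pos z_params)

text \<open>From x to x + 1 the first two Gamma factors lose the two factors of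
  \<open>birth_factor\<close> at x, and the last two gain those of \<open>death_factor\<close> at x
  + 1.\<close>

lemma G_step: "Re (G N x) * death_factor N (real (Suc x)) = Re (G N (Suc x)) * birth_factor N (real x)"
proof -
  let ?e = "of_real (2 * e) :: complex"
  let ?b = "(of_int (int N - int (Suc x)) + z) * (of_int (int N - int (Suc x)) + z')"
  let ?d = "(of_int (int N + int x) + (z + ?e)) * (of_int (int N + int x) + (z' + ?e))"
  have b: "birth_factor N (real x) = Re ?b" and d: "death_factor N (real (Suc x)) = Re ?d"
    unfolding birth_factor_eq death_factor_eq by (simp_all add: algebra_simps)
  have pb: "pos_real ?b" and pd: "pos_real ?d" by (intro Z_shift_pos_real z_params)+
  have 1: "int N - int (Suc x) + 1 = int N - int x" "int N + int x + 1 = int N + int (Suc x)" by auto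
  have "G N x * ?d = G N (Suc x) * ?b"
    unfolding G_eq using Z_Gamma_step[OF z_params(1), of "int N - int (Suc x)"]
      Z_Gamma_step[OF z_params(2), of "int N + int x"] unfolding 1 by (simp only: mult_ac)
  then have "complex_of_real (Re (G N x)) * of_real (Re ?d) = of_real (Re (G N (Suc x))) * of_real (Re ?b)"
    using pos_real_Re(2)[OF G_pos] pos_real_Re(2)[OF pb] pos_real_Re(2)[OF pd] by simp
  then show ?thesis unfolding b d of_real_mult[symmetric] of_real_eq_iff .
qed

definition pref :: "nat \<Rightarrow> real" where
  "pref x = (if x = 0 \<and> e = 0 then 1 / 2 else (real x + e) * Gamma (real x + 2 * e))"

abbreviation "W \<equiv> W_weight a b z z'"

lemma W_eq: "W N x = pref x * Gamma (real x + a + 1) / (Gamma (real x + b + 1) * Gamma (real x + 1) * Re (G N x))"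
  unfolding W_weight_def Let_def pref_def G_def ..

lemma arg_pos: "real x + a + 1 > 0" "real x + b + 1 > 0" "2 * real x + 2 * e + 1 > 0"
proof -
  have "real x \<ge> 0" by simp
  then show "real x + a + 1 > 0" "real x + b + 1 > 0" "2 * real x + 2 * e + 1 > 0"
    using ab e_nonneg by linarith+
qed

lemma pref_pos: "pref x > 0"
proof (cases "x = 0 \<and> e = 0")
  case False
  then have "real x + e > 0" "real x + 2 * e > 0" using e_nonneg by (cases "x = 0"; simp)+
  then show ?thesis using False Gamma_real_pos by (simp add: pref_def)
qed (simp add: pref_def)

lemma W_pos: "W N x > 0"
  unfolding W_eq using pref_pos arg_pos pos_real_Re(1)[OF G_pos] by (simp add: Gamma_real_pos)

lemma Gamma_Suc_real: "(y::real) > 0 \<Longrightarrow> Gamma (y + 1) = y * Gamma y"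
  by (intro Gamma_plus1) (auto elim!: nonpos_Ints_cases)

text \<open>The conventions at x = e = 0, namely 1/2 in the weight and 1 in the birth rate, agree
  with each other: their product is the value that the Gamma expression takes there.\<close>

lemma pref_step: "pref x * (if x = 0 \<and> e = 0 then 1 else (real x + 2 * e) / (2 * (real x + e))) = Gamma (real x + 2 * e + 1) / 2"
proof (cases "x = 0 \<and> e = 0")
  case False
  then have "real x + e > 0" "real x + 2 * e > 0" using e_nonneg by (cases "x = 0"; simp)+
  moreover have "p * g * (q / (2 * p)) = q * g / 2" if "p > 0" for p q g :: real using that by simp
  ultimately show ?thesis using False Gamma_Suc_real[of "real x + 2 * e"] by (simp only: pref_def if_False)
qed (auto simp: pref_def)

lemma W_balance: "W N x * br N x = W N (Suc x) * dr N (Suc x)"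
proof -
  define A where "A = Gamma (real x + a + 1)"
  define B where "B = Gamma (real x + b + 1)"
  define C where "C = Gamma (real x + 1)"
  define g where "g = Re (G N x)"
  define g' where "g' = Re (G N (Suc x))"
  define T where "T = Gamma (real x + 2 * e + 1)"
  define m where "m = 2 * real x + 2 * e + 1"
  define bf where "bf = birth_factor N (real x)"
  define df where "df = death_factor N (real (Suc x))"
  have gam: "Gamma (real (Suc x) + a + 1) = (real x + a + 1) * A" "Gamma (real (Suc x) + b + 1) = (real x + b + 1) * B"
    "Gamma (real (Suc x) + 1) = (real x + 1) * C"
    using Gamma_Suc_real[of "real x + a + 1"] Gamma_Suc_real[of "real x + b + 1"] Gamma_Suc_real[of "real x + 1"] arg_pos[of x]
    by (simp_all add: A_def B_def C_def add_ac)
  have pos: "A > 0" "B > 0" "C > 0" "g > 0" "g' > 0" "m > 0" "real x + b + 1 > 0" "real x + 1 + e > 0"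
    using arg_pos[of x] pos_real_Re(1)[OF G_pos] e_nonneg by (auto simp: A_def B_def C_def g_def g'_def m_def Gamma_real_pos)
  have "W N x * br N x = (T / 2) * (A / (B * C * g)) * ((real x + a + 1) * bf / m)"
    unfolding W_eq birth_rate_eq T_def pref_step[symmetric] by (simp add: A_def B_def C_def g_def bf_def m_def)
  also have "\<dots> = (T / 2) * A * (real x + a + 1) * (bf / g) / (B * C * m)" by (simp add: mult_ac)
  also have "bf / g = df / g'"
    using G_step[of N x] pos by (simp add: g_def g'_def bf_def df_def field_simps)
  also have "(T / 2) * A * (real x + a + 1) * (df / g') / (B * C * m)
     = ((real x + 1 + e) * T) * ((real x + a + 1) * A) / (((real x + b + 1) * B) * ((real x + 1) * C) * g')
        * ((real x + 1) * (real x + 1 + b) * df / (2 * (real x + 1 + e) * m))"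
    using pos by (simp add: divide_simps) (simp add: algebra_simps)
  also have "\<dots> = W N (Suc x) * dr N (Suc x)"
    unfolding W_eq death_rate_eq gam by (simp add: pref_def g'_def df_def T_def m_def algebra_simps)
  finally show ?thesis .
qed

lemma W_Rm_balance: "W N x * Rm N x y = W N y * Rm N y x"
  using W_balance[of N x] W_balance[of N y] by (auto simp: R_matrix_def)

section \<open>Balance and irreducibility on signatures\<close>

lemma nbr_sym: "\<mu> \<in> GT N \<Longrightarrow> \<nu> \<in> nbr N \<mu> k \<Longrightarrow> \<mu> \<in> nbr N \<nu> k"
  by (auto simp: nbr_def)

lemma z_weight_pos:
  assumes "lam \<in> GT N" shows "z_weight a b z z' N lam > 0"
  unfolding z_weight_def using V_pos[OF strict_on_shifted[OF assms]] W_pos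
  by (intro mult_pos_pos prod_pos) (auto simp: V_def)

text \<open>The squared Vandermonde of the weight times the Vandermonde ratio of the Doob transform
  is symmetric in the two signatures. What remains is the one-dimensional balance in the coordinate
  that moves.\<close>

lemma z_weight_balance:
  assumes \<mu>: "\<mu> \<in> GT N" and \<nu>: "\<nu> \<in> GT N"
  shows "z_weight a b z z' N \<mu> * RN a b z z' N \<mu> \<nu> = z_weight a b z z' N \<nu> * RN a b z z' N \<nu> \<mu>"
proof (cases "\<mu> = \<nu>")
  case False
  let ?m = "shifted N \<mu>" and ?n = "shifted N \<nu>"
  have V: "V N ?m > 0" "V N ?n > 0" using V_pos strict_on_shifted \<mu> \<nu> by auto
  have zw: "z_weight a b z z' N lam = (V N (shifted N lam))\<^sup>2 * (\<Prod>i<N. W N (shifted N lam i))" for lam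
    by (simp add: z_weight_def V_def)
  have "(\<Sum>k<N. z_weight a b z z' N \<mu> * (if \<nu> \<in> nbr N \<mu> k then V N ?n / V N ?m * Rm N (?m k) (?n k) else 0))
      = (\<Sum>k<N. z_weight a b z z' N \<nu> * (if \<mu> \<in> nbr N \<nu> k then V N ?m / V N ?n * Rm N (?n k) (?m k) else 0))"
  proof (intro sum.cong refl)
    fix k assume "k \<in> {..<N}"
    then have k: "k < N" by simp
    show "z_weight a b z z' N \<mu> * (if \<nu> \<in> nbr N \<mu> k then V N ?n / V N ?m * Rm N (?m k) (?n k) else 0)
      = z_weight a b z z' N \<nu> * (if \<mu> \<in> nbr N \<nu> k then V N ?m / V N ?n * Rm N (?n k) (?m k) else 0)"
    proof (cases "\<nu> \<in> nbr N \<mu> k")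
      case True
      then have T2: "\<mu> \<in> nbr N \<nu> k" using nbr_sym \<mu> by auto
      define Q where "Q = (\<Prod>i\<in>{..<N} - {k}. W N (?m i))"
      have Qn: "Q = (\<Prod>i\<in>{..<N} - {k}. W N (?n i))"
        unfolding Q_def using True by (intro prod.cong refl) (auto simp: nbr_def)
      have m: "z_weight a b z z' N \<mu> = (V N ?m)\<^sup>2 * (W N (?m k) * Q)"
        unfolding zw Q_def using k by (subst prod.remove[of _ k]) auto
      have n: "z_weight a b z z' N \<nu> = (V N ?n)\<^sup>2 * (W N (?n k) * Q)"
        unfolding zw Qn using k by (subst prod.remove[of _ k]) auto
      have "z_weight a b z z' N \<mu> * (V N ?n / V N ?m * Rm N (?m k) (?n k)) = V N ?m * V N ?n * Q * (W N (?m k) * Rm N (?m k) (?n k))"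
        unfolding m using V by (simp add: power2_eq_square)
      also have "\<dots> = z_weight a b z z' N \<nu> * (V N ?m / V N ?n * Rm N (?n k) (?m k))"
        unfolding n W_Rm_balance[of N "?m k"] using V by (simp add: power2_eq_square)
      finally show ?thesis using True T2 by simp
    next
      case False
      then have "\<mu> \<notin> nbr N \<nu> k" using nbr_sym \<nu> by auto
      then show ?thesis using False by simp
    qed
  qed
  then show ?thesis using False unfolding RN_eq[OF \<mu>] RN_eq[OF \<nu>] by (simp add: sum_distrib_left)
qed simp

lemma Rm_nonneg: "x \<noteq> y \<Longrightarrow> Rm N x y \<ge> 0"
  using birth_rate_pos[of N x] death_rate_pos[of x N] by (cases "x = 0") (auto simp: R_matrix_def)

lemma RN_pos:
  assumes "\<mu> \<in> GT N" "\<nu> \<in> nbr N \<mu> k" "k < N" "\<mu> \<noteq> \<nu>" "Rm N (shifted N \<mu> k) (shifted N \<nu> k) > 0"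
  shows "RN a b z z' N \<mu> \<nu> > 0"
proof -
  have \<nu>: "\<nu> \<in> GT N" using assms by (auto simp: nbr_def)
  have V: "V N (shifted N \<mu>) > 0" "V N (shifted N \<nu>) > 0" using V_pos strict_on_shifted assms \<nu> by auto
  let ?t = "\<lambda>k. if \<nu> \<in> nbr N \<mu> k
      then V N (shifted N \<nu>) / V N (shifted N \<mu>) * Rm N (shifted N \<mu> k) (shifted N \<nu> k) else 0"
  have nn: "?t j \<ge> 0" if "j < N" for j
  proof (cases "\<nu> \<in> nbr N \<mu> j")
    case True
    then have "shifted N \<mu> j \<noteq> shifted N \<nu> j"
      using GT_eqI[OF assms(1) \<nu>] assms(4) by (auto simp: nbr_def)
    then show ?thesis using V Rm_nonneg[of "shifted N \<mu> j" "shifted N \<nu> j" N] by auto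
  qed simp
  have "0 < ?t k" using assms V by simp
  also have "\<dots> \<le> (\<Sum>k<N. ?t k)" using nn assms(3) by (intro member_le_sum) auto
  finally show ?thesis unfolding RN_eq[OF \<nu>] using assms(4) by simp
qed

text \<open>Lowering the last positive part by one keeps the parts ordered, since all later ones are
  0. The move and its reverse have positive death and birth rates.\<close>

lemma down_move:
  assumes lam: "lam \<in> GT N" and ne: "lam \<noteq> replicate N 0"
  obtains \<nu> where "\<nu> \<in> GT N" "sum_list \<nu> < sum_list lam" "RN a b z z' N lam \<nu> > 0" "RN a b z z' N \<nu> lam > 0"
proof -
  have len: "length lam = N" and sorted: "\<And>i j. i < j \<Longrightarrow> j < N \<Longrightarrow> lam ! j \<le> lam ! i"
    using lam by (auto simp: GT_def sorted_wrt_iff_nth_less)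
  define S where "S = {i. i < N \<and> lam ! i > 0}"
  have S: "finite S" "S \<noteq> {}"
    using ne len by (auto simp: S_def list_eq_iff_nth_eq)
  define k where "k = Max S"
  have k: "k < N" "lam ! k > 0" using Max_in[OF S] by (auto simp: k_def S_def)
  have above: "lam ! j = 0" if "k < j" "j < N" for j
  proof (rule ccontr)
    assume "lam ! j \<noteq> 0"
    then have "j \<in> S" using that by (simp add: S_def)
    then show False using Max_ge[OF S(1)] that by (force simp: k_def)
  qed
  define \<nu> where "\<nu> = lam[k := lam ! k - 1]"
  have \<nu>_nth: "\<nu> ! i = (if i = k then lam ! k - 1 else lam ! i)" if "i < N" for i
    using that len by (simp add: \<nu>_def)
  have \<nu>: "\<nu> \<in> GT N"
    unfolding GT_def sorted_wrt_iff_nth_less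
  proof (intro CollectI conjI allI impI)
    show "length \<nu> = N" using len by (simp add: \<nu>_def)
    fix i j assume ij: "i < j" "j < length \<nu>"
    then have "j < N" using len by (simp add: \<nu>_def)
    then show "\<nu> ! i \<ge> \<nu> ! j" using ij sorted[of i j] above[of j] by (cases "j = k") (simp_all add: \<nu>_nth)
  qed
  have sh: "shifted N \<nu> i = shifted N lam i" if "i < N" "i \<noteq> k" for i using that by (simp add: shifted_def \<nu>_nth)
  have shk: "shifted N lam k = Suc (shifted N \<nu> k)" using k by (simp add: shifted_def \<nu>_nth)
  have nb: "\<nu> \<in> nbr N lam k" "lam \<in> nbr N \<nu> k" using sh lam \<nu> by (auto simp: nbr_def)
  have neq: "lam \<noteq> \<nu>" using shk by auto
  have 1: "RN a b z z' N lam \<nu> > 0"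
    using death_rate_pos[of "Suc (shifted N \<nu> k)" N] by (intro RN_pos[OF lam nb(1) k(1) neq]) (simp add: shk R_matrix_def)
  have 2: "RN a b z z' N \<nu> lam > 0"
    using birth_rate_pos[of N "shifted N \<nu> k"] by (intro RN_pos[OF \<nu> nb(2) k(1) neq[symmetric]]) (simp add: shk R_matrix_def)
  have "sum_list \<nu> + 1 = sum_list lam"
  proof -
    have "sum_list lam = (\<Sum>i<N. lam ! i)" "sum_list \<nu> = (\<Sum>i<N. \<nu> ! i)"
      using len by (simp_all add: sum_list_sum_nth atLeast0LessThan \<nu>_def)
    moreover have "(\<Sum>i<N. lam ! i) = lam ! k + (\<Sum>i\<in>{..<N} - {k}. lam ! i)" using k by (intro sum.remove) auto
    moreover have "(\<Sum>i<N. \<nu> ! i) = \<nu> ! k + (\<Sum>i\<in>{..<N} - {k}. \<nu> ! i)" using k by (intro sum.remove) auto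
    moreover have "(\<Sum>i\<in>{..<N} - {k}. \<nu> ! i) = (\<Sum>i\<in>{..<N} - {k}. lam ! i)" by (intro sum.cong) (auto simp: \<nu>_nth)
    ultimately show ?thesis using k by (simp add: \<nu>_nth)
  qed
  then show ?thesis using that[OF \<nu> _ 1 2] by simp
qed

text \<open>Every signature is joined in both directions to the zero signature, by induction on the
  sum of its parts.\<close>

lemma RN_irreducible:
  assumes "\<mu> \<in> GT N" "\<nu> \<in> GT N"
  shows "(\<mu>, \<nu>) \<in> {(\<mu>, \<nu>). \<mu> \<in> GT N \<and> \<nu> \<in> GT N \<and> RN a b z z' N \<mu> \<nu> > 0}\<^sup>*" (is "_ \<in> ?R\<^sup>*")
proof -
  let ?o = "replicate N (0::nat)"
  have "(lam, ?o) \<in> ?R\<^sup>* \<and> (?o, lam) \<in> ?R\<^sup>*" if "lam \<in> GT N" for lam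
    using that
  proof (induction "sum_list lam" arbitrary: lam rule: less_induct)
    case less
    show ?case
    proof (cases "lam = ?o")
      case False
      obtain \<nu> where \<nu>: "\<nu> \<in> GT N" "sum_list \<nu> < sum_list lam" "RN a b z z' N lam \<nu> > 0" "RN a b z z' N \<nu> lam > 0"
        using down_move[OF less.prems False] by blast
      then have "(lam, \<nu>) \<in> ?R" "(\<nu>, lam) \<in> ?R" using less.prems by auto
      then show ?thesis using less.hyps[OF \<nu>(2,1)]
        by (meson converse_rtrancl_into_rtrancl rtrancl_into_rtrancl)
    qed simp
  qed
  then show ?thesis using assms by (meson rtrancl_trans)
qed

text \<open>A normalizing sum of 0, the default value for a family that is not summable, would make
  every quotient 0 and the measure null, against \<open>prob\<close>.\<close>

lemma measure_z_measure:
  assumes prob: "prob_space (z_measure a b z z' N)"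
  obtains s where "s > 0" "\<And>lam. lam \<in> GT N \<Longrightarrow> measure (z_measure a b z z' N) {lam} = z_weight a b z z' N lam / s"
proof -
  define s where "s = (\<Sum>\<^sub>\<infinity>\<mu>\<in>GT N. z_weight a b z z' N \<mu>)"
  have s0: "s \<ge> 0" unfolding s_def by (intro infsum_nonneg order.strict_implies_order z_weight_pos)
  have "s \<noteq> 0"
  proof
    assume "s = 0"
    then have "z_measure a b z z' N = point_measure (GT N) (\<lambda>_. 0)" by (simp add: z_measure_def s_def)
    then have "emeasure (z_measure a b z z' N) (space (z_measure a b z z' N)) = 0"
      by (simp add: point_measure_def emeasure_density space_density)
    then show False using prob_space.emeasure_space_1[OF prob] by simp
  qed
  moreover have "measure (z_measure a b z z' N) {lam} = z_weight a b z z' N lam / s" if "lam \<in> GT N" for lam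
  proof -
    have "emeasure (z_measure a b z z' N) {lam} = ennreal (z_weight a b z z' N lam / s)"
      unfolding z_measure_def s_def using that by (subst emeasure_point_measure_finite2) auto
    then show ?thesis using s0 z_weight_pos[OF that] by (simp add: Sigma_Algebra.measure_def)
  qed
  ultimately show ?thesis using that s0 by (metis order_le_less)
qed

lemma PN_chain:
  assumes N: "N > 0" and semigroup: "markov_semigroup (count_space (GT N)) PN"
    and q: "has_q_matrix (GT N) PN (RN a b z z' N)"
    and prob: "prob_space (z_measure a b z z' N)"
  shows "reversible_q_chain (GT N) PN (RN a b z z' N) (z_measure a b z z' N) (lyapunov N) (lyapunov_rate N)"
proof -
  obtain s where s: "s > 0" "\<And>lam. lam \<in> GT N \<Longrightarrow> measure (z_measure a b z z' N) {lam} = z_weight a b z z' N lam / s"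
    using measure_z_measure[OF prob] by blast
  show ?thesis
  proof unfold_locales
    show "z_measure a b z z' N \<in> space (prob_algebra (count_space (GT N)))"
      using prob by (simp add: space_prob_algebra z_measure_def sets_point_measure)
    show "measure (z_measure a b z z' N) {x} * RN a b z z' N x y = measure (z_measure a b z z' N) {y} * RN a b z z' N y x"
      if "x \<in> GT N" "y \<in> GT N" for x y
      using z_weight_balance[OF that] by (simp add: s(2)[OF that(1)] s(2)[OF that(2)])
    show "measure (z_measure a b z z' N) {x} > 0" if "x \<in> GT N" for x
      using s z_weight_pos that by simp
  qed (use countable_GT semigroup q finite_RN RN_conservative RN_irreducible lyapunov_ge_1 lyapunov_generator[OF _ N]
        finite_lyapunov_sublevel in \<open>auto simp: lyapunov_rate_def\<close>)
qed

end

section \<open>Polynomial approximation and power series\<close>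

lemma weierstrass_poly:
  fixes f :: "real \<Rightarrow> real"
  assumes "continuous_on {c..d} f" "e > 0"
  obtains p where "\<And>x. x \<in> {c..d} \<Longrightarrow> \<bar>f x - poly p x\<bar> < e"
proof -
  obtain g where g: "real_polynomial_function g" "\<And>x. x \<in> {c..d} \<Longrightarrow> \<bar>f x - g x\<bar> < e"
    using Stone_Weierstrass_real_polynomial_function[OF compact_Icc assms] by blast
  then obtain a n where "g = (\<lambda>x. \<Sum>i\<le>n. a i * x ^ i)"
    unfolding real_polynomial_function_iff_sum by blast
  then have "g x = poly (\<Sum>i\<le>n. Polynomial.monom (a i) i) x" for x
    by (simp add: poly_sum poly_monom)
  then show ?thesis using that[of "\<Sum>i\<le>n. Polynomial.monom (a i) i"] g(2) by metis
qed

text \<open>For functionals continuous under bounded pointwise convergence: \<open>f\<close> is a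
  pointwise limit of continuous functions bounded by \<open>K\<close>, and polynomials within 1/(n +
  1) of the n-th of them are bounded by \<open>K + 1\<close> with the same limit.\<close>

lemma poly_functional_eq:
  fixes L L' :: "(real \<Rightarrow> real) \<Rightarrow> real" and f :: "real \<Rightarrow> real"
  assumes eq: "\<And>p. L (poly p) = L' (poly p)"
    and L: "\<And>q. (\<And>n x. x \<in> {c..d} \<Longrightarrow> \<bar>poly (q n) x\<bar> \<le> K + 1) \<Longrightarrow>
        (\<And>x. x \<in> {c..d} \<Longrightarrow> (\<lambda>n. poly (q n) x) \<longlonglongrightarrow> f x) \<Longrightarrow> (\<lambda>n. L (poly (q n))) \<longlonglongrightarrow> L f"
    and L': "\<And>q. (\<And>n x. x \<in> {c..d} \<Longrightarrow> \<bar>poly (q n) x\<bar> \<le> K + 1) \<Longrightarrow>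
        (\<And>x. x \<in> {c..d} \<Longrightarrow> (\<lambda>n. poly (q n) x) \<longlonglongrightarrow> f x) \<Longrightarrow> (\<lambda>n. L' (poly (q n))) \<longlonglongrightarrow> L' f"
    and g: "\<And>n. continuous_on {c..d} (g n)" "\<And>n x. x \<in> {c..d} \<Longrightarrow> \<bar>g n x\<bar> \<le> K"
      "\<And>x. x \<in> {c..d} \<Longrightarrow> (\<lambda>n. g n x) \<longlonglongrightarrow> f x"
  shows "L f = L' f"
proof -
  have "\<exists>p. \<forall>x\<in>{c..d}. \<bar>g n x - poly p x\<bar> < 1 / real (Suc n)" for n
    using weierstrass_poly[OF g(1), of "1 / real (Suc n)" n] by (metis of_nat_0_less_iff zero_less_Suc zero_less_divide_1_iff)
  then obtain q where q: "\<And>n x. x \<in> {c..d} \<Longrightarrow> \<bar>g n x - poly (q n) x\<bar> < 1 / real (Suc n)" by metis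
  have bound: "\<bar>poly (q n) x\<bar> \<le> K + 1" if "x \<in> {c..d}" for n x
  proof -
    have "1 / real (Suc n) \<le> 1" by simp
    then show ?thesis using q[OF that, of n] g(2)[OF that, of n] by linarith
  qed
  have lim: "(\<lambda>n. poly (q n) x) \<longlonglongrightarrow> f x" if "x \<in> {c..d}" for x
  proof -
    have "(\<lambda>n. g n x - poly (q n) x) \<longlonglongrightarrow> 0"
      using q[OF that] by (intro Lim_null_comparison[OF _ LIMSEQ_inverse_real_of_nat])
        (auto simp: inverse_eq_divide intro!: always_eventually less_imp_le)
    from tendsto_diff[OF g(3)[OF that] this] show ?thesis by simp
  qed
  have "(\<lambda>n. L (poly (q n))) \<longlonglongrightarrow> L f" "(\<lambda>n. L (poly (q n))) \<longlonglongrightarrow> L' f"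
    using L[of q] L'[of q] bound lim eq by auto
  then show ?thesis by (rule LIMSEQ_unique)
qed

lemma powser_zero_along_sequence:
  fixes a :: "nat \<Rightarrow> real"
  assumes r: "\<And>j. r j > 0" "r \<longlonglongrightarrow> 0" and zero: "\<And>j. (\<lambda>k. a k * r j ^ k) sums 0"
  shows "a k = 0"
proof (rule ccontr)
  assume ak: "a k \<noteq> 0"
  define f where "f s = (\<Sum>n. a n * s ^ n)" for s
  have sm: "(\<lambda>n. a n * s ^ n) sums f s" if "\<bar>s\<bar> < r 0" for s
  proof -
    have "summable (\<lambda>n. a n * r 0 ^ n)" using zero[of 0] by (auto simp: sums_iff)
    moreover have "norm s < norm (r 0)" using that by simp
    ultimately have "summable (\<lambda>n. a n * s ^ n)" by (rule powser_inside)
    then show ?thesis unfolding f_def by (rule summable_sums)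
  qed
  \<comment> \<open>Multiplication by \<open>s\<close> gives a function that vanishes at the centre
    0, as the theorem on isolated zeros demands; its coefficients are those of \<open>a\<close>
    shifted by one.\<close>
  define b where "b n = (case n of 0 \<Rightarrow> 0 | Suc m \<Rightarrow> a m)" for n
  have b: "(\<lambda>n. b n * (s - 0) ^ n) sums (s * f s)" if "norm (s - 0) < r 0" for s
  proof -
    have "(\<lambda>n. b (Suc n) * s ^ Suc n) sums (s * f s)"
      using sums_mult[OF sm[of s], of s] that by (simp add: b_def mult_ac)
    then show ?thesis using sums_Suc[of "\<lambda>n. b n * s ^ n"] by (simp add: b_def)
  qed
  have bk: "b (Suc k) \<noteq> 0" using ak by (simp add: b_def)
  show False
  proof (rule powser_0_nonzero[of "r 0" 0 b "\<lambda>s. s * f s" "Suc k"])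
    show "(\<lambda>n. b n * (s - 0) ^ n) sums (s * f s)" if "norm (s - 0) < r 0" for s by (rule b[OF that])
    fix s :: real assume s: "0 < s" "\<And>x. x \<in> cball 0 s - {0} \<Longrightarrow> x * f x \<noteq> 0"
    obtain j where j: "r j < s"
      using order_tendstoD(2)[OF r(2) s(1)] by (auto simp: eventually_sequentially)
    have "f (r j) = 0" using zero[of j] by (auto simp: f_def sums_iff)
    moreover have "r j * f (r j) \<noteq> 0" using r(1)[of j] j by (intro s(2)) auto
    ultimately show False by simp
  qed (use r(1)[of 0] bk in simp_all)
qed

lemma summable_power_Suc:
  fixes c :: "nat \<Rightarrow> real"
  assumes c: "summable (\<lambda>i. \<bar>c i\<bar>)"
  shows "summable (\<lambda>i. c i ^ Suc k)"
proof -
  have "c \<longlonglongrightarrow> 0" using summable_LIMSEQ_zero[OF summable_rabs_cancel[OF c]] .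
  then have "eventually (\<lambda>i. \<bar>c i\<bar> \<le> 1) sequentially"
    using order_tendstoD(2)[OF tendsto_rabs_zero, of c sequentially 1] by (auto elim: eventually_mono)
  then have "eventually (\<lambda>i. norm (c i ^ Suc k) \<le> \<bar>c i\<bar>) sequentially"
  proof eventually_elim
    case (elim i)
    have "\<bar>c i\<bar> * \<bar>c i\<bar> ^ k \<le> \<bar>c i\<bar> * 1" using elim by (intro mult_left_mono power_le_one) auto
    then show ?case by (simp add: norm_power abs_mult power_abs)
  qed
  then show ?thesis using c by (rule summable_comparison_test_ev)
qed

text \<open>The level sum is t^2 times the multiplicity of the value t. At the first index where the
  sequences differ, let t be the larger of the two values: from there on the other sequence stays
  below t, so it takes the value t less often.\<close>

lemma decseq_eq_of_level_sums:
  fixes u v :: "nat \<Rightarrow> real"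
  assumes u: "decseq u" "\<And>i. u i \<ge> 0" and v: "decseq v" "\<And>i. v i \<ge> 0"
    and su: "summable u" and sv: "summable v"
    and eq: "\<And>t. t > 0 \<Longrightarrow> (\<Sum>i. (u i)\<^sup>2 * of_bool (u i = t)) = (\<Sum>i. (v i)\<^sup>2 * of_bool (v i = t))"
  shows "u = v"
proof (rule ccontr)
  assume ne: "u \<noteq> v"
  \<comment> \<open>Stated for arbitrary sequences, since it is applied in both orders.\<close>
  have contra: False if d: "decseq v" "\<And>i. u i \<ge> 0" "\<And>i. v i \<ge> 0" "summable u" "summable v"
    and lt: "v n < u n" and same: "\<And>i. i < n \<Longrightarrow> u i = v i"
    and eq: "\<And>t. t > 0 \<Longrightarrow> (\<Sum>i. (u i)\<^sup>2 * of_bool (u i = t)) = (\<Sum>i. (v i)\<^sup>2 * of_bool (v i = t))"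
    for u v :: "nat \<Rightarrow> real" and n
  proof -
    define t where "t = u n"
    have t: "t > 0" using lt d(3)[of n] by (simp add: t_def)
    let ?U = "\<lambda>i. (u i)\<^sup>2 * of_bool (u i = t)" and ?V = "\<lambda>i. (v i)\<^sup>2 * of_bool (v i = t)"
    have sm: "summable (\<lambda>i. (w i)\<^sup>2 * of_bool (w i = t))" if "summable w" "\<And>i. w i \<ge> 0" for w :: "nat \<Rightarrow> real"
      using that(2) t by (intro summable_comparison_test'[OF summable_mult[OF that(1), of t], of 0])
        (auto simp: power2_eq_square)
    have "(\<Sum>i. ?U i) = (\<Sum>i. ?U (i + n)) + (\<Sum>i<n. ?U i)" "(\<Sum>i. ?V i) = (\<Sum>i. ?V (i + n)) + (\<Sum>i<n. ?V i)"
      by (intro suminf_split_initial_segment sm d)+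
    moreover have "(\<Sum>i<n. ?U i) = (\<Sum>i<n. ?V i)" using same by (intro sum.cong) auto
    moreover have "?V (i + n) = 0" for i
      using decseqD[OF d(1), of n "i + n"] lt by (auto simp: t_def)
    moreover have "0 < (\<Sum>i. ?U (i + n))"
      using summable_ignore_initial_segment[OF sm[OF d(4,2)], of n] t by (intro suminf_pos2[of _ 0]) (auto simp: t_def)
    ultimately show False using eq[OF t] by simp
  qed
  obtain m where "u m \<noteq> v m" using ne by auto
  then have n: "u (LEAST n. u n \<noteq> v n) \<noteq> v (LEAST n. u n \<noteq> v n)" by (rule LeastI)
  have same: "u i = v i" if "i < (LEAST n. u n \<noteq> v n)" for i using not_less_Least[OF that] by simp
  show False
  proof (cases "v (LEAST n. u n \<noteq> v n) < u (LEAST n. u n \<noteq> v n)")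
    case True
    show False by (rule contra[OF v(1) u(2) v(2) su sv True same eq])
  next
    case False
    then have "u (LEAST n. u n \<noteq> v n) < v (LEAST n. u n \<noteq> v n)" using n by simp
    from contra[OF u(1) v(2) u(2) sv su this same[symmetric] eq[symmetric]] show False .
  qed
qed

text \<open>Tannery's theorem exchanges the sum over \<open>i\<close> with the power series: the
  k-th term, summed over \<open>i < n\<close>, is at most A |s| / 2^k for every n, because all |c_i
  s| are at most 1/2.\<close>

lemma log_series_exchange:
  fixes c :: "nat \<Rightarrow> real"
  assumes c: "summable (\<lambda>i. \<bar>c i\<bar>)" and s: "\<And>i. \<bar>c i * s\<bar> \<le> 1 / 2"
  shows "summable (\<lambda>i. ln (1 - c i * s))"
    and "(\<lambda>k. (\<Sum>i. c i ^ Suc k) * s ^ Suc k / real (Suc k)) sums (- (\<Sum>i. ln (1 - c i * s)))"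
proof -
  define A where "A = (\<Sum>i. \<bar>c i\<bar>)"
  have ln_series: "(\<lambda>k. - ((c i * s) ^ Suc k / real (Suc k))) sums ln (1 - c i * s)" for i
  proof -
    have "\<bar>- (c i * s)\<bar> < 1" using s[of i] by linarith
    from ln_series'[OF this] show ?thesis
      by (subst sums_Suc_iff[of "\<lambda>n. - ((c i * s) ^ n / real n)"]) simp
  qed
  show sm: "summable (\<lambda>i. ln (1 - c i * s))"
  proof (rule summable_comparison_test'[OF summable_mult[OF c, of "2 * \<bar>s\<bar>"], of 0])
    fix i :: nat
    define y where "y = - (c i * s)"
    have y: "\<bar>y\<bar> \<le> 1 / 2" using s[of i] by (simp add: y_def)
    have "y\<^sup>2 = \<bar>y\<bar> * \<bar>y\<bar>" by (simp add: power2_eq_square)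
    also have "\<dots> \<le> \<bar>y\<bar> * (1 / 2)" using y by (intro mult_left_mono) auto
    finally have "\<bar>ln (1 + y)\<bar> \<le> 2 * \<bar>y\<bar>" using abs_ln_one_plus_x_minus_x_bound[OF y] by linarith
    then show "norm (ln (1 - c i * s)) \<le> 2 * \<bar>s\<bar> * \<bar>c i\<bar>" by (simp add: abs_mult mult_ac y_def)
  qed
  define F where "F k n = (\<Sum>i<n. c i ^ Suc k) * s ^ Suc k / real (Suc k)" for k n
  define b where "b k = (\<Sum>i. c i ^ Suc k) * s ^ Suc k / real (Suc k)" for k
  note pw = summable_power_Suc[OF c]
  have F_eq: "F k n = (\<Sum>i<n. (c i * s) ^ Suc k) / real (Suc k)" for k n
    unfolding F_def by (simp only: sum_distrib_right power_mult_distrib)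
  have F_bound: "norm (F k n) \<le> A * \<bar>s\<bar> * (1 / 2) ^ k" for k n
  proof -
    have "norm (F k n) = \<bar>\<Sum>i<n. (c i * s) ^ Suc k\<bar> / real (Suc k)"
      unfolding F_eq by (simp only: abs_divide real_norm_def abs_of_nat)
    also have "\<dots> \<le> \<bar>\<Sum>i<n. (c i * s) ^ Suc k\<bar>"
    proof -
      have "y / real (Suc k) \<le> y" if "y \<ge> 0" for y :: real using that by (simp add: field_simps)
      then show ?thesis by simp
    qed
    also have "\<dots> \<le> (\<Sum>i<n. \<bar>(c i * s) ^ Suc k\<bar>)" by (rule sum_abs)
    also have "\<dots> \<le> (\<Sum>i<n. \<bar>c i\<bar> * (\<bar>s\<bar> * (1 / 2) ^ k))"
    proof (rule sum_mono)
      fix i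
      have "\<bar>c i * s\<bar> * \<bar>c i * s\<bar> ^ k \<le> \<bar>c i * s\<bar> * (1 / 2) ^ k"
        using s[of i] by (intro mult_left_mono power_mono) auto
      then show "\<bar>(c i * s) ^ Suc k\<bar> \<le> \<bar>c i\<bar> * (\<bar>s\<bar> * (1 / 2) ^ k)" by (simp add: abs_mult power_abs)
    qed
    also have "\<dots> \<le> A * (\<bar>s\<bar> * (1 / 2) ^ k)"
      unfolding sum_distrib_right[symmetric] A_def by (intro mult_right_mono sum_le_suminf c) auto
    finally show ?thesis by simp
  qed
  have F_sums: "(\<lambda>k. F k n) sums (- (\<Sum>i<n. ln (1 - c i * s)))" for n
  proof -
    have "(\<lambda>k. - (\<Sum>i<n. - ((c i * s) ^ Suc k / real (Suc k)))) sums (- (\<Sum>i<n. ln (1 - c i * s)))"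
      by (intro sums_minus sums_sum ln_series)
    then show ?thesis by (simp only: F_eq sum_negf minus_minus sum_divide_distrib)
  qed
  have T: "summable (\<lambda>k. norm (b k))" "(\<lambda>n. \<Sum>k. F k n) \<longlonglongrightarrow> suminf b"
  proof -
    have "eventually (\<lambda>n. summable (\<lambda>k. norm (F k n))) sequentially \<and> summable (\<lambda>n. norm (b n)) \<and>
        (\<lambda>n. \<Sum>k. F k n) \<longlonglongrightarrow> suminf b"
    proof (rule tannerys_theorem)
      show "(\<lambda>n. F k n) \<longlonglongrightarrow> b k" for k
        unfolding F_def b_def by (intro tendsto_intros summable_LIMSEQ pw) simp
      show "eventually (\<lambda>(k, n). norm (F k n) \<le> A * \<bar>s\<bar> * (1 / 2) ^ k) (sequentially \<times>\<^sub>F sequentially)"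
        using F_bound by (auto intro: always_eventually)
      show "summable (\<lambda>k. A * \<bar>s\<bar> * (1 / 2) ^ k)" by (intro summable_mult summable_geometric) simp
    qed simp
    then show "summable (\<lambda>k. norm (b k))" "(\<lambda>n. \<Sum>k. F k n) \<longlonglongrightarrow> suminf b" by auto
  qed
  have "(\<lambda>n. \<Sum>k. F k n) \<longlonglongrightarrow> - (\<Sum>i. ln (1 - c i * s))"
    using summable_LIMSEQ[OF sm] F_sums by (simp add: sums_iff tendsto_minus)
  then have "suminf b = - (\<Sum>i. ln (1 - c i * s))" using LIMSEQ_unique T(2) by blast
  then show "(\<lambda>k. (\<Sum>i. c i ^ Suc k) * s ^ Suc k / real (Suc k)) sums (- (\<Sum>i. ln (1 - c i * s)))"
    using summable_sums[OF summable_norm_cancel[OF T(1)]] unfolding b_def by simp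
qed

section \<open>The functions \<open>Psi\<close>\<close>

definition psi_factor :: "real \<Rightarrow> real \<Rightarrow> real \<Rightarrow> real" where
  "psi_factor \<alpha> \<beta> x = (1 + \<beta> * (2 - \<beta>) * (x - 1) / 2) / (1 - \<alpha> * (2 + \<alpha>) * (x - 1) / 2)"

lemma Psi_eq: "Psi (\<alpha>, \<beta>, \<delta>) x = exp ((\<delta> - (\<Sum>i. \<alpha> i + \<beta> i)) * (x - 1)) * (\<Prod>i. psi_factor (\<alpha> i) (\<beta> i) x)"
  by (simp add: Psi_def psi_factor_def)

lemma OmegaD:
  assumes "(\<alpha>, \<beta>, \<delta>) \<in> Omega"
  shows "\<And>i. 0 \<le> \<alpha> i" "\<And>i. 0 \<le> \<beta> i" "\<And>i. \<beta> i \<le> 1" "decseq \<alpha>" "decseq \<beta>"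
    "summable (\<lambda>i. \<alpha> i + \<beta> i)" "(\<Sum>i. \<alpha> i + \<beta> i) \<le> \<delta>" "summable \<alpha>" "summable \<beta>" "0 \<le> \<delta>"
proof -
  show 1: "\<And>i. 0 \<le> \<alpha> i" "\<And>i. 0 \<le> \<beta> i" "\<And>i. \<beta> i \<le> 1" "decseq \<alpha>" "decseq \<beta>"
    and s: "summable (\<lambda>i. \<alpha> i + \<beta> i)" and le: "(\<Sum>i. \<alpha> i + \<beta> i) \<le> \<delta>"
    using assms by (auto simp: Omega_def decseq_Suc_iff)
  show "summable \<alpha>" by (rule summable_comparison_test'[OF s, of 0]) (use 1 in auto)
  show "summable \<beta>" by (rule summable_comparison_test'[OF s, of 0]) (use 1 in auto)
  show "0 \<le> \<delta>" using suminf_nonneg[OF s] 1 le by (meson add_nonneg_nonneg order_trans)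
qed

text \<open>For a decreasing sequence, i + 1 times the i-th term is at most the total sum. The
  resulting decay is uniform for \<delta> bounded and later supplies a summable majorant of order
  1/i^2.\<close>

lemma Omega_decay:
  assumes "(\<alpha>, \<beta>, \<delta>) \<in> Omega"
  shows "\<alpha> i \<le> \<delta> / real (Suc i)" "\<beta> i \<le> \<delta> / real (Suc i)"
proof -
  note O = OmegaD[OF assms]
  have "real (Suc i) * (\<alpha> i + \<beta> i) = (\<Sum>j<Suc i. \<alpha> i + \<beta> i)" by simp
  also have "\<dots> \<le> (\<Sum>j<Suc i. \<alpha> j + \<beta> j)"
    by (intro sum_mono add_mono decseqD[OF O(4)] decseqD[OF O(5)]) auto
  also have "\<dots> \<le> (\<Sum>j. \<alpha> j + \<beta> j)"
    using O(1,2) by (intro sum_le_suminf O(6)) auto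
  also have "\<dots> \<le> \<delta>" by (rule O(7))
  finally have *: "real (Suc i) * (\<alpha> i + \<beta> i) \<le> \<delta>" .
  have "real (Suc i) * \<alpha> i \<le> real (Suc i) * (\<alpha> i + \<beta> i)" "real (Suc i) * \<beta> i \<le> real (Suc i) * (\<alpha> i + \<beta> i)"
    using O(1)[of i] O(2)[of i] by (intro mult_left_mono; simp)+
  then have "real (Suc i) * \<alpha> i \<le> \<delta>" "real (Suc i) * \<beta> i \<le> \<delta>" using * by linarith+
  then show "\<alpha> i \<le> \<delta> / real (Suc i)" "\<beta> i \<le> \<delta> / real (Suc i)" by (simp_all add: field_simps)
qed

lemma psi_factor_bounds:
  assumes "0 \<le> \<alpha>" "0 \<le> \<beta>" "\<beta> \<le> 1" "x \<in> {-1..1}"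
  shows "0 \<le> psi_factor \<alpha> \<beta> x" "psi_factor \<alpha> \<beta> x \<le> 1" "1 - \<alpha> * (2 + \<alpha>) * (x - 1) / 2 \<ge> 1"
    "\<bar>psi_factor \<alpha> \<beta> x - 1\<bar> \<le> \<alpha> * (2 + \<alpha>) + 2 * \<beta>"
proof -
  define s where "s = (1 - x) / 2"
  have s: "0 \<le> s" "s \<le> 1" using assms by (auto simp: s_def)
  define A where "A = \<alpha> * (2 + \<alpha>)"
  define B where "B = \<beta> * (2 - \<beta>)"
  have A: "A \<ge> 0" using assms by (simp add: A_def)
  have "B = 1 - (1 - \<beta>)\<^sup>2" by (simp add: B_def power2_eq_square algebra_simps)
  then have B: "B \<le> 1" by simp
  have B0: "0 \<le> B" using assms by (simp add: B_def)
  have B2: "B \<le> 2 * \<beta>" using assms by (simp add: B_def algebra_simps)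
  have f: "psi_factor \<alpha> \<beta> x = (1 - B * s) / (1 + A * s)" and d: "1 - \<alpha> * (2 + \<alpha>) * (x - 1) / 2 = 1 + A * s"
    by (simp_all add: psi_factor_def A_def B_def s_def field_simps)
  have As: "A * s \<ge> 0" using A s by simp
  have Bs: "0 \<le> B * s" "B * s \<le> 1" using B B0 s by (auto intro: mult_le_one)
  show "1 - \<alpha> * (2 + \<alpha>) * (x - 1) / 2 \<ge> 1" unfolding d using As by simp
  show nn: "0 \<le> psi_factor \<alpha> \<beta> x" unfolding f using As Bs by simp
  show le: "psi_factor \<alpha> \<beta> x \<le> 1" unfolding f using As Bs by (simp add: divide_le_eq)
  have "1 - psi_factor \<alpha> \<beta> x = (A * s + B * s) / (1 + A * s)" unfolding f using As by (simp add: field_simps)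
  also have "\<dots> \<le> A * s + B * s" using As Bs mult_nonneg_nonneg[OF As As] mult_nonneg_nonneg[OF As Bs(1)]
    by (simp add: divide_le_eq algebra_simps)
  also have "\<dots> \<le> A + B" using A B0 s by (intro add_mono) (auto intro: mult_right_le_one_le)
  finally show "\<bar>psi_factor \<alpha> \<beta> x - 1\<bar> \<le> \<alpha> * (2 + \<alpha>) + 2 * \<beta>" using le B2 by (simp add: A_def)
qed

lemma summable_psi_bound:
  assumes "(\<alpha>, \<beta>, \<delta>) \<in> Omega"
  shows "summable (\<lambda>i. \<alpha> i * (2 + \<alpha> i) + 2 * \<beta> i)"
proof -
  note O = OmegaD[OF assms]
  have "\<alpha> i * (2 + \<alpha> i) \<le> (2 + \<alpha> 0) * \<alpha> i" for i
    using O(1)[of i] decseqD[OF O(4), of 0 i] by (subst mult.commute[of "2 + \<alpha> 0"]) (intro mult_left_mono, auto)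
  then have "summable (\<lambda>i. \<alpha> i * (2 + \<alpha> i))"
    using O(1) by (intro summable_comparison_test'[OF summable_mult[OF O(8), of "2 + \<alpha> 0"], of 0]) auto
  then show ?thesis using O(9) by (intro summable_add summable_mult)
qed

lemma psi_prod_tendsto:
  assumes "(\<alpha>, \<beta>, \<delta>) \<in> Omega" "x \<in> {-1..1}"
  shows "(\<lambda>n. \<Prod>i<n. psi_factor (\<alpha> i) (\<beta> i) x) \<longlonglongrightarrow> (\<Prod>i. psi_factor (\<alpha> i) (\<beta> i) x)"
proof -
  note O = OmegaD[OF assms(1)]
  have "summable (\<lambda>i. norm (psi_factor (\<alpha> i) (\<beta> i) x - 1))"
    using psi_factor_bounds(4)[OF O(1,2,3) assms(2)]
    by (intro summable_comparison_test'[OF summable_psi_bound[OF assms(1)], of 0]) auto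
  then have "convergent_prod (\<lambda>i. psi_factor (\<alpha> i) (\<beta> i) x)"
    by (intro abs_convergent_prod_imp_convergent_prod summable_imp_abs_convergent_prod)
  from convergent_prod_LIMSEQ[OF this] show ?thesis by (simp add: LIMSEQ_lessThan_iff_atMost)
qed

lemma Psi_bounds:
  assumes "\<omega> \<in> Omega" "x \<in> {-1..1}"
  shows "0 \<le> Psi \<omega> x" "Psi \<omega> x \<le> 1"
proof -
  obtain \<alpha> \<beta> \<delta> where \<omega>: "\<omega> = (\<alpha>, \<beta>, \<delta>)" by (cases \<omega>)
  note O = OmegaD[OF assms(1)[unfolded \<omega>]]
  note b = psi_factor_bounds(1,2)[OF O(1,2,3) assms(2)]
  note lim = psi_prod_tendsto[OF assms(1)[unfolded \<omega>] assms(2)]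
  have p0: "0 \<le> (\<Prod>i. psi_factor (\<alpha> i) (\<beta> i) x)"
    using lim b by (intro LIMSEQ_le_const[OF lim]) (auto intro!: exI[of _ 0] prod_nonneg)
  have p1: "(\<Prod>i. psi_factor (\<alpha> i) (\<beta> i) x) \<le> 1"
    using lim b by (intro LIMSEQ_le_const2[OF lim]) (auto intro!: exI[of _ 0] prod_le_1)
  have "(\<delta> - (\<Sum>i. \<alpha> i + \<beta> i)) * (x - 1) \<le> 0" using O(7) assms(2) by (intro mult_nonneg_nonpos) auto
  then have "exp ((\<delta> - (\<Sum>i. \<alpha> i + \<beta> i)) * (x - 1)) \<le> 1" by simp
  then show "0 \<le> Psi \<omega> x" "Psi \<omega> x \<le> 1" unfolding \<omega> Psi_eq using p0 p1 by (auto intro: mult_le_one)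
qed

lemma Psi_1: "Psi \<omega> 1 = 1"
  by (cases \<omega>) (simp add: Psi_eq psi_factor_def)

lemma psi_factor_continuous:
  assumes "0 \<le> \<alpha>" "0 \<le> \<beta>" "\<beta> \<le> 1"
  shows "continuous_on {-1..1} (psi_factor \<alpha> \<beta>)"
proof -
  have "1 - \<alpha> * (2 + \<alpha>) * (x - 1) / 2 \<noteq> 0" if "x \<in> {-1..1}" for x
    using psi_factor_bounds(3)[OF assms that] by linarith
  then show ?thesis unfolding psi_factor_def by (intro continuous_intros) auto
qed

lemma Psi_continuous:
  assumes "\<omega> \<in> Omega" shows "continuous_on {-1..1} (Psi \<omega>)"
proof -
  obtain \<alpha> \<beta> \<delta> where \<omega>: "\<omega> = (\<alpha>, \<beta>, \<delta>)" by (cases \<omega>)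
  note O = OmegaD[OF assms(1)[unfolded \<omega>]]
  let ?f = "\<lambda>i x. psi_factor (\<alpha> i) (\<beta> i) x"
  have c: "continuous_on {-1..1} (?f i)" for i using psi_factor_continuous[OF O(1,2,3)] .
  have "uniformly_convergent_on {-1..1} (\<lambda>N x. \<Prod>n<N. ?f n x)"
  proof (rule uniformly_convergent_on_prod'[OF c compact_Icc])
    show "uniformly_convergent_on {-1..1} (\<lambda>N x. \<Sum>n<N. norm (?f n x - 1))"
      using psi_factor_bounds(4)[OF O(1,2,3)]
      by (intro Weierstrass_m_test'[OF _ summable_psi_bound[OF assms(1)[unfolded \<omega>]]]) auto
  qed
  then obtain l where l: "uniform_limit {-1..1} (\<lambda>N x. \<Prod>n<N. ?f n x) l sequentially"
    by (auto simp: uniformly_convergent_on_def)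
  have "continuous_on {-1..1} l"
    by (rule uniform_limit_theorem[OF _ l]) (auto intro!: always_eventually continuous_on_prod c)
  moreover have "l x = (\<Prod>i. ?f i x)" if "x \<in> {-1..1}" for x
    using LIMSEQ_unique[OF tendsto_uniform_limitI[OF l that] psi_prod_tendsto[OF assms(1)[unfolded \<omega>] that]] .
  ultimately have "continuous_on {-1..1} (\<lambda>x. \<Prod>i. ?f i x)"
    using continuous_on_cong[OF refl, of "{-1..1}" l "\<lambda>x. \<Prod>i. ?f i x"] by blast
  then show ?thesis unfolding \<omega> Psi_eq by (intro continuous_intros)
qed

section \<open>Measurability and the logarithm of \<open>Psi\<close>\<close>

lemma omega_components_measurable [measurable]:
  "(\<lambda>\<omega>::omega. fst \<omega> i) \<in> borel_measurable borel" "(\<lambda>\<omega>::omega. fst (snd \<omega>) i) \<in> borel_measurable borel"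
  "(\<lambda>\<omega>::omega. snd (snd \<omega>)) \<in> borel_measurable borel"
proof -
  have "continuous_on UNIV (\<lambda>\<omega>::omega. fst \<omega>)" "continuous_on UNIV (\<lambda>\<omega>::omega. fst (snd \<omega>))"
    "continuous_on UNIV (\<lambda>\<omega>::omega. snd (snd \<omega>))"
    by (intro continuous_intros)+
  then show "(\<lambda>\<omega>::omega. fst \<omega> i) \<in> borel_measurable borel" "(\<lambda>\<omega>::omega. fst (snd \<omega>) i) \<in> borel_measurable borel"
    "(\<lambda>\<omega>::omega. snd (snd \<omega>)) \<in> borel_measurable borel"
    by (blast intro: borel_measurable_continuous_onI dest: continuous_on_product_then_coordinatewise)+
qed

lemma Psi_measurable_pair:
  "(\<lambda>(\<omega>, x). Psi \<omega> x) \<in> borel_measurable (Omega_borel \<Otimes>\<^sub>M restrict_space borel {-1..1})"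
proof -
  let ?M = "Omega_borel \<Otimes>\<^sub>M restrict_space borel {-1..1::real}"
  have [measurable]: "fst \<in> ?M \<rightarrow>\<^sub>M borel" "snd \<in> ?M \<rightarrow>\<^sub>M borel"
    by (auto simp: Omega_borel_def intro: measurable_compose[OF measurable_fst measurable_restrict_space1[OF measurable_id, unfolded id_def]]
          measurable_compose[OF measurable_snd measurable_restrict_space1[OF measurable_id, unfolded id_def]])
  define u where "u n p = exp ((snd (snd (fst p)) - (\<Sum>i. fst (fst p) i + fst (snd (fst p)) i)) * (snd p - 1))
      * (\<Prod>i<n. psi_factor (fst (fst p) i) (fst (snd (fst p)) i) (snd p))" for n and p :: "omega \<times> real"
  show ?thesis
  proof (rule borel_measurable_LIMSEQ_real)
    show "u n \<in> borel_measurable ?M" for n unfolding u_def psi_factor_def by measurable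
    fix p assume "p \<in> space ?M"
    then obtain \<alpha> \<beta> \<delta> x where p: "p = ((\<alpha>, \<beta>, \<delta>), x)" "(\<alpha>, \<beta>, \<delta>) \<in> Omega" "x \<in> {-1..1}"
      by (auto simp: space_pair_measure Omega_borel_def space_restrict_space)
    then show "(\<lambda>n. u n p) \<longlonglongrightarrow> (case p of (\<omega>, x) \<Rightarrow> Psi \<omega> x)"
      using psi_prod_tendsto[OF p(2,3)] by (auto simp: u_def Psi_eq intro!: tendsto_mult_left)
  qed
qed

lemma Psi_measurable:
  assumes "x \<in> {-1..1}" shows "(\<lambda>\<omega>. Psi \<omega> x) \<in> borel_measurable Omega_borel"
  using measurable_compose[OF measurable_Pair2' Psi_measurable_pair, of x] assms by simp

text \<open>\<open>A\<close> and \<open>B\<close> are the natural variables: 1 + A = (1 +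
  \<alpha>)^2 and 1 - B = (1 - \<beta>)^2. On the ranges of \<alpha> and \<beta> these are
  increasing bijections onto their images, so order and information are preserved.\<close>

lemma Omega_AB:
  assumes \<omega>: "(\<alpha>, \<beta>, \<delta>) \<in> Omega"
  defines "A \<equiv> \<lambda>i. \<alpha> i * (2 + \<alpha> i)" and "B \<equiv> \<lambda>i. \<beta> i * (2 - \<beta> i)"
  shows "summable (\<lambda>i. \<bar>A i\<bar>)" "summable (\<lambda>i. \<bar>B i\<bar>)" "decseq A" "decseq B" "\<And>i. A i \<ge> 0" "\<And>i. B i \<ge> 0" "\<And>i. B i \<le> 1"
proof -
  note O = OmegaD[OF \<omega>]
  show A0: "A i \<ge> 0" for i using O(1) by (simp add: A_def)
  have Beq: "B i = 1 - (1 - \<beta> i)\<^sup>2" for i by (simp add: B_def power2_eq_square algebra_simps)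
  then show "B i \<le> 1" for i by simp
  show B0: "B i \<ge> 0" for i using O(2,3)[of i] by (simp add: B_def)
  have "\<bar>A i\<bar> \<le> \<alpha> i * (2 + \<alpha> i) + 2 * \<beta> i" "\<bar>B i\<bar> \<le> \<alpha> i * (2 + \<alpha> i) + 2 * \<beta> i" for i
    using A0[of i] B0[of i] O(1,2)[of i] by (auto simp: A_def B_def algebra_simps add_increasing)
  then show "summable (\<lambda>i. \<bar>A i\<bar>)" and "summable (\<lambda>i. \<bar>B i\<bar>)"
    by (auto intro!: summable_comparison_test'[OF summable_psi_bound[OF \<omega>], of 0])
  show "decseq A" unfolding A_def using O(1,4) by (auto simp: decseq_def intro!: mult_mono)
  show "decseq B" unfolding decseq_def Beq
    using O(3) decseqD[OF O(5)] by (auto intro!: power_mono)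
qed

text \<open>In the variable s = (1 - x) / 2 every factor is (1 - B s) / (1 + A s). The bound s \<le>
  1/2 keeps the numerators at least 1/2, so the logarithms exist and are summable.\<close>

lemma ln_Psi:
  assumes \<omega>: "(\<alpha>, \<beta>, \<delta>) \<in> Omega" and s: "0 \<le> s" "s \<le> 1 / 2"
  shows "summable (\<lambda>i. ln (1 - \<beta> i * (2 - \<beta> i) * s))" "summable (\<lambda>i. ln (1 + \<alpha> i * (2 + \<alpha> i) * s))"
    "Psi (\<alpha>, \<beta>, \<delta>) (1 - 2 * s) = exp (- 2 * (\<delta> - (\<Sum>i. \<alpha> i + \<beta> i)) * s
       + (\<Sum>i. ln (1 - \<beta> i * (2 - \<beta> i) * s)) - (\<Sum>i. ln (1 + \<alpha> i * (2 + \<alpha> i) * s)))"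
proof -
  note O = OmegaD[OF \<omega>]
  define A where "A i = \<alpha> i * (2 + \<alpha> i)" for i
  define B where "B i = \<beta> i * (2 - \<beta> i)" for i
  note AB = Omega_AB[OF \<omega>, folded A_def B_def]
  note A0 = AB(5) and B0 = AB(6) and B1 = AB(7) and sA = AB(1) and sB = AB(2)
  have Bs: "\<bar>B i * s\<bar> \<le> 1 / 2" for i
  proof -
    have "B i * s \<le> 1 * (1 / 2)" using B0 B1 s by (intro mult_mono) auto
    then show ?thesis using B0[of i] s by simp
  qed
  show 1: "summable (\<lambda>i. ln (1 - \<beta> i * (2 - \<beta> i) * s))"
    using log_series_exchange(1)[OF sB Bs] by (simp add: B_def)
  have "norm (ln (1 + A i * s)) \<le> s * \<bar>A i\<bar>" for i
    using ln_add_one_self_le_self[of "A i * s"] A0[of i] s by (simp add: mult.commute)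
  then show 2: "summable (\<lambda>i. ln (1 + \<alpha> i * (2 + \<alpha> i) * s))"
    using summable_comparison_test'[OF summable_mult[OF sA, of s], of 0 "\<lambda>i. ln (1 + A i * s)"] by (simp add: A_def)
  have "psi_factor (\<alpha> i) (\<beta> i) (1 - 2 * s) = exp (ln (1 - B i * s) - ln (1 + A i * s))" for i
  proof -
    have "1 - B i * s > 0" using Bs[of i] by linarith
    moreover have "1 + A i * s > 0" using A0[of i] s by (simp add: add_pos_nonneg)
    moreover have "psi_factor (\<alpha> i) (\<beta> i) (1 - 2 * s) = (1 - B i * s) / (1 + A i * s)"
      by (simp add: psi_factor_def A_def B_def mult.assoc)
    ultimately show ?thesis by (simp add: exp_diff)
  qed
  moreover have "(\<Prod>i. exp (ln (1 - B i * s) - ln (1 + A i * s))) = exp (\<Sum>i. ln (1 - B i * s) - ln (1 + A i * s))"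
    using 1 2 unfolding A_def B_def by (intro prodinf_exp summable_diff)
  moreover have "(\<Sum>i. ln (1 - B i * s) - ln (1 + A i * s)) = (\<Sum>i. ln (1 - B i * s)) - (\<Sum>i. ln (1 + A i * s))"
    using 1 2 unfolding A_def B_def by (intro suminf_diff[symmetric])
  ultimately show "Psi (\<alpha>, \<beta>, \<delta>) (1 - 2 * s) = exp (- 2 * (\<delta> - (\<Sum>i. \<alpha> i + \<beta> i)) * s
       + (\<Sum>i. ln (1 - \<beta> i * (2 - \<beta> i) * s)) - (\<Sum>i. ln (1 + \<alpha> i * (2 + \<alpha> i) * s)))"
    by (simp add: Psi_eq exp_add[symmetric] A_def B_def algebra_simps)
qed

text \<open>The points \<open>pt j\<close> accumulate at 1, around which the logarithm of
  \<open>Psi\<close> is expanded. The shift by 2 keeps \<open>rad j\<close> at most 1/2, as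
  \<open>ln_Psi\<close> demands.\<close>

definition rad :: "nat \<Rightarrow> real" where "rad j = 1 / real (j + 2)"

definition pt :: "nat \<Rightarrow> real" where "pt j = 1 - 2 * rad j"

lemma rad: "rad j > 0" "rad j \<le> 1 / 2" "rad \<longlonglongrightarrow> 0"
proof -
  show "rad j > 0" "rad j \<le> 1 / 2" by (auto simp: rad_def field_simps)
  have "(\<lambda>j. inverse (real (Suc (j + 1)))) \<longlonglongrightarrow> 0"
    using LIMSEQ_ignore_initial_segment[OF LIMSEQ_inverse_real_of_nat, of 1] .
  then show "rad \<longlonglongrightarrow> 0" by (simp add: rad_def[abs_def] inverse_eq_divide add_ac)
qed

lemma pt: "pt j \<in> {-1..1}"
  using rad(1,2)[of j] by (auto simp: pt_def)

text \<open>\<open>moment\<close> collects the coefficients of \<open>- ln (Psi \<omega> (1 - 2 s)) / s\<close>.\<close>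

definition moment :: "omega \<Rightarrow> nat \<Rightarrow> real" where
  "moment = (\<lambda>(\<alpha>, \<beta>, \<delta>) k. ((\<Sum>i. (\<beta> i * (2 - \<beta> i)) ^ Suc k) - (\<Sum>i. (- (\<alpha> i * (2 + \<alpha> i))) ^ Suc k)) / real (Suc k)
     + (if k = 0 then 2 * (\<delta> - (\<Sum>i. \<alpha> i + \<beta> i)) else 0))"

lemma moment_series:
  assumes \<omega>: "(\<alpha>, \<beta>, \<delta>) \<in> Omega" and s: "0 < s" "s \<le> 1 / 2" "\<alpha> 0 * (2 + \<alpha> 0) * s \<le> 1 / 2"
  shows "(\<lambda>k. moment (\<alpha>, \<beta>, \<delta>) k * s ^ k) sums (- ln (Psi (\<alpha>, \<beta>, \<delta>) (1 - 2 * s)) / s)"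
proof -
  define A where "A i = \<alpha> i * (2 + \<alpha> i)" for i
  define B where "B i = \<beta> i * (2 - \<beta> i)" for i
  define g where "g = \<delta> - (\<Sum>i. \<alpha> i + \<beta> i)"
  note AB = Omega_AB[OF \<omega>, folded A_def B_def]
  have Bs: "\<bar>B i * s\<bar> \<le> 1 / 2" for i
  proof -
    have "B i * s \<le> 1 * (1 / 2)" using AB(6,7) s by (intro mult_mono) auto
    then show ?thesis using AB(6)[of i] s by simp
  qed
  have As: "\<bar>- A i * s\<bar> \<le> 1 / 2" for i
  proof -
    have "A i * s \<le> A 0 * s" using decseqD[OF AB(3), of 0 i] s by (intro mult_right_mono) auto
    moreover have "A 0 * s \<le> 1 / 2" using s(3) by (simp add: A_def)
    ultimately have "A i * s \<le> 1 / 2" by linarith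
    then show ?thesis using s AB(5)[of i] by simp
  qed
  have "(\<lambda>k. (\<Sum>i. B i ^ Suc k) * s ^ Suc k / real (Suc k)) sums (- (\<Sum>i. ln (1 - B i * s)))"
    by (rule log_series_exchange(2)[OF AB(2) Bs])
  moreover have "(\<lambda>k. (\<Sum>i. (- A i) ^ Suc k) * s ^ Suc k / real (Suc k)) sums (- (\<Sum>i. ln (1 - (- A i) * s)))"
    using AB(1) As by (intro log_series_exchange(2)) auto
  moreover have "(\<lambda>k. if k = 0 then 2 * g * s else 0) sums (2 * g * s)"
    using sums_single[of 0 "\<lambda>_. 2 * g * s"] by simp
  ultimately have "(\<lambda>k. ((\<Sum>i. B i ^ Suc k) * s ^ Suc k / real (Suc k) - (\<Sum>i. (- A i) ^ Suc k) * s ^ Suc k / real (Suc k))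
      + (if k = 0 then 2 * g * s else 0)) sums
      (- (\<Sum>i. ln (1 - B i * s)) - (- (\<Sum>i. ln (1 - (- A i) * s))) + 2 * g * s)"
    by (intro sums_add sums_diff)
  then have "(\<lambda>k. (((\<Sum>i. B i ^ Suc k) * s ^ Suc k / real (Suc k) - (\<Sum>i. (- A i) ^ Suc k) * s ^ Suc k / real (Suc k))
      + (if k = 0 then 2 * g * s else 0)) / s) sums
      ((- (\<Sum>i. ln (1 - B i * s)) - (- (\<Sum>i. ln (1 - (- A i) * s))) + 2 * g * s) / s)"
    by (rule sums_divide)
  moreover have "(((\<Sum>i. B i ^ Suc k) * s ^ Suc k / real (Suc k) - (\<Sum>i. (- A i) ^ Suc k) * s ^ Suc k / real (Suc k))
      + (if k = 0 then 2 * g * s else 0)) / s = moment (\<alpha>, \<beta>, \<delta>) k * s ^ k" for k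
  proof -
    have "(X * s ^ Suc k / m - Y * s ^ Suc k / m + (if k = 0 then 2 * g * s else 0)) / s
        = ((X - Y) / m + (if k = 0 then 2 * g else 0)) * s ^ k" if "m > 0" for X Y m :: real
      using s(1) that by (simp add: field_simps)
    then show ?thesis unfolding moment_def A_def B_def g_def by (simp del: power_Suc of_nat_Suc)
  qed
  moreover have "- (\<Sum>i. ln (1 - B i * s)) - (- (\<Sum>i. ln (1 - (- A i) * s))) + 2 * g * s = - ln (Psi (\<alpha>, \<beta>, \<delta>) (1 - 2 * s))"
    using ln_Psi(3)[OF \<omega>, of s] s by (simp add: A_def B_def g_def algebra_simps)
  ultimately show ?thesis by (simp only:)
qed

section \<open>Recovering \<omega> from countably many values of \<open>Psi\<close>\<close>

lemma Psi_determines_moments: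
  assumes \<omega>: "\<omega> \<in> Omega" "\<omega>' \<in> Omega" and eq: "\<And>j. Psi \<omega> (pt j) = Psi \<omega>' (pt j)"
  shows "moment \<omega> = moment \<omega>'"
proof
  fix k
  obtain \<alpha> \<beta> \<delta> \<alpha>' \<beta>' \<delta>' where o: "\<omega> = (\<alpha>, \<beta>, \<delta>)" "\<omega>' = (\<alpha>', \<beta>', \<delta>')" by (cases \<omega>, cases \<omega>')
  \<comment> \<open>\<open>C\<close> dominates the largest \<open>A\<close>-values of both points,
    so from some index on both series converge at \<open>rad j\<close>; only this tail of the
    sequence is used.\<close>
  define C where "C = \<alpha> 0 * (2 + \<alpha> 0) + \<alpha>' 0 * (2 + \<alpha>' 0)"
  have nn: "\<alpha> 0 * (2 + \<alpha> 0) \<ge> 0" "\<alpha>' 0 * (2 + \<alpha>' 0) \<ge> 0"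
    using OmegaD(1)[OF \<omega>(1)[unfolded o]] OmegaD(1)[OF \<omega>(2)[unfolded o]] by auto
  have "(\<lambda>j. C * rad j) \<longlonglongrightarrow> C * 0" by (intro tendsto_intros rad)
  then have "eventually (\<lambda>j. C * rad j < 1 / 2) sequentially" by (rule order_tendstoD) simp
  then obtain n where n: "\<And>j. j \<ge> n \<Longrightarrow> C * rad j < 1 / 2" by (auto simp: eventually_sequentially)
  have "moment \<omega> k - moment \<omega>' k = 0"
  proof (rule powser_zero_along_sequence[of "\<lambda>j. rad (j + n)" "\<lambda>k. moment \<omega> k - moment \<omega>' k"])
    show "rad (j + n) > 0" for j by (rule rad)
    show "(\<lambda>j. rad (j + n)) \<longlonglongrightarrow> 0" by (rule LIMSEQ_ignore_initial_segment[OF rad(3)])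
    fix j
    let ?s = "rad (j + n)"
    have "\<alpha> 0 * (2 + \<alpha> 0) * ?s \<le> C * ?s" "\<alpha>' 0 * (2 + \<alpha>' 0) * ?s \<le> C * ?s"
      unfolding C_def using nn rad(1)[of "j + n"] by (intro mult_right_mono; simp)+
    moreover have "C * ?s < 1 / 2" using n[of "j + n"] by simp
    ultimately have le: "\<alpha> 0 * (2 + \<alpha> 0) * ?s \<le> 1 / 2" "\<alpha>' 0 * (2 + \<alpha>' 0) * ?s \<le> 1 / 2" by linarith+
    have "(\<lambda>k. moment \<omega> k * ?s ^ k) sums (- ln (Psi \<omega> (1 - 2 * ?s)) / ?s)"
      "(\<lambda>k. moment \<omega>' k * ?s ^ k) sums (- ln (Psi \<omega>' (1 - 2 * ?s)) / ?s)"
      unfolding o by (rule moment_series[OF \<omega>(1)[unfolded o] rad(1,2) le(1)], rule moment_series[OF \<omega>(2)[unfolded o] rad(1,2) le(2)])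
    from sums_diff[OF this] show "(\<lambda>k. (moment \<omega> k - moment \<omega>' k) * ?s ^ k) sums 0"
      using eq[of "j + n"] by (simp add: pt_def left_diff_distrib)
  qed
  then show "moment \<omega> k = moment \<omega>' k" by simp
qed

text \<open>The weight (c_i)^2 skips the power sum of order 1, which \<open>moment\<close> at index
  0 mixes with \<gamma>; from order 2 on, only power sums occur in the moments.\<close>

lemma sum_power_functional:
  fixes c :: "nat \<Rightarrow> real"
  assumes c: "summable (\<lambda>i. \<bar>c i\<bar>)"
  shows "(\<Sum>i. (c i)\<^sup>2 * poly p (c i)) = (\<Sum>k\<le>degree p. Polynomial.coeff p k * (\<Sum>i. c i ^ (k + 2)))"
proof -
  have pw: "summable (\<lambda>i. c i ^ (k + 2))" for k using summable_power_Suc[OF c, of "Suc k"] by simp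
  have "(\<Sum>i. (c i)\<^sup>2 * poly p (c i)) = (\<Sum>i. \<Sum>k\<le>degree p. Polynomial.coeff p k * c i ^ (k + 2))"
    by (intro suminf_cong) (simp add: poly_altdef sum_distrib_left power_add power2_eq_square mult_ac)
  also have "\<dots> = (\<Sum>k\<le>degree p. \<Sum>i. Polynomial.coeff p k * c i ^ (k + 2))"
    by (intro suminf_sum summable_mult pw)
  also have "\<dots> = (\<Sum>k\<le>degree p. Polynomial.coeff p k * (\<Sum>i. c i ^ (k + 2)))"
    by (intro sum.cong refl suminf_mult pw)
  finally show ?thesis .
qed

lemma sum_functional_tendsto:
  fixes c :: "nat \<Rightarrow> real" and f :: "real \<Rightarrow> real"
  assumes c: "summable (\<lambda>i. \<bar>c i\<bar>)" and q: "\<And>n i. \<bar>q n (c i)\<bar> \<le> K" "\<And>i. (\<lambda>n. q n (c i)) \<longlonglongrightarrow> f (c i)"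
  shows "(\<lambda>n. \<Sum>i. (c i)\<^sup>2 * q n (c i)) \<longlonglongrightarrow> (\<Sum>i. (c i)\<^sup>2 * f (c i))"
proof -
  have "summable (\<lambda>i. (c i)\<^sup>2 * K)" using summable_power_Suc[OF c, of 1] by (intro summable_mult2) (simp add: power2_eq_square)
  moreover have "norm ((c i)\<^sup>2 * q n (c i)) \<le> (c i)\<^sup>2 * K" for i n
    using q(1)[of n i] by (simp add: abs_mult mult_left_mono)
  ultimately have "eventually (\<lambda>n. summable (\<lambda>i. norm ((c i)\<^sup>2 * q n (c i)))) sequentially \<and>
      summable (\<lambda>i. norm ((c i)\<^sup>2 * f (c i))) \<and> (\<lambda>n. \<Sum>i. (c i)\<^sup>2 * q n (c i)) \<longlonglongrightarrow> (\<Sum>i. (c i)\<^sup>2 * f (c i))"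
    by (intro tannerys_theorem[where M = "\<lambda>i. (c i)\<^sup>2 * K"]) (auto intro!: tendsto_intros q(2) always_eventually)
  then show ?thesis by blast
qed

lemma point_indicator_limit:
  fixes x t :: real
  shows "(\<lambda>n. max 0 (1 - real n * \<bar>x - t\<bar>)) \<longlonglongrightarrow> of_bool (x = t)"
proof (cases "x = t")
  case False
  obtain N :: nat where N: "1 / \<bar>x - t\<bar> < real N" using reals_Archimedean2 by blast
  have "max 0 (1 - real n * \<bar>x - t\<bar>) = 0" if "n \<ge> N" for n
  proof -
    have "1 < real N * \<bar>x - t\<bar>" using N False by (simp add: field_simps)
    also have "\<dots> \<le> real n * \<bar>x - t\<bar>" using that by (intro mult_right_mono) auto
    finally show ?thesis by simp
  qed
  then have "eventually (\<lambda>n. max 0 (1 - real n * \<bar>x - t\<bar>) = 0) sequentially" by (auto simp: eventually_sequentially)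
  then show ?thesis using False by (simp add: tendsto_eventually)
qed simp

text \<open>\<open>L B A\<close> integrates against the signed measure with mass B_i^2 at B_i and
  -A_i^2 at -A_i. It is finite with bounded support, so its polynomial integrals determine the mass
  of every point. Atoms on the positive half-line come from \<beta>, those on the negative one from
  \<alpha>; finally \<open>moment\<close> at 0 gives \<delta>.\<close>

lemma Psi_injective:
  assumes \<omega>: "\<omega> \<in> Omega" "\<omega>' \<in> Omega" and eq: "\<And>j. Psi \<omega> (pt j) = Psi \<omega>' (pt j)"
  shows "\<omega> = \<omega>'"
proof -
  obtain \<alpha> \<beta> \<delta> \<alpha>' \<beta>' \<delta>' where o: "\<omega> = (\<alpha>, \<beta>, \<delta>)" "\<omega>' = (\<alpha>', \<beta>', \<delta>')" by (cases \<omega>, cases \<omega>')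
  define A where "A i = \<alpha> i * (2 + \<alpha> i)" for i
  define B where "B i = \<beta> i * (2 - \<beta> i)" for i
  define A' where "A' i = \<alpha>' i * (2 + \<alpha>' i)" for i
  define B' where "B' i = \<beta>' i * (2 - \<beta>' i)" for i
  note AB = Omega_AB[OF \<omega>(1)[unfolded o], folded A_def B_def]
  note AB' = Omega_AB[OF \<omega>(2)[unfolded o], folded A'_def B'_def]
  note O = OmegaD[OF \<omega>(1)[unfolded o]] and O' = OmegaD[OF \<omega>(2)[unfolded o]]
  have m: "moment (\<alpha>, \<beta>, \<delta>) k = moment (\<alpha>', \<beta>', \<delta>') k" for k
    using Psi_determines_moments[OF \<omega> eq] by (simp add: o)
  have pw: "(\<Sum>i. B i ^ (k + 2)) - (\<Sum>i. (- A i) ^ (k + 2)) = (\<Sum>i. B' i ^ (k + 2)) - (\<Sum>i. (- A' i) ^ (k + 2))" for k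
    using m[of "Suc k"] by (simp add: moment_def A_def B_def A'_def B'_def)
  define L where "L B A f = (\<Sum>i. (B i)\<^sup>2 * f (B i)) - (\<Sum>i. (- A i)\<^sup>2 * f (- A i))" for A B :: "nat \<Rightarrow> real" and f :: "real \<Rightarrow> real"
  have L_poly: "L B A (poly p) = L B' A' (poly p)" for p
    unfolding L_def
      sum_power_functional[OF AB(2)] sum_power_functional[OF AB'(2)]
      sum_power_functional[of "\<lambda>i. - A i", unfolded abs_minus_cancel, OF AB(1)]
      sum_power_functional[of "\<lambda>i. - A' i", unfolded abs_minus_cancel, OF AB'(1)]
      sum_subtractf[symmetric] right_diff_distrib[symmetric] pw ..
  \<comment> \<open>All atoms of both measures lie in one compact interval, as polynomial
    approximation requires.\<close>
  define lo where "lo = - max (A 0) (A' 0)"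
  have ran: "B i \<in> {lo..1}" "- A i \<in> {lo..1}" "B' i \<in> {lo..1}" "- A' i \<in> {lo..1}" for i
  proof -
    have "A i \<le> max (A 0) (A' 0)" "A' i \<le> max (A 0) (A' 0)"
      using decseqD[OF AB(3), of 0 i] decseqD[OF AB'(3), of 0 i] by auto
    then have "lo \<le> - A i" "lo \<le> - A' i" by (auto simp: lo_def)
    moreover have "0 \<le> A i" "0 \<le> A' i" "0 \<le> B i" "0 \<le> B' i" "B i \<le> 1" "B' i \<le> 1"
      using AB(5,6,7) AB'(5,6,7) by auto
    ultimately show "B i \<in> {lo..1}" "- A i \<in> {lo..1}" "B' i \<in> {lo..1}" "- A' i \<in> {lo..1}"
      unfolding atLeastAtMost_iff by linarith+
  qed
  have L_point: "L B A (\<lambda>x. of_bool (x = t)) = L B' A' (\<lambda>x. of_bool (x = t))" for t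
  proof (rule poly_functional_eq[where L = "L B A" and L' = "L B' A'" and f = "\<lambda>x. of_bool (x = t)" and c = lo and d = 1 and K = 1 and g = "\<lambda>n x. max 0 (1 - real n * \<bar>x - t\<bar>)"])
    show "(\<lambda>n. L B A (poly (q n))) \<longlonglongrightarrow> L B A (\<lambda>x. of_bool (x = t))"
      if "\<And>n x. x \<in> {lo..1} \<Longrightarrow> \<bar>poly (q n) x\<bar> \<le> 1 + 1"
        "\<And>x. x \<in> {lo..1} \<Longrightarrow> (\<lambda>n. poly (q n) x) \<longlonglongrightarrow> of_bool (x = t)" for q
      unfolding L_def using that ran AB(1,2) by (intro tendsto_diff sum_functional_tendsto[where K = 2]) auto
    show "(\<lambda>n. L B' A' (poly (q n))) \<longlonglongrightarrow> L B' A' (\<lambda>x. of_bool (x = t))"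
      if "\<And>n x. x \<in> {lo..1} \<Longrightarrow> \<bar>poly (q n) x\<bar> \<le> 1 + 1"
        "\<And>x. x \<in> {lo..1} \<Longrightarrow> (\<lambda>n. poly (q n) x) \<longlonglongrightarrow> of_bool (x = t)" for q
      unfolding L_def using that ran AB'(1,2) by (intro tendsto_diff sum_functional_tendsto[where K = 2]) auto
    show "continuous_on {lo..1} (\<lambda>x. max 0 (1 - real n * \<bar>x - t\<bar>))" for n by (intro continuous_intros)
    show "(\<lambda>n. max 0 (1 - real n * \<bar>x - t\<bar>)) \<longlonglongrightarrow> of_bool (x = t)" for x by (rule point_indicator_limit)
  qed (use L_poly in auto)
  have "B = B'"
  proof (rule decseq_eq_of_level_sums)
    fix t :: real assume t: "t > 0"
    have ne: "- A i \<noteq> t" "- A' i \<noteq> t" for i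
      using AB(5)[of i] AB'(5)[of i] t by linarith+
    show "(\<Sum>i. (B i)\<^sup>2 * of_bool (B i = t)) = (\<Sum>i. (B' i)\<^sup>2 * of_bool (B' i = t))"
      using L_point[of t] by (simp add: L_def ne)
  qed (use AB AB' in \<open>auto intro: summable_rabs_cancel\<close>)
  have "A = A'"
  proof (rule decseq_eq_of_level_sums)
    fix t :: real assume t: "t > 0"
    have ne: "B i \<noteq> - t" "B' i \<noteq> - t" for i
      using AB(6)[of i] AB'(6)[of i] t by linarith+
    show "(\<Sum>i. (A i)\<^sup>2 * of_bool (A i = t)) = (\<Sum>i. (A' i)\<^sup>2 * of_bool (A' i = t))"
      using L_point[of "- t"] by (simp add: L_def ne)
  qed (use AB AB' in \<open>auto intro: summable_rabs_cancel\<close>)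
  have \<alpha>: "\<alpha> = \<alpha>'"
  proof
    fix i
    have "(1 + \<alpha> i)\<^sup>2 = (1 + \<alpha>' i)\<^sup>2"
      using fun_cong[OF \<open>A = A'\<close>, of i] by (simp add: A_def A'_def power2_eq_square algebra_simps)
    then show "\<alpha> i = \<alpha>' i" using O(1)[of i] O'(1)[of i] by (simp add: power2_eq_iff_nonneg)
  qed
  have \<beta>: "\<beta> = \<beta>'"
  proof
    fix i
    have "(1 - \<beta> i)\<^sup>2 = (1 - \<beta>' i)\<^sup>2"
      using fun_cong[OF \<open>B = B'\<close>, of i] by (simp add: B_def B'_def power2_eq_square algebra_simps)
    then show "\<beta> i = \<beta>' i" using O(3)[of i] O'(3)[of i] by (simp add: power2_eq_iff_nonneg)
  qed
  have "\<delta> = \<delta>'" using m[of 0] unfolding \<alpha> \<beta> by (simp add: moment_def)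
  then show ?thesis using \<alpha> \<beta> o by simp
qed

section \<open>Measures on \<open>Omega\<close> and mixed moments of \<open>Psi\<close>\<close>

text \<open>The infinite sum is not continuous in the product topology, but each partial sum is;
  bounding all of them describes the set by closed conditions.\<close>

lemma Omega_alt:
  "Omega = {\<omega>. (\<forall>i. 0 \<le> fst \<omega> i \<and> fst \<omega> (Suc i) \<le> fst \<omega> i) \<and>
     (\<forall>i. 0 \<le> fst (snd \<omega>) i \<and> fst (snd \<omega>) (Suc i) \<le> fst (snd \<omega>) i \<and> fst (snd \<omega>) i \<le> 1) \<and>
     (\<forall>n. (\<Sum>i<n. fst \<omega> i + fst (snd \<omega>) i) \<le> snd (snd \<omega>))}" (is "_ = ?R")
proof (intro equalityI subsetI)
  fix \<omega> :: omega assume \<omega>: "\<omega> \<in> Omega"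
  obtain \<alpha> \<beta> \<delta> where o: "\<omega> = (\<alpha>, \<beta>, \<delta>)" by (cases \<omega>)
  note O = OmegaD[OF \<omega>[unfolded o]]
  have "(\<Sum>i<n. \<alpha> i + \<beta> i) \<le> \<delta>" for n
    using O(1,2) order_trans[OF sum_le_suminf[OF O(6)] O(7)] by (simp add: add_nonneg_nonneg)
  then show "\<omega> \<in> ?R" using \<omega> o by (auto simp: Omega_def)
next
  fix \<omega> :: omega assume \<omega>: "\<omega> \<in> ?R"
  obtain \<alpha> \<beta> \<delta> where o: "\<omega> = (\<alpha>, \<beta>, \<delta>)" by (cases \<omega>)
  have nn: "\<And>i. 0 \<le> \<alpha> i + \<beta> i" and le: "\<And>n. (\<Sum>i<n. \<alpha> i + \<beta> i) \<le> \<delta>"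
    using \<omega> o by (auto intro: add_nonneg_nonneg)
  then have s: "summable (\<lambda>i. \<alpha> i + \<beta> i)" by (intro summableI_nonneg_bounded[of _ \<delta>]) auto
  moreover have "(\<Sum>i. \<alpha> i + \<beta> i) \<le> \<delta>" using le by (intro suminf_le_const s)
  ultimately show "\<omega> \<in> Omega" using \<omega> o by (auto simp: Omega_def)
qed

lemma omega_continuous:
  "continuous_on S (\<lambda>\<omega>::omega. fst \<omega> i)" "continuous_on S (\<lambda>\<omega>::omega. fst (snd \<omega>) i)"
  "continuous_on S (\<lambda>\<omega>::omega. snd (snd \<omega>))"
proof -
  have "continuous_on S (\<lambda>\<omega>::omega. fst \<omega>)" "continuous_on S (\<lambda>\<omega>::omega. fst (snd \<omega>))"
    by (intro continuous_intros)+
  then show "continuous_on S (\<lambda>\<omega>::omega. fst \<omega> i)" "continuous_on S (\<lambda>\<omega>::omega. fst (snd \<omega>) i)"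
    by (blast dest: continuous_on_product_then_coordinatewise)+
  show "continuous_on S (\<lambda>\<omega>::omega. snd (snd \<omega>))" by (intro continuous_intros)
qed

lemma closed_Omega: "closed Omega"
  unfolding Omega_alt
  by (intro closed_Collect_conj closed_Collect_all closed_Collect_le continuous_on_sum continuous_on_add
      continuous_on_const omega_continuous)

definition OmegaR :: "real \<Rightarrow> omega set" where "OmegaR R = {\<omega>\<in>Omega. snd (snd \<omega>) \<le> R}"

text \<open>The bound on \<delta> bounds every coordinate, so this is a closed subset of a Tychonoff
  product of intervals.\<close>

lemma compact_OmegaR: "compact (OmegaR R)"
proof -
  have cP: "compact (Pi\<^sub>E (UNIV :: nat set) S)" if "\<And>i. compact (S i)" for S :: "nat \<Rightarrow> real set"
  proof -
    have "compactin (product_topology (\<lambda>_. euclidean) UNIV) (Pi\<^sub>E UNIV S)"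
      using that by (auto simp: compactin_PiE)
    then show ?thesis by (simp add: euclidean_product_topology)
  qed
  have "compact (Pi\<^sub>E UNIV (\<lambda>_. {0..R}) \<times> Pi\<^sub>E UNIV (\<lambda>_. {0..1}) \<times> {0..R} :: omega set)"
    by (rule compact_Times[OF cP compact_Times[OF cP compact_Icc]]) auto
  moreover have "closed (OmegaR R)"
    unfolding OmegaR_def using closed_Omega
    by (intro closed_Collect_conj[of "\<lambda>\<omega>. \<omega> \<in> Omega", simplified] closed_Collect_le omega_continuous continuous_on_const)
  moreover have "OmegaR R \<subseteq> Pi\<^sub>E UNIV (\<lambda>_. {0..R}) \<times> Pi\<^sub>E UNIV (\<lambda>_. {0..1}) \<times> {0..R}"
  proof
    fix \<omega> assume \<omega>: "\<omega> \<in> OmegaR R"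
    obtain \<alpha> \<beta> \<delta> where o: "\<omega> = (\<alpha>, \<beta>, \<delta>)" by (cases \<omega>)
    have oO: "(\<alpha>, \<beta>, \<delta>) \<in> Omega" and \<delta>: "\<delta> \<le> R" using \<omega> o by (auto simp: OmegaR_def)
    note O = OmegaD[OF oO]
    have "\<alpha> i \<le> R" for i
    proof -
      have "\<alpha> i \<le> \<delta> / real (Suc i)" by (rule Omega_decay(1)[OF oO])
      also have "\<dots> \<le> \<delta>" using O(10) by (simp add: divide_le_eq mult_le_cancel_left1)
      finally show ?thesis using \<delta> by simp
    qed
    then show "\<omega> \<in> Pi\<^sub>E UNIV (\<lambda>_. {0..R}) \<times> Pi\<^sub>E UNIV (\<lambda>_. {0..1}) \<times> {0..R}"
      using O(1,2,3,10) \<delta> by (auto simp: o)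
  qed
  ultimately show ?thesis using compact_Int_closed by (metis inf.absorb_iff2)
qed

lemma ln_one_plus_bounds:
  assumes "(y::real) \<ge> 0" shows "\<bar>ln (1 + y) - y\<bar> \<le> y\<^sup>2"
proof (cases "y \<le> 1")
  case True then show ?thesis using abs_ln_one_plus_x_minus_x_bound_nonneg assms by blast
next
  case False
  then have "y * 1 \<le> y * y" by (intro mult_left_mono) auto
  moreover have "0 \<le> ln (1 + y)" "ln (1 + y) \<le> y" using assms by (auto intro: ln_add_one_self_le_self)
  ultimately show ?thesis by (simp add: power2_eq_square)
qed

text \<open>Although \<open>\<delta> - (\<Sum>i. \<alpha> i + \<beta> i)\<close> is not continuous, \<open>Psi\<close> is: combined with the linear parts of the
  logarithms, only \<open>\<delta>\<close> remains, and the remainders are quadratic, hence uniformly summable.\<close>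

lemma Psi_continuous_omega:
  assumes s: "0 \<le> s" "s \<le> 1 / 2"
  shows "continuous_on (OmegaR R) (\<lambda>\<omega>. Psi \<omega> (1 - 2 * s))"
proof -
  define h where "h i \<omega> = (ln (1 - fst (snd \<omega>) i * (2 - fst (snd \<omega>) i) * s) + 2 * fst (snd \<omega>) i * s)
      - (ln (1 + fst \<omega> i * (2 + fst \<omega> i) * s) - 2 * fst \<omega> i * s)" for i and \<omega> :: omega
  \<comment> \<open>The \<beta> part contributes 8 + 1 and the \<alpha> part (2 + R)^2 + 1: in each
    case the remainder of the logarithm, then the quadratic term by which B s or A s differs from
    its linear part.\<close>
  define C where "C = 10 + (2 + R)\<^sup>2"
  define M where "M i = C * (R / real (Suc i))\<^sup>2" for i
  have facts: "0 \<le> \<alpha> i" "0 \<le> \<beta> i" "\<beta> i \<le> 1" "\<alpha> i \<le> R / real (Suc i)" "\<beta> i \<le> R / real (Suc i)" "\<alpha> i \<le> R"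
    if "(\<alpha>, \<beta>, \<delta>) \<in> OmegaR R" for \<alpha> \<beta> \<delta> i
  proof -
    have oO: "(\<alpha>, \<beta>, \<delta>) \<in> Omega" and \<delta>: "\<delta> \<le> R" using that by (auto simp: OmegaR_def)
    note O = OmegaD[OF oO]
    show "0 \<le> \<alpha> i" "0 \<le> \<beta> i" "\<beta> i \<le> 1" using O by auto
    have "\<delta> / real (Suc i) \<le> R / real (Suc i)" using \<delta> by (intro divide_right_mono) auto
    then show a: "\<alpha> i \<le> R / real (Suc i)" "\<beta> i \<le> R / real (Suc i)"
      using Omega_decay[OF oO, of i] by linarith+
    have "R / real (Suc i) \<le> R" using O(10) \<delta> by (simp add: divide_le_eq mult_le_cancel_left1)
    then show "\<alpha> i \<le> R" using a by linarith
  qed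
  have arg: "0 \<le> B" "B * s \<le> 1 / 2" if "0 \<le> \<beta>" "\<beta> \<le> 1" "B = \<beta> * (2 - \<beta>)" for \<beta> B :: real
  proof -
    have "B = 1 - (1 - \<beta>)\<^sup>2" by (simp add: that power2_eq_square algebra_simps)
    then have "B \<le> 1" by simp
    show "0 \<le> B" using that by simp
    have "B * s \<le> 1 * (1 / 2)" using \<open>B \<le> 1\<close> \<open>0 \<le> B\<close> s by (intro mult_mono) auto
    then show "B * s \<le> 1 / 2" by simp
  qed
  have bound: "norm (h i \<omega>) \<le> M i" if \<omega>: "\<omega> \<in> OmegaR R" for i \<omega>
  proof -
    obtain \<alpha> \<beta> \<delta> where o: "\<omega> = (\<alpha>, \<beta>, \<delta>)" by (cases \<omega>)
    note f = facts[OF \<omega>[unfolded o], of i]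
    define a where "a = \<alpha> i"
    define b where "b = \<beta> i"
    define A where "A = a * (2 + a)"
    define B where "B = b * (2 - b)"
    have ab: "0 \<le> a" "a \<le> R" "0 \<le> b" "b \<le> 1" using f by (auto simp: a_def b_def)
    note B = arg[OF ab(3,4) B_def]
    have A0: "0 \<le> A" using ab by (simp add: A_def)
    have "\<bar>ln (1 + (- (B * s))) - (- (B * s))\<bar> \<le> 2 * (- (B * s))\<^sup>2"
      using B s by (intro abs_ln_one_plus_x_minus_x_bound) auto
    also have "\<dots> = 2 * (B\<^sup>2 * s\<^sup>2)" by (simp add: power_mult_distrib)
    also have "\<dots> \<le> 2 * ((2 * b)\<^sup>2 * 1)"
      using ab s B by (intro mult_left_mono mult_mono power_mono power_le_one) (auto simp: B_def algebra_simps)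
    finally have 1: "\<bar>ln (1 - B * s) + B * s\<bar> \<le> 8 * b\<^sup>2" by (simp add: power_mult_distrib)
    have "\<bar>ln (1 + A * s) - A * s\<bar> \<le> (A * s)\<^sup>2" using A0 s by (intro ln_one_plus_bounds) auto
    also have "\<dots> = a\<^sup>2 * (2 + a)\<^sup>2 * s\<^sup>2" by (simp add: A_def power_mult_distrib)
    also have "\<dots> \<le> a\<^sup>2 * (2 + R)\<^sup>2 * 1"
      using ab s by (intro mult_mono mult_left_mono power_mono power_le_one) auto
    finally have 2: "\<bar>ln (1 + A * s) - A * s\<bar> \<le> (2 + R)\<^sup>2 * a\<^sup>2" by (simp add: mult.commute)
    have 3: "b\<^sup>2 * s \<le> b\<^sup>2" "a\<^sup>2 * s \<le> a\<^sup>2" "0 \<le> b\<^sup>2 * s" "0 \<le> a\<^sup>2 * s" using s by (auto intro: mult_left_le)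
    have "h i \<omega> = (ln (1 - B * s) + B * s) - (ln (1 + A * s) - A * s) + b\<^sup>2 * s - a\<^sup>2 * s"
      by (simp add: h_def o A_def B_def a_def b_def power2_eq_square algebra_simps)
    then have "norm (h i \<omega>) \<le> 8 * b\<^sup>2 + (2 + R)\<^sup>2 * a\<^sup>2 + b\<^sup>2 + a\<^sup>2" using 1 2 3 unfolding real_norm_def by linarith
    also have "\<dots> = 9 * b\<^sup>2 + ((2 + R)\<^sup>2 + 1) * a\<^sup>2" by (simp add: algebra_simps)
    also have "\<dots> \<le> 9 * (R / real (Suc i))\<^sup>2 + ((2 + R)\<^sup>2 + 1) * (R / real (Suc i))\<^sup>2"
      using f ab by (intro add_mono mult_left_mono power_mono) (auto simp: a_def b_def)
    also have "\<dots> = M i" by (simp add: M_def C_def algebra_simps)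
    finally show ?thesis .
  qed
  have sM: "summable M"
  proof -
    have "summable (\<lambda>n. inverse (real n ^ 2))" by (rule inverse_power_summable) simp
    then have "summable (\<lambda>i. inverse (real (Suc i) ^ 2))" by (subst summable_Suc_iff)
    then have "summable (\<lambda>i. (C * R\<^sup>2) * inverse (real (Suc i) ^ 2))" by (rule summable_mult)
    moreover have "M = (\<lambda>i. (C * R\<^sup>2) * inverse (real (Suc i) ^ 2))"
      by (simp add: M_def fun_eq_iff power_divide divide_inverse power_mult_distrib power_inverse)
    ultimately show ?thesis by (simp only:)
  qed
  have ul: "uniform_limit (OmegaR R) (\<lambda>n \<omega>. \<Sum>i<n. h i \<omega>) (\<lambda>\<omega>. \<Sum>i. h i \<omega>) sequentially"
    by (rule Weierstrass_m_test[OF bound sM])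
  have ch: "continuous_on (OmegaR R) (h i)" for i
  proof -
    have "1 - fst (snd \<omega>) i * (2 - fst (snd \<omega>) i) * s \<noteq> 0" "1 + fst \<omega> i * (2 + fst \<omega> i) * s \<noteq> 0"
      if \<omega>: "\<omega> \<in> OmegaR R" for \<omega>
    proof -
      obtain \<alpha> \<beta> \<delta> where o: "\<omega> = (\<alpha>, \<beta>, \<delta>)" by (cases \<omega>)
      note f = facts[OF \<omega>[unfolded o], of i]
      show "1 - fst (snd \<omega>) i * (2 - fst (snd \<omega>) i) * s \<noteq> 0" using arg(2)[OF f(2,3) refl] by (simp add: o)
      have "0 \<le> \<alpha> i * (2 + \<alpha> i) * s" using f(1) s by simp
      then show "1 + fst \<omega> i * (2 + fst \<omega> i) * s \<noteq> 0" by (simp add: o)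
    qed
    then show ?thesis unfolding h_def by (intro continuous_intros omega_continuous) auto
  qed
  have cs: "continuous_on (OmegaR R) (\<lambda>\<omega>. \<Sum>i. h i \<omega>)"
    by (rule uniform_limit_theorem[OF _ ul]) (auto intro!: always_eventually continuous_on_sum ch)
  have eq: "Psi \<omega> (1 - 2 * s) = exp (- 2 * snd (snd \<omega>) * s + (\<Sum>i. h i \<omega>))" if \<omega>: "\<omega> \<in> OmegaR R" for \<omega>
  proof -
    obtain \<alpha> \<beta> \<delta> where o: "\<omega> = (\<alpha>, \<beta>, \<delta>)" by (cases \<omega>)
    have oO: "(\<alpha>, \<beta>, \<delta>) \<in> Omega" using \<omega> o by (auto simp: OmegaR_def)
    note O = OmegaD[OF oO] and L = ln_Psi[OF oO s]
    have "(\<Sum>i. h i \<omega>) = (\<Sum>i. (ln (1 - \<beta> i * (2 - \<beta> i) * s) - ln (1 + \<alpha> i * (2 + \<alpha> i) * s)) + 2 * s * (\<alpha> i + \<beta> i))"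
      by (simp add: h_def o algebra_simps)
    also have "\<dots> = (\<Sum>i. ln (1 - \<beta> i * (2 - \<beta> i) * s)) - (\<Sum>i. ln (1 + \<alpha> i * (2 + \<alpha> i) * s)) + 2 * s * (\<Sum>i. \<alpha> i + \<beta> i)"
      using L(1,2) O(6)
      by (subst suminf_add[symmetric]) (auto simp: suminf_diff suminf_mult intro!: summable_diff summable_mult)
    finally show ?thesis unfolding o using L(3) by (simp add: algebra_simps)
  qed
  have "continuous_on (OmegaR R) (\<lambda>\<omega>. exp (- 2 * snd (snd \<omega>) * s + (\<Sum>i. h i \<omega>)))"
    by (intro continuous_intros omega_continuous cs)
  then show ?thesis by (rule continuous_on_eq) (simp only: eq)
qed

section \<open>Embedding \<open>Omega\<close> into a sequence space\<close>

definition psi_seq :: "omega \<Rightarrow> nat \<Rightarrow> real" where "psi_seq \<omega> j = Psi \<omega> (pt j)"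

lemma psi_seq_continuous: "continuous_on (OmegaR R) psi_seq"
  unfolding psi_seq_def pt_def
  by (rule continuous_on_coordinatewise_then_product) (rule Psi_continuous_omega[OF less_imp_le[OF rad(1)] rad(2)])

lemma psi_seq_inj: "inj_on psi_seq Omega"
  using Psi_injective by (auto simp: inj_on_def psi_seq_def fun_eq_iff)

lemma psi_seq_measurable: "psi_seq \<in> Omega_borel \<rightarrow>\<^sub>M (\<Pi>\<^sub>M j\<in>UNIV. borel)"
  unfolding psi_seq_def by (intro measurable_PiM_single') (auto intro!: Psi_measurable pt)

lemma space_Omega_borel: "space Omega_borel = Omega"
  by (simp add: Omega_borel_def space_restrict_space)

lemma sets_Omega_borel: "A \<in> sets Omega_borel \<longleftrightarrow> A \<in> sets borel \<and> A \<subseteq> Omega"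
  using closed_Omega by (auto simp: Omega_borel_def sets_restrict_space_iff borel_closed)

text \<open>By injectivity a compact set is the preimage of its image, and by continuity on
  \<open>OmegaR R\<close> that image is compact, hence measurable; so the law determines the mass of
  compact sets without any measurable inverse. Closed sets are exhausted by their compact parts with
  \<delta> \<le> n.\<close>

lemma measure_eq_of_psi_law:
  assumes M: "M \<in> space (prob_algebra Omega_borel)" and M': "M' \<in> space (prob_algebra Omega_borel)"
    and law: "distr M (\<Pi>\<^sub>M j\<in>UNIV. borel) psi_seq = distr M' (\<Pi>\<^sub>M j\<in>UNIV. borel) psi_seq"
  shows "M = M'"
proof -
  have sets: "sets M = sets Omega_borel" "sets M' = sets Omega_borel" using M M' by (auto simp: space_prob_algebra)
  then have sp: "space M = Omega" "space M' = Omega" using sets_eq_imp_space_eq space_Omega_borel by metis+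
  have pm: "psi_seq \<in> M \<rightarrow>\<^sub>M (\<Pi>\<^sub>M j\<in>UNIV. borel)" "psi_seq \<in> M' \<rightarrow>\<^sub>M (\<Pi>\<^sub>M j\<in>UNIV. borel)"
    using psi_seq_measurable sets by (auto cong: measurable_cong_sets)
  have comp: "emeasure M K = emeasure M' K" if K: "compact K" "K \<subseteq> OmegaR R" for K R
  proof -
    have KO: "K \<subseteq> Omega" using K(2) by (auto simp: OmegaR_def)
    have "compact (psi_seq ` K)"
      using continuous_on_subset[OF psi_seq_continuous K(2)] K(1) by (rule compact_continuous_image)
    then have c: "psi_seq ` K \<in> sets (\<Pi>\<^sub>M j\<in>UNIV. borel)"
      unfolding sets_PiM_equal_borel by (intro borel_closed compact_imp_closed)
    have "K = psi_seq -` (psi_seq ` K) \<inter> Omega" using KO inj_onD[OF psi_seq_inj] by blast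
    then have "emeasure M K = emeasure (distr M (\<Pi>\<^sub>M j\<in>UNIV. borel) psi_seq) (psi_seq ` K)"
      "emeasure M' K = emeasure (distr M' (\<Pi>\<^sub>M j\<in>UNIV. borel) psi_seq) (psi_seq ` K)"
      using emeasure_distr[OF pm(1) c] emeasure_distr[OF pm(2) c] sp by simp_all
    then show ?thesis using law by simp
  qed
  have clo: "emeasure M (C \<inter> Omega) = emeasure M' (C \<inter> Omega)" if C: "closed C" for C
  proof -
    define K where "K n = C \<inter> OmegaR (real n)" for n :: nat
    have cK: "compact (K n)" for n unfolding K_def using compact_OmegaR C by (metis Int_commute compact_Int_closed)
    have inc: "incseq K" by (auto simp: incseq_def K_def OmegaR_def)
    have KU: "(\<Union>n. K n) = C \<inter> Omega"
      using real_arch_simple by (auto simp: K_def OmegaR_def)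
    have Ks: "K n \<in> sets Omega_borel" for n
      unfolding sets_Omega_borel using cK[of n] by (auto simp: K_def OmegaR_def intro: borel_closed compact_imp_closed)
    have "range K \<subseteq> sets M" "range K \<subseteq> sets M'" using Ks sets by auto
    from Lim_emeasure_incseq[OF this(1) inc] Lim_emeasure_incseq[OF this(2) inc]
    have "(\<lambda>n. emeasure M (K n)) \<longlonglongrightarrow> emeasure M (C \<inter> Omega)" "(\<lambda>n. emeasure M' (K n)) \<longlonglongrightarrow> emeasure M' (C \<inter> Omega)"
      unfolding KU by simp_all
    moreover have "emeasure M (K n) = emeasure M' (K n)" for n
      by (rule comp[OF cK, of n "real n"]) (auto simp: K_def)
    ultimately show ?thesis by (simp add: LIMSEQ_unique)
  qed
  define M1 where "M1 = distr M borel (\<lambda>x. x)"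
  define M1' where "M1' = distr M' borel (\<lambda>x. x)"
  have id: "(\<lambda>x. x) \<in> M \<rightarrow>\<^sub>M borel" "(\<lambda>x. x) \<in> M' \<rightarrow>\<^sub>M borel"
    using sets by (auto simp: Omega_borel_def measurable_restrict_space1 cong: measurable_cong_sets)
  have M1: "emeasure M1 B = emeasure M (B \<inter> Omega)" "emeasure M1' B = emeasure M' (B \<inter> Omega)" if "B \<in> sets borel" for B
    unfolding M1_def M1'_def using that id sp by (simp_all add: emeasure_distr)
  interpret M: prob_space M using M by (simp add: space_prob_algebra)
  have "M1 = M1'"
  proof (rule measure_eqI_generator_eq[where E = "Collect closed" and \<Omega> = UNIV and A = "\<lambda>_. UNIV"])
    show "Int_stable (Collect (closed :: omega set \<Rightarrow> bool))" by (auto simp: Int_stable_def)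
    show "emeasure M1 X = emeasure M1' X" if "X \<in> Collect closed" for X
      using that clo M1 by (simp add: borel_closed)
    show "sets M1 = sigma_sets UNIV (Collect closed)" "sets M1' = sigma_sets UNIV (Collect closed)"
      by (simp_all add: M1_def M1'_def borel_eq_closed)
    show "emeasure M1 UNIV \<noteq> \<infinity>" by (simp add: M1)
  qed auto
  show ?thesis
  proof (rule measure_eqI)
    show "sets M = sets M'" using sets by simp
    fix A assume "A \<in> sets M"
    then have "A \<in> sets borel" "A \<inter> Omega = A" using sets sets_Omega_borel by auto
    then show "emeasure M A = emeasure M' A" using M1[of A] \<open>M1 = M1'\<close> by simp
  qed
qed

section \<open>The moment problem on a cube of countable dimension\<close>

lemma integrable_bounded_prob:
  fixes f :: "'a \<Rightarrow> real"
  assumes M: "M \<in> space (prob_algebra S)" and f: "f \<in> borel_measurable S" "\<And>x. x \<in> space S \<Longrightarrow> \<bar>f x\<bar> \<le> B"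
  shows "integrable M f"
proof -
  have s: "sets M = sets S" and p: "prob_space M" using M by (auto simp: space_prob_algebra)
  interpret prob_space M by fact
  show ?thesis using f sets_eq_imp_space_eq[OF s] s
    by (intro integrable_const_bound[where B = B] AE_I2) (auto cong: measurable_cong_sets)
qed

lemma half_line_indicator_limit:
  fixes x t :: real
  shows "(\<lambda>n. min 1 (max 0 (real n * (x - t)))) \<longlonglongrightarrow> indicator {t<..} x"
proof (cases "t < x")
  case True
  obtain N :: nat where N: "1 / (x - t) < real N" using reals_Archimedean2 by blast
  have "min 1 (max 0 (real n * (x - t))) = 1" if "n \<ge> N" for n
  proof -
    have "1 < real N * (x - t)" using N True by (simp add: field_simps)
    also have "\<dots> \<le> real n * (x - t)" using that True by (intro mult_right_mono) auto
    finally show ?thesis by simp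
  qed
  then have "eventually (\<lambda>n. min 1 (max 0 (real n * (x - t))) = 1) sequentially" by (auto simp: eventually_sequentially)
  then show ?thesis using True by (simp add: tendsto_eventually)
next
  case False
  then have "real n * (x - t) \<le> 0" for n by (intro mult_nonneg_nonpos) auto
  then have "min 1 (max 0 (real n * (x - t))) = 0" for n by (simp add: max_absorb1)
  then show ?thesis using False by simp
qed

text \<open>The one-variable Hausdorff moment problem under a weight: powers give polynomials,
  bounded limits of polynomials give half-lines, and half-lines determine the measure. The weight
  will hold the coordinates already treated and the monomial in the others.\<close>

lemma weighted_law_eq:
  fixes X Z :: "'a \<Rightarrow> real"
  assumes M: "M \<in> space (prob_algebra S)" and M': "M' \<in> space (prob_algebra S)"
    and X: "X \<in> borel_measurable S" "\<And>x. x \<in> space S \<Longrightarrow> X x \<in> {0..1}"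
    and Z: "Z \<in> borel_measurable S" "\<And>x. x \<in> space S \<Longrightarrow> Z x \<in> {0..1}"
    and eq: "\<And>k. (\<integral>x. Z x * X x ^ k \<partial>M) = (\<integral>x. Z x * X x ^ k \<partial>M')"
    and A: "A \<in> sets borel"
  shows "(\<integral>x. Z x * indicator A (X x) \<partial>M) = (\<integral>x. Z x * indicator A (X x) \<partial>M')"
proof -
  note [measurable] = X(1) Z(1)
  define L where "L M f = (\<integral>x. Z x * f (X x) \<partial>M)" for M and f :: "real \<Rightarrow> real"
  have lim: "(\<lambda>n. L M (q n)) \<longlonglongrightarrow> L M f"
    if M: "M \<in> space (prob_algebra S)" and q: "\<And>n. q n \<in> borel_measurable borel" "\<And>n x. x \<in> {0..1} \<Longrightarrow> \<bar>q n x\<bar> \<le> K"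
      "\<And>x. x \<in> {0..1} \<Longrightarrow> (\<lambda>n. q n x) \<longlonglongrightarrow> f x" and f: "f \<in> borel_measurable borel" for M f q K
  proof -
    note [measurable] = q(1) f
    have s: "sets M = sets S" and p: "prob_space M" using M by (auto simp: space_prob_algebra)
    interpret prob_space M by fact
    have sp: "space M = space S" by (rule sets_eq_imp_space_eq[OF s])
    show ?thesis unfolding L_def
    proof (rule integral_dominated_convergence[where w = "\<lambda>_. K"])
      show "(\<lambda>x. Z x * f (X x)) \<in> borel_measurable M" "(\<lambda>x. Z x * q n (X x)) \<in> borel_measurable M" for n
        unfolding measurable_cong_sets[OF s refl] by measurable
      show "AE x in M. (\<lambda>n. Z x * q n (X x)) \<longlonglongrightarrow> Z x * f (X x)"
        using X(2) q(3) sp by (intro AE_I2 tendsto_intros) auto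
      show "AE x in M. norm (Z x * q n (X x)) \<le> K" for n
      proof (rule AE_I2)
        fix x assume "x \<in> space M"
        then have "X x \<in> {0..1}" "Z x \<in> {0..1}" using X(2) Z(2) sp by auto
        then have "\<bar>Z x\<bar> * \<bar>q n (X x)\<bar> \<le> 1 * K" using q(2)[of "X x" n] by (intro mult_mono) auto
        then show "norm (Z x * q n (X x)) \<le> K" by (simp add: abs_mult)
      qed
    qed simp
  qed
  have int: "integrable N (\<lambda>x. Z x * X x ^ k)" if "N \<in> space (prob_algebra S)" for N k
  proof (rule integrable_bounded_prob[OF that, where B = 1])
    show "(\<lambda>x. Z x * X x ^ k) \<in> borel_measurable S" by measurable
    show "\<bar>Z x * X x ^ k\<bar> \<le> 1" if "x \<in> space S" for x
      using X(2)[OF that] Z(2)[OF that] by (auto simp: abs_mult power_abs intro!: mult_le_one power_le_one)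
  qed
  have poly: "L M (poly p) = L M' (poly p)" for p
  proof -
    have *: "L N (poly p) = (\<Sum>k\<le>degree p. Polynomial.coeff p k * (\<integral>x. Z x * X x ^ k \<partial>N))"
      if "N \<in> space (prob_algebra S)" for N
    proof -
      have "L N (poly p) = (\<integral>x. (\<Sum>k\<le>degree p. Polynomial.coeff p k * (Z x * X x ^ k)) \<partial>N)"
        unfolding L_def by (simp add: poly_altdef sum_distrib_left mult.left_commute)
      also have "\<dots> = (\<Sum>k\<le>degree p. Polynomial.coeff p k * (\<integral>x. Z x * X x ^ k \<partial>N))"
        using int[OF that] by (subst Bochner_Integration.integral_sum) auto
      finally show ?thesis .
    qed
    show ?thesis unfolding *[OF M] *[OF M'] eq ..
  qed
  have polyb: "poly p \<in> borel_measurable borel" for p :: "real poly"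
    by (intro borel_measurable_continuous_onI continuous_intros)
  have half: "L M (indicator {t<..}) = L M' (indicator {t<..})" for t
  proof (rule poly_functional_eq[where L = "L M" and L' = "L M'" and f = "indicator {t<..}" and c = 0 and d = 1
        and K = 1 and g = "\<lambda>n x. min 1 (max 0 (real n * (x - t)))"])
    show "(\<lambda>n. L M (poly (q n))) \<longlonglongrightarrow> L M (indicator {t<..})"
      if "\<And>n x. x \<in> {0..1} \<Longrightarrow> \<bar>poly (q n) x\<bar> \<le> 1 + 1"
        "\<And>x. x \<in> {0..1} \<Longrightarrow> (\<lambda>n. poly (q n) x) \<longlonglongrightarrow> indicator {t<..} x" for q
      by (rule lim[OF M polyb that]) auto
    show "(\<lambda>n. L M' (poly (q n))) \<longlonglongrightarrow> L M' (indicator {t<..})"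
      if "\<And>n x. x \<in> {0..1} \<Longrightarrow> \<bar>poly (q n) x\<bar> \<le> 1 + 1"
        "\<And>x. x \<in> {0..1} \<Longrightarrow> (\<lambda>n. poly (q n) x) \<longlonglongrightarrow> indicator {t<..} x" for q
      by (rule lim[OF M' polyb that]) auto
    show "continuous_on {0..1} (\<lambda>x. min 1 (max 0 (real n * (x - t))))" for n by (intro continuous_intros)
    show "\<bar>min 1 (max 0 (real n * (x - t)))\<bar> \<le> 1" for n x by (auto simp: min_def max_def)
    show "(\<lambda>n. min 1 (max 0 (real n * (x - t)))) \<longlonglongrightarrow> indicator {t<..} x" for x by (rule half_line_indicator_limit)
  qed (rule poly)
  define \<mu> where "\<mu> N = distr (density N (\<lambda>x. ennreal (Z x))) borel X" for N
  have \<mu>: "emeasure (\<mu> N) B = ennreal (L N (indicator B))" if N: "N \<in> space (prob_algebra S)" and B: "B \<in> sets borel" for N B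
  proof -
    have s: "sets N = sets S" using N by (auto simp: space_prob_algebra)
    have sp: "space N = space S" by (rule sets_eq_imp_space_eq[OF s])
    have [measurable]: "X \<in> borel_measurable N" "Z \<in> borel_measurable N" using X(1) Z(1) s by (auto cong: measurable_cong_sets)
    note [measurable] = B
    have "emeasure (\<mu> N) B = (\<integral>\<^sup>+x. ennreal (Z x) * indicator (X -` B \<inter> space N) x \<partial>N)"
      unfolding \<mu>_def by (subst emeasure_distr) (auto simp: emeasure_density)
    also have "\<dots> = (\<integral>\<^sup>+x. ennreal (Z x * indicator B (X x)) \<partial>N)"
      by (intro nn_integral_cong) (auto simp: indicator_def)
    also have "\<dots> = ennreal (L N (indicator B))"
      unfolding L_def
    proof (rule nn_integral_eq_integral)
      show "integrable N (\<lambda>x. Z x * indicator B (X x))"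
      proof (rule integrable_bounded_prob[OF N, where B = 1])
        show "(\<lambda>x. Z x * indicator B (X x)) \<in> borel_measurable S" by measurable
        show "\<bar>Z x * indicator B (X x)\<bar> \<le> 1" if "x \<in> space S" for x using Z(2)[OF that] by (auto simp: indicator_def)
      qed
      show "AE x in N. 0 \<le> Z x * indicator B (X x)" using Z(2) sp by (intro AE_I2) auto
    qed
    finally show ?thesis .
  qed
  have "\<mu> M = \<mu> M'"
  proof (rule measure_eqI_lessThan)
    show "sets (\<mu> M) = sets borel" "sets (\<mu> M') = sets borel" by (simp_all add: \<mu>_def)
    show "emeasure (\<mu> M) {x<..} < \<infinity>" "emeasure (\<mu> M) {x<..} = emeasure (\<mu> M') {x<..}" for x
      using half[of x] by (simp_all add: \<mu>[OF M] \<mu>[OF M'])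
  qed
  then have "ennreal (L M (indicator A)) = ennreal (L M' (indicator A))" using \<mu>[OF M A] \<mu>[OF M' A] by simp
  moreover have "0 \<le> L N (indicator A)" if "N \<in> space (prob_algebra S)" for N
  proof -
    have "space N = space S" using that sets_eq_imp_space_eq by (auto simp: space_prob_algebra)
    then show ?thesis unfolding L_def using Z(2) by (intro integral_nonneg_AE AE_I2) auto
  qed
  ultimately show ?thesis using M M' by (simp add: L_def)
qed

text \<open>Coordinates pass from powers to indicators one at a time. The induction keeps an
  arbitrary monomial \<open>js\<close>, to which the powers of the next coordinate are
  appended.\<close>

lemma joint_law_eq:
  fixes X :: "'a \<Rightarrow> nat \<Rightarrow> real"
  assumes M: "M \<in> space (prob_algebra S)" and M': "M' \<in> space (prob_algebra S)"
    and X: "\<And>j. (\<lambda>x. X x j) \<in> borel_measurable S" "\<And>x j. x \<in> space S \<Longrightarrow> X x j \<in> {0..1}"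
    and eq: "\<And>js. (\<integral>x. (\<Prod>j\<leftarrow>js. X x j) \<partial>M) = (\<integral>x. (\<Prod>j\<leftarrow>js. X x j) \<partial>M')"
  shows "distr M (\<Pi>\<^sub>M j\<in>UNIV. borel) X = distr M' (\<Pi>\<^sub>M j\<in>UNIV. borel) X"
proof -
  note [measurable] = X(1)
  have mon: "(\<lambda>x. \<Prod>j\<leftarrow>js. X x j) \<in> borel_measurable S" for js by (induction js) auto
  have mon01: "(\<Prod>j\<leftarrow>js. X x j) \<in> {0..1}" if "x \<in> space S" for x js
    using X(2)[OF that] by (induction js) (auto intro: mult_le_one)
  have ind: "(\<integral>x. (\<Prod>j\<in>J. indicator (A j) (X x j)) * (\<Prod>j\<leftarrow>js. X x j) \<partial>M)
      = (\<integral>x. (\<Prod>j\<in>J. indicator (A j) (X x j)) * (\<Prod>j\<leftarrow>js. X x j) \<partial>M')"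
    if "finite J" "\<And>j. j \<in> J \<Longrightarrow> A j \<in> sets borel" for J js and A :: "nat \<Rightarrow> real set"
    using that
  proof (induction J arbitrary: js rule: finite_induct)
    case empty
    then show ?case using eq by simp
  next
    case (insert j J)
    let ?Z = "\<lambda>x. (\<Prod>j\<in>J. indicator (A j) (X x j)) * (\<Prod>j\<leftarrow>js. X x j)"
    have [measurable]: "A i \<in> sets borel" if "i \<in> insert j J" for i using insert.prems that by auto
    have "(\<integral>x. ?Z x * indicator (A j) (X x j) \<partial>M) = (\<integral>x. ?Z x * indicator (A j) (X x j) \<partial>M')"
    proof (rule weighted_law_eq[OF M M' X(1)])
      show "X x j \<in> {0..1}" if "x \<in> space S" for x by (rule X(2)[OF that])
      show "?Z \<in> borel_measurable S"
        by (intro borel_measurable_times mon borel_measurable_prod borel_measurable_indicator' measurable_compose[OF X(1)])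
           (auto intro!: borel_measurable_indicator)
      show "?Z x \<in> {0..1}" if "x \<in> space S" for x
        using mon01[OF that, of js] prod_le_1[of J "\<lambda>j. indicator (A j) (X x j) :: real"]
        by (auto intro!: mult_le_one mult_nonneg_nonneg prod_nonneg simp: indicator_def)
      show "(\<integral>x. ?Z x * X x j ^ k \<partial>M) = (\<integral>x. ?Z x * X x j ^ k \<partial>M')" for k
        using insert.IH[of "js @ replicate k j"] insert.prems by (simp add: mult.assoc prod_list_replicate)
      show "A j \<in> sets borel" using insert.prems by auto
    qed
    then show ?case using insert.hyps by (simp add: mult_ac)
  qed
  have sM: "sets M = sets S" "sets M' = sets S" and pM: "prob_space M" "prob_space M'"
    using M M' by (auto simp: space_prob_algebra)
  have sp: "space M = space S" "space M' = space S" using sM by (auto dest: sets_eq_imp_space_eq)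
  have XS: "X \<in> S \<rightarrow>\<^sub>M (\<Pi>\<^sub>M j\<in>UNIV. borel)" by (intro measurable_PiM_single') (auto intro: X(1))
  then have XM: "X \<in> M \<rightarrow>\<^sub>M (\<Pi>\<^sub>M j\<in>UNIV. borel)" "X \<in> M' \<rightarrow>\<^sub>M (\<Pi>\<^sub>M j\<in>UNIV. borel)"
    using sM by (auto cong: measurable_cong_sets)
  show ?thesis
  proof (rule measure_eqI_PiM_infinite)
    fix A :: "nat \<Rightarrow> real set" and J :: "nat set"
    assume J: "finite J" "\<And>i. i \<in> J \<Longrightarrow> A i \<in> sets borel"
    define C where "C = prod_emb UNIV (\<lambda>_. borel) J (Pi\<^sub>E J A)"
    have C: "C \<in> sets (\<Pi>\<^sub>M j\<in>UNIV. borel)" unfolding C_def using J by (intro sets_PiM_I) auto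
    have inC: "X x \<in> C \<longleftrightarrow> (\<forall>j\<in>J. X x j \<in> A j)" for x by (auto simp: C_def prod_emb_def PiE_iff)
    have e: "emeasure (distr N (\<Pi>\<^sub>M j\<in>UNIV. borel) X) C = ennreal (\<integral>x. (\<Prod>j\<in>J. indicator (A j) (X x j)) * (\<Prod>j\<leftarrow>[]. X x j) \<partial>N)"
      if N: "N \<in> space (prob_algebra S)" and XN: "X \<in> N \<rightarrow>\<^sub>M (\<Pi>\<^sub>M j\<in>UNIV. borel)" for N
    proof -
      interpret N: prob_space N using N by (simp add: space_prob_algebra)
      have "emeasure (distr N (\<Pi>\<^sub>M j\<in>UNIV. borel) X) C = emeasure N (X -` C \<inter> space N)"
        by (rule emeasure_distr[OF XN C])
      also have "\<dots> = ennreal (\<integral>x. indicator (X -` C \<inter> space N) x \<partial>N)"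
        using measurable_sets[OF XN C] by (simp add: N.emeasure_eq_measure)
      also have "(\<integral>x. indicator (X -` C \<inter> space N) x \<partial>N) = (\<integral>x. (\<Prod>j\<in>J. indicator (A j) (X x j)) * (\<Prod>j\<leftarrow>[]. X x j) \<partial>N)"
      proof (intro Bochner_Integration.integral_cong refl)
        fix x assume x: "x \<in> space N"
        show "(indicator (X -` C \<inter> space N) x :: real) = (\<Prod>j\<in>J. indicator (A j) (X x j)) * (\<Prod>j\<leftarrow>[]. X x j)"
        proof (cases "X x \<in> C")
          case True
          then show ?thesis using inC x by simp
        next
          case False
          then have "(\<Prod>j\<in>J. indicator (A j) (X x j) :: real) = 0" using inC J(1) by (auto intro!: prod_zero simp: indicator_def)
          then show ?thesis using False by simp
        qed
      qed
      finally show ?thesis .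
    qed
    show "emeasure (distr M (\<Pi>\<^sub>M j\<in>UNIV. borel) X) (prod_emb UNIV (\<lambda>_. borel) J (Pi\<^sub>E J A))
        = emeasure (distr M' (\<Pi>\<^sub>M j\<in>UNIV. borel) X) (prod_emb UNIV (\<lambda>_. borel) J (Pi\<^sub>E J A))"
      unfolding C_def[symmetric] e[OF M XM(1)] e[OF M' XM(2)] using ind[OF J(1), of A "[]"] J(2) by simp
  next
    interpret D: prob_space "distr M (\<Pi>\<^sub>M j\<in>UNIV. borel) X" by (rule prob_space.prob_space_distr[OF pM(1) XM(1)])
    show "finite_measure (distr M (\<Pi>\<^sub>M j\<in>UNIV. borel) X)" by (rule D.finite_measure_axioms)
  qed simp_all
qed

theorem omega_measure_eqI:
  assumes M: "M \<in> space (prob_algebra Omega_borel)" and M': "M' \<in> space (prob_algebra Omega_borel)"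
    and eq: "\<And>js. (\<integral>\<omega>. (\<Prod>j\<leftarrow>js. Psi \<omega> (pt j)) \<partial>M) = (\<integral>\<omega>. (\<Prod>j\<leftarrow>js. Psi \<omega> (pt j)) \<partial>M')"
  shows "M = M'"
proof (rule measure_eq_of_psi_law[OF M M'])
  show "distr M (\<Pi>\<^sub>M j\<in>UNIV. borel) psi_seq = distr M' (\<Pi>\<^sub>M j\<in>UNIV. borel) psi_seq"
    using eq Psi_bounds[OF _ pt] unfolding psi_seq_def
    by (intro joint_law_eq[OF M M'] Psi_measurable pt) (auto simp: space_Omega_borel)
qed

section \<open>Jacobi alternants\<close>

text \<open>The Jacobi weight for a = b = -1/2, which dominates the others up to a constant. Its
  antiderivative arcsin has finite limits at both ends.\<close>

lemma integrable_inverse_sqrt: "set_integrable lborel {-1<..<1::real} (\<lambda>x. inverse (sqrt (1 - x\<^sup>2)))"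
proof -
  have lim: "((arcsin \<circ> real_of_ereal) \<longlongrightarrow> arcsin (-1)) (at_right (ereal (-1)))"
    "((arcsin \<circ> real_of_ereal) \<longlongrightarrow> arcsin 1) (at_left (ereal 1))"
  proof -
    have c: "continuous_on {-1..1} arcsin" by (rule continuous_on_arcsin')
    have "(arcsin \<longlongrightarrow> arcsin (-1)) (at (-1) within {-1..1})" "(arcsin \<longlongrightarrow> arcsin 1) (at 1 within {-1..1})"
      by (rule c[unfolded continuous_on, THEN bspec], simp)+
    then have "(arcsin \<longlongrightarrow> arcsin (-1)) (at_right (-1))" "(arcsin \<longlongrightarrow> arcsin 1) (at_left 1)"
      by (simp_all add: at_within_Icc_at_right at_within_Icc_at_left)
    then show "((arcsin \<circ> real_of_ereal) \<longlongrightarrow> arcsin (-1)) (at_right (ereal (-1)))"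
      "((arcsin \<circ> real_of_ereal) \<longlongrightarrow> arcsin 1) (at_left (ereal 1))"
      by (simp_all only: ereal_tendsto_simps)
  qed
  have pos: "1 - x\<^sup>2 > 0" if "-1 < x" "x < 1" for x :: real
    using that by (simp add: abs_square_less_1 abs_less_iff)
  have "set_integrable lborel (einterval (ereal (-1)) (ereal 1)) (\<lambda>x. inverse (sqrt (1 - x\<^sup>2)))"
  proof (rule interval_integral_FTC_nonneg(1)[OF _ _ _ _ lim])
    show "DERIV arcsin x :> inverse (sqrt (1 - x\<^sup>2))" if "ereal (-1) < ereal x" "ereal x < ereal 1" for x
      using that by (intro DERIV_arcsin) auto
    show "isCont (\<lambda>x. inverse (sqrt (1 - x\<^sup>2))) x" if "ereal (-1) < ereal x" "ereal x < ereal 1" for x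
      using pos[of x] that by (intro continuous_intros) auto
    show "AE x in lborel. ereal (-1) < ereal x \<longrightarrow> ereal x < ereal 1 \<longrightarrow> 0 \<le> inverse (sqrt (1 - x\<^sup>2))"
      using pos by (intro AE_I2) (auto intro: less_imp_le)
  qed simp
  then show ?thesis by simp
qed

lemma jacobi_weight_measurable [measurable]: "jacobi_weight a b \<in> borel_measurable borel"
  unfolding jacobi_weight_def by measurable

lemma jacobi_weight_nonneg: "0 \<le> jacobi_weight a b x"
  by (simp add: jacobi_weight_def)

lemma jacobi_weight_integrable:
  assumes "a \<ge> -1/2" "b \<ge> -1/2"
  shows "set_integrable lborel {-1..1} (jacobi_weight a b)"
proof -
  define C where "C = (2::real) powr (a + 1/2) * 2 powr (b + 1/2)"
  have bound: "jacobi_weight a b x \<le> C * inverse (sqrt (1 - x\<^sup>2))" if x: "-1 < x" "x < 1" for x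
  proof -
    \<comment> \<open>Among the admissible exponents -1/2 is the most singular at 0; the remaining
      power of \<open>y\<close> is bounded because \<open>y \<le> 2\<close>.\<close>
    have p: "(y::real) powr c \<le> 2 powr (c + 1/2) * y powr (-1/2)" if "0 < y" "y \<le> 2" "c \<ge> -1/2" for y c
    proof -
      have "y powr c = y powr (c + 1/2) * y powr (-1/2)" by (simp add: powr_add[symmetric])
      also have "\<dots> \<le> 2 powr (c + 1/2) * y powr (-1/2)" using that by (intro mult_right_mono powr_mono2) auto
      finally show ?thesis .
    qed
    have "jacobi_weight a b x \<le> (2 powr (a + 1/2) * (1 - x) powr (-1/2)) * (2 powr (b + 1/2) * (1 + x) powr (-1/2))"
      unfolding jacobi_weight_def using x assms by (intro mult_mono p) auto
    also have "\<dots> = C * ((1 - x) * (1 + x)) powr (-1/2)" using x by (simp add: C_def powr_mult mult_ac)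
    also have "(1 - x) * (1 + x) = 1 - x\<^sup>2" by (simp add: power2_eq_square algebra_simps)
    also have "(1 - x\<^sup>2) powr (-1/2) = inverse (sqrt (1 - x\<^sup>2))"
      using x by (simp add: powr_minus powr_half_sqrt abs_square_le_1)
    finally show ?thesis .
  qed
  have "set_integrable lborel {-1<..<1} (jacobi_weight a b)"
  proof (rule set_integrable_bound[OF set_integrable_mult_right[OF integrable_inverse_sqrt, of C]])
    show "set_borel_measurable lborel {-1<..<1} (jacobi_weight a b)" unfolding set_borel_measurable_def by measurable
    show "AE x in lborel. x \<in> {-1<..<1} \<longrightarrow> norm (jacobi_weight a b x) \<le> norm (C * inverse (sqrt (1 - x\<^sup>2)))"
    proof (intro AE_I2 impI)
      fix x :: real assume "x \<in> {-1<..<1}"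
      then have "jacobi_weight a b x \<le> C * inverse (sqrt (1 - x\<^sup>2))" by (intro bound) auto
      then show "norm (jacobi_weight a b x) \<le> norm (C * inverse (sqrt (1 - x\<^sup>2)))"
        using jacobi_weight_nonneg[of a b x] unfolding real_norm_def by linarith
    qed
  qed
  moreover have "AE x in lborel. (x \<in> {-1<..<1}) = (x \<in> {-1..1::real})"
    using AE_lborel_singleton[of "-1::real"] AE_lborel_singleton[of "1::real"] by eventually_elim auto
  ultimately show ?thesis
    unfolding set_integrable_def
    by (subst (asm) integrable_cong_AE[where g = "\<lambda>x. indicator {-1..1} x *\<^sub>R jacobi_weight a b x"])
       (auto elim!: eventually_mono simp: indicator_def)
qed

section \<open>Reference measures on the interval and the cube\<close>

definition Bm :: "real measure" where "Bm = restrict_space lborel {-1..1}"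
definition Pm :: "nat \<Rightarrow> (nat \<Rightarrow> real) measure" where "Pm N = (\<Pi>\<^sub>M i\<in>{..<N}. Bm)"

lemma space_Bm: "space Bm = {-1..1}" by (simp add: Bm_def space_restrict_space)

lemma sets_Bm [measurable_cong]: "sets Bm = sets (restrict_space borel {-1..1})"
  by (simp add: Bm_def sets_restrict_space)

lemma emeasure_Bm: "A \<in> sets borel \<Longrightarrow> A \<subseteq> {-1..1} \<Longrightarrow> emeasure Bm A = emeasure lborel A"
  unfolding Bm_def by (intro emeasure_restrict_space) auto

lemma finite_Bm: "finite_measure Bm"
  by (rule finite_measureI) (simp add: emeasure_Bm space_Bm)

interpretation Bm: finite_measure Bm by (rule finite_Bm)
interpretation BP: product_sigma_finite "\<lambda>i::nat. Bm" ..

lemma Bm_measurable: "f \<in> borel_measurable borel \<Longrightarrow> f \<in> borel_measurable Bm"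
  unfolding measurable_cong_sets[OF sets_Bm refl] by (rule measurable_restrict_space1)

lemma space_Pm: "x \<in> space (Pm N) \<Longrightarrow> i < N \<Longrightarrow> x i \<in> {-1..1}"
  unfolding Pm_def space_PiM space_Bm by (erule PiE_mem) (rule lessThan_iff[THEN iffD2])

lemma Pm_component [measurable]: "i < N \<Longrightarrow> (\<lambda>x. x i) \<in> Pm N \<rightarrow>\<^sub>M Bm"
  unfolding Pm_def by (rule measurable_component_singleton) (rule lessThan_iff[THEN iffD2])

lemma AE_Pm_component:
  assumes i: "i < N" and A: "A \<in> sets Bm" "emeasure Bm A = 0"
  shows "AE x in Pm N. x i \<notin> A"
proof -
  interpret finite_product_sigma_finite "\<lambda>i::nat. Bm" "{..<N}" by standard simp
  define S where "S j = (if j = i then A else space Bm)" for j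
  have "emeasure (Pm N) (Pi\<^sub>E {..<N} S) = (\<Prod>j<N. emeasure Bm (S j))"
    unfolding Pm_def using A by (intro measure_times) (auto simp: S_def)
  also have "\<dots> = 0" using i A by (intro prod_zero) (auto simp: S_def)
  finally have e: "emeasure (Pm N) (Pi\<^sub>E {..<N} S) = 0" .
  show ?thesis
  proof (rule AE_I[OF _ e])
    show "{x \<in> space (Pm N). \<not> x i \<notin> A} \<subseteq> Pi\<^sub>E {..<N} S"
      by (auto simp: Pm_def space_PiM S_def PiE_iff extensional_def)
    show "Pi\<^sub>E {..<N} S \<in> sets (Pm N)" unfolding Pm_def using A by (intro sets_PiM_I_finite) (auto simp: S_def)
  qed
qed

text \<open>With coordinate \<open>i\<close> integrated first, the section of a diagonal is a single
  point. Off the diagonals \<open>vandermonde\<close> is nonzero and \<open>jacobi_multi\<close> is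
  an ordinary quotient.\<close>

lemma AE_Pm_distinct: "AE x in Pm N. inj_on x {..<N}"
proof -
  have "AE x in Pm N. x i \<noteq> x j" if ij: "i < N" "j < N" "i \<noteq> j" for i j
  proof -
    define I where "I = {..<N} - {i}"
    have I: "finite I" "i \<notin> I" "insert i I = {..<N}" "j \<in> I" using ij by (auto simp: I_def)
    let ?f = "\<lambda>x. indicator {x\<in>space (Pm N). x i = x j} x :: ennreal"
    have m: "{x\<in>space (Pm N). x i = x j} \<in> sets (Pm N)"
    proof -
      have [measurable]: "(\<lambda>x. x i) \<in> borel_measurable (Pm N)" "(\<lambda>x. x j) \<in> borel_measurable (Pm N)"
        using measurable_compose[OF Pm_component Bm_measurable[of "\<lambda>x. x"]] ij by auto
      show ?thesis by measurable
    qed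
    have "emeasure (Pm N) {x\<in>space (Pm N). x i = x j} = integral\<^sup>N (PiM (insert i I) (\<lambda>_. Bm)) ?f"
      unfolding I(3) Pm_def[symmetric] using m by (simp add: nn_integral_indicator)
    also have "\<dots> = (\<integral>\<^sup>+x. (\<integral>\<^sup>+y. ?f (x(i := y)) \<partial>Bm) \<partial>PiM I (\<lambda>_. Bm))"
      using m I by (intro BP.product_nn_integral_insert) (auto simp: Pm_def)
    also have "\<dots> = (\<integral>\<^sup>+x. 0 \<partial>PiM I (\<lambda>_. Bm))"
    proof (rule nn_integral_cong)
      fix x assume "x \<in> space (PiM I (\<lambda>_. Bm))"
      have xj: "x j \<in> {-1..1}" using \<open>x \<in> space _\<close> I(4) by (auto simp: space_PiM space_Bm)
      have "(\<integral>\<^sup>+y. ?f (x(i := y)) \<partial>Bm) \<le> (\<integral>\<^sup>+y. indicator {x j} y \<partial>Bm)"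
        using ij by (intro nn_integral_mono) (auto simp: indicator_def)
      also have "\<dots> = emeasure Bm {x j}"
        using xj by (intro nn_integral_indicator) (auto simp: sets_Bm sets_restrict_space_iff)
      also have "\<dots> = 0" using xj by (subst emeasure_Bm) auto
      finally show "(\<integral>\<^sup>+y. ?f (x(i := y)) \<partial>Bm) = 0" by simp
    qed
    finally have "emeasure (Pm N) {x\<in>space (Pm N). x i = x j} = 0" by simp
    then show ?thesis using m by (intro AE_I[of _ _ "{x\<in>space (Pm N). x i = x j}"]) auto
  qed
  then have "AE x in Pm N. i \<noteq> j \<longrightarrow> x i \<noteq> x j" if "i < N" "j < N" for i j
    using that by (intro AE_impI) auto
  then have "AE x in Pm N. \<forall>i\<in>{..<N}. \<forall>j\<in>{..<N}. i \<noteq> j \<longrightarrow> x i \<noteq> x j"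
    by (intro AE_finite_allI) auto
  then show ?thesis by (rule eventually_mono) (auto simp: inj_on_def)
qed

text \<open>The value at \<open>i\<close> is the largest element of the common image that has not
  occurred at a smaller index.\<close>

lemma strict_on_eq_of_image:
  assumes n: "strict_on N n" and m: "strict_on N m" and im: "n ` {..<N} = m ` {..<N}" and i: "i < N"
  shows "n i = m i"
  using i
proof (induction i rule: less_induct)
  case (less i)
  have inj: "inj_on k {..<N}" if "strict_on N k" for k
    using that by (auto simp: strict_on_def inj_on_def) (metis linorder_neqE_nat less_irrefl)
  have le: "k i \<le> l i" if k: "strict_on N k" and l: "strict_on N l" and im: "k ` {..<N} = l ` {..<N}"
    and same: "\<And>j. j < i \<Longrightarrow> k j = l j" for k l
  proof -
    have "k i \<in> l ` {..<N}" using im less.prems by blast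
    then obtain j where j: "j < N" "k i = l j" by auto
    have "\<not> j < i"
    proof
      assume "j < i"
      then have "k j = k i" using same j by simp
      moreover have "k i < k j" using k \<open>j < i\<close> less.prems by (auto simp: strict_on_def)
      ultimately show False by simp
    qed
    then show ?thesis using l j by (cases "i = j") (auto simp: strict_on_def intro: less_imp_le)
  qed
  show ?case using le[OF n m im] le[OF m n im[symmetric]] less by (intro antisym) auto
qed

lemma GT_eq_of_image:
  assumes "lam \<in> GT N" "\<mu> \<in> GT N" "shifted N lam ` {..<N} = shifted N \<mu> ` {..<N}"
  shows "lam = \<mu>"
  by (rule GT_eqI[OF assms(1,2)])
     (rule strict_on_eq_of_image[OF strict_on_shifted[OF assms(1)] strict_on_shifted[OF assms(2)] assms(3)])

section \<open>Orthogonality of Jacobi alternants\<close>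

locale jacobi =
  fixes a b :: real and p :: "nat \<Rightarrow> real poly"
  assumes ab: "a \<ge> -1/2" "b \<ge> -1/2" and jacobi: "jacobi_polys a b p"
begin

abbreviation "w \<equiv> jacobi_weight a b"

definition ww :: "nat \<Rightarrow> (nat \<Rightarrow> real) \<Rightarrow> real" where "ww N x = (\<Prod>i<N. w (x i))"

text \<open>The squared Vandermonde of \<open>H_norm2\<close> is moved into the functions:
  multiplication by \<open>vandermonde\<close> turns \<open>Phi\<close> into a multiple of the
  alternant \<open>D\<close>, and orthogonality becomes that of an ordinary L^2 space with product
  weight.\<close>

definition Pw :: "nat \<Rightarrow> (nat \<Rightarrow> real) measure" where "Pw N = density (Pm N) (\<lambda>x. ennreal (ww N x))"

lemma w_integrable: "integrable Bm w"
  using jacobi_weight_integrable[OF ab] unfolding Bm_def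
  by (subst integrable_restrict_space) (auto simp: set_integrable_def)

lemma w_mult_integrable:
  assumes f: "f \<in> borel_measurable borel" "\<And>x. x \<in> {-1..1} \<Longrightarrow> \<bar>f x\<bar> \<le> C"
  shows "integrable Bm (\<lambda>x. f x * w x)"
proof (rule Bochner_Integration.integrable_bound[OF integrable_mult_right[OF w_integrable, of C]])
  show "(\<lambda>x. f x * w x) \<in> borel_measurable Bm" using f(1) by (intro borel_measurable_times Bm_measurable) auto
  show "AE x in Bm. norm (f x * w x) \<le> norm (C * w x)"
  proof (intro AE_I2)
    fix x assume "x \<in> space Bm"
    then have "\<bar>f x\<bar> * w x \<le> C * w x" using f(2) jacobi_weight_nonneg[of a b x] by (intro mult_right_mono) (auto simp: space_Bm)
    moreover have "C * w x \<le> \<bar>C\<bar> * w x" using jacobi_weight_nonneg[of a b x] by (intro mult_right_mono) auto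
    ultimately show "norm (f x * w x) \<le> norm (C * w x)"
      using jacobi_weight_nonneg[of a b x] by (simp add: abs_mult)
  qed
qed

lemma coord_measurable: "f \<in> borel_measurable borel \<Longrightarrow> i < N \<Longrightarrow> (\<lambda>x. f (x i)) \<in> borel_measurable (Pm N)"
  using measurable_compose[OF Pm_component Bm_measurable] .

lemma ww_measurable [measurable]: "ww N \<in> borel_measurable (Pm N)"
  unfolding ww_def by (intro borel_measurable_prod coord_measurable) auto

lemma ww_nonneg: "0 \<le> ww N x" by (auto simp: ww_def intro!: prod_nonneg jacobi_weight_nonneg)

lemma space_Pw: "space (Pw N) = space (Pm N)" and sets_Pw: "sets (Pw N) = sets (Pm N)"
  by (simp_all add: Pw_def)

lemma measurable_Pw: "f \<in> borel_measurable (Pm N) \<Longrightarrow> f \<in> borel_measurable (Pw N)"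
  by (simp add: Pw_def)

lemma finite_Pw: "finite_measure (Pw N)"
proof (rule finite_measureI)
  have "emeasure (Pw N) (space (Pw N)) = (\<integral>\<^sup>+x. ennreal (ww N x) \<partial>Pm N)"
    unfolding Pw_def by (subst emeasure_density) (auto simp: nn_integral_indicator intro!: nn_integral_cong)
  also have "\<dots> = (\<integral>\<^sup>+x. (\<Prod>i<N. ennreal (w (x i))) \<partial>Pm N)"
    by (simp add: ww_def prod_ennreal jacobi_weight_nonneg)
  also have "\<dots> = (\<Prod>i<N. \<integral>\<^sup>+x. ennreal (w x) \<partial>Bm)"
    unfolding Pm_def by (intro BP.product_nn_integral_prod) (auto intro!: measurable_compose[OF Bm_measurable])
  also have "(\<integral>\<^sup>+x. ennreal (w x) \<partial>Bm) = ennreal (\<integral>x. w x \<partial>Bm)"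
    by (intro nn_integral_eq_integral w_integrable) (auto intro!: AE_I2 jacobi_weight_nonneg)
  finally show "emeasure (Pw N) (space (Pw N)) \<noteq> \<infinity>" by (simp add: power_eq_top_ennreal)
qed

lemma integrable_Pw:
  fixes f :: "(nat \<Rightarrow> real) \<Rightarrow> real"
  assumes f: "f \<in> borel_measurable (Pm N)" "\<And>x. x \<in> space (Pm N) \<Longrightarrow> \<bar>f x\<bar> \<le> C"
  shows "integrable (Pw N) f"
proof -
  interpret finite_measure "Pw N" by (rule finite_Pw)
  show ?thesis using f by (intro integrable_const_bound[where B = C] AE_I2) (auto simp: space_Pw measurable_Pw)
qed

lemma poly_measurable: "poly q \<in> borel_measurable borel" for q :: "real poly"
  by (intro borel_measurable_continuous_onI continuous_intros)

lemma poly_bounded: "\<exists>C. \<forall>x\<in>{-1..1}. \<bar>poly q x\<bar> \<le> C" for q :: "real poly"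
proof -
  have "compact (poly q ` {-1..1})" by (intro compact_continuous_image continuous_intros) auto
  then obtain C where "\<And>x. x \<in> poly q ` {-1..1} \<Longrightarrow> norm x \<le> C" using compact_imp_bounded bounded_iff by metis
  then show ?thesis by auto
qed

lemma alternant_measurable [measurable]: "alternant N (\<lambda>j. poly (f j)) \<in> borel_measurable (Pm N)"
  unfolding alternant_def
  by (intro borel_measurable_sum borel_measurable_times borel_measurable_const borel_measurable_prod coord_measurable poly_measurable) auto

lemma alternant_bounded: "\<exists>C. \<forall>x\<in>space (Pm N). \<bar>alternant N (\<lambda>j. poly (f j)) x\<bar> \<le> C"
proof -
  have "\<forall>j. \<exists>c. \<forall>x\<in>{-1..1}. \<bar>poly (f j) x\<bar> \<le> c" using poly_bounded by blast
  then obtain c where c: "\<And>j x. x \<in> {-1..1} \<Longrightarrow> \<bar>poly (f j) x\<bar> \<le> c j" by metis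
  have "\<bar>alternant N (\<lambda>j. poly (f j)) x\<bar> \<le> (\<Sum>\<sigma> | \<sigma> permutes {..<N}. \<Prod>i<N. c (\<sigma> i))" if x: "x \<in> space (Pm N)" for x
  proof -
    have "\<bar>alternant N (\<lambda>j. poly (f j)) x\<bar> \<le> (\<Sum>\<sigma> | \<sigma> permutes {..<N}. \<bar>of_int (sign \<sigma>) * (\<Prod>i<N. poly (f (\<sigma> i)) (x i))\<bar>)"
      unfolding alternant_def by (rule sum_abs)
    also have "\<dots> = (\<Sum>\<sigma> | \<sigma> permutes {..<N}. \<Prod>i<N. \<bar>poly (f (\<sigma> i)) (x i)\<bar>)"
      by (intro sum.cong refl) (simp add: abs_mult abs_prod sign_def)
    also have "\<dots> \<le> (\<Sum>\<sigma> | \<sigma> permutes {..<N}. \<Prod>i<N. c (\<sigma> i))"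
      using c space_Pm[OF x] by (intro sum_mono prod_mono) auto
    finally show ?thesis .
  qed
  then show ?thesis by blast
qed

lemma integral_Pw: "f \<in> borel_measurable (Pm N) \<Longrightarrow> (\<integral>x. f x \<partial>Pw N) = (\<integral>x. ww N x * f x \<partial>Pm N)"
  unfolding Pw_def using ww_nonneg by (subst integral_real_density) auto

text \<open>Andreief's double sum over permutations is left uncollapsed: for orthogonality it is
  enough that every product of one-dimensional integrals vanishes.\<close>

lemma alternant_integral:
  "(\<integral>x. alternant N (\<lambda>j. poly (f j)) x * alternant N (\<lambda>j. poly (h j)) x \<partial>Pw N)
   = (\<Sum>\<sigma> | \<sigma> permutes {..<N}. \<Sum>\<tau> | \<tau> permutes {..<N}. of_int (sign \<sigma>) * of_int (sign \<tau>) *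
        (\<Prod>i<N. \<integral>t. poly (f (\<sigma> i)) t * poly (h (\<tau> i)) t * w t \<partial>Bm))"
proof -
  let ?g = "\<lambda>\<sigma> \<tau> i t. poly (f (\<sigma> i)) t * poly (h (\<tau> i)) t * w t"
  have int1: "integrable Bm (?g \<sigma> \<tau> i)" for \<sigma> \<tau> i
  proof -
    obtain C where C: "\<And>x. x \<in> {-1..1} \<Longrightarrow> \<bar>poly (f (\<sigma> i) * h (\<tau> i)) x\<bar> \<le> C" using poly_bounded by metis
    show ?thesis using w_mult_integrable[OF poly_measurable C] by simp
  qed
  have int: "integrable (Pm N) (\<lambda>x. \<Prod>i<N. ?g \<sigma> \<tau> i (x i))" for \<sigma> \<tau>
    unfolding Pm_def by (intro BP.product_integrable_prod int1) auto
  have "(\<integral>x. alternant N (\<lambda>j. poly (f j)) x * alternant N (\<lambda>j. poly (h j)) x \<partial>Pw N)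
      = (\<integral>x. ww N x * (alternant N (\<lambda>j. poly (f j)) x * alternant N (\<lambda>j. poly (h j)) x) \<partial>Pm N)"
    by (rule integral_Pw) measurable
  also have "\<dots> = (\<integral>x. (\<Sum>\<sigma> | \<sigma> permutes {..<N}. \<Sum>\<tau> | \<tau> permutes {..<N}. of_int (sign \<sigma>) * of_int (sign \<tau>) *
        (\<Prod>i<N. ?g \<sigma> \<tau> i (x i))) \<partial>Pm N)"
    unfolding alternant_def ww_def sum_product unfolding sum_distrib_left
    by (intro Bochner_Integration.integral_cong refl sum.cong) (simp add: prod.distrib mult_ac)
  also have "\<dots> = (\<Sum>\<sigma> | \<sigma> permutes {..<N}. \<Sum>\<tau> | \<tau> permutes {..<N}. of_int (sign \<sigma>) * of_int (sign \<tau>) *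
        (\<integral>x. (\<Prod>i<N. ?g \<sigma> \<tau> i (x i)) \<partial>Pm N))"
    using int by (simp add: Bochner_Integration.integral_sum)
  also have "\<dots> = (\<Sum>\<sigma> | \<sigma> permutes {..<N}. \<Sum>\<tau> | \<tau> permutes {..<N}. of_int (sign \<sigma>) * of_int (sign \<tau>) *
        (\<Prod>i<N. \<integral>t. ?g \<sigma> \<tau> i t \<partial>Bm))"
    unfolding Pm_def using int1 by (subst BP.product_integral_prod) auto
  finally show ?thesis .
qed

lemma jacobi_orthogonal: "j \<noteq> k \<Longrightarrow> (\<integral>t. poly (p j) t * poly (p k) t * w t \<partial>Bm) = 0"
  using jacobi unfolding jacobi_polys_def Bm_def
  by (subst integral_restrict_space) (auto simp: set_lebesgue_integral_def)

definition D :: "nat \<Rightarrow> nat list \<Rightarrow> (nat \<Rightarrow> real) \<Rightarrow> real" where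
  "D N lam = alternant N (\<lambda>j. poly (p (shifted N lam j)))"

text \<open>In a nonzero term the two permutations would match all degrees, and signatures with the
  same set of shifted parts are equal.\<close>

lemma D_orthogonal:
  assumes lam: "lam \<in> GT N" and \<mu>: "\<mu> \<in> GT N" and ne: "lam \<noteq> \<mu>"
  shows "(\<integral>x. D N lam x * D N \<mu> x \<partial>Pw N) = 0"
proof -
  have zero: "(\<Prod>i<N. \<integral>t. poly (p (shifted N lam (\<sigma> i))) t * poly (p (shifted N \<mu> (\<tau> i))) t * w t \<partial>Bm) = 0"
    if \<sigma>: "\<sigma> permutes {..<N}" and \<tau>: "\<tau> permutes {..<N}" for \<sigma> \<tau>
  proof -
    have "\<exists>i<N. shifted N lam (\<sigma> i) \<noteq> shifted N \<mu> (\<tau> i)"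
    proof (rule ccontr)
      assume "\<not> ?thesis"
      then have eq: "shifted N lam (\<sigma> i) = shifted N \<mu> (\<tau> i)" if "i < N" for i using that by auto
      have "shifted N lam ` {..<N} = shifted N lam ` \<sigma> ` {..<N}" by (simp add: permutes_image[OF \<sigma>])
      also have "\<dots> = shifted N \<mu> ` \<tau> ` {..<N}" using eq by (auto simp: image_iff)
      also have "\<dots> = shifted N \<mu> ` {..<N}" by (simp add: permutes_image[OF \<tau>])
      finally have "lam = \<mu>" by (rule GT_eq_of_image[OF lam \<mu>])
      then show False using ne by simp
    qed
    then obtain i where "i < N" "shifted N lam (\<sigma> i) \<noteq> shifted N \<mu> (\<tau> i)" by blast
    then show ?thesis using jacobi_orthogonal by (intro prod_zero bexI[of _ i]) auto
  qed
  show ?thesis unfolding D_def alternant_integral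
    by (intro sum.neutral ballI) (simp add: zero)
qed

end

section \<open>The coefficients of \<open>Lambda\<close>\<close>

lemma abs_mult_le_mult: "\<bar>u\<bar> \<le> C \<Longrightarrow> \<bar>v\<bar> \<le> C' \<Longrightarrow> \<bar>u * v\<bar> \<le> C * (C' :: real)"
  unfolding abs_mult by (rule mult_mono) auto

lemma vandermonde_alternant:
  "vandermonde N x = (-1) ^ (N * (N - 1) div 2) * alternant N (\<lambda>j. poly (Polynomial.monom 1 j)) x"
proof -
  have "alternant N (\<lambda>j. poly (Polynomial.monom 1 j)) x = alternant N (newton (\<lambda>_. 0)) x"
    by (rule alternant_cong) (simp add: newton_def poly_monom)
  then show ?thesis by (simp add: alternant_newton_vandermonde power_add[symmetric] power_mult_distrib[symmetric] mult.assoc[symmetric])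
qed

text \<open>Moving coordinate \<open>N\<close>, which the condition does not see, shows that the
  filter in \<open>jacobi_multi\<close> is nontrivial at such points, so that \<open>Lim\<close> has
  the expected value.\<close>

lemma distinct_islimpt:
  fixes x :: "nat \<Rightarrow> real"
  assumes "inj_on x {..<N}" shows "x islimpt {y. inj_on y {..<N}}"
  unfolding islimpt_def
proof (intro allI impI)
  fix T assume T: "x \<in> T" "open T"
  have "continuous_on UNIV (\<lambda>t. x(N := t))"
  proof (rule continuous_on_coordinatewise_then_product)
    show "continuous_on UNIV (\<lambda>t. (x(N := t)) i)" for i by (cases "i = N") (auto intro!: continuous_intros)
  qed
  then have "open ((\<lambda>t. x(N := t)) -` T)" using T(2) by (simp add: continuous_on_open_vimage)
  moreover have "x N \<in> (\<lambda>t. x(N := t)) -` T" using T(1) by simp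
  ultimately have "\<exists>t\<in>UNIV. t \<in> (\<lambda>t. x(N := t)) -` T \<and> t \<noteq> x N"
    using islimpt_UNIV[of "x N"] unfolding islimpt_def by blast
  then obtain t where t: "x(N := t) \<in> T" "t \<noteq> x N" by auto
  have "inj_on (x(N := t)) {..<N}" using assms by (auto simp: inj_on_def)
  moreover have "x(N := t) \<noteq> x" using t(2) by (metis fun_upd_same)
  ultimately show "\<exists>y\<in>{y. inj_on y {..<N}}. y \<in> T \<and> y \<noteq> x" using t(1) by blast
qed

lemma coordinate_continuous: "continuous_on S (\<lambda>x :: nat \<Rightarrow> real. x i)"
  by (rule continuous_on_subset[OF continuous_on_product_coordinates]) simp

lemma alternant_continuous: "continuous_on S (alternant N (\<lambda>j. poly (f j)))"
  unfolding alternant_def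
  by (intro continuous_on_sum continuous_on_mult continuous_on_const continuous_on_prod continuous_on_poly coordinate_continuous)

lemma vandermonde_nonzero: "inj_on x {..<N} \<Longrightarrow> vandermonde N x \<noteq> 0"
  unfolding vandermonde_def by (auto simp: inj_on_def)

lemma prob_Omega:
  assumes "\<nu> \<in> space (prob_algebra Omega_borel)"
  shows "prob_space \<nu>" "sets \<nu> = sets Omega_borel" "space \<nu> = Omega"
  using assms sets_eq_imp_space_eq[of \<nu> Omega_borel] by (auto simp: space_prob_algebra space_Omega_borel)

section \<open>Products of \<open>Psi\<close> and their means over \<omega>\<close>

definition Psi_prod :: "nat \<Rightarrow> omega \<Rightarrow> (nat \<Rightarrow> real) \<Rightarrow> real" where
  "Psi_prod N \<omega> x = (\<Prod>i<N. Psi \<omega> (x i))"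

definition mean_Psi :: "nat \<Rightarrow> omega measure \<Rightarrow> (nat \<Rightarrow> real) \<Rightarrow> real" where
  "mean_Psi N \<nu> x = (\<integral>\<omega>. Psi_prod N \<omega> x \<partial>\<nu>)"

lemma Psi_prod_bounds:
  assumes "\<omega> \<in> Omega" "\<And>i. i < N \<Longrightarrow> x i \<in> {-1..1}"
  shows "0 \<le> Psi_prod N \<omega> x" "Psi_prod N \<omega> x \<le> 1"
  unfolding Psi_prod_def using Psi_bounds[OF assms(1)] assms(2) by (auto intro!: prod_nonneg prod_le_1)

lemma Psi_prod_measurable_pair: "(\<lambda>(\<omega>, x). Psi_prod N \<omega> x) \<in> borel_measurable (Omega_borel \<Otimes>\<^sub>M Pm N)"
proof -
  have "(\<lambda>z. Psi (fst z) (snd z i)) \<in> borel_measurable (Omega_borel \<Otimes>\<^sub>M Pm N)" if i: "i < N" for i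
  proof -
    have "(\<lambda>z. (fst z, snd z i)) \<in> Omega_borel \<Otimes>\<^sub>M Pm N \<rightarrow>\<^sub>M Omega_borel \<Otimes>\<^sub>M Bm"
      using measurable_compose[OF measurable_snd Pm_component[OF i]] by (intro measurable_Pair) auto
    then have "(\<lambda>z. (fst z, snd z i)) \<in> Omega_borel \<Otimes>\<^sub>M Pm N \<rightarrow>\<^sub>M Omega_borel \<Otimes>\<^sub>M restrict_space borel {-1..1}"
      by (subst measurable_cong_sets[OF refl sets_pair_measure_cong[OF refl sets_Bm[symmetric]]])
    from measurable_compose[OF this Psi_measurable_pair] show ?thesis by simp
  qed
  then show ?thesis unfolding Psi_prod_def case_prod_beta by (intro borel_measurable_prod) auto
qed

lemma Psi_prod_measurable:
  "\<omega> \<in> Omega \<Longrightarrow> Psi_prod N \<omega> \<in> borel_measurable (Pm N)"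
  "(\<And>i. i < N \<Longrightarrow> x i \<in> {-1..1}) \<Longrightarrow> (\<lambda>\<omega>. Psi_prod N \<omega> x) \<in> borel_measurable Omega_borel"
proof -
  show "Psi_prod N \<omega> \<in> borel_measurable (Pm N)" if "\<omega> \<in> Omega"
  proof -
    have "Pair \<omega> \<in> Pm N \<rightarrow>\<^sub>M Omega_borel \<Otimes>\<^sub>M Pm N" using that by (intro measurable_Pair1') (simp add: space_Omega_borel)
    from measurable_compose[OF this Psi_prod_measurable_pair] show ?thesis by simp
  qed
  show "(\<lambda>\<omega>. Psi_prod N \<omega> x) \<in> borel_measurable Omega_borel" if "\<And>i. i < N \<Longrightarrow> x i \<in> {-1..1}"
    unfolding Psi_prod_def using that by (intro borel_measurable_prod Psi_measurable) auto
qed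

lemma mean_Psi_bounds:
  assumes \<nu>: "\<nu> \<in> space (prob_algebra Omega_borel)" and x: "\<And>i. i < N \<Longrightarrow> x i \<in> {-1..1}"
  shows "0 \<le> mean_Psi N \<nu> x" "mean_Psi N \<nu> x \<le> 1"
proof -
  interpret prob_space \<nu> using prob_Omega[OF \<nu>] by auto
  note sp = prob_Omega(3)[OF \<nu>]
  have i: "integrable \<nu> (\<lambda>\<omega>. Psi_prod N \<omega> x)"
    using Psi_prod_bounds[of _ N x] x
    by (intro integrable_bounded_prob[OF \<nu> Psi_prod_measurable(2), where B = 1]) (auto simp: space_Omega_borel)
  show "0 \<le> mean_Psi N \<nu> x"
    unfolding mean_Psi_def using Psi_prod_bounds(1)[OF _ x] sp by (intro integral_nonneg_AE AE_I2) auto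
  have "mean_Psi N \<nu> x \<le> (\<integral>\<omega>. 1 \<partial>\<nu>)"
    unfolding mean_Psi_def using Psi_prod_bounds(2)[OF _ x] sp i by (intro integral_mono) auto
  then show "mean_Psi N \<nu> x \<le> 1" using prob_space by simp
qed

lemma mean_Psi_measurable:
  assumes \<nu>: "\<nu> \<in> space (prob_algebra Omega_borel)"
  shows "mean_Psi N \<nu> \<in> borel_measurable (Pm N)"
proof -
  interpret prob_space \<nu> using prob_Omega[OF \<nu>] by auto
  have "(\<lambda>(x, \<omega>). Psi_prod N \<omega> x) \<in> borel_measurable (Pm N \<Otimes>\<^sub>M \<nu>)"
    using measurable_compose[OF measurable_pair_swap' Psi_prod_measurable_pair]
    by (simp add: case_prod_beta measurable_cong_sets[OF sets_pair_measure_cong[OF refl prob_Omega(2)[OF \<nu>]] refl])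
  then show ?thesis unfolding mean_Psi_def by (rule borel_measurable_lebesgue_integral)
qed

lemma mean_Psi_tendsto:
  assumes \<nu>: "\<nu> \<in> space (prob_algebra Omega_borel)"
    and x: "\<And>i. i < N \<Longrightarrow> x i \<in> {-1..1}" and y: "\<And>n i. i < N \<Longrightarrow> y n i \<in> {-1..1}"
    and lim: "\<And>i. i < N \<Longrightarrow> (\<lambda>n. y n i) \<longlonglongrightarrow> x i"
  shows "(\<lambda>n. mean_Psi N \<nu> (y n)) \<longlonglongrightarrow> mean_Psi N \<nu> x"
proof -
  interpret prob_space \<nu> using prob_Omega[OF \<nu>] by auto
  note s = prob_Omega(2,3)[OF \<nu>]
  show ?thesis unfolding mean_Psi_def
  proof (rule integral_dominated_convergence[where w = "\<lambda>_. 1"])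
    show "(\<lambda>\<omega>. Psi_prod N \<omega> x) \<in> borel_measurable \<nu>" "(\<lambda>\<omega>. Psi_prod N \<omega> (y n)) \<in> borel_measurable \<nu>" for n
      unfolding measurable_cong_sets[OF s(1) refl] by (rule Psi_prod_measurable(2), fact)+
    show "AE \<omega> in \<nu>. norm (Psi_prod N \<omega> (y n)) \<le> 1" for n
      using Psi_prod_bounds[OF _ y] s by (intro AE_I2) auto
    show "AE \<omega> in \<nu>. (\<lambda>n. Psi_prod N \<omega> (y n)) \<longlonglongrightarrow> Psi_prod N \<omega> x"
    proof (rule AE_I2)
      fix \<omega> assume "\<omega> \<in> space \<nu>"
      then have \<omega>: "\<omega> \<in> Omega" using s by simp
      show "(\<lambda>n. Psi_prod N \<omega> (y n)) \<longlonglongrightarrow> Psi_prod N \<omega> x"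
        unfolding Psi_prod_def
      proof (intro tendsto_prod)
        fix i assume "i \<in> {..<N}"
        then have i: "i < N" by simp
        show "(\<lambda>n. Psi \<omega> (y n i)) \<longlonglongrightarrow> Psi \<omega> (x i)"
          using continuous_on_tendsto_compose[OF Psi_continuous[OF \<omega>] lim[OF i] x[OF i]] y[OF i] by simp
      qed
    qed
  qed simp
qed

section \<open>Extracting a coefficient by orthogonality\<close>

context jacobi begin

lemma jacobi_quot_eq: "jacobi_quot p N lam x = D N lam x / vandermonde N x"
proof -
  have "Determinant.det (Matrix.mat N N (\<lambda>(i, j). poly (p (shifted N lam i)) (x j)))
      = Determinant.det (transpose_mat (Matrix.mat N N (\<lambda>(i, j). poly (p (shifted N lam j)) (x i))))"
    by (intro arg_cong[where f = Determinant.det] Matrix.eq_matI) auto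
  also have "\<dots> = D N lam x" unfolding D_def alternant_det by (rule Determinant.det_transpose[of _ N]) simp
  finally show ?thesis by (simp add: jacobi_quot_def)
qed

lemma jacobi_multi_eq:
  assumes x: "inj_on x {..<N}" shows "jacobi_multi p N lam x = D N lam x / vandermonde N x"
proof -
  let ?S = "{y :: nat \<Rightarrow> real. inj_on y {..<N}}"
  have "continuous_on ?S (\<lambda>x. D N lam x / vandermonde N x)"
  proof (intro continuous_on_divide)
    show "continuous_on ?S (D N lam)" unfolding D_def by (rule alternant_continuous)
    show "continuous_on ?S (vandermonde N)" unfolding vandermonde_alternant[abs_def]
      by (intro continuous_on_mult continuous_on_const alternant_continuous)
  qed (auto simp: vandermonde_nonzero)
  then have "(jacobi_quot p N lam \<longlongrightarrow> jacobi_quot p N lam x) (at x within ?S)"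
    using x unfolding jacobi_quot_eq[abs_def] continuous_on_def by blast
  moreover have "at x within ?S \<noteq> bot" using distinct_islimpt[OF x] by (simp add: trivial_limit_within)
  ultimately show ?thesis unfolding jacobi_multi_def jacobi_quot_eq[symmetric] by (intro tendsto_Lim)
qed

lemma D_measurable [measurable]: "D N lam \<in> borel_measurable (Pm N)" unfolding D_def by measurable

lemma vandermonde_measurable [measurable]: "vandermonde N \<in> borel_measurable (Pm N)"
  unfolding vandermonde_alternant[abs_def] by measurable

lemma D_bounded: "\<exists>C. \<forall>x\<in>space (Pm N). \<bar>D N lam x\<bar> \<le> C" unfolding D_def by (rule alternant_bounded)

lemma vandermonde_bounded: "\<exists>C. \<forall>x\<in>space (Pm N). \<bar>vandermonde N x\<bar> \<le> C"
  unfolding vandermonde_alternant using alternant_bounded by (simp add: abs_mult power_abs)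

definition coef :: "nat \<Rightarrow> nat list \<Rightarrow> real" where
  "coef N \<mu> = (\<integral>x. D N \<mu> x * D N \<mu> x \<partial>Pw N) / jacobi_multi p N \<mu> (\<lambda>_. 1)"

text \<open>If the normalizing denominator of \<open>Phi\<close> were \<open>0\<close>, both sides would be \<open>0\<close>, as \<open>x / 0 = 0\<close>.\<close>

lemma Lambda_coefficient:
  assumes Lam: "is_Lambda a b p N K" and \<omega>: "\<omega> \<in> Omega" and \<mu>: "\<mu> \<in> GT N"
  shows "(\<integral>x. Psi_prod N \<omega> x * (vandermonde N x * D N \<mu> x) \<partial>Pw N) = measure (K \<omega>) {\<mu>} * coef N \<mu>"
proof -
  define k where "k lam = measure (K \<omega>) {lam} / jacobi_multi p N lam (\<lambda>_. 1)" for lam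
  \<comment> \<open>The residual of the expansion multiplied by \<open>vandermonde\<close>; its L^2
    norm under \<open>Pw N\<close> is the norm in the definition of \<open>is_Lambda\<close>, since
    coordinates are distinct almost everywhere.\<close>
  define T where "T F x = Psi_prod N \<omega> x * vandermonde N x - (\<Sum>lam\<in>F. k lam * D N lam x)" for F x
  have [measurable]: "Psi_prod N \<omega> \<in> borel_measurable (Pm N)" by (rule Psi_prod_measurable(1)[OF \<omega>])
  have T_meas [measurable]: "T F \<in> borel_measurable (Pm N)" for F unfolding T_def by measurable
  obtain CV where CV: "\<And>x. x \<in> space (Pm N) \<Longrightarrow> \<bar>vandermonde N x\<bar> \<le> CV" using vandermonde_bounded by metis
  have "\<forall>lam. \<exists>C. \<forall>x\<in>space (Pm N). \<bar>D N lam x\<bar> \<le> C" using D_bounded by blast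
  then obtain CD where CD: "\<And>lam x. x \<in> space (Pm N) \<Longrightarrow> \<bar>D N lam x\<bar> \<le> CD lam" by metis
  have PV: "\<bar>Psi_prod N \<omega> x * vandermonde N x\<bar> \<le> CV" if "x \<in> space (Pm N)" for x
  proof -
    have "\<bar>Psi_prod N \<omega> x\<bar> * \<bar>vandermonde N x\<bar> \<le> 1 * CV"
      using Psi_prod_bounds[OF \<omega>, of N x] space_Pm[OF that] CV[OF that] by (intro mult_mono) auto
    then show ?thesis by (simp add: abs_mult)
  qed
  have T_bound: "\<bar>T F x\<bar> \<le> CV + (\<Sum>lam\<in>F. \<bar>k lam\<bar> * CD lam)" if "x \<in> space (Pm N)" for F x
  proof -
    have "\<bar>\<Sum>lam\<in>F. k lam * D N lam x\<bar> \<le> (\<Sum>lam\<in>F. \<bar>k lam\<bar> * CD lam)"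
      using CD[OF that] by (intro order_trans[OF sum_abs] sum_mono) (simp add: abs_mult mult_left_mono)
    then show ?thesis unfolding T_def using PV[OF that] by linarith
  qed
  have intTT: "integrable (Pw N) (\<lambda>x. T F x * T F x)" for F
    by (rule integrable_Pw, measurable) (rule abs_mult_le_mult[OF T_bound T_bound])
  have intDD: "integrable (Pw N) (\<lambda>x. D N lam x * D N \<mu> x)" for lam
    using CD by (intro integrable_Pw[where C = "CD lam * CD \<mu>"]) (auto intro!: abs_mult_le_mult)
  have intPD: "integrable (Pw N) (\<lambda>x. Psi_prod N \<omega> x * vandermonde N x * D N \<mu> x)"
    using CD PV by (intro integrable_Pw[where C = "CV * CD \<mu>"])
      (auto intro!: abs_mult_le_mult)
  have intTD: "integrable (Pw N) (\<lambda>x. T F x * D N \<mu> x)" for F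
  proof -
    have "(\<lambda>x. T F x * D N \<mu> x) = (\<lambda>x. Psi_prod N \<omega> x * vandermonde N x * D N \<mu> x - (\<Sum>lam\<in>F. k lam * (D N lam x * D N \<mu> x)))"
      by (simp add: T_def left_diff_distrib sum_distrib_right mult.assoc)
    then show ?thesis using intPD intDD by simp
  qed
  define A where "A = (\<integral>x. Psi_prod N \<omega> x * vandermonde N x * D N \<mu> x \<partial>Pw N)"
  define S where "S = (\<integral>x. D N \<mu> x * D N \<mu> x \<partial>Pw N)"
  define I where "I F = (\<integral>x. T F x * T F x \<partial>Pw N)" for F
  \<comment> \<open>Once \<open>F\<close> contains \<open>\<mu>\<close>, orthogonality leaves a
    single term, independent of \<open>F\<close>.\<close>
  have J: "(\<integral>x. T F x * D N \<mu> x \<partial>Pw N) = A - k \<mu> * S" if F: "finite F" "F \<subseteq> GT N" "\<mu> \<in> F" for F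
  proof -
    have "(\<integral>x. T F x * D N \<mu> x \<partial>Pw N) = (\<integral>x. Psi_prod N \<omega> x * vandermonde N x * D N \<mu> x - (\<Sum>lam\<in>F. k lam * (D N lam x * D N \<mu> x)) \<partial>Pw N)"
      by (simp add: T_def left_diff_distrib sum_distrib_right mult.assoc)
    also have "\<dots> = A - (\<Sum>lam\<in>F. k lam * (\<integral>x. D N lam x * D N \<mu> x \<partial>Pw N))"
      using intPD intDD by (simp add: A_def)
    also have "(\<Sum>lam\<in>F. k lam * (\<integral>x. D N lam x * D N \<mu> x \<partial>Pw N)) = (\<Sum>lam\<in>{\<mu>}. k lam * (\<integral>x. D N lam x * D N \<mu> x \<partial>Pw N))"
      using F D_orthogonal[OF _ \<mu>] by (intro sum.mono_neutral_right) auto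
    finally show ?thesis by (simp add: S_def)
  qed
  have norm: "H_norm2 a b N (\<lambda>x. (\<Prod>i<N. Psi \<omega> (x i)) - (\<Sum>lam\<in>F. measure (K \<omega>) {lam} * Phi p N lam x)) = ennreal (I F)" for F
  proof -
    have "H_norm2 a b N (\<lambda>x. (\<Prod>i<N. Psi \<omega> (x i)) - (\<Sum>lam\<in>F. measure (K \<omega>) {lam} * Phi p N lam x))
        = (\<integral>\<^sup>+x. ennreal (ww N x) * ennreal (T F x * T F x) \<partial>Pm N)"
      unfolding H_norm2_def Pm_def[unfolded Bm_def, symmetric]
    proof (rule nn_integral_cong_AE)
      show "AE x in Pm N. ennreal (((\<Prod>i<N. Psi \<omega> (x i)) - (\<Sum>lam\<in>F. measure (K \<omega>) {lam} * Phi p N lam x))\<^sup>2 * (vandermonde N x)\<^sup>2 * (\<Prod>i<N. w (x i)))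
          = ennreal (ww N x) * ennreal (T F x * T F x)"
        using AE_Pm_distinct
      proof eventually_elim
        case (elim x)
        have "((\<Prod>i<N. Psi \<omega> (x i)) - (\<Sum>lam\<in>F. measure (K \<omega>) {lam} * Phi p N lam x)) * vandermonde N x = T F x"
          using vandermonde_nonzero[OF elim]
          by (simp add: T_def Psi_prod_def left_diff_distrib sum_distrib_right Phi_def jacobi_multi_eq[OF elim] k_def)
        then have "((\<Prod>i<N. Psi \<omega> (x i)) - (\<Sum>lam\<in>F. measure (K \<omega>) {lam} * Phi p N lam x))\<^sup>2 * (vandermonde N x)\<^sup>2 = T F x * T F x"
          unfolding power_mult_distrib[symmetric] by (simp add: power2_eq_square)
        then show ?case by (simp add: ww_def[symmetric] ennreal_mult'[symmetric] ww_nonneg mult.commute)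
      qed
    qed
    also have "\<dots> = (\<integral>\<^sup>+x. ennreal (T F x * T F x) \<partial>Pw N)"
      unfolding Pw_def by (subst nn_integral_density) auto
    also have "\<dots> = ennreal (I F)" unfolding I_def by (intro nn_integral_eq_integral intTT) auto
    finally show ?thesis .
  qed
  have I0: "(I \<longlongrightarrow> 0) (finite_subsets_at_top (GT N))"
  proof -
    have "((\<lambda>F. ennreal (I F)) \<longlongrightarrow> 0) (finite_subsets_at_top (GT N))"
      unfolding norm[symmetric] using Lam \<omega> unfolding is_Lambda_def by blast
    moreover have "I F \<ge> 0" for F unfolding I_def by (intro integral_nonneg_AE) auto
    ultimately show ?thesis using tendsto_ennrealD[of I 0] by simp
  qed
  have S0: "S \<ge> 0" unfolding S_def by (intro integral_nonneg_AE) auto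
  \<comment> \<open>A weighted mean inequality |u v| \<le> u^2 / r + r v^2 replaces Cauchy-Schwarz:
    the first part tends to 0 along \<open>I0\<close>, and \<open>r\<close> is arbitrary in the
    second.\<close>
  have bnd: "\<bar>A - k \<mu> * S\<bar> \<le> r * S" if r: "r > 0" for r
  proof -
    have ev: "eventually (\<lambda>F. \<bar>A - k \<mu> * S\<bar> \<le> I F / r + r * S) (finite_subsets_at_top (GT N))"
      unfolding eventually_finite_subsets_at_top
    proof (intro exI[of _ "{\<mu>}"] conjI allI impI)
      fix F assume "finite F \<and> {\<mu>} \<subseteq> F \<and> F \<subseteq> GT N"
      then have F: "finite F" "F \<subseteq> GT N" "\<mu> \<in> F" by auto
      have am: "\<bar>u * v\<bar> \<le> u * u / r + r * (v * v)" for u v :: real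
      proof -
        have "0 \<le> (\<bar>u\<bar> / r - \<bar>v\<bar>)\<^sup>2 * r" using r by simp
        also have "\<dots> = u * u / r - 2 * \<bar>u\<bar> * \<bar>v\<bar> + r * (v * v)" using r by (simp add: power2_eq_square field_simps)
        finally have "2 * \<bar>u\<bar> * \<bar>v\<bar> \<le> u * u / r + r * (v * v)" by simp
        moreover have "0 \<le> \<bar>u\<bar> * \<bar>v\<bar>" by simp
        ultimately show ?thesis unfolding abs_mult by linarith
      qed
      have "\<bar>A - k \<mu> * S\<bar> = \<bar>\<integral>x. T F x * D N \<mu> x \<partial>Pw N\<bar>" using J[OF F] by simp
      also have "\<dots> \<le> (\<integral>x. \<bar>T F x * D N \<mu> x\<bar> \<partial>Pw N)" by (rule integral_abs_bound)
      also have "\<dots> \<le> (\<integral>x. T F x * T F x / r + r * (D N \<mu> x * D N \<mu> x) \<partial>Pw N)"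
        using intTD intTT intDD am by (intro integral_mono) auto
      also have "\<dots> = I F / r + r * S" using intTT intDD by (simp add: I_def S_def)
      finally show "\<bar>A - k \<mu> * S\<bar> \<le> I F / r + r * S" .
    qed (use \<mu> in auto)
    have "((\<lambda>F. I F / r + r * S) \<longlongrightarrow> 0 / r + r * S) (finite_subsets_at_top (GT N))"
      using r by (intro tendsto_intros I0) auto
    then show ?thesis using ev by (intro tendsto_lowerbound[of "\<lambda>F. I F / r + r * S" "r * S" "finite_subsets_at_top (GT N)"]) auto
  qed
  have "A - k \<mu> * S = 0"
  proof (rule ccontr)
    assume ne: "A - k \<mu> * S \<noteq> 0"
    define d where "d = \<bar>A - k \<mu> * S\<bar>"
    have d: "d > 0" using ne by (simp add: d_def)
    \<comment> \<open>This value of \<open>r\<close> makes the bound smaller than \<open>d\<close>;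
      the summand 1 covers \<open>S = 0\<close>.\<close>
    have "d \<le> d / (2 * (S + 1)) * S" unfolding d_def[symmetric] using bnd[of "d / (2 * (S + 1))"] d S0 by (simp add: d_def[symmetric])
    also have "\<dots> < d"
    proof -
      have "0 \<le> S * d" using d S0 by simp
      then have "0 < S * d + d * 2" using d by linarith
      then show ?thesis using d S0 by (simp add: field_simps)
    qed
    finally show False by simp
  qed
  then show ?thesis by (simp add: A_def S_def k_def coef_def mult.assoc)
qed

end

section \<open>The kernels \<open>Lambda\<close> separate measures\<close>

lemma alternant_permute:
  assumes \<pi>: "\<pi> permutes {..<N}"
  shows "alternant N (\<lambda>j. f (\<pi> j)) x = of_int (sign \<pi>) * alternant N f x"
proof -
  have s: "(of_int (sign \<pi>) :: real) * of_int (sign \<pi>) = 1" by (simp add: sign_def)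
  have "alternant N f x = (\<Sum>q | q permutes {..<N}. of_int (sign (\<pi> \<circ> q)) * (\<Prod>i<N. f ((\<pi> \<circ> q) i) (x i)))"
    unfolding alternant_def by (rule setum_permutations_compose_left[OF \<pi>])
  also have "\<dots> = (\<Sum>q | q permutes {..<N}. of_int (sign \<pi>) * (of_int (sign q) * (\<Prod>i<N. f (\<pi> (q i)) (x i))))"
  proof (intro sum.cong refl)
    fix q assume "q \<in> {q. q permutes {..<N}}"
    then have "sign (\<pi> \<circ> q) = sign \<pi> * sign q"
      using \<pi> by (intro sign_compose permutation_permutes[THEN iffD2]) auto
    then show "of_int (sign (\<pi> \<circ> q)) * (\<Prod>i<N. f ((\<pi> \<circ> q) i) (x i))
        = of_int (sign \<pi>) * (of_int (sign q) * (\<Prod>i<N. f (\<pi> (q i)) (x i)))" by simp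
  qed
  also have "\<dots> = of_int (sign \<pi>) * alternant N (\<lambda>j. f (\<pi> j)) x"
    unfolding alternant_def sum_distrib_left ..
  finally show ?thesis using s by (simp add: mult.assoc[symmetric])
qed

lemma ex_strict_on_permutation:
  assumes k: "inj_on k {..<N}" shows "\<exists>\<pi>. \<pi> permutes {..<N} \<and> strict_on N (\<lambda>i. k (\<pi> i))"
proof -
  define xs where "xs = rev (sorted_list_of_set (k ` {..<N}))"
  have xs: "set xs = k ` {..<N}" "distinct xs" "length xs = N"
    using card_image[OF k] by (simp_all add: xs_def)
  define \<pi> where "\<pi> i = (if i < N then inv_into {..<N} k (xs ! i) else i)" for i
  have mem: "xs ! i \<in> k ` {..<N}" if "i < N" for i using xs that nth_mem by metis
  have k\<pi>: "k (\<pi> i) = xs ! i" if "i < N" for i using that mem by (simp add: \<pi>_def f_inv_into_f)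
  have into: "\<pi> i \<in> {..<N}" if "i < N" for i using that inv_into_into[OF mem] by (simp add: \<pi>_def)
  have inj: "inj_on \<pi> {..<N}"
  proof (rule inj_onI)
    fix i j assume "i \<in> {..<N}" "j \<in> {..<N}" "\<pi> i = \<pi> j"
    then have "xs ! i = xs ! j" "i < N" "j < N" using k\<pi>[of i] k\<pi>[of j] by auto
    then show "i = j" using xs nth_eq_iff_index_eq by metis
  qed
  have "\<pi> ` {..<N} = {..<N}" using into inj by (intro endo_inj_surj) auto
  then have "\<pi> permutes {..<N}" using inj by (intro bij_imp_permutes) (auto simp: bij_betw_def \<pi>_def)
  moreover have "xs ! j < xs ! i" if "i < j" "j < N" for i j
  proof -
    have "sorted_wrt (>) xs" unfolding xs_def sorted_wrt_rev using strict_sorted_list_of_set by simp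
    then show ?thesis using that xs by (simp add: sorted_wrt_iff_nth_less)
  qed
  ultimately show ?thesis using k\<pi> by (intro exI[of _ \<pi>]) (auto simp: strict_on_def)
qed

lemma alternant_mult_common:
  "alternant N (\<lambda>j t. f j t * q t) x = alternant N f x * (\<Prod>i<N. q (x i))"
  unfolding alternant_def sum_distrib_right by (simp add: prod.distrib mult.assoc)

context jacobi begin

text \<open>By multilinearity every slot is expanded in the triangular basis \<open>p\<close>. An
  alternant of Jacobi polynomials with a repeated degree vanishes; any other one is, after sorting,
  some \<open>D N \<mu>\<close> up to sign.\<close>

lemma integral_alternant_eq_0:
  assumes g: "g \<in> borel_measurable (Pm N)" "\<And>x. x \<in> space (Pm N) \<Longrightarrow> \<bar>g x\<bar> \<le> C"
    and ann: "\<And>\<mu>. \<mu> \<in> GT N \<Longrightarrow> (\<integral>x. g x * D N \<mu> x \<partial>Pw N) = 0"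
  shows "(\<integral>x. g x * alternant N (\<lambda>j. poly (f j)) x \<partial>Pw N) = 0"
proof -
  define L where "L f = (\<integral>x. g x * alternant N (\<lambda>j. poly (f j)) x \<partial>Pw N)" for f
  have int: "integrable (Pw N) (\<lambda>x. g x * alternant N (\<lambda>j. poly (f j)) x)" for f
  proof -
    obtain C' where "\<And>x. x \<in> space (Pm N) \<Longrightarrow> \<bar>alternant N (\<lambda>j. poly (f j)) x\<bar> \<le> C'" using alternant_bounded by metis
    then show ?thesis using g by (intro integrable_Pw[where C = "C * C'"] abs_mult_le_mult borel_measurable_times) auto
  qed
  have L_linear: "L (f(j := Polynomial.smult c q + r)) = c * L (f(j := q)) + L (f(j := r))" if j: "j < N" for f j c q r
  proof -
    have upd: "(\<lambda>i. poly ((f(j := s)) i)) = (\<lambda>i. poly (f i))(j := poly s)" for s by auto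
    have "alternant N (\<lambda>i. poly ((f(j := Polynomial.smult c q + r)) i)) x
        = c * alternant N (\<lambda>i. poly ((f(j := q)) i)) x + alternant N (\<lambda>i. poly ((f(j := r)) i)) x" for x
      using alternant_linear[OF j, of "\<lambda>i. poly (f i)" c "poly q" 1 "poly r" x] unfolding upd
      by (simp add: fun_upd_def poly_add[abs_def] poly_smult[abs_def])
    then have "L (f(j := Polynomial.smult c q + r)) = (\<integral>x. c * (g x * alternant N (\<lambda>i. poly ((f(j := q)) i)) x)
         + g x * alternant N (\<lambda>i. poly ((f(j := r)) i)) x \<partial>Pw N)"
      unfolding L_def by (intro Bochner_Integration.integral_cong refl) (simp add: algebra_simps)
    also have "\<dots> = c * L (f(j := q)) + L (f(j := r))" unfolding L_def using int by simp
    finally show ?thesis .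
  qed
  have L_jacobi: "L (\<lambda>j. p (k j)) = 0" for k
  proof (cases "inj_on k {..<N}")
    case False
    then obtain i j where ij: "i < N" "j < N" "i \<noteq> j" "k i = k j" by (auto simp: inj_on_def)
    have "alternant N (\<lambda>j. poly (p (k j))) x = 0" for x using ij by (intro alternant_equal_funs[of i _ j]) auto
    then show ?thesis by (simp add: L_def)
  next
    case True
    from ex_strict_on_permutation[OF True] obtain \<pi>
      where \<pi>: "\<pi> permutes {..<N}" and st: "strict_on N (\<lambda>i. k (\<pi> i))" by blast
    let ?\<mu> = "unshift N (\<lambda>i. k (\<pi> i))"
    have "D N ?\<mu> x = of_int (sign \<pi>) * alternant N (\<lambda>j. poly (p (k j))) x" for x
    proof -
      have "D N ?\<mu> x = alternant N (\<lambda>j. poly (p (k (\<pi> j)))) x"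
        unfolding D_def using shifted_unshift[OF st] by (intro alternant_cong) auto
      then show ?thesis using alternant_permute[OF \<pi>, of "\<lambda>j. poly (p (k j))"] by simp
    qed
    then have "of_int (sign \<pi>) * L (\<lambda>j. p (k j)) = (\<integral>x. g x * D N ?\<mu> x \<partial>Pw N)"
      unfolding L_def by (subst integral_mult_right_zero[symmetric]) (simp add: mult.left_commute)
    also have "\<dots> = 0" by (rule ann[OF unshift_GT[OF st]])
    finally show ?thesis by (simp add: sign_def split: if_splits)
  qed
  \<comment> \<open>All slots from \<open>m\<close> on already hold Jacobi polynomials; the inner
    induction removes leading terms in slot \<open>m\<close>, one degree at a time.\<close>
  have "L f = 0" if "m \<le> N" "\<forall>j. m \<le> j \<longrightarrow> (\<exists>k. f j = p k)" for m f
    using that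
  proof (induction m arbitrary: f)
    case 0
    then have "\<forall>j. \<exists>k. f j = p k" by simp
    then obtain k where "\<And>j. f j = p (k j)" by metis
    then have "f = (\<lambda>j. p (k j))" by auto
    then show ?case using L_jacobi by simp
  next
    case (Suc m)
    have m: "m < N" using Suc.prems(1) by simp
    have "L (f(m := q)) = 0" for q
    proof (induction "degree q" arbitrary: q rule: less_induct)
      case less
      define n where "n = degree q"
      have pn: "degree (p n) = n" "p n \<noteq> 0" using jacobi by (auto simp: jacobi_polys_def)
      define c where "c = lead_coeff q / lead_coeff (p n)"
      define r where "r = q - Polynomial.smult c (p n)"
      have "degree r \<le> n" unfolding r_def using pn by (intro degree_diff_le) (auto simp: n_def)
      moreover have "Polynomial.coeff r n = 0"
        using pn by (simp add: r_def c_def n_def[symmetric] leading_coeff_0_iff[symmetric] del: leading_coeff_0_iff)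
      ultimately have r: "r = 0 \<or> degree r < degree q" using eq_zero_or_degree_less n_def by metis
      have "L (f(m := r)) = 0"
        using r
      proof
        assume "r = 0"
        then show ?thesis using L_linear[OF m, of f 0 0 0] L_linear[OF m, of f 1 0 0] by simp
      qed (rule less)
      moreover have "L (f(m := p n)) = 0"
      proof (rule Suc.IH)
        show "\<forall>j\<ge>m. \<exists>k. (f(m := p n)) j = p k" using Suc.prems(2) by (auto simp: le_Suc_eq Suc_le_eq)
      qed (use m in simp)
      moreover have "q = Polynomial.smult c (p n) + r" by (simp add: r_def)
      ultimately show ?case using L_linear[OF m, of f c "p n" r] by simp
    qed
    from this[of "f m"] show ?case by simp
  qed
  \<comment> \<open>Slots beyond \<open>N\<close> do not enter the alternant; filling them with
    \<open>p\<close> meets the premise at \<open>m = N\<close>.\<close>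
  from this[of N "\<lambda>j. if j < N then f j else p j"]
  have "L (\<lambda>j. if j < N then f j else p j) = 0" by auto
  moreover have "alternant N (\<lambda>j. poly (if j < N then f j else p j)) x = alternant N (\<lambda>j. poly (f j)) x" for x
    by (intro alternant_cong) auto
  ultimately show ?thesis by (simp add: L_def)
qed

text \<open>One polynomial approximating \<open>Psi \<omega>\<close> is used in all coordinates: the
  Vandermonde times such a product is again an alternant, so its integral is 0, and bounded
  convergence passes to \<open>Psi_prod\<close>.\<close>

lemma integral_Psi_prod_eq_0:
  assumes g: "g \<in> borel_measurable (Pm N)" "\<And>x. x \<in> space (Pm N) \<Longrightarrow> \<bar>g x\<bar> \<le> C"
    and ann: "\<And>\<mu>. \<mu> \<in> GT N \<Longrightarrow> (\<integral>x. g x * D N \<mu> x \<partial>Pw N) = 0"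
    and \<omega>: "\<omega> \<in> Omega"
  shows "(\<integral>x. g x * (vandermonde N x * Psi_prod N \<omega> x) \<partial>Pw N) = 0"
proof -
  have "\<exists>q. \<forall>x\<in>{-1..1}. \<bar>Psi \<omega> x - poly q x\<bar> < 1 / real (Suc n)" for n
    using weierstrass_poly[OF Psi_continuous[OF \<omega>], of "1 / real (Suc n)"] by (metis of_nat_0_less_iff zero_less_Suc zero_less_divide_1_iff)
  then obtain q where q: "\<And>n x. x \<in> {-1..1} \<Longrightarrow> \<bar>Psi \<omega> x - poly (q n) x\<bar> < 1 / real (Suc n)" by metis
  have lim: "(\<lambda>n. poly (q n) x) \<longlonglongrightarrow> Psi \<omega> x" if "x \<in> {-1..1}" for x
  proof (rule LIM_zero_cancel)
    show "(\<lambda>n. poly (q n) x - Psi \<omega> x) \<longlonglongrightarrow> 0"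
      using q[OF that] by (intro Lim_null_comparison[OF _ LIMSEQ_Suc[OF lim_inverse_n']] always_eventually)
        (auto simp: abs_minus_commute[of "poly _ _"] intro: less_imp_le)
  qed
  have bound: "\<bar>poly (q n) x\<bar> \<le> 2" if x: "x \<in> {-1..1}" for n x
  proof -
    have "1 / real (Suc n) \<le> 1" by simp
    then show ?thesis using q[OF x, of n] Psi_bounds[OF \<omega> x] by linarith
  qed
  obtain CV where CV: "\<And>x. x \<in> space (Pm N) \<Longrightarrow> \<bar>vandermonde N x\<bar> \<le> CV" using vandermonde_bounded by metis
  have [measurable]: "g \<in> borel_measurable (Pm N)" "Psi_prod N \<omega> \<in> borel_measurable (Pm N)"
    using g(1) Psi_prod_measurable(1)[OF \<omega>] .
  have Q_meas [measurable]: "(\<lambda>x. \<Prod>i<N. poly (q n) (x i)) \<in> borel_measurable (Pm N)" for n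
    by (intro borel_measurable_prod coord_measurable poly_measurable) auto
  have zero: "(\<integral>x. g x * (vandermonde N x * (\<Prod>i<N. poly (q n) (x i))) \<partial>Pw N) = 0" for n
  proof -
    have "vandermonde N x * (\<Prod>i<N. poly (q n) (x i))
        = (-1) ^ (N * (N - 1) div 2) * alternant N (\<lambda>j. poly (Polynomial.monom 1 j * q n)) x" for x
      unfolding vandermonde_alternant using alternant_mult_common[of N "\<lambda>j. poly (Polynomial.monom 1 j)" "poly (q n)" x]
      by (simp add: poly_mult[abs_def])
    then have "(\<integral>x. g x * (vandermonde N x * (\<Prod>i<N. poly (q n) (x i))) \<partial>Pw N)
        = (-1) ^ (N * (N - 1) div 2) * (\<integral>x. g x * alternant N (\<lambda>j. poly (Polynomial.monom 1 j * q n)) x \<partial>Pw N)"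
      by (subst integral_mult_right_zero[symmetric]) (simp add: mult.left_commute)
    also have "\<dots> = 0" using integral_alternant_eq_0[OF g ann, of "\<lambda>j. Polynomial.monom 1 j * q n"] by simp
    finally show ?thesis .
  qed
  interpret finite_measure "Pw N" by (rule finite_Pw)
  have "(\<lambda>n. \<integral>x. g x * (vandermonde N x * (\<Prod>i<N. poly (q n) (x i))) \<partial>Pw N)
      \<longlonglongrightarrow> (\<integral>x. g x * (vandermonde N x * Psi_prod N \<omega> x) \<partial>Pw N)"
  proof (rule integral_dominated_convergence[where w = "\<lambda>_. C * (CV * 2 ^ N)"])
    show "(\<lambda>x. g x * (vandermonde N x * Psi_prod N \<omega> x)) \<in> borel_measurable (Pw N)"
      "(\<lambda>x. g x * (vandermonde N x * (\<Prod>i<N. poly (q n) (x i)))) \<in> borel_measurable (Pw N)" for n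
      by (intro measurable_Pw; measurable)+
    show "AE x in Pw N. (\<lambda>n. g x * (vandermonde N x * (\<Prod>i<N. poly (q n) (x i))))
        \<longlonglongrightarrow> g x * (vandermonde N x * Psi_prod N \<omega> x)"
      unfolding Psi_prod_def using space_Pm by (intro AE_I2 tendsto_mult tendsto_const tendsto_prod lim) (auto simp: space_Pw)
    show "AE x in Pw N. norm (g x * (vandermonde N x * (\<Prod>i<N. poly (q n) (x i)))) \<le> C * (CV * 2 ^ N)" for n
    proof (rule AE_I2)
      fix x assume "x \<in> space (Pw N)"
      then have x: "x \<in> space (Pm N)" by (simp add: space_Pw)
      have "\<bar>\<Prod>i<N. poly (q n) (x i)\<bar> \<le> (\<Prod>i<N. 2)"
        unfolding abs_prod using bound space_Pm[OF x] by (intro prod_mono) auto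
      then show "norm (g x * (vandermonde N x * (\<Prod>i<N. poly (q n) (x i)))) \<le> C * (CV * 2 ^ N)"
        unfolding real_norm_def by (intro abs_mult_le_mult g(2) CV x) auto
    qed
  qed simp
  then show ?thesis unfolding zero using LIMSEQ_unique tendsto_const by metis
qed

lemma mean_Psi_Fubini:
  assumes \<nu>: "\<nu> \<in> space (prob_algebra Omega_borel)"
    and h: "h \<in> borel_measurable (Pm N)" "\<And>x. x \<in> space (Pm N) \<Longrightarrow> \<bar>h x\<bar> \<le> C"
  shows "(\<integral>x. mean_Psi N \<nu> x * h x \<partial>Pw N) = (\<integral>\<omega>. (\<integral>x. Psi_prod N \<omega> x * h x \<partial>Pw N) \<partial>\<nu>)"
proof -
  note s = prob_Omega[OF \<nu>]
  interpret \<nu>: prob_space \<nu> by (rule s(1))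
  interpret Pw: finite_measure "Pw N" by (rule finite_Pw)
  interpret pair_sigma_finite \<nu> "Pw N" ..
  interpret fin: finite_measure "\<nu> \<Otimes>\<^sub>M Pw N" by (rule finite_measure_pair_measure) unfold_locales
  have sets: "sets (\<nu> \<Otimes>\<^sub>M Pw N) = sets (Omega_borel \<Otimes>\<^sub>M Pm N)" using s sets_Pw by (intro sets_pair_measure_cong)
  have "(\<lambda>(\<omega>, x). Psi_prod N \<omega> x * h x) \<in> borel_measurable (Omega_borel \<Otimes>\<^sub>M Pm N)"
    using borel_measurable_times[OF Psi_prod_measurable_pair measurable_compose[OF measurable_snd h(1)]]
    by (simp add: case_prod_beta)
  then have m: "(\<lambda>(\<omega>, x). Psi_prod N \<omega> x * h x) \<in> borel_measurable (\<nu> \<Otimes>\<^sub>M Pw N)"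
    unfolding measurable_cong_sets[OF sets refl] .
  have int: "integrable (\<nu> \<Otimes>\<^sub>M Pw N) (\<lambda>(\<omega>, x). Psi_prod N \<omega> x * h x)"
  proof (rule fin.integrable_const_bound[OF _ m, where B = "1 * C"], rule AE_I2)
    fix z assume "z \<in> space (\<nu> \<Otimes>\<^sub>M Pw N)"
    then have z: "fst z \<in> Omega" "snd z \<in> space (Pm N)" using s by (auto simp: space_pair_measure space_Pw)
    have "\<bar>Psi_prod N (fst z) (snd z)\<bar> \<le> 1" using Psi_prod_bounds[OF z(1)] space_Pm[OF z(2)] by (simp add: abs_le_iff)
    then show "norm (case z of (\<omega>, x) \<Rightarrow> Psi_prod N \<omega> x * h x) \<le> 1 * C"
      unfolding case_prod_beta real_norm_def using h(2)[OF z(2)] by (intro abs_mult_le_mult)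
  qed
  show ?thesis using Fubini_integral[OF int] by (simp add: mean_Psi_def)
qed

end

text \<open>A null set contains no box of positive measure. This yields good points arbitrarily
  close to any point of the cube, its boundary included.\<close>

lemma AE_Pm_witness:
  assumes Q: "AE x in Pm N. Q x" and A: "\<And>i. i < N \<Longrightarrow> A i \<in> sets Bm" "\<And>i. i < N \<Longrightarrow> emeasure Bm (A i) \<noteq> 0"
  shows "\<exists>x. Q x \<and> (\<forall>i<N. x i \<in> A i)"
proof (rule ccontr)
  assume "\<not> ?thesis"
  then have no: "x \<notin> Pi\<^sub>E {..<N} A" if "Q x" for x using that by (auto simp: PiE_iff)
  interpret finite_product_sigma_finite "\<lambda>i::nat. Bm" "{..<N}" by standard simp
  have "Pi\<^sub>E {..<N} A \<in> sets (Pm N)" unfolding Pm_def using A by (intro sets_PiM_I_finite) auto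
  moreover have "AE x in Pm N. x \<notin> Pi\<^sub>E {..<N} A" using Q by (rule eventually_mono) (rule no)
  ultimately have "emeasure (Pm N) (Pi\<^sub>E {..<N} A) = 0"
    using sets.sets_into_space by (subst (asm) AE_iff_measurable) auto
  moreover have "emeasure (Pm N) (Pi\<^sub>E {..<N} A) = (\<Prod>i<N. emeasure Bm (A i))"
    unfolding Pm_def using A by (intro measure_times) auto
  ultimately show False using A(2) by (auto simp: prod_zero_iff)
qed

lemma emeasure_Bm_near:
  assumes x: "x \<in> {-1..1}" and d: "d > 0"
  shows "{-1..1} \<inter> {x - d..x + d} \<in> sets Bm" "emeasure Bm ({-1..1} \<inter> {x - d..x + d}) \<noteq> 0"
proof -
  have eq: "{-1..1} \<inter> {x - d..x + d} = {max (-1) (x - d)..min 1 (x + d)}" by auto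
  show "{-1..1} \<inter> {x - d..x + d} \<in> sets Bm" unfolding sets_Bm by (auto simp: sets_restrict_space_iff)
  have "emeasure Bm ({-1..1} \<inter> {x - d..x + d}) = ennreal (min 1 (x + d) - max (-1) (x - d))"
    unfolding eq using x d by (subst emeasure_Bm) auto
  also have "\<dots> \<noteq> 0" using x d by (auto simp: ennreal_eq_0_iff)
  finally show "emeasure Bm ({-1..1} \<inter> {x - d..x + d}) \<noteq> 0" .
qed

lemma jacobi_weight_pos: "-1 < x \<Longrightarrow> x < 1 \<Longrightarrow> 0 < jacobi_weight a b x"
  by (simp add: jacobi_weight_def)

lemma (in jacobi) AE_ww_pos: "AE x in Pm N. 0 < ww N x"
proof -
  have "AE x in Pm N. x i \<noteq> c" if i: "i < N" and c: "c \<in> {-1..1}" for i c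
  proof -
    have "AE x in Pm N. x i \<notin> {c}"
    proof (rule AE_Pm_component[OF i])
      show "{c} \<in> sets Bm" using c by (simp add: sets_Bm sets_restrict_space_iff)
      show "emeasure Bm {c} = 0" using c by (subst emeasure_Bm) auto
    qed
    then show ?thesis by simp
  qed
  from this[of _ "-1"] this[of _ 1] have "AE x in Pm N. x i \<noteq> -1 \<and> x i \<noteq> 1" if "i < N" for i using that by auto
  then have "AE x in Pm N. \<forall>i\<in>{..<N}. x i \<noteq> -1 \<and> x i \<noteq> 1" by (intro AE_finite_allI) auto
  moreover have "AE x in Pm N. x \<in> space (Pm N)" by (rule AE_space)
  ultimately show ?thesis
  proof eventually_elim
    case (elim x)
    have "0 < w (x i)" if "i < N" for i
      using elim(1) space_Pm[OF elim(2) that] that by (intro jacobi_weight_pos) (auto simp: order_less_le)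
    then show ?case by (auto simp: ww_def intro!: prod_pos)
  qed
qed

section \<open>From equal images under one kernel to equal means of \<open>Psi\<close>\<close>

context
  fixes a b :: real and p :: "nat \<Rightarrow> real poly" and N :: nat and K \<nu> \<nu>'
  assumes jac: "jacobi a b p" and Lam: "is_Lambda a b p N K"
    and \<nu>: "\<nu> \<in> space (prob_algebra Omega_borel)" and \<nu>': "\<nu>' \<in> space (prob_algebra Omega_borel)"
    and same: "\<nu> \<bind> K = \<nu>' \<bind> K"
begin

interpretation jacobi a b p by (rule jac)

private definition g where "g x = mean_Psi N \<nu> x - mean_Psi N \<nu>' x"

private lemma g_measurable [measurable]: "g \<in> borel_measurable (Pm N)"
  unfolding g_def by (intro borel_measurable_diff mean_Psi_measurable \<nu> \<nu>')

private lemma g_bound: "x \<in> space (Pm N) \<Longrightarrow> \<bar>g x\<bar> \<le> 1"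
  using mean_Psi_bounds[OF \<nu>, of N x] mean_Psi_bounds[OF \<nu>', of N x] space_Pm[of x N] by (force simp: g_def abs_le_iff)

private lemma integral_g:
  assumes h: "h \<in> borel_measurable (Pm N)" "\<And>x. x \<in> space (Pm N) \<Longrightarrow> \<bar>h x\<bar> \<le> C"
  shows "(\<integral>x. g x * h x \<partial>Pw N)
    = (\<integral>\<omega>. (\<integral>x. Psi_prod N \<omega> x * h x \<partial>Pw N) \<partial>\<nu>) - (\<integral>\<omega>. (\<integral>x. Psi_prod N \<omega> x * h x \<partial>Pw N) \<partial>\<nu>')"
proof -
  have "integrable (Pw N) (\<lambda>x. mean_Psi N \<mu> x * h x)" if \<mu>: "\<mu> \<in> space (prob_algebra Omega_borel)" for \<mu>
  proof (intro integrable_Pw[where C = "1 * C"] borel_measurable_times mean_Psi_measurable[OF \<mu>] h abs_mult_le_mult)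
    show "\<bar>mean_Psi N \<mu> x\<bar> \<le> 1" if "x \<in> space (Pm N)" for x
      using mean_Psi_bounds[OF \<mu> space_Pm[OF that]] by simp
  qed
  from this[OF \<nu>] this[OF \<nu>'] have "(\<integral>x. g x * h x \<partial>Pw N) = (\<integral>x. mean_Psi N \<nu> x * h x \<partial>Pw N) - (\<integral>x. mean_Psi N \<nu>' x * h x \<partial>Pw N)"
    by (simp add: g_def left_diff_distrib)
  then show ?thesis using mean_Psi_Fubini[OF \<nu> h] mean_Psi_Fubini[OF \<nu>' h] by simp
qed

private lemma integral_g_D: "\<mu> \<in> GT N \<Longrightarrow> (\<integral>x. g x * vandermonde N x * D N \<mu> x \<partial>Pw N) = 0"
proof -
  assume \<mu>: "\<mu> \<in> GT N"
  obtain CV CD where C: "\<And>x. x \<in> space (Pm N) \<Longrightarrow> \<bar>vandermonde N x\<bar> \<le> CV" "\<And>x. x \<in> space (Pm N) \<Longrightarrow> \<bar>D N \<mu> x\<bar> \<le> CD"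
    using vandermonde_bounded D_bounded by metis
  have K: "K \<in> Omega_borel \<rightarrow>\<^sub>M prob_algebra (count_space (GT N))" using Lam by (simp add: is_Lambda_def)
  have "(\<integral>\<omega>. (\<integral>x. Psi_prod N \<omega> x * (vandermonde N x * D N \<mu> x) \<partial>Pw N) \<partial>\<rho>) = measure (\<rho> \<bind> K) {\<mu>} * coef N \<mu>"
    if \<rho>: "\<rho> \<in> space (prob_algebra Omega_borel)" for \<rho>
  proof -
    have "(\<integral>\<omega>. (\<integral>x. Psi_prod N \<omega> x * (vandermonde N x * D N \<mu> x) \<partial>Pw N) \<partial>\<rho>) = (\<integral>\<omega>. measure (K \<omega>) {\<mu>} * coef N \<mu> \<partial>\<rho>)"
      using Lambda_coefficient[OF Lam _ \<mu>] prob_Omega(3)[OF \<rho>] by (intro Bochner_Integration.integral_cong) auto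
    also have "\<dots> = (\<integral>\<omega>. measure (K \<omega>) {\<mu>} \<partial>\<rho>) * coef N \<mu>" by simp
    also have "(\<integral>\<omega>. measure (K \<omega>) {\<mu>} \<partial>\<rho>) = measure (\<rho> \<bind> K) {\<mu>}"
      using \<mu> by (intro measure_bind_prob_algebra[OF \<rho> K, symmetric]) simp
    finally show ?thesis .
  qed
  moreover have "(\<integral>x. g x * (vandermonde N x * D N \<mu> x) \<partial>Pw N)
    = (\<integral>\<omega>. (\<integral>x. Psi_prod N \<omega> x * (vandermonde N x * D N \<mu> x) \<partial>Pw N) \<partial>\<nu>) - (\<integral>\<omega>. (\<integral>x. Psi_prod N \<omega> x * (vandermonde N x * D N \<mu> x) \<partial>Pw N) \<partial>\<nu>')"
    by (rule integral_g, measurable) (rule abs_mult_le_mult[OF C])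
  ultimately show ?thesis using \<nu> \<nu>' same by (simp add: mult.assoc)
qed

text \<open>\<open>h\<close>, the product of \<open>g\<close> and the Vandermonde, is orthogonal to
  the Vandermonde times every \<open>Psi_prod N \<omega>\<close>. Since \<open>g\<close> is itself a
  difference of averages of these functions over \<omega>, integrating over \<omega> shows that
  \<open>h\<close> is orthogonal to itself.\<close>

private lemma AE_g_eq_0: "AE x in Pm N. g x = 0"
proof -
  obtain CV where CV: "\<And>x. x \<in> space (Pm N) \<Longrightarrow> \<bar>vandermonde N x\<bar> \<le> CV" using vandermonde_bounded by metis
  define h where "h x = g x * vandermonde N x" for x
  have h [measurable]: "h \<in> borel_measurable (Pm N)" unfolding h_def by measurable
  have h_bound: "\<bar>h x\<bar> \<le> 1 * CV" if "x \<in> space (Pm N)" for x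
    unfolding h_def using g_bound[OF that] CV[OF that] by (rule abs_mult_le_mult)
  have hV: "(\<lambda>x. h x * vandermonde N x) \<in> borel_measurable (Pm N)"
    "\<And>x. x \<in> space (Pm N) \<Longrightarrow> \<bar>h x * vandermonde N x\<bar> \<le> 1 * CV * CV"
    using CV h_bound by (measurable, intro abs_mult_le_mult)
  have "(\<integral>x. Psi_prod N \<omega> x * (h x * vandermonde N x) \<partial>Pw N) = 0" if "\<omega> \<in> Omega" for \<omega>
    using integral_Psi_prod_eq_0[OF h h_bound integral_g_D[folded h_def] that]
    by (simp add: mult_ac)
  then have z: "(\<integral>\<omega>. (\<integral>x. Psi_prod N \<omega> x * (h x * vandermonde N x) \<partial>Pw N) \<partial>\<rho>) = 0"
    if "\<rho> \<in> space (prob_algebra Omega_borel)" for \<rho>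
    using prob_Omega(3)[OF that] by (subst Bochner_Integration.integral_cong[where g = "\<lambda>_. 0"]) auto
  have "(\<integral>x. h x * h x \<partial>Pw N) = (\<integral>x. g x * (h x * vandermonde N x) \<partial>Pw N)" by (simp add: h_def mult_ac)
  also have "\<dots> = 0" using integral_g[OF hV] z[OF \<nu>] z[OF \<nu>'] by simp
  finally have "(\<integral>x. h x * h x \<partial>Pw N) = 0" .
  moreover have "integrable (Pw N) (\<lambda>x. h x * h x)"
    by (rule integrable_Pw, measurable) (rule abs_mult_le_mult[OF h_bound h_bound])
  ultimately have "AE x in Pw N. h x * h x = 0" by (subst (asm) integral_nonneg_eq_0_iff_AE) auto
  then have "AE x in Pm N. 0 < ennreal (ww N x) \<longrightarrow> h x * h x = 0" unfolding Pw_def by (subst (asm) AE_density) auto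
  then show ?thesis using AE_ww_pos AE_Pm_distinct
  proof eventually_elim
    case (elim x)
    then show ?case using vandermonde_nonzero[OF elim(3)] by (auto simp: h_def)
  qed
qed

text \<open>The points needed later may have coordinates that repeat or equal 1, and so lie in a
  null set; equality almost everywhere is carried to them by continuity of
  \<open>mean_Psi\<close>.\<close>

lemma mean_Psi_eq_of_bind_eq:
  assumes x: "\<And>i. i < N \<Longrightarrow> x i \<in> {-1..1}" shows "mean_Psi N \<nu> x = mean_Psi N \<nu>' x"
proof -
  have "\<exists>y. g y = 0 \<and> (\<forall>i<N. y i \<in> {-1..1} \<inter> {x i - 1 / real (Suc n)..x i + 1 / real (Suc n)})" for n
    using emeasure_Bm_near[OF x] by (intro AE_Pm_witness AE_g_eq_0) auto
  then obtain y where y0: "\<And>n. g (y n) = 0"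
    and y: "\<And>n i. i < N \<Longrightarrow> y n i \<in> {-1..1} \<inter> {x i - 1 / real (Suc n)..x i + 1 / real (Suc n)}" by metis
  have lim: "(\<lambda>n. y n i) \<longlonglongrightarrow> x i" if "i < N" for i
  proof (rule LIM_zero_cancel)
    have "\<bar>y n i - x i\<bar> \<le> 1 / real (Suc n)" for n using y[OF that, of n] by (auto simp: abs_le_iff)
    then show "(\<lambda>n. y n i - x i) \<longlonglongrightarrow> 0"
      by (intro Lim_null_comparison[OF _ LIMSEQ_Suc[OF lim_inverse_n']] always_eventually) simp
  qed
  have "(\<lambda>n. mean_Psi N \<rho> (y n)) \<longlonglongrightarrow> mean_Psi N \<rho> x" if "\<rho> \<in> space (prob_algebra Omega_borel)" for \<rho>
    using y by (intro mean_Psi_tendsto that x lim) auto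
  from tendsto_diff[OF this[OF \<nu>] this[OF \<nu>']] have "(\<lambda>n. 0) \<longlonglongrightarrow> mean_Psi N \<nu> x - mean_Psi N \<nu>' x"
    using y0 by (simp add: g_def)
  then show ?thesis by (simp add: LIMSEQ_const_iff)
qed

end

theorem Lambda_separates_measures:
  assumes jac: "jacobi a b p" and Lam: "\<And>N. N \<ge> 2 \<Longrightarrow> is_Lambda a b p N (\<Lambda> N)"
    and \<nu>: "\<nu> \<in> space (prob_algebra Omega_borel)" and \<nu>': "\<nu>' \<in> space (prob_algebra Omega_borel)"
    and same: "\<And>N. N \<ge> 2 \<Longrightarrow> \<nu> \<bind> \<Lambda> N = \<nu>' \<bind> \<Lambda> N"
  shows "\<nu> = \<nu>'"
proof (rule omega_measure_eqI[OF \<nu> \<nu>'])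
  fix js :: "nat list"
  \<comment> \<open>Two spare coordinates, set to 1 where \<open>Psi\<close> is 1, secure
    \<open>N \<ge> 2\<close> for every list, the empty one included. Repetitions in
    \<open>js\<close> yield the powers.\<close>
  define N where "N = length js + 2"
  define x where "x i = (if i < length js then pt (js ! i) else 1)" for i
  have N: "N \<ge> 2" by (simp add: N_def)
  have "Psi_prod N \<omega> x = (\<Prod>j\<leftarrow>js. Psi \<omega> (pt j))" for \<omega>
  proof -
    have "Psi_prod N \<omega> x = (\<Prod>i<length js. Psi \<omega> (pt (js ! i)))"
      unfolding Psi_prod_def N_def by (simp add: x_def Psi_1)
    then show ?thesis by (simp add: prod.list_conv_set_nth atLeast0LessThan)
  qed
  then have "mean_Psi N \<rho> x = (\<integral>\<omega>. (\<Prod>j\<leftarrow>js. Psi \<omega> (pt j)) \<partial>\<rho>)" for \<rho> by (simp add: mean_Psi_def)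
  moreover have "mean_Psi N \<nu> x = mean_Psi N \<nu>' x"
    by (rule mean_Psi_eq_of_bind_eq[OF jac Lam[OF N] \<nu> \<nu>' same[OF N]]) (use pt in \<open>auto simp: x_def\<close>)
  ultimately show "(\<integral>\<omega>. (\<Prod>j\<leftarrow>js. Psi \<omega> (pt j)) \<partial>\<nu>) = (\<integral>\<omega>. (\<Prod>j\<leftarrow>js. Psi \<omega> (pt j)) \<partial>\<nu>')" by simp
qed

section \<open>The invariant measure of the limit semigroup\<close>

theorem theorem6p12:
  fixes a b :: real and z z' :: complex
    and p :: "nat \<Rightarrow> real poly"
    and \<Lambda> :: "nat \<Rightarrow> omega \<Rightarrow> nat list measure"
    and PN :: "nat \<Rightarrow> real \<Rightarrow> nat list \<Rightarrow> nat list measure"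
    and P :: "real \<Rightarrow> omega \<Rightarrow> omega measure"
    and M :: "omega measure"
  assumes ab: "a \<ge> b" "b \<ge> -1/2"
    and zz': "(z, z') \<in> H_params a b"
    and jacobi: "jacobi_polys a b p"
    and Lambda: "\<And>N. N \<ge> 1 \<Longrightarrow> is_Lambda a b p N (\<Lambda> N)"
    and PN_semigroup: "\<And>N. N \<ge> 1 \<Longrightarrow> markov_semigroup (count_space (GT N)) (PN N)"
    and PN_q_matrix: "\<And>N. N \<ge> 1 \<Longrightarrow> has_q_matrix (GT N) (PN N) (RN a b z z' N)"
    and P_feller: "feller_semigroup Omega P"
    and intertwining: "\<And>N t \<omega>. N \<ge> 2 \<Longrightarrow> t \<ge> 0 \<Longrightarrow> \<omega> \<in> Omega \<Longrightarrow>
           P t \<omega> \<bind> \<Lambda> N = \<Lambda> N \<omega> \<bind> PN N t"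
    and M_spectral: "is_spectral_z_measure a b z z' \<Lambda> M"
  shows "invariant_prob Omega_borel P M \<and>
         (\<forall>\<nu>. invariant_prob Omega_borel P \<nu> \<longrightarrow> \<nu> = M)"
proof -
  interpret z_params a b z z' by unfold_locales (fact ab zz')+
  have jac: "jacobi a b p" using ab jacobi by unfold_locales auto
  have M: "M \<in> space (prob_algebra Omega_borel)" and M_bind: "\<And>N. N \<ge> 1 \<Longrightarrow> M \<bind> \<Lambda> N = z_measure a b z z' N"
    using M_spectral by (auto simp: is_spectral_z_measure_def)
  have P: "P t \<in> Omega_borel \<rightarrow>\<^sub>M prob_algebra Omega_borel" if "t \<ge> 0" for t
    using P_feller that by (simp add: feller_semigroup_def markov_semigroup_def Omega_borel_def)
  have Lam: "is_Lambda a b p N (\<Lambda> N)" and Lam_kernel: "\<Lambda> N \<in> Omega_borel \<rightarrow>\<^sub>M prob_algebra (count_space (GT N))"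
    if "N \<ge> 2" for N
    using Lambda[of N] that by (auto simp: is_Lambda_def)
  have PN_kernel: "PN N t \<in> count_space (GT N) \<rightarrow>\<^sub>M prob_algebra (count_space (GT N))" if "N \<ge> 2" "t \<ge> 0" for N t
    using PN_semigroup[of N] that by (simp add: markov_semigroup_def)
  have chain: "reversible_q_chain (GT N) (PN N) (RN a b z z' N) (z_measure a b z z' N) (lyapunov N) (lyapunov_rate N)"
    if N: "N \<ge> 2" for N
  proof (intro PN_chain PN_semigroup PN_q_matrix)
    \<comment> \<open>That the weights can be normalized is inherited from \<open>M\<close>: the
      z-measure is its image under a Markov kernel.\<close>
    have "z_measure a b z z' N \<in> space (prob_algebra (count_space (GT N)))"
      using bind_in_prob_algebra[OF M Lam_kernel[OF N]] M_bind[of N] N by simp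
    then show "prob_space (z_measure a b z z' N)" by (simp add: space_prob_algebra)
  qed (use N in auto)
  have swap: "(\<nu> \<bind> P t) \<bind> \<Lambda> N = (\<nu> \<bind> \<Lambda> N) \<bind> PN N t"
    if \<nu>: "\<nu> \<in> space (prob_algebra Omega_borel)" and N: "N \<ge> 2" and t: "t \<ge> 0" for \<nu> N t
  proof -
    have "(\<nu> \<bind> P t) \<bind> \<Lambda> N = \<nu> \<bind> (\<lambda>\<omega>. P t \<omega> \<bind> \<Lambda> N)" by (rule bind_assoc_prob_algebra[OF \<nu> P[OF t] Lam_kernel[OF N]])
    also have "\<dots> = \<nu> \<bind> (\<lambda>\<omega>. \<Lambda> N \<omega> \<bind> PN N t)"
      using intertwining[OF N t] prob_Omega(3)[OF \<nu>] by (intro bind_cong) auto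
    also have "\<dots> = (\<nu> \<bind> \<Lambda> N) \<bind> PN N t" by (rule bind_assoc_prob_algebra[OF \<nu> Lam_kernel[OF N] PN_kernel[OF N t], symmetric])
    finally show ?thesis .
  qed
  have "M \<bind> P t = M" if t: "t \<ge> 0" for t
  proof (rule Lambda_separates_measures[OF jac Lam bind_in_prob_algebra[OF M P[OF t]] M])
    fix N :: nat assume N: "N \<ge> 2"
    interpret N: reversible_q_chain "GT N" "PN N" "RN a b z z' N" "z_measure a b z z' N" "lyapunov N" "lyapunov_rate N"
      by (rule chain[OF N])
    show "(M \<bind> P t) \<bind> \<Lambda> N = M \<bind> \<Lambda> N"
      unfolding swap[OF M N t] using N t M_bind[of N] N.\<pi>_invariant by simp
  qed
  moreover have "\<nu> = M" if inv: "invariant_prob Omega_borel P \<nu>" for \<nu>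
  proof -
    have \<nu>: "\<nu> \<in> space (prob_algebra Omega_borel)" and fix_\<nu>: "\<And>t. t \<ge> 0 \<Longrightarrow> \<nu> \<bind> P t = \<nu>"
      using inv by (auto simp: invariant_prob_def)
    show ?thesis
    proof (rule Lambda_separates_measures[OF jac Lam \<nu> M])
      fix N :: nat assume N: "N \<ge> 2"
      interpret N: reversible_q_chain "GT N" "PN N" "RN a b z z' N" "z_measure a b z z' N" "lyapunov N" "lyapunov_rate N"
        by (rule chain[OF N])
      have "\<nu> \<bind> \<Lambda> N = z_measure a b z z' N"
      proof (rule N.invariant_eq_\<pi>[OF bind_in_prob_algebra[OF \<nu> Lam_kernel[OF N]]])
        show "(\<nu> \<bind> \<Lambda> N) \<bind> PN N t = \<nu> \<bind> \<Lambda> N" if "t \<ge> 0" for t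
          using swap[OF \<nu> N that] fix_\<nu>[OF that] by simp
      qed
      then show "\<nu> \<bind> \<Lambda> N = M \<bind> \<Lambda> N" using M_bind[of N] N by simp
    qed
  qed
  ultimately show ?thesis using M by (auto simp: invariant_prob_def)
qed

end
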